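(* Let $\epsilon>0$. For every real $X>0$, every integer $q\ge1$, every integer $l$ with $(l,q)=1$, and every real $\mu$ with $0<\mu<1/5$, \[ S_q(X;l) = C_q(l)\frac{X^{1/2}}{q} + D_q(l)\frac{X^{1/3}}{q} + O_\epsilon\Bigl(\frac{X^{1/2-3\mu/2}}{q^{1/2-\epsilon}} + \max(X^\mu,q^{1/2})\,q^\epsilon\Bigr), \] where the implied constant depends at most on $\epsilon$.
   Context: Here \[ S_q(X;l) := \#\{(a,b) : a,b \text{ positive integers},\ a^2b^3\le X,\ a^2b^3\equiv l \pmod q\}. \] $(l,q)$ is the greatest common divisor and $\phi$ is Euler's totient function. For integers $n$ and $q\ge1$, \[ N_2(n;q) := \#\{x \bmod q : x^2\equiv n \pmod q,\ (x,q)=1\},\qquad N_3(n;q) := \#\{x \bmod q : x^3\equiv n \pmod q,\ (x,q)=1\}. \] For $(l,q)=1$, \[ C_q(l) := \sum_{b=1}^{\infty}\frac{N_2(lb;q)}{b^{3/2}},\qquad D_q(l) := -2\frac{\phi(q)}{q} + \frac23\int_1^\infty \frac{\sum_{1\le a\le u} N_3(la;q) - \frac{\phi(q)}{q}u}{u^{5/3}}\,du . \] $f=O_\epsilon(g)$ means $|f|\le C g$ for some constant $C>0$ that may depend on $\epsilon$. *)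

theory Defs
  imports "HOL-Analysis.Analysis" "HOL-Number_Theory.Number_Theory"
begin

definition Sq :: "nat \<Rightarrow> real \<Rightarrow> int \<Rightarrow> nat" where
  "Sq q X l = card {(a::nat, b::nat). a > 0 \<and> b > 0 \<and> real (a ^ 2 * b ^ 3) \<le> X \<and>
      [int (a ^ 2 * b ^ 3) = l] (mod int q)}"

text \<open>Residue classes modulo q are represented by the integers in \<open>{0..<q}\<close>.\<close>

definition N2 :: "int \<Rightarrow> nat \<Rightarrow> nat" where
  "N2 n q = card {x::int. 0 \<le> x \<and> x < int q \<and> [x ^ 2 = n] (mod int q) \<and> coprime x (int q)}"

definition N3 :: "int \<Rightarrow> nat \<Rightarrow> nat" where
  "N3 n q = card {x::int. 0 \<le> x \<and> x < int q \<and> [x ^ 3 = n] (mod int q) \<and> coprime x (int q)}"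

text \<open>The series over \<open>b \<ge> 1\<close> is indexed from 0, with \<open>Suc b\<close> in place of b;
  it converges since \<open>N2 n q \<le> q\<close>.\<close>

definition Cq :: "nat \<Rightarrow> int \<Rightarrow> real" where
  "Cq q l = (\<Sum>b::nat. real (N2 (l * int (Suc b)) q) / real (Suc b) powr (3/2))"

text \<open>For \<open>q \<ge> 1\<close> and \<open>l\<close> coprime to q, \<open>N3 (l * a) q\<close> sums to \<open>totient q\<close> as a runs over
  a period, so the numerator of the integrand is bounded and the integral converges absolutely.\<close>

definition Dq :: "nat \<Rightarrow> int \<Rightarrow> real" where
  "Dq q l = - 2 * (real (totient q) / real q) +
     2/3 * (LINT u:{1..}|lborel.
       ((\<Sum>a\<in>{1..nat \<lfloor>u\<rfloor>}. real (N3 (l * int a) q)) - real (totient q) / real q * u)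
         / u powr (5/3))"

end

theory Submission
  imports Defs "HOL-Computational_Algebra.Fundamental_Theorem_Algebra"
begin

text \<open>
  The solutions of \<open>a\<^sup>2 b\<^sup>3 \<equiv> l\<close> modulo \<open>q\<close> are parametrized by the unit \<open>t = ab\<close>: up to constants, \<open>a = t\<^sup>3\<close> and
  \<open>b = t\<^sup>-\<^sup>2\<close>. Hence the number of solutions in a box deviates from its expected value by sums of
  \<open>e((m t\<^sup>3 + n t\<^sup>-\<^sup>2) / q)\<close> over units \<open>t\<close>, which have square root cancellation. For prime \<open>q\<close> this is Weil's bound:
  the associated L-function is a polynomial of degree at most 5, and Stepanov's method bounds its
  roots; for prime powers the stationary phase formula suffices. The algebraic closure of \<open>\<bbbF>\<^sub>p\<close> is realized as the
  ring generated by the complex roots of unity modulo a maximal ideal above \<open>p\<close>.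

  For the hyperbolic region \<open>a\<^sup>2 b\<^sup>3 \<le> X\<close>, let \<open>B = X\<^sup>\<mu>\<close> and \<open>V = B q\<^sup>1\<^sup>/\<^sup>3\<close>. Columns with \<open>b \<le> B\<close>
  and rows beyond \<open>b = V\<close> are counted exactly up to \<open>O(1)\<close> each, the part in between is
  approximated by a staircase of boxes. The main terms are completed to \<open>Cq\<close> and \<open>Dq\<close> by partial summation.
\<close>

section \<open>Cyclotomic integers modulo a maximal ideal\<close>

text \<open>With \<open>V\<close> = B q^(1/3) there are at most \<open>U\<close> = X^(1/2 - 3 mu/2)
  / q^(1/2) rows beyond \<open>V\<close>, which is the first error term; the second consists of the
  columns up to B and of \<open>Delta\<close>, the error of one box, which is q^(1/2) up to
  q^epsilon. In between, n boxes cost n \<open>Delta\<close>, and the cells crossed by the curve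
  cost A B / (n q) up to logarithms, \<open>A\<close> being its height at B. At the optimal n both
  are the geometric mean of B and A \<open>Delta\<close> / q, and the latter is again about
  \<open>U\<close>, so the staircase adds no new error term. Stepanov's method bounds the fibres of
  the trace only from above. This suffices because the total size of the fibres is known, and fields
  of even degree suffice because a root of the L-function larger than p^(1/2) would show there. That
  polynomials split over the residue field is not proved by constructing roots but read off from a
  count of Frobenius-invariant multisets. The primes 2, 3, 5, which may divide the exponents or the
  coefficients of the derivative, are treated crudely: a constant for each prime factor of q is
  absorbed by q^epsilon.\<close>

lemma uminus_sum_list: "- sum_list xs = sum_list (map uminus (xs :: 'a::ab_group_add list))"
  by (induction xs) auto

text \<open>This makes sums of roots of unity closed under negation, so that no signs are needed in
  the definition of \<open>cyc\<close>.\<close>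

lemma uminus_root_unity:
  assumes "\<exists>n>0. x ^ n = 1"
  shows "\<exists>n>0. (- x :: 'a::comm_ring_1) ^ n = 1"
proof -
  obtain n where "n > 0" "x ^ n = 1" using assms by blast
  moreover have "(- x) ^ (2 * n) = (x ^ n) ^ 2" by (simp add: mult.commute flip: power_mult)
  ultimately have "(- x) ^ (2 * n) = 1" "2 * n > 0" by simp_all
  then show ?thesis by blast
qed

text \<open>The ring generated by all complex roots of unity. Finite sums exhaust it because
  products and negatives of roots of unity are roots of unity; lists are used so that summands may
  repeat.\<close>

typedef cyc = "{s::complex. \<exists>xs. (\<forall>x\<in>set xs. \<exists>n>0. x ^ n = 1) \<and> s = sum_list xs}"
  morphisms of_cyc Abs_cyc
  by (rule exI[of _ 0], rule CollectI, rule exI[of _ "[]"]) simp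

setup_lifting type_definition_cyc

instantiation cyc :: comm_ring_1
begin

lift_definition zero_cyc :: cyc is 0 by (rule exI[of _ "[]"]) simp
lift_definition one_cyc :: cyc is 1 by (rule exI[of _ "[1]"]) auto

lift_definition plus_cyc :: "cyc \<Rightarrow> cyc \<Rightarrow> cyc" is "(+)"
proof -
  fix a b :: complex
  assume "\<exists>xs. (\<forall>x\<in>set xs. \<exists>n>0. x ^ n = 1) \<and> a = sum_list xs"
    and "\<exists>xs. (\<forall>x\<in>set xs. \<exists>n>0. x ^ n = 1) \<and> b = sum_list xs"
  then obtain xs ys where "\<forall>x\<in>set xs. \<exists>n>0. x ^ n = 1" "a = sum_list xs"
    "\<forall>x\<in>set ys. \<exists>n>0. x ^ n = 1" "b = sum_list ys" by blast
  then show "\<exists>xs. (\<forall>x\<in>set xs. \<exists>n>0. x ^ n = 1) \<and> a + b = sum_list xs"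
    by (intro exI[of _ "xs @ ys"]) auto
qed

lift_definition uminus_cyc :: "cyc \<Rightarrow> cyc" is uminus
proof -
  fix a :: complex
  assume "\<exists>xs. (\<forall>x\<in>set xs. \<exists>n>0. x ^ n = 1) \<and> a = sum_list xs"
  then obtain xs where xs: "\<forall>x\<in>set xs. \<exists>n>0. x ^ n = 1" "a = sum_list xs" by blast
  have "\<forall>x\<in>set (map uminus xs). \<exists>n>0. x ^ n = 1" using xs(1) uminus_root_unity unfolding set_map by blast
  moreover have "- a = sum_list (map uminus xs)" unfolding xs(2) by (rule uminus_sum_list)
  ultimately show "\<exists>xs. (\<forall>x\<in>set xs. \<exists>n>0. x ^ n = 1) \<and> - a = sum_list xs" by blast
qed

lift_definition minus_cyc :: "cyc \<Rightarrow> cyc \<Rightarrow> cyc" is "(-)"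
proof -
  fix a b :: complex
  assume "\<exists>xs. (\<forall>x\<in>set xs. \<exists>n>0. x ^ n = 1) \<and> a = sum_list xs"
    and "\<exists>xs. (\<forall>x\<in>set xs. \<exists>n>0. x ^ n = 1) \<and> b = sum_list xs"
  then obtain xs ys where xs: "\<forall>x\<in>set xs. \<exists>n>0. x ^ n = 1" "a = sum_list xs"
    "\<forall>x\<in>set ys. \<exists>n>0. x ^ n = 1" "b = sum_list ys" by blast
  have "\<forall>x\<in>set (xs @ map uminus ys). \<exists>n>0. x ^ n = 1" using xs(1,3) uminus_root_unity unfolding set_append set_map by blast
  moreover have "a - b = sum_list (xs @ map uminus ys)" unfolding xs(2,4) by (simp flip: uminus_sum_list)
  ultimately show "\<exists>xs. (\<forall>x\<in>set xs. \<exists>n>0. x ^ n = 1) \<and> a - b = sum_list xs" by blast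
qed

lift_definition times_cyc :: "cyc \<Rightarrow> cyc \<Rightarrow> cyc" is "(*)"
proof -
  fix a b :: complex
  assume "\<exists>xs. (\<forall>x\<in>set xs. \<exists>n>0. x ^ n = 1) \<and> a = sum_list xs"
    and "\<exists>xs. (\<forall>x\<in>set xs. \<exists>n>0. x ^ n = 1) \<and> b = sum_list xs"
  then obtain xs ys where xs: "\<forall>x\<in>set xs. \<exists>n>0. x ^ n = 1" "a = sum_list xs"
    "\<forall>x\<in>set ys. \<exists>n>0. x ^ n = 1" "b = sum_list ys" by blast
  have *: "\<exists>n>0. (x * y) ^ n = 1" if xy: "x \<in> set xs" "y \<in> set ys" for x y
  proof -
    obtain n m where nm: "n > 0" "x ^ n = 1" "m > 0" "y ^ m = 1" using xs xy by blast
    have "(x * y) ^ (n * m) = (x ^ n) ^ m * (y ^ m) ^ n"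
      by (simp add: power_mult_distrib power_mult mult.commute flip: power_mult)
    then have "(x * y) ^ (n * m) = 1" "n * m > 0" using nm by simp_all
    then show ?thesis by blast
  qed
  have "sum_list xs * sum_list ys = sum_list (concat (map (\<lambda>x. map ((*) x) ys) xs))"
    by (induction xs) (auto simp: algebra_simps sum_list_const_mult)
  moreover have "\<forall>x\<in>set (concat (map (\<lambda>x. map ((*) x) ys) xs)). \<exists>n>0. x ^ n = 1"
  proof
    fix z assume "z \<in> set (concat (map (\<lambda>x. map ((*) x) ys) xs))"
    then obtain x y where "x \<in> set xs" "y \<in> set ys" "z = x * y" by auto
    then show "\<exists>n>0. z ^ n = 1" using * by simp
  qed
  ultimately show "\<exists>xs. (\<forall>x\<in>set xs. \<exists>n>0. x ^ n = 1) \<and> a * b = sum_list xs"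
    using xs(2,4) by blast
qed

instance by standard (transfer; simp add: algebra_simps)+

end

lemma of_cyc_simps [simp]:
  "of_cyc 0 = 0" "of_cyc 1 = 1" "of_cyc (x + y) = of_cyc x + of_cyc y"
  "of_cyc (x * y) = of_cyc x * of_cyc y" "of_cyc (x - y) = of_cyc x - of_cyc y"
  by (transfer; simp)+

lemma of_cyc_power [simp]: "of_cyc (x ^ n) = of_cyc x ^ n"
  by (induction n) auto

lemma of_cyc_of_nat [simp]: "of_cyc (of_nat n) = of_nat n"
  by (induction n) auto

text \<open>Every complex root of unity lies in the ring, so nothing is lost by restricting to
  \<open>cyc\<close>. For n = p^k - 1 these roots will represent the nonzero elements of the field
  with p^k elements.\<close>

lemma card_roots_unity_cyc:
  assumes "n > 0"
  shows "card {t::cyc. t ^ n = 1} = n" "finite {t::cyc. t ^ n = 1}"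
proof -
  have "bij_betw of_cyc {t::cyc. t ^ n = 1} {z::complex. z ^ n = 1}"
  proof (rule bij_betwI')
    fix x y :: cyc show "of_cyc x = of_cyc y \<longleftrightarrow> x = y" by (rule of_cyc_inject)
  next
    fix x :: cyc assume "x \<in> {t. t ^ n = 1}"
    then have "of_cyc (x ^ n) = 1" by simp
    then show "of_cyc x \<in> {z. z ^ n = 1}" by simp
  next
    fix z :: complex assume z: "z \<in> {z. z ^ n = 1}"
    then have "z \<in> {s::complex. \<exists>xs. (\<forall>x\<in>set xs. \<exists>n>0. x ^ n = 1) \<and> s = sum_list xs}"
      using assms by (intro CollectI exI[of _ "[z]"]) auto
    then have "of_cyc (Abs_cyc z) = z" by (rule Abs_cyc_inverse)
    then obtain t where t: "of_cyc t = z" ..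
    then have "of_cyc (t ^ n) = of_cyc 1" using z by simp
    then have "t ^ n = 1" by (simp only: of_cyc_inject)
    then show "\<exists>x\<in>{t. t ^ n = 1}. z = of_cyc x" using t by blast
  qed
  note bij = this
  have "card {t::cyc. t ^ n = 1} = card {z::complex. z ^ n = 1}" using bij_betw_same_card[OF bij] .
  then show "card {t::cyc. t ^ n = 1} = n" using card_roots_unity_eq[of n] assms by simp
  have "finite {z::complex. z ^ n = 1}" using assms by (intro finite_roots_unity) auto
  then show "finite {t::cyc. t ^ n = 1}" using bij_betw_finite[OF bij] by simp
qed

text \<open>Nakayama's lemma for a lattice that is divisible by p, by eliminating generators one at a time.\<close>

lemma divisible_generators_eq_0:
  fixes b :: "'i \<Rightarrow> 'a::{idom,ring_char_0}" and p :: int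
  assumes "finite S" "prime p"
    and "\<And>i. i \<in> S \<Longrightarrow> \<exists>u c. \<not> p dvd u \<and> of_int u * b i = of_int p * (\<Sum>j\<in>S. of_int (c j) * b j)"
  shows "\<forall>i\<in>S. b i = 0"
  using assms(1,3)
proof (induction S rule: finite_induct)
  case (insert a F)
  obtain u0 c where u0: "\<not> p dvd u0" "of_int u0 * b a = of_int p * (\<Sum>j\<in>insert a F. of_int (c j) * b j)"
    using insert.prems by blast
  \<comment> \<open>The relation is solved for the generator \<open>b a\<close>: moving its own term
    to the left changes the coefficient by a multiple of \<open>p\<close> only, so it stays prime to
    \<open>p\<close>.\<close>
  define u where "u = u0 - p * c a"
  have u: "\<not> p dvd u" unfolding u_def using u0(1) by (simp add: dvd_diff_left_iff)
  have ua: "of_int u * b a = of_int p * (\<Sum>j\<in>F. of_int (c j) * b j)"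
    using u0(2) insert.hyps by (simp add: u_def algebra_simps)
  have "\<exists>u c. \<not> p dvd u \<and> of_int u * b i = of_int p * (\<Sum>j\<in>F. of_int (c j) * b j)" if "i \<in> F" for i
  proof -
    obtain v d where v: "\<not> p dvd v" "of_int v * b i = of_int p * (\<Sum>j\<in>insert a F. of_int (d j) * b j)"
      using insert.prems \<open>i \<in> F\<close> by blast
    have "of_int (u * v) * b i = of_int u * (of_int p * (of_int (d a) * b a + (\<Sum>j\<in>F. of_int (d j) * b j)))"
      using v(2) insert.hyps by (simp add: mult.assoc)
    also have "\<dots> = of_int p * (of_int (d a) * (of_int u * b a) + of_int u * (\<Sum>j\<in>F. of_int (d j) * b j))"
      by (simp add: algebra_simps)
    also have "\<dots> = of_int p * (\<Sum>j\<in>F. of_int (p * d a * c j + u * d j) * b j)"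
      unfolding ua by (simp add: sum_distrib_left sum.distrib algebra_simps)
    finally show ?thesis using u v(1) assms(2) by (metis prime_dvd_mult_iff)
  qed
  then have F: "\<forall>i\<in>F. b i = 0" by (rule insert.IH)
  then have "of_int u * b a = 0" unfolding ua by simp
  then show ?case using F u by auto
qed simp

lemma sum_list_eq_sum_of_nat_count:
  fixes xs :: "'a::comm_semiring_1 list"
  assumes "set xs \<subseteq> S" "finite S"
  shows "sum_list xs = (\<Sum>w\<in>S. of_nat (count_list xs w) * w)"
  using assms(1)
proof (induction xs)
  case (Cons a xs)
  have "(\<Sum>w\<in>S. of_nat (count_list (a # xs) w) * w) = (\<Sum>w\<in>S. (if w = a then w else 0) + of_nat (count_list xs w) * w)"
    by (rule sum.cong) (auto simp: algebra_simps)
  also have "\<dots> = a + sum_list xs" using Cons assms(2) by (simp add: sum.distrib)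
  finally show ?case by simp
qed simp

text \<open>The inverse of \<open>p\<close> would be a sum of N-th roots of unity for some N, so
  multiplying by it would map the lattice spanned by all N-th roots of unity into itself. The
  lattice would then be divisible by \<open>p\<close>, hence zero, although it contains 1.\<close>

lemma prime_not_unit_cyc:
  assumes "prime p"
  shows "of_nat p * (c::cyc) \<noteq> 1"
proof
  assume pc: "of_nat p * c = 1"
  obtain xs where xs: "\<forall>x\<in>set xs. \<exists>n>0. x ^ n = 1" "of_cyc c = sum_list xs"
    using of_cyc[of c] by blast
  then obtain o1 where o1: "\<And>x. x \<in> set xs \<Longrightarrow> o1 x > 0 \<and> x ^ o1 x = (1::complex)" by metis
  define N where "N = (\<Prod>x\<in>set xs. o1 x)"
  have N: "N > 0" unfolding N_def using o1 by (intro prod_pos) auto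
  have xN: "x ^ N = 1" if "x \<in> set xs" for x
  proof -
    have "o1 x dvd N" unfolding N_def using that by (intro dvd_prodI) auto
    then show ?thesis using o1[OF that] by (auto simp: power_mult elim!: dvdE)
  qed
  define S where "S = {z::complex. z ^ N = 1}"
  have fS: "finite S" unfolding S_def using N by (intro finite_roots_unity) auto
  have "\<forall>z\<in>S. id z = 0"
  proof (rule divisible_generators_eq_0[OF fS, of "int p"])
    show "prime (int p)" using assms by simp
    fix z assume z: "z \<in> S"
    have "set (map (\<lambda>x. x * z) xs) \<subseteq> S" using z xN by (auto simp: S_def power_mult_distrib)
    then have "sum_list (map (\<lambda>x. x * z) xs) = (\<Sum>w\<in>S. of_nat (count_list (map (\<lambda>x. x * z) xs) w) * w)"
      using fS by (rule sum_list_eq_sum_of_nat_count)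
    then have 1: "(\<Sum>w\<in>S. of_nat (count_list (map (\<lambda>x. x * z) xs) w) * w) = sum_list (map (\<lambda>x. x * z) xs)" by simp
    have 2: "sum_list (map (\<lambda>x. x * z) xs) = of_cyc c * z"
      unfolding xs(2) by (simp add: sum_list_mult_const)
    have 3: "of_nat p * of_cyc c = 1" using arg_cong[OF pc, of of_cyc] by simp
    have "z = of_nat p * (\<Sum>w\<in>S. of_nat (count_list (map (\<lambda>x. x * z) xs) w) * w)"
      unfolding 1 2 mult.assoc[symmetric] 3 by simp
    then have eq: "of_int 1 * id z = of_int (int p) * (\<Sum>w\<in>S. of_int (int (count_list (map (\<lambda>x. x * z) xs) w)) * id w)"
      by simp
    have "\<not> int p dvd 1" using assms not_prime_unit[of "int p"] by auto
    from this eq show "\<exists>u c. \<not> int p dvd u \<and> of_int u * id z = of_int (int p) * (\<Sum>j\<in>S. of_int (c j) * id j)"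
      by (intro exI conjI)
  qed
  moreover have "1 \<in> S" by (simp add: S_def)
  ultimately show False by auto
qed

section \<open>Ideals and maximal ideals\<close>

definition ideal_of :: "'a::comm_ring_1 set \<Rightarrow> bool" where
  "ideal_of I \<longleftrightarrow> 0 \<in> I \<and> (\<forall>x\<in>I. \<forall>y\<in>I. x + y \<in> I) \<and> (\<forall>x\<in>I. \<forall>r. r * x \<in> I)"

text \<open>Krull's theorem by Zorn's lemma. Maximality is delivered in the form in which it is
  used: the quotient is a field.\<close>

lemma ex_maximal_ideal:
  fixes I :: "'a::comm_ring_1 set"
  assumes "ideal_of I" "1 \<notin> I"
  obtains P where "ideal_of P" "I \<subseteq> P" "1 \<notin> P" "\<And>x. x \<notin> P \<Longrightarrow> \<exists>y. x * y - 1 \<in> P"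
proof -
  define \<A> where "\<A> = {J. ideal_of J \<and> I \<subseteq> J \<and> 1 \<notin> J}"
  have "\<exists>M\<in>\<A>. \<forall>X\<in>\<A>. M \<subseteq> X \<longrightarrow> X = M"
  proof (rule subset_Zorn_nonempty)
    show "\<A> \<noteq> {}" using assms by (auto simp: \<A>_def)
    fix C assume C: "C \<noteq> {}" "subset.chain \<A> C"
    have sub: "C \<subseteq> \<A>" and lin: "\<And>X Y. X \<in> C \<Longrightarrow> Y \<in> C \<Longrightarrow> X \<subseteq> Y \<or> Y \<subseteq> X"
      using C(2) by (auto simp: subset.chain_def)
    have idl: "ideal_of X" if "X \<in> C" for X using sub that unfolding \<A>_def by blast
    have "ideal_of (\<Union>C)"
      unfolding ideal_of_def
    proof (intro conjI ballI allI)
      show "0 \<in> \<Union>C" using C(1) idl unfolding ideal_of_def by blast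
      fix x assume x: "x \<in> \<Union>C"
      then obtain X where X: "X \<in> C" "x \<in> X" by blast
      have "r * x \<in> X" for r using idl[OF X(1)] X(2) unfolding ideal_of_def by simp
      then show "r * x \<in> \<Union>C" for r using X(1) by (rule UnionI[rotated])
      fix y assume "y \<in> \<Union>C"
      then obtain Y where Y: "Y \<in> C" "y \<in> Y" by blast
      obtain Z where Z: "Z \<in> C" "x \<in> Z" "y \<in> Z"
      proof (cases "X \<subseteq> Y")
        case True then show ?thesis using that[OF Y(1)] X Y by blast
      next
        case False then show ?thesis using that[OF X(1)] lin[OF X(1) Y(1)] X Y by blast
      qed
      have "x + y \<in> Z" using idl[OF Z(1)] Z(2,3) unfolding ideal_of_def by simp
      then show "x + y \<in> \<Union>C" using Z(1) by (rule UnionI[rotated])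
    qed
    moreover have "I \<subseteq> X" "1 \<notin> X" if "X \<in> C" for X using sub that unfolding \<A>_def by auto
    then have "I \<subseteq> \<Union>C" "1 \<notin> \<Union>C" using C(1) by (meson Union_upper all_not_in_conv order_trans, meson UnionE)
    ultimately show "\<Union>C \<in> \<A>" unfolding \<A>_def by simp
  qed
  then obtain P where PA: "P \<in> \<A>" and max: "\<And>X. X \<in> \<A> \<Longrightarrow> P \<subseteq> X \<Longrightarrow> X = P" by blast
  from PA have P: "ideal_of P" "I \<subseteq> P" "1 \<notin> P" unfolding \<A>_def by simp_all
  have "\<exists>y. x * y - 1 \<in> P" if x: "x \<notin> P" for x
  proof (rule ccontr)
    assume no: "\<nexists>y. x * y - 1 \<in> P"
    \<comment> \<open>The ideal generated by \<open>P\<close> and \<open>x\<close>. If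
      \<open>x\<close> had no inverse modulo \<open>P\<close>, this ideal would be proper and
      contradict the maximality of \<open>P\<close>.\<close>
    define J where "J = {a + x * y | a y. a \<in> P}"
    have JI: "a + x * y \<in> J" if "a \<in> P" for a y using that unfolding J_def by blast
    have P0: "0 \<in> P" and Pa: "\<And>a b. a \<in> P \<Longrightarrow> b \<in> P \<Longrightarrow> a + b \<in> P" and Pm: "\<And>a r. a \<in> P \<Longrightarrow> r * a \<in> P"
      using P(1) unfolding ideal_of_def by simp_all
    have J: "ideal_of J" unfolding ideal_of_def
    proof (intro conjI ballI allI)
      show "0 \<in> J" using JI[OF P0, of 0] by simp
      fix u assume "u \<in> J"
      then obtain a y where u: "u = a + x * y" "a \<in> P" unfolding J_def by blast
      have "r * u = r * a + x * (r * y)" for r by (simp add: u algebra_simps)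
      then show "r * u \<in> J" for r using JI[OF Pm[OF u(2)]] by metis
      fix v assume "v \<in> J"
      then obtain b z where v: "v = b + x * z" "b \<in> P" unfolding J_def by blast
      have "u + v = (a + b) + x * (y + z)" by (simp add: u v algebra_simps)
      then show "u + v \<in> J" using JI[OF Pa[OF u(2) v(2)]] by metis
    qed
    have PJ: "P \<subseteq> J"
    proof
      fix a assume "a \<in> P" then show "a \<in> J" using JI[of a 0] by simp
    qed
    have "x \<in> J" using JI[OF P0, of 1] by simp
    have "1 \<notin> J"
    proof
      assume "1 \<in> J"
      then obtain a y where ay: "1 = a + x * y" "a \<in> P" unfolding J_def by blast
      have "- 1 * a \<in> P" using Pm[OF ay(2)] .
      moreover have "x * y = 1 - a" unfolding eq_diff_eq using ay(1)[symmetric] by (simp add: add.commute)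
      then have "- 1 * a = x * y - 1" by simp
      ultimately show False using no by metis
    qed
    then have "J \<in> \<A>" using J PJ P(2) unfolding \<A>_def by blast
    then show False using max PJ \<open>x \<in> J\<close> x by blast
  qed
  then show ?thesis using that P by blast
qed

text \<open>The quotient of the ring by \<open>P\<close> is an algebraic closure of \<open>\<bbbF>\<^sub>p\<close>; the \<open>(p^k - 1)\<close>-th roots of unity
  are the Teichmueller representatives of the nonzero elements of its subfield of order \<open>p^k\<close>.\<close>

locale residue_closure =
  fixes P :: "'a::comm_ring_1 set" and p :: nat
  assumes prime_p: "prime p"
    and ideal_P: "ideal_of P"
    and one_notin: "1 \<notin> P"
    and inverse_mod: "x \<notin> P \<Longrightarrow> \<exists>y. x * y - 1 \<in> P"
    and p_in: "of_nat p \<in> P"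
    and card_U: "k > 0 \<Longrightarrow> card {t::'a. t ^ (p ^ k - 1) = 1} = p ^ k - 1"
    and U_inj: "\<lbrakk>k > 0; t ^ (p ^ k - 1) = 1; s ^ (p ^ k - 1) = 1; t - s \<in> P\<rbrakk> \<Longrightarrow> t = s"

text \<open>The point is that reduction modulo \<open>P\<close> is injective on the n-th roots of
  unity for n = p^k - 1. The quotient x of two distinct ones satisfies 1 + x + ... + x^(n-1) = 0; if
  x were 1 modulo \<open>P\<close>, this sum would be n, which is -1 modulo \<open>P\<close> because
  \<open>p\<close> lies in \<open>P\<close>.\<close>

lemma ex_residue_closure:
  assumes "prime p"
  shows "\<exists>P::cyc set. residue_closure P p"
proof -
  define I where "I = range (\<lambda>c::cyc. of_nat p * c)"
  have "ideal_of I" unfolding ideal_of_def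
  proof (intro conjI ballI allI)
    show "0 \<in> I" unfolding I_def by (rule range_eqI[of _ _ 0]) simp
    fix x assume "x \<in> I"
    then obtain a where a: "x = of_nat p * a" by (auto simp: I_def)
    show "r * x \<in> I" for r unfolding I_def by (rule range_eqI[of _ _ "r * a"]) (simp add: a algebra_simps)
    fix y assume "y \<in> I"
    then obtain b where b: "y = of_nat p * b" by (auto simp: I_def)
    show "x + y \<in> I" unfolding I_def by (rule range_eqI[of _ _ "a + b"]) (simp add: a b algebra_simps)
  qed
  moreover have "1 \<notin> I" using prime_not_unit_cyc[OF assms] unfolding I_def by (auto dest: sym)
  ultimately obtain P where P: "ideal_of P" "I \<subseteq> P" "1 \<notin> P" "\<And>x. x \<notin> P \<Longrightarrow> \<exists>y. x * y - 1 \<in> P"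
    using ex_maximal_ideal[of I] by blast
  have "of_nat p * 1 \<in> P" using P(2) unfolding I_def by blast
  then have pP: "of_nat p \<in> P" by simp
  have Padd: "x + y \<in> P" if "x \<in> P" "y \<in> P" for x y using P(1) that unfolding ideal_of_def by blast
  have Pm: "r * x \<in> P" if "x \<in> P" for x r using P(1) that unfolding ideal_of_def by blast
  have p1: "p > 1" using assms prime_gt_1_nat by blast
  have inj: "t = s" if k: "k > 0" and t: "t ^ (p ^ k - 1) = 1" "s ^ (p ^ k - 1) = 1" "t - s \<in> P" for k and t s :: cyc
  proof (rule ccontr)
    assume "t \<noteq> s"
    define n where "n = p ^ k - 1"
    have "p ^ k > 1" using p1 k by (rule one_less_power)
    then have n0: "n > 0" unfolding n_def by linarith
    define x where "x = t * s ^ (n - 1)"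
    have sn: "s * s ^ (n - 1) = 1" using t(2) n0 unfolding n_def[symmetric] by (cases n) auto
    have "x ^ n = t ^ n * (s ^ n) ^ (n - 1)"
      unfolding x_def power_mult_distrib by (simp add: mult.commute flip: power_mult)
    then have xn: "x ^ n = 1" using t unfolding n_def[symmetric] by simp
    have "x \<noteq> 1"
    proof
      assume "x = 1"
      then have "s * x = s" by simp
      then have "t * (s * s ^ (n - 1)) = s" by (simp add: x_def ac_simps)
      then show False using sn \<open>t \<noteq> s\<close> by simp
    qed
    then have x1: "of_cyc x \<noteq> 1" using of_cyc_inject[of x 1] by simp
    have x1P: "x - 1 \<in> P" using Pm[OF t(3), of "s ^ (n - 1)"] sn by (simp add: x_def algebra_simps)
    have xi: "x ^ i - 1 \<in> P" for i
    proof (induction i)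
      case 0 then show ?case using P(1) by (simp add: ideal_of_def)
    next
      case (Suc i)
      have "x ^ Suc i - 1 = x * (x ^ i - 1) + (x - 1)" by (simp add: algebra_simps)
      then show ?case using Padd[OF Pm[OF Suc, of x] x1P] by metis
    qed
    have "(of_cyc x - 1) * (\<Sum>i<n. of_cyc x ^ i) = of_cyc x ^ n - 1"
      by (rule power_diff_1_eq[symmetric])
    then have "(\<Sum>i<n. of_cyc x ^ i) = 0" using x1 xn by (simp flip: of_cyc_power)
    moreover have "of_cyc (\<Sum>i<m. x ^ i) = (\<Sum>i<m. of_cyc x ^ i)" for m by (induction m) auto
    ultimately have "of_cyc (\<Sum>i<n. x ^ i) = of_cyc 0" by simp
    then have z: "(\<Sum>i<n. x ^ i) = 0" by (simp only: of_cyc_inject)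
    have "(\<Sum>i<m. x ^ i - 1) \<in> P" for m
    proof (induction m)
      case 0 then show ?case using P(1) by (simp add: ideal_of_def)
    qed (use Padd xi in auto)
    then have "(\<Sum>i<n. x ^ i - 1) \<in> P" .
    then have "- of_nat n \<in> P" using z by (simp add: sum_subtractf)
    moreover have "of_nat p ^ k \<in> P" using Pm[OF pP, of "of_nat p ^ (k - 1)"] k
      by (simp add: power_eq_if mult.commute)
    moreover have "(1::cyc) = of_nat p ^ k + - of_nat n"
      unfolding n_def using p1 by (simp add: of_nat_diff)
    ultimately show False using P(3) Padd[of "of_nat p ^ k" "- of_nat n"] by simp
  qed
  have crd: "card {t::cyc. t ^ (p ^ k - 1) = 1} = p ^ k - 1" if "k > 0" for k
  proof -
    have "p ^ k > 1" using p1 that by (rule one_less_power)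
    then show ?thesis using card_roots_unity_cyc(1)[of "p ^ k - 1"] by linarith
  qed
  have "residue_closure P p"
    by (rule residue_closure.intro) (fact assms P pP crd inj)+
  then show ?thesis by blast
qed

section \<open>Frobenius and additive characters\<close>

hide_const (open) up_ring.coeff up_ring.monom

section \<open>Additive characters of the integers modulo q\<close>

definition ee :: "nat \<Rightarrow> int \<Rightarrow> complex" where
  "ee q x = cis (2 * pi * of_int x / of_nat q)"

lemma ee_add: "ee q (x + y) = ee q x * ee q y"
  by (simp add: ee_def cis_mult distrib_left add_divide_distrib)

lemma ee_0 [simp]: "ee q 0 = 1"
  by (simp add: ee_def)

lemma norm_ee [simp]: "norm (ee q x) = 1"
  by (simp add: ee_def)

lemma ee_mult_self: "q > 0 \<Longrightarrow> ee q (int q * x) = 1"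
  using cis_multiple_2pi[of "of_int x"] by (simp add: ee_def mult.assoc)

lemma ee_cong:
  assumes "q > 0" "[x = y] (mod int q)"
  shows "ee q x = ee q y"
proof -
  obtain k where "x = y + int q * k" using assms(2) by (metis cong_iff_lin cong_sym)
  then show ?thesis using ee_mult_self[OF assms(1), of k] by (simp add: ee_add)
qed

lemma ee_eq_1_imp_dvd:
  assumes "q > 0" "ee q x = 1"
  shows "int q dvd x"
proof -
  have "cos (2 * pi * of_int x / of_nat q) = 1"
    using arg_cong[OF assms(2), of Re] by (simp add: ee_def)
  then obtain n :: int where "2 * pi * of_int x / of_nat q = of_int n * (2 * pi)"
    by (auto simp: cos_one_2pi_int)
  then have "real_of_int x = of_int (int q * n)" using assms(1) by (simp add: field_simps)
  then have "x = int q * n" by linarith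
  then show ?thesis by simp
qed

context residue_closure
begin

section \<open>Congruence modulo the ideal \<open>P\<close>\<close>

definition eqm :: "'a \<Rightarrow> 'a \<Rightarrow> bool" (infix "\<doteq>" 50) where
  "x \<doteq> y \<longleftrightarrow> x - y \<in> P"

lemma zero_in: "0 \<in> P" and add_in: "x \<in> P \<Longrightarrow> y \<in> P \<Longrightarrow> x + y \<in> P" and mult_in: "x \<in> P \<Longrightarrow> r * x \<in> P"
  using ideal_P unfolding ideal_of_def by simp_all

lemma mult_in': "x \<in> P \<Longrightarrow> x * r \<in> P"
  using mult_in[of x r] by (simp add: mult.commute)

lemma uminus_in: "x \<in> P \<Longrightarrow> - x \<in> P"
  using mult_in[of x "-1"] by simp

lemma eqm_refl [simp, intro]: "x \<doteq> x"
  by (simp add: eqm_def zero_in)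

lemma eqm_sym: "x \<doteq> y \<Longrightarrow> y \<doteq> x"
  using uminus_in[of "x - y"] by (simp add: eqm_def)

lemma eqm_trans [trans]: "x \<doteq> y \<Longrightarrow> y \<doteq> z \<Longrightarrow> x \<doteq> z"
  using add_in[of "x - y" "y - z"] by (simp add: eqm_def)

lemma eqm_0_iff: "x \<doteq> 0 \<longleftrightarrow> x \<in> P"
  by (simp add: eqm_def)

lemma eqm_add: "x \<doteq> y \<Longrightarrow> x' \<doteq> y' \<Longrightarrow> x + x' \<doteq> y + y'"
  using add_in[of "x - y" "x' - y'"] by (simp add: eqm_def algebra_simps)

lemma eqm_uminus: "x \<doteq> y \<Longrightarrow> - x \<doteq> - y"
  using uminus_in[of "x - y"] by (simp add: eqm_def)

lemma eqm_diff: "x \<doteq> y \<Longrightarrow> x' \<doteq> y' \<Longrightarrow> x - x' \<doteq> y - y'"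
  using eqm_add[OF _ eqm_uminus] by simp

lemma eqm_mult:
  assumes "x \<doteq> y" "x' \<doteq> y'"
  shows "x * x' \<doteq> y * y'"
proof -
  have "x * x' - y * y' = (x - y) * x' + y * (x' - y')" by (simp add: algebra_simps)
  moreover have "(x - y) * x' + y * (x' - y') \<in> P"
    using assms by (intro add_in mult_in mult_in') (simp_all add: eqm_def)
  ultimately show ?thesis by (simp add: eqm_def)
qed

lemma eqm_power: "x \<doteq> y \<Longrightarrow> x ^ n \<doteq> y ^ n"
  by (induction n) (auto intro: eqm_mult)

lemma eqm_sum: "(\<And>i. i \<in> A \<Longrightarrow> f i \<doteq> g i) \<Longrightarrow> sum f A \<doteq> sum g A"
  by (induction A rule: infinite_finite_induct) (auto intro: eqm_add)

lemma eqm_sum_mset: "(\<And>i. i \<in># A \<Longrightarrow> f i \<doteq> g i) \<Longrightarrow> (\<Sum>i\<in>#A. f i) \<doteq> (\<Sum>i\<in>#A. g i)"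
  by (induction A) (auto intro: eqm_add)

lemma eqm_mem: "x \<doteq> y \<Longrightarrow> y \<in> P \<Longrightarrow> x \<in> P"
  using add_in[of "x - y" y] by (simp add: eqm_def)

lemma prime_P:
  assumes "x * y \<in> P"
  shows "x \<in> P \<or> y \<in> P"
proof (rule ccontr)
  assume *: "\<not> ?thesis"
  then obtain u where u: "x * u - 1 \<in> P" using inverse_mod by blast
  have "u * (x * y) - (x * u - 1) * y \<in> P"
    using mult_in[OF assms, of u] uminus_in[OF mult_in'[OF u, of y]] add_in by fastforce
  moreover have "u * (x * y) - (x * u - 1) * y = y" by (simp add: algebra_simps)
  ultimately show False using * by simp
qed

lemma power_in_P: "x ^ n \<in> P \<Longrightarrow> x \<in> P"
  by (induction n) (use one_notin prime_P in auto)

lemma p_pos: "p > 0" and p_gt1: "p > 1"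
  using prime_gt_1_nat[OF prime_p] by auto

lemma of_int_in_P_iff: "of_int a \<in> P \<longleftrightarrow> int p dvd a"
proof
  assume "int p dvd a"
  then obtain k where "a = int p * k" by auto
  then show "of_int a \<in> P" using mult_in'[OF p_in, of "of_int k"] by simp
next
  assume a: "of_int a \<in> P"
  show "int p dvd a"
  proof (rule ccontr)
    assume "\<not> int p dvd a"
    then have "coprime a (int p)" using prime_p
      by (metis coprime_commute prime_imp_coprime prime_nat_int_transfer)
    then obtain u v where "u * a + v * int p = 1"
      using bezout_int[of a "int p"] by auto
    then have "of_int (u * a + v * int p) = (1::'a)" by simp
    then have "of_int u * of_int a + of_int v * of_nat p = (1::'a)" by simp
    then show False using add_in[OF mult_in[OF a] mult_in[OF p_in]] one_notin by metis
  qed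
qed

lemma of_int_eqm_iff: "of_int a \<doteq> of_int b \<longleftrightarrow> [a = b] (mod int p)"
  using of_int_in_P_iff[of "a - b"] by (simp add: eqm_def cong_iff_dvd_diff)

section \<open>The Frobenius endomorphism modulo \<open>P\<close>\<close>

lemma frob_add: "(x + y) ^ p \<doteq> x ^ p + y ^ p"
proof -
  have "(x + y) ^ p = (\<Sum>k\<le>p. of_nat (p choose k) * x ^ k * y ^ (p - k))"
    by (rule binomial_ring)
  also have "\<dots> = (\<Sum>k\<in>{0<..<p}. of_nat (p choose k) * x ^ k * y ^ (p - k)) + (x ^ p + y ^ p)"
  proof -
    have "{..p} = {0<..<p} \<union> {0, p}" using p_pos by auto
    moreover have "{0<..<p} \<inter> {0, p} = {}" by auto
    ultimately have "(\<Sum>k\<le>p. of_nat (p choose k) * x ^ k * y ^ (p - k)) =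
        (\<Sum>k\<in>{0<..<p}. of_nat (p choose k) * x ^ k * y ^ (p - k)) +
        (\<Sum>k\<in>{0, p}. of_nat (p choose k) * x ^ k * y ^ (p - k))"
      by (simp only:) (rule sum.union_disjoint; simp)
    then show ?thesis using p_pos by (simp add: add.commute)
  qed
  also have "\<dots> \<doteq> 0 + (x ^ p + y ^ p)"
  proof (rule eqm_add[OF _ eqm_refl])
    have "(\<Sum>k\<in>{0<..<p}. of_nat (p choose k) * x ^ k * y ^ (p - k)) \<doteq> (\<Sum>k\<in>{0<..<p}. 0)"
    proof (rule eqm_sum)
      fix k assume "k \<in> {0<..<p}"
      then have "p dvd p choose k" using prime_p by (intro dvd_choose_prime) auto
      then have "of_int (int (p choose k)) \<in> P" by (subst of_int_in_P_iff) simp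
      then have "of_nat (p choose k) \<in> P" by simp
      then show "of_nat (p choose k) * x ^ k * y ^ (p - k) \<doteq> 0"
        unfolding eqm_0_iff by (intro mult_in')
    qed
    then show "(\<Sum>k\<in>{0<..<p}. of_nat (p choose k) * x ^ k * y ^ (p - k)) \<doteq> 0" by simp
  qed
  finally show ?thesis by simp
qed

lemma frob_0: "(0::'a) ^ p = 0"
  using p_pos by (simp add: power_0_left)

lemma frob_uminus: "(- x) ^ p \<doteq> - (x ^ p)"
proof -
  have "x ^ p + (- x) ^ p \<doteq> 0" using eqm_sym[OF frob_add[of x "- x"]] frob_0 by simp
  then show ?thesis using eqm_diff[of _ _ "x ^ p" "x ^ p"] by fastforce
qed

lemma frob_sum: "(\<Sum>i\<in>A. f i) ^ p \<doteq> (\<Sum>i\<in>A. f i ^ p)"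
proof (induction A rule: infinite_finite_induct)
  case (insert x F)
  then show ?case using eqm_trans[OF frob_add eqm_add[OF eqm_refl insert.IH]] by simp
qed (auto simp: frob_0)

lemma frob_sum_mset: "(\<Sum>i\<in>#A. f i) ^ p \<doteq> (\<Sum>i\<in>#A. f i ^ p)"
proof (induction A)
  case (add x F)
  then show ?case using eqm_trans[OF frob_add eqm_add[OF eqm_refl add]] by simp
qed (auto simp: frob_0)

lemma frob_of_int: "(of_int a) ^ p \<doteq> of_int a"
proof -
  have *: "(of_nat n) ^ p \<doteq> of_nat n" for n
  proof (induction n)
    case (Suc n)
    have "(of_nat n + 1) ^ p \<doteq> of_nat n ^ p + 1 ^ p" by (rule frob_add)
    also have "\<dots> \<doteq> of_nat n + 1" using eqm_add[OF Suc] by simp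
    finally show ?case by (simp add: add.commute)
  qed (auto simp: frob_0)
  show ?thesis
  proof (cases "a \<ge> 0")
    case True
    then show ?thesis using *[of "nat a"] by simp
  next
    case False
    then have "of_int a = - (of_nat (nat (- a)) :: 'a)" by simp
    then show ?thesis using eqm_trans[OF frob_uminus eqm_uminus[OF *]] by metis
  qed
qed

lemma frobk_add: "(x + y) ^ (p ^ k) \<doteq> x ^ (p ^ k) + y ^ (p ^ k)"
proof (induction k)
  case (Suc k)
  have "((x + y) ^ p ^ k) ^ p \<doteq> (x ^ p ^ k + y ^ p ^ k) ^ p" by (rule eqm_power[OF Suc])
  also have "\<dots> \<doteq> (x ^ p ^ k) ^ p + (y ^ p ^ k) ^ p" by (rule frob_add)
  finally show ?case by (simp add: mult.commute flip: power_mult)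
qed auto

lemma frobk_sum: "(\<Sum>i\<in>A. f i) ^ (p ^ k) \<doteq> (\<Sum>i\<in>A. f i ^ (p ^ k))"
proof (induction k)
  case (Suc k)
  have "((\<Sum>i\<in>A. f i) ^ p ^ k) ^ p \<doteq> (\<Sum>i\<in>A. f i ^ p ^ k) ^ p" by (rule eqm_power[OF Suc])
  also have "\<dots> \<doteq> (\<Sum>i\<in>A. (f i ^ p ^ k) ^ p)" by (rule frob_sum)
  finally show ?case by (simp add: mult.commute flip: power_mult)
qed auto

lemma frobk_of_int: "(of_int a) ^ (p ^ k) \<doteq> of_int a"
proof (induction k)
  case (Suc k)
  have "(of_int a ^ p ^ k) ^ p \<doteq> of_int a ^ p" by (rule eqm_power[OF Suc])
  also have "\<dots> \<doteq> of_int a" by (rule frob_of_int)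
  finally show ?case by (simp add: mult.commute flip: power_mult)
qed auto

text \<open>The quotient by \<open>P\<close> is an integral domain, so a polynomial with more roots
  than its degree vanishes there. The division by X - t is carried out over the ring itself;
  \<open>degree G\<close> is the degree before reduction and may be larger than the degree modulo
  \<open>P\<close>.\<close>

lemma root_bound:
  assumes "finite T" "\<And>t. t \<in> T \<Longrightarrow> poly G t \<in> P"
    and "\<And>t s. t \<in> T \<Longrightarrow> s \<in> T \<Longrightarrow> t \<doteq> s \<Longrightarrow> t = s" "card T > degree G"
  shows "coeff G i \<in> P"
  using assms
proof (induction T arbitrary: G i rule: finite_induct)
  case (insert t T)
  define Q where "Q = synthetic_div G t"
  have G: "G = [:- t, 1:] * Q + [:poly G t:]"
    unfolding Q_def by (rule synthetic_div_correct'[symmetric])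
  have tP: "poly G t \<in> P" using insert.prems by simp
  show ?case
  proof (cases "degree G = 0")
    case True
    then obtain c where "G = [:c:]" by (rule degree_eq_zeroE)
    then show ?thesis using tP by (cases i) (auto simp: zero_in)
  next
    case False
    have Q: "coeff Q j \<in> P" for j
    proof (rule insert.IH)
      show "degree Q < card T" unfolding Q_def degree_synthetic_div
        using False insert.prems(3) insert.hyps by simp
      show "s = s'" if "s \<in> T" "s' \<in> T" "s \<doteq> s'" for s s' using insert.prems(2) that by blast
      fix s assume s: "s \<in> T"
      have "poly G s = (s - t) * poly Q s + poly G t" by (subst G) (simp add: algebra_simps)
      then have "(s - t) * poly Q s = poly G s - poly G t" by simp
      also have "\<dots> \<in> P" using insert.prems(1)[of s] tP s uminus_in add_in by fastforce
      finally have "s - t \<in> P \<or> poly Q s \<in> P" by (rule prime_P)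
      moreover have "s - t \<notin> P"
        using insert.prems(2)[of s t] s insert.hyps by (auto simp: eqm_def)
      ultimately show "poly Q s \<in> P" by simp
    qed
    have "coeff G i = coeff ([:- t, 1:] * Q) i + coeff [:poly G t:] i"
      by (subst G) simp
    moreover have "coeff ([:- t, 1:] * Q) i \<in> P"
      using Q uminus_in[OF mult_in[OF Q, of t i]] add_in[OF Q, of "- (t * coeff Q i)"]
      by (cases i) (simp_all add: zero_in)
    moreover have "coeff [:poly G t:] i \<in> P"
      using tP zero_in by (cases i) simp_all
    ultimately show ?thesis using add_in by simp
  qed
qed simp

section \<open>The prime field and its additive character\<close>

definition Fp :: "'a set" where "Fp = {x. x ^ p \<doteq> x}"

text \<open>The polynomial X^p - X already has the p residues 0, ..., p - 1 as roots modulo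
  \<open>P\<close>; one more root would exceed its degree.\<close>

lemma Fp_eqm_int:
  assumes "x \<in> Fp"
  shows "\<exists>a::int. 0 \<le> a \<and> a < int p \<and> x \<doteq> of_int a"
proof (rule ccontr)
  assume no: "\<not> ?thesis"
  define T where "T = insert x ((\<lambda>a::int. of_int a) ` {0..<int p})"
  have inj: "inj_on (\<lambda>a::int. of_int a :: 'a) {0..<int p}"
  proof (rule inj_onI)
    fix a b :: int assume ab: "a \<in> {0..<int p}" "b \<in> {0..<int p}" "(of_int a :: 'a) = of_int b"
    then have "[a = b] (mod int p)" using of_int_eqm_iff[of a b] by simp
    then show "a = b" using ab by (simp add: cong_def)
  qed
  have xn: "x \<notin> (\<lambda>a::int. of_int a) ` {0..<int p}" using no by auto
  have cT: "card T = Suc p" unfolding T_def using xn card_image[OF inj] by simp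
  define G :: "'a poly" where "G = monom 1 p - monom 1 1"
  have dG: "degree G \<le> p" unfolding G_def
    using p_gt1 by (intro degree_diff_le order_trans[OF degree_monom_le]) auto
  have "coeff G p \<in> P"
  proof (rule root_bound[of T])
    show "finite T" by (simp add: T_def)
    show "degree G < card T" using dG cT by simp
    show "poly G t \<in> P" if "t \<in> T" for t
      using that assms frob_of_int by (auto simp: T_def G_def poly_monom Fp_def eqm_def)
    fix t s assume ts: "t \<in> T" "s \<in> T" "t \<doteq> s"
    have 1: "\<not> x \<doteq> of_int a" if "a \<in> {0..<int p}" for a using no that by auto
    have 2: "\<not> of_int a \<doteq> x" if "a \<in> {0..<int p}" for a using 1[OF that] eqm_sym by blast
    show "t = s"
      using ts 1 2 by (auto simp: T_def of_int_eqm_iff cong_def)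
  qed
  moreover have "coeff G p = 1" using p_gt1 by (simp add: G_def)
  ultimately show False using one_notin by simp
qed

text \<open>\<open>psi\<close> is meaningful on \<open>Fp\<close> only; elsewhere the choice of a representative is arbitrary.\<close>

definition rs :: "'a \<Rightarrow> int" where "rs x = (SOME a. 0 \<le> a \<and> a < int p \<and> x \<doteq> of_int a)"

definition psi :: "'a \<Rightarrow> complex" where "psi x = ee p (rs x)"

lemma rs:
  assumes "x \<in> Fp"
  shows "0 \<le> rs x" "rs x < int p" "x \<doteq> of_int (rs x)"
  using someI_ex[OF Fp_eqm_int[OF assms]] unfolding rs_def by simp_all

lemma of_int_in_Fp [simp]: "of_int a \<in> Fp" "0 \<in> Fp"
  using frob_of_int by (auto simp: Fp_def frob_0)

lemma Fp_cong: "x \<doteq> y \<Longrightarrow> x \<in> Fp \<Longrightarrow> y \<in> Fp"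
  unfolding Fp_def mem_Collect_eq by (meson eqm_power eqm_sym eqm_trans)

lemma psi_eqm_int:
  assumes "x \<doteq> of_int a"
  shows "psi x = ee p a"
proof -
  have x: "x \<in> Fp" using Fp_cong[OF eqm_sym[OF assms]] by simp
  have "of_int (rs x) \<doteq> of_int a" using eqm_trans[OF eqm_sym[OF rs(3)[OF x]] assms] .
  then show ?thesis unfolding psi_def by (intro ee_cong p_pos) (simp add: of_int_eqm_iff)
qed

lemma psi_cong: "x \<doteq> y \<Longrightarrow> x \<in> Fp \<Longrightarrow> psi x = psi y"
  using psi_eqm_int[of y "rs x"] eqm_trans[OF eqm_sym, of x y "of_int (rs x)"] rs(3)[of x]
  by (simp add: psi_def)

lemma psi_add:
  assumes "x \<in> Fp" "y \<in> Fp"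
  shows "psi (x + y) = psi x * psi y"
proof -
  have "x + y \<doteq> of_int (rs x + rs y)" using eqm_add[OF rs(3)[OF assms(1)] rs(3)[OF assms(2)]] by simp
  then have "psi (x + y) = ee p (rs x + rs y)" by (rule psi_eqm_int)
  then show ?thesis by (simp add: ee_add psi_def)
qed

lemma psi_0 [simp]: "psi 0 = 1"
  using psi_eqm_int[of 0 0] by simp

end

section \<open>Frobenius orbits and Newton's identity\<close>

context residue_closure
begin

text \<open>Roots of unity stand for the residue classes they represent. By \<open>Uall_inj\<close>
  congruence modulo \<open>P\<close> is equality on them, so sets, multisets and cardinalities can
  be used without forming a quotient.\<close>

definition U :: "nat \<Rightarrow> 'a set" where "U k = {t. t ^ (p ^ k - 1) = 1}"

definition Uall :: "'a set" where "Uall = (\<Union>k\<in>{0<..}. U k)"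

lemma pk_gt1: "k > 0 \<Longrightarrow> p ^ k > 1"
  using p_gt1 by (rule one_less_power)

lemma U_power: "t \<in> U k \<Longrightarrow> t ^ (p ^ k) = t"
proof -
  assume t: "t \<in> U k"
  have "p ^ k = Suc (p ^ k - 1)" using p_pos by simp
  then have "t ^ (p ^ k) = t * t ^ (p ^ k - 1)" by (metis power_Suc)
  then show ?thesis using t by (simp add: U_def)
qed

lemma finite_U: "k > 0 \<Longrightarrow> finite (U k)"
  using card_U[of k] pk_gt1[of k] unfolding U_def by (intro card_ge_0_finite) simp

lemma card_U': "k > 0 \<Longrightarrow> card (U k) = p ^ k - 1"
  unfolding U_def by (rule card_U)

lemma Uall_unit:
  assumes "t \<in> Uall"
  shows "\<exists>s. t * s = 1"
proof -
  obtain k where k: "k > 0" "t \<in> U k" using assms by (auto simp: Uall_def)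
  have "p ^ k - 1 = Suc (p ^ k - 2)" using pk_gt1[OF k(1)] by simp
  then have "t * t ^ (p ^ k - 2) = 1" using k(2) unfolding U_def by (metis mem_Collect_eq power_Suc)
  then show ?thesis by blast
qed

definition tinv :: "'a \<Rightarrow> 'a" where "tinv t = (SOME s. t * s = 1)"

lemma tinv: "t \<in> Uall \<Longrightarrow> t * tinv t = 1"
  unfolding tinv_def by (rule someI_ex[OF Uall_unit])

lemma tinv_unique: "t \<in> Uall \<Longrightarrow> t * s = 1 \<Longrightarrow> tinv t = s"
  using tinv[of t] by (metis mult.assoc mult.commute mult_1)

lemma unit_notin_P: "t * s = 1 \<Longrightarrow> t \<notin> P"
  using mult_in'[of t s] one_notin by auto

lemma Uall_notin_P: "t \<in> Uall \<Longrightarrow> t \<notin> P"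
  using tinv unit_notin_P by blast

lemma U_sub_Uall: "k > 0 \<Longrightarrow> t \<in> U k \<Longrightarrow> t \<in> Uall"
  by (auto simp: Uall_def)

lemma U_pow: "t \<in> U k \<Longrightarrow> t ^ n \<in> U k"
proof -
  assume t: "t \<in> U k"
  have "(t ^ n) ^ (p ^ k - 1) = (t ^ (p ^ k - 1)) ^ n" by (simp add: mult.commute flip: power_mult)
  then show ?thesis using t by (simp add: U_def)
qed

lemma Uall_pow: "t \<in> Uall \<Longrightarrow> t ^ n \<in> Uall"
  unfolding Uall_def using U_pow by blast

lemma unit_cancel: "t * s = (1::'a) \<Longrightarrow> t * x = t * y \<Longrightarrow> x = y"
  by (metis mult.assoc mult.commute mult_1)

lemma U_iff:
  assumes "t \<in> Uall"
  shows "t \<in> U k \<longleftrightarrow> t ^ (p ^ k) = t"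
proof
  assume *: "t ^ (p ^ k) = t"
  have "p ^ k = Suc (p ^ k - 1)" using p_pos by simp
  then have "t * t ^ (p ^ k - 1) = t * 1" using * by (metis mult_1_right power_Suc)
  then have "t ^ (p ^ k - 1) = 1" by (rule unit_cancel[OF tinv[OF assms]])
  then show "t \<in> U k" by (simp add: U_def)
qed (rule U_power)

lemma U_mult: "t \<in> U k \<Longrightarrow> t \<in> U (k * j)"
proof (induction j)
  case (Suc j)
  have "p ^ (k * Suc j) - 1 = p ^ k * (p ^ (k * j) - 1) + (p ^ k - 1)"
    using p_pos by (simp add: power_add algebra_simps diff_mult_distrib2)
  then have "t ^ (p ^ (k * Suc j) - 1) = (t ^ (p ^ (k * j) - 1)) ^ (p ^ k) * t ^ (p ^ k - 1)"
    by (simp add: power_add mult.commute flip: power_mult)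
  then show ?case using Suc by (simp add: U_def)
qed (simp add: U_def)

lemma Uall_common:
  assumes "t \<in> Uall" "s \<in> Uall"
  obtains k where "k > 0" "t \<in> U k" "s \<in> U k"
proof -
  obtain a b where "a > 0" "t \<in> U a" "b > 0" "s \<in> U b" using assms by (auto simp: Uall_def)
  then show ?thesis using that[of "a * b"] U_mult[of t a b] U_mult[of s b a] by (simp add: mult.commute)
qed

lemma Uall_inj:
  assumes "t \<in> Uall" "s \<in> Uall" "t \<doteq> s"
  shows "t = s"
  using assms(3) Uall_common[OF assms(1,2)] U_inj[of _ t s] unfolding U_def eqm_def by auto

lemma tinv_pow: "t \<in> Uall \<Longrightarrow> tinv (t ^ n) = tinv t ^ n"
  by (rule tinv_unique[OF Uall_pow]) (simp_all add: tinv flip: power_mult_distrib)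

text \<open>The length \<open>k\<close> may be a proper multiple of the degree of \<open>t\<close>;
  the conjugates then occur several times. The sum of a function over this multiset is its trace
  from the field with p^k elements.\<close>

definition orb :: "nat \<Rightarrow> 'a \<Rightarrow> 'a multiset" where
  "orb k t = image_mset (\<lambda>i. t ^ (p ^ i)) (mset_set {..<k})"

text \<open>By \<open>cvec_bij\<close> these are, for d > 0, the monic polynomials of degree d over
  the prime field with nonzero constant term, encoded by their roots.\<close>

definition Inv :: "nat \<Rightarrow> 'a multiset set" where
  "Inv d = {M. size M = d \<and> set_mset M \<subseteq> Uall \<and> image_mset (\<lambda>t. t ^ p) M = M}"

lemma size_orb [simp]: "size (orb k t) = k"
  by (simp add: orb_def)

lemma orb_invariant:
  assumes "t \<in> U k"
  shows "image_mset (\<lambda>t. t ^ p) (orb k t) = orb k t"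
proof -
  let ?g = "\<lambda>i. t ^ (p ^ i)"
  have "image_mset ?g (mset_set {..<Suc k}) = add_mset (?g k) (image_mset ?g (mset_set {..<k}))"
    by (simp add: lessThan_Suc)
  moreover have "image_mset ?g (mset_set {..<Suc k}) = add_mset (?g 0) (image_mset (\<lambda>i. ?g (Suc i)) (mset_set {..<k}))"
  proof -
    have "mset_set {..<Suc k} = add_mset 0 (mset_set (Suc ` {..<k}))"
      by (simp add: lessThan_Suc_eq_insert_0)
    also have "mset_set (Suc ` {..<k}) = image_mset Suc (mset_set {..<k})"
      by (rule image_mset_mset_set[symmetric]) simp
    finally show ?thesis by (simp add: multiset.map_comp o_def)
  qed
  moreover have "?g k = ?g 0" using U_power[OF assms] by simp
  ultimately have "image_mset (\<lambda>i. ?g (Suc i)) (mset_set {..<k}) = orb k t" unfolding orb_def by simp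
  moreover have "image_mset (\<lambda>t. t ^ p) (orb k t) = image_mset (\<lambda>i. ?g (Suc i)) (mset_set {..<k})"
    unfolding orb_def by (simp add: multiset.map_comp o_def mult.commute flip: power_mult)
  ultimately show ?thesis by simp
qed

lemma orb_in_Inv: "t \<in> U k \<Longrightarrow> orb k t \<in> Inv k"
proof (cases "k = 0")
  case False
  assume t: "t \<in> U k"
  have "t \<in> Uall" using U_sub_Uall[OF _ t] False by simp
  then show ?thesis unfolding Inv_def using orb_invariant[OF t] Uall_pow by (auto simp: orb_def)
qed (simp add: Inv_def orb_def)

lemma Inv_add: "M \<in> Inv a \<Longrightarrow> N \<in> Inv b \<Longrightarrow> M + N \<in> Inv (a + b)"
  by (auto simp: Inv_def)

lemma Inv_diff:
  assumes "M \<in> Inv d" "N \<in> Inv k" "N \<subseteq># M"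
  shows "M - N \<in> Inv (d - k)"
proof -
  have "image_mset (\<lambda>t. t ^ p) (M - N) = M - N"
    using assms image_mset_Diff[OF assms(3), of "\<lambda>t. t ^ p"] by (simp add: Inv_def)
  moreover have "set_mset (M - N) \<subseteq> Uall" using assms in_diffD[of _ M N] by (auto simp: Inv_def)
  ultimately show ?thesis using assms by (simp add: Inv_def size_Diff_submset)
qed

lemma Inv_closed:
  assumes "M \<in> Inv d" "t \<in># M"
  shows "t ^ (p ^ i) \<in># M"
proof (induction i)
  case (Suc i)
  have "(t ^ p ^ i) ^ p \<in># image_mset (\<lambda>t. t ^ p) M" using Suc by simp
  also have "image_mset (\<lambda>t. t ^ p) M = M" using assms by (simp add: Inv_def)
  finally show ?case by (simp add: mult.commute flip: power_mult)
qed (use assms in simp)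

text \<open>The degree of \<open>t\<close> over the prime field.\<close>

definition fdeg :: "'a \<Rightarrow> nat" where "fdeg t = (LEAST k. k > 0 \<and> t \<in> U k)"

lemma fdeg:
  assumes "t \<in> Uall"
  shows "fdeg t > 0" "t \<in> U (fdeg t)" "k > 0 \<Longrightarrow> t \<in> U k \<Longrightarrow> fdeg t \<le> k"
proof -
  obtain j where "j > 0 \<and> t \<in> U j" using assms by (auto simp: Uall_def)
  from LeastI[of "\<lambda>k. k > 0 \<and> t \<in> U k", OF this]
  show "fdeg t > 0" "t \<in> U (fdeg t)" unfolding fdeg_def by simp_all
  show "k > 0 \<Longrightarrow> t \<in> U k \<Longrightarrow> fdeg t \<le> k" unfolding fdeg_def by (rule Least_le) simp
qed

text \<open>Suppose the conjugates with indices i < j < e coincide, where e is the degree. Applying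
  Frobenius e - i more times shows that t is fixed by the Frobenius power j - i, which contradicts
  the minimality of e.\<close>

lemma orb_fdeg_inj:
  assumes "t \<in> Uall"
  shows "inj_on (\<lambda>i. t ^ (p ^ i)) {..<fdeg t}"
proof -
  have "\<not> (i < j \<and> j < fdeg t \<and> t ^ (p ^ i) = t ^ (p ^ j))" for i j
  proof
    define e where "e = fdeg t"
    assume ij: "i < j \<and> j < fdeg t \<and> t ^ (p ^ i) = t ^ (p ^ j)"
    have te: "t ^ (p ^ e) = t" using U_power[OF fdeg(2)[OF assms]] by (simp add: e_def)
    have "(t ^ (p ^ i)) ^ (p ^ (e - i)) = t ^ (p ^ (i + (e - i)))" by (simp add: power_add power_mult)
    also have "i + (e - i) = e" using ij by (simp add: e_def)
    finally have "t = (t ^ (p ^ i)) ^ (p ^ (e - i))" using te by simp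
    also have "\<dots> = (t ^ (p ^ j)) ^ (p ^ (e - i))" using ij by simp
    also have "\<dots> = t ^ (p ^ (j + (e - i)))" by (simp add: power_add power_mult)
    also have "j + (e - i) = e + (j - i)" using ij by (simp add: e_def)
    also have "t ^ (p ^ (e + (j - i))) = (t ^ (p ^ e)) ^ (p ^ (j - i))" by (simp add: power_add power_mult)
    finally have "t ^ (p ^ (j - i)) = t" unfolding te by simp
    then have "t \<in> U (j - i)" using U_iff[OF assms] by simp
    then have "fdeg t \<le> j - i" using fdeg(3)[OF assms, of "j - i"] ij by simp
    moreover have "j - i \<le> j" by simp
    ultimately show False using ij by linarith
  qed
  then show ?thesis unfolding inj_on_def by (metis lessThan_iff nat_neq_iff)
qed

lemma orb_fdeg_subset:
  assumes "t \<in> Uall" "M \<in> Inv d" "t \<in># M"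
  shows "orb (fdeg t) t \<subseteq># M"
proof -
  have "orb (fdeg t) t = mset_set ((\<lambda>i. t ^ (p ^ i)) ` {..<fdeg t})"
    unfolding orb_def using orb_fdeg_inj[OF assms(1)] by (rule image_mset_mset_set)
  also have "\<dots> \<subseteq># mset_set (set_mset M)"
    using Inv_closed[OF assms(2,3)] by (intro subset_imp_msubset_mset_set) auto
  also have "\<dots> \<subseteq># M" by (rule mset_set_set_mset_msubset)
  finally show ?thesis .
qed

lemma count_orb_fdeg: "t \<in> Uall \<Longrightarrow> count (orb (fdeg t) t) t = 1"
proof -
  assume t: "t \<in> Uall"
  have "orb (fdeg t) t = mset_set ((\<lambda>i. t ^ (p ^ i)) ` {..<fdeg t})"
    unfolding orb_def using orb_fdeg_inj[OF t] by (rule image_mset_mset_set)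
  moreover have "t \<in> (\<lambda>i. t ^ (p ^ i)) ` {..<fdeg t}"
    using fdeg(1)[OF t] by (intro image_eqI[of _ _ 0]) auto
  ultimately show ?thesis by simp
qed

lemma orb_add:
  assumes "t \<in> U e"
  shows "orb (e + k) t = orb e t + orb k t"
proof -
  have "mset_set {..<e + k} = mset_set {..<e} + image_mset (\<lambda>i. e + i) (mset_set {..<k})"
  proof -
    have "{..<e + k} = {..<e} \<union> (\<lambda>i. e + i) ` {..<k}"
    proof (intro equalityI subsetI)
      fix x assume x: "x \<in> {..<e + k}"
      show "x \<in> {..<e} \<union> (\<lambda>i. e + i) ` {..<k}"
        using x by (cases "x < e") (auto intro!: image_eqI[of _ _ "x - e"])
    qed auto
    then have "mset_set {..<e + k} = mset_set {..<e} + mset_set ((\<lambda>i. e + i) ` {..<k})"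
      by (simp only:) (rule mset_set_Union; auto)
    moreover have "mset_set ((\<lambda>i. e + i) ` {..<k}) = image_mset (\<lambda>i. e + i) (mset_set {..<k})"
      by (rule image_mset_mset_set[symmetric]) simp
    ultimately show ?thesis by simp
  qed
  moreover have "t ^ (p ^ (e + i)) = t ^ (p ^ i)" for i
    using U_power[OF assms] by (simp add: power_add power_mult)
  ultimately show ?thesis by (simp add: orb_def multiset.map_comp o_def)
qed

definition sub_orbits :: "'a multiset \<Rightarrow> 'a \<Rightarrow> nat set" where
  "sub_orbits M t = {k. k > 0 \<and> t \<in> U k \<and> orb k t \<subseteq># M}"

lemma in_orb: "k > 0 \<Longrightarrow> t \<in># orb k t"
  by (auto simp: orb_def intro!: image_eqI[of _ _ 0])

lemma sub_orbits_le_size: "k \<in> sub_orbits M t \<Longrightarrow> k \<le> size M"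
  unfolding sub_orbits_def using size_mset_mono[of "orb k t" M] by simp

lemma finite_sub_orbits: "finite (sub_orbits M t)"
  by (rule finite_subset[of _ "{..size M}"]) (auto dest: sub_orbits_le_size)

text \<open>If e is the degree of \<open>t\<close>, the admissible lengths are e, 2e, 3e and so on.
  Removing one orbit of length e from \<open>M\<close> lowers the multiplicity of \<open>t\<close>
  and the number of admissible lengths by one each. The lemma thus rewrites a multiplicity as a
  number of orbits that can be split off.\<close>

lemma card_sub_orbits:
  assumes "t \<in> Uall" "M \<in> Inv d"
  shows "card (sub_orbits M t) = count M t"
  using assms(2)
proof (induction d arbitrary: M rule: less_induct)
  case (less d)
  show ?case
  proof (cases "t \<in># M")
    case False
    have "k \<notin> sub_orbits M t" for k
      using False in_orb[of k t] mset_subset_eqD[of "orb k t" M t] by (auto simp: sub_orbits_def)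
    then have "sub_orbits M t = {}" by blast
    then show ?thesis using False by (simp add: not_in_iff)
  next
    case True
    define e where "e = fdeg t"
    have e: "e > 0" "t \<in> U e" "\<And>k. k > 0 \<Longrightarrow> t \<in> U k \<Longrightarrow> e \<le> k" unfolding e_def using fdeg[OF assms(1)] by auto
    define M' where "M' = M - orb e t"
    have sub: "orb e t \<subseteq># M" unfolding e_def by (rule orb_fdeg_subset[OF assms(1) less.prems True])
    have M: "M = orb e t + M'" unfolding M'_def using sub by simp
    have M'I: "M' \<in> Inv (d - e)" unfolding M'_def by (rule Inv_diff[OF less.prems orb_in_Inv[OF e(2)] sub])
    have "M \<noteq> {#}" using True by auto
    then have "d > 0" using less.prems by (auto simp: Inv_def simp flip: nonempty_has_size)
    then have IH: "card (sub_orbits M' t) = count M' t" using less.IH[OF _ M'I] e(1) by simp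
    have Uadd: "t \<in> U (e + k) \<longleftrightarrow> t \<in> U k" for k
      unfolding U_iff[OF assms(1)] using U_power[OF e(2)] by (simp add: power_add power_mult)
    have eq: "sub_orbits M t = insert e ((\<lambda>k. e + k) ` sub_orbits M' t)"
    proof (intro equalityI subsetI)
      fix k assume k: "k \<in> sub_orbits M t"
      then have ke: "e \<le> k" using e(3) by (simp add: sub_orbits_def)
      show "k \<in> insert e ((\<lambda>k. e + k) ` sub_orbits M' t)"
      proof (cases "k = e")
        case False
        then have "orb e t + orb (k - e) t \<subseteq># orb e t + M'"
          using k ke orb_add[OF e(2), of "k - e"] M by (simp add: sub_orbits_def)
        then have "orb (k - e) t \<subseteq># M'" by simp
        then have "k - e \<in> sub_orbits M' t" using k ke False Uadd[of "k - e"] by (simp add: sub_orbits_def)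
        then show ?thesis using ke by (intro insertI2 image_eqI[of _ _ "k - e"]) auto
      qed simp
    next
      fix k assume "k \<in> insert e ((\<lambda>k. e + k) ` sub_orbits M' t)"
      then show "k \<in> sub_orbits M t"
      proof
        assume "k = e" then show ?thesis using e sub by (simp add: sub_orbits_def)
      next
        assume "k \<in> (\<lambda>k. e + k) ` sub_orbits M' t"
        then obtain j where j: "k = e + j" "j \<in> sub_orbits M' t" by blast
        then show ?thesis using orb_add[OF e(2), of j] M Uadd[of j] by (simp add: sub_orbits_def)
      qed
    qed
    have "e \<notin> (\<lambda>k. e + k) ` sub_orbits M' t" by (auto simp: sub_orbits_def)
    then have "card (sub_orbits M t) = Suc (card (sub_orbits M' t))"
      unfolding eq using finite_sub_orbits by (simp add: card_image)
    moreover have "count M t = Suc (count M' t)" unfolding M using count_orb_fdeg[OF assms(1)] by (simp add: e_def)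
    ultimately show ?thesis using IH by simp
  qed
qed

lemma Inv_support:
  assumes "M \<in> Inv d"
  shows "set_mset M \<subseteq> (\<Union>k\<in>{1..d}. U k)"
proof
  fix t assume t: "t \<in># M"
  then have tU: "t \<in> Uall" using assms by (auto simp: Inv_def)
  have "size (orb (fdeg t) t) \<le> size M" by (rule size_mset_mono[OF orb_fdeg_subset[OF tU assms t]])
  then have "fdeg t \<le> d" using assms by (simp add: Inv_def)
  then show "t \<in> (\<Union>k\<in>{1..d}. U k)" using fdeg[OF tU] by (intro UN_I[of "fdeg t"]) auto
qed

lemma finite_Inv: "finite (Inv d)"
proof (rule finite_subset)
  show "Inv d \<subseteq> multisets_of_size (\<Union>k\<in>{1..d}. U k) d"
    using Inv_support by (auto simp: multisets_of_size_def Inv_def)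
  show "finite (multisets_of_size (\<Union>k\<in>{1..d}. U k) d)"
    using finite_U by (intro finite_multisets_of_size finite_UN_I) auto
qed

lemma Inv_0: "Inv 0 = {{#}}"
  by (auto simp: Inv_def)

text \<open>Newton's identity \<open>T L'(T) = L(T) \<Sum> W\<^sub>k T^k\<close> for the Euler product \<open>L\<close> over Frobenius orbits.\<close>

lemma newton_identity:
  fixes L :: "'a multiset \<Rightarrow> complex"
  assumes L: "\<And>M N a b. M \<in> Inv a \<Longrightarrow> N \<in> Inv b \<Longrightarrow> L (M + N) = L M * L N"
  shows "of_nat d * (\<Sum>M\<in>Inv d. L M) = (\<Sum>k\<in>{1..d}. (\<Sum>t\<in>U k. L (orb k t)) * (\<Sum>M\<in>Inv (d - k). L M))"
proof -
  define T where "T = (\<Union>k\<in>{1..d}. U k)"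
  have fT: "finite T" unfolding T_def using finite_U by (intro finite_UN_I) auto
  have TU: "T \<subseteq> Uall" unfolding T_def by (auto intro: U_sub_Uall[rotated])
  \<comment> \<open>The factor d is the size of \<open>M\<close>, that is, the number of pairs (t,
    k) such that the orbit of length k of t is contained in \<open>M\<close>. Exchanging the sums
    sorts these pairs by k.\<close>
  have size: "of_nat d = (\<Sum>t\<in>T. of_nat (card (sub_orbits M t)) :: complex)" if M: "M \<in> Inv d" for M
  proof -
    have "(\<Sum>t\<in>T. card (sub_orbits M t)) = (\<Sum>t\<in>T. count M t)"
      using card_sub_orbits[OF _ M] TU by (intro sum.cong) auto
    also have "\<dots> = (\<Sum>t\<in>set_mset M. count M t)"
      using Inv_support[OF M] fT unfolding T_def[symmetric]
      by (intro sum.mono_neutral_right) (auto simp: not_in_iff)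
    also have "\<dots> = d" using M by (simp add: Inv_def size_multiset_overloaded_eq)
    finally show ?thesis by (simp flip: of_nat_sum)
  qed
  have card_eq: "of_nat (card (sub_orbits M t)) = (\<Sum>k\<in>{1..d}. if t \<in> U k \<and> orb k t \<subseteq># M then 1 else (0::complex))"
    if "M \<in> Inv d" for M t
  proof -
    have "sub_orbits M t = {k\<in>{1..d}. t \<in> U k \<and> orb k t \<subseteq># M}"
      using sub_orbits_le_size[of _ M t] that by (auto simp: sub_orbits_def Inv_def)
    then show ?thesis by (simp add: sum.If_cases Int_def)
  qed
  have "of_nat d * (\<Sum>M\<in>Inv d. L M) =
      (\<Sum>M\<in>Inv d. \<Sum>t\<in>T. \<Sum>k\<in>{1..d}. (if t \<in> U k \<and> orb k t \<subseteq># M then L M else 0))"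
    unfolding sum_distrib_left
  proof (rule sum.cong)
    fix M assume M: "M \<in> Inv d"
    have "of_nat d * L M = (\<Sum>t\<in>T. \<Sum>k\<in>{1..d}. (if t \<in> U k \<and> orb k t \<subseteq># M then 1 else 0) * L M)"
      unfolding size[OF M] card_eq[OF M] by (simp only: sum_distrib_right)
    also have "\<dots> = (\<Sum>t\<in>T. \<Sum>k\<in>{1..d}. (if t \<in> U k \<and> orb k t \<subseteq># M then L M else 0))"
      by (intro sum.cong) auto
    finally show "of_nat d * L M = \<dots>" .
  qed simp
  also have "\<dots> = (\<Sum>k\<in>{1..d}. \<Sum>t\<in>T. \<Sum>M\<in>Inv d. (if t \<in> U k \<and> orb k t \<subseteq># M then L M else 0))"
    by (subst sum.swap, subst (2) sum.swap, subst sum.swap) (rule refl)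
  also have "\<dots> = (\<Sum>k\<in>{1..d}. \<Sum>t\<in>U k. \<Sum>M\<in>Inv d. (if orb k t \<subseteq># M then L M else 0))"
  proof (rule sum.cong)
    fix k assume k: "k \<in> {1..d}"
    have "U k \<subseteq> T" using k by (auto simp: T_def)
    then have "(\<Sum>t\<in>T. \<Sum>M\<in>Inv d. (if t \<in> U k \<and> orb k t \<subseteq># M then L M else 0)) =
        (\<Sum>t\<in>U k. \<Sum>M\<in>Inv d. (if t \<in> U k \<and> orb k t \<subseteq># M then L M else 0))"
      using fT by (intro sum.mono_neutral_right) auto
    also have "\<dots> = (\<Sum>t\<in>U k. \<Sum>M\<in>Inv d. (if orb k t \<subseteq># M then L M else 0))"
      by (intro sum.cong) auto
    finally show "(\<Sum>t\<in>T. \<Sum>M\<in>Inv d. (if t \<in> U k \<and> orb k t \<subseteq># M then L M else 0)) = \<dots>" .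
  qed simp
  also have "\<dots> = (\<Sum>k\<in>{1..d}. \<Sum>t\<in>U k. L (orb k t) * (\<Sum>M\<in>Inv (d - k). L M))"
  proof (intro sum.cong refl)
    fix k t assume k: "k \<in> {1..d}" and t: "t \<in> U k"
    have "(\<Sum>M\<in>Inv d. (if orb k t \<subseteq># M then L M else 0)) = (\<Sum>M\<in>{M\<in>Inv d. orb k t \<subseteq># M}. L M)"
      using finite_Inv by (simp add: sum.inter_filter)
    \<comment> \<open>Removing the orbit is a bijection onto the invariant multisets of size d -
      k.\<close>
    also have "\<dots> = (\<Sum>M\<in>Inv (d - k). L (orb k t + M))"
    proof (rule sum.reindex_bij_witness[of _ "\<lambda>M. orb k t + M" "\<lambda>M. M - orb k t"])
      fix M assume M: "M \<in> {M\<in>Inv d. orb k t \<subseteq># M}"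
      show "orb k t + (M - orb k t) = M" using M by simp
      show "M - orb k t \<in> Inv (d - k)" using M Inv_diff[OF _ orb_in_Inv[OF t]] by simp
      show "L (orb k t + (M - orb k t)) = L M" using M by simp
    next
      fix M assume M: "M \<in> Inv (d - k)"
      show "orb k t + M - orb k t = M" by simp
      show "orb k t + M \<in> {M\<in>Inv d. orb k t \<subseteq># M}"
        using Inv_add[OF orb_in_Inv[OF t] M] k by simp
    qed
    also have "\<dots> = L (orb k t) * (\<Sum>M\<in>Inv (d - k). L M)"
      using L[OF orb_in_Inv[OF t]] by (simp add: sum_distrib_left)
    finally show "(\<Sum>M\<in>Inv d. (if orb k t \<subseteq># M then L M else 0)) = \<dots>" .
  qed
  finally show ?thesis by (simp add: sum_distrib_right)
qed

text \<open>Newton's identity with the constant function 1 is a recursion for these cardinalities.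
  The value is the number of monic polynomials of degree d over the prime field with nonzero
  constant term, and this coincidence is what makes \<open>cvec\<close> surjective.\<close>

lemma card_Inv:
  "d > 0 \<Longrightarrow> real (card (Inv d)) = real p ^ d - real p ^ (d - 1)"
proof (induction d rule: less_induct)
  case (less d)
  have "of_nat d * (\<Sum>M\<in>Inv d. 1) = (\<Sum>k\<in>{1..d}. (\<Sum>t\<in>U k. 1) * (\<Sum>M\<in>Inv (d - k). 1 :: complex))"
    by (rule newton_identity) simp
  then have "complex_of_real (real d * real (card (Inv d))) =
      complex_of_real (\<Sum>k\<in>{1..d}. real (card (U k)) * real (card (Inv (d - k))))"
    by simp
  then have 1: "real d * real (card (Inv d)) = (\<Sum>k\<in>{1..d}. real (card (U k)) * real (card (Inv (d - k))))"
    by (simp only: of_real_eq_iff)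
  obtain e where d: "d = Suc e" using less.prems by (cases d) auto
  have cU: "real (card (U k)) = real p ^ k - 1" if "k > 0" for k
    using card_U'[OF that] p_pos by (simp add: of_nat_diff)
  have "(\<Sum>k\<in>{1..d}. real (card (U k)) * real (card (Inv (d - k)))) =
      (\<Sum>k\<in>{1..e}. real (card (U k)) * real (card (Inv (d - k)))) + (real p ^ d - 1)"
    using cU[of d] by (simp add: d Inv_0)
  also have "(\<Sum>k\<in>{1..e}. real (card (U k)) * real (card (Inv (d - k)))) =
      (\<Sum>k\<in>{1..e}. (real p ^ d - real p ^ e) + (real p ^ (e - k) - real p ^ (Suc e - k)))"
  proof (rule sum.cong)
    fix k assume k: "k \<in> {1..e}"
    have "real (card (Inv (d - k))) = real p ^ (d - k) - real p ^ (d - k - 1)"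
      using k less.IH[of "d - k"] by (simp add: d)
    note cI = this
    have *: "real p ^ k * real p ^ (d - k) = real p ^ d" "real p ^ k * real p ^ (d - k - 1) = real p ^ e"
      using k by (auto simp: d simp flip: power_add)
    have "real (card (U k)) = real p ^ k - 1" using cU k by simp
    note * = * cI this
    show "real (card (U k)) * real (card (Inv (d - k))) =
        (real p ^ d - real p ^ e) + (real p ^ (e - k) - real p ^ (Suc e - k))"
    proof -
      have gen: "(A - 1) * (B - C) = (A * B - A * C) + (C - B)" for A B C :: real
        by (simp add: algebra_simps)
      have "d - k - 1 = e - k" "Suc e - k = d - k" by (simp_all add: d)
      then show ?thesis using * cU[of k] k by (simp only: gen)
    qed
  qed simp
  also have "\<dots> = real e * (real p ^ d - real p ^ e) + (1 - real p ^ e)"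
  proof -
    have "(\<Sum>k\<in>{1..e}. real p ^ (e - k) - real p ^ (Suc e - k)) = 1 - real p ^ e"
    proof -
      have "(\<Sum>k\<in>{1..n}. real p ^ (e - k) - real p ^ (Suc e - k)) = real p ^ (e - n) - real p ^ e" for n
        by (induction n) auto
      from this[of e] show ?thesis by simp
    qed
    then show ?thesis by (simp add: sum.distrib)
  qed
  finally have "real d * real (card (Inv d)) = real d * (real p ^ d - real p ^ e)"
    using 1 by (simp add: d algebra_simps)
  then show ?case by (simp add: d)
qed

end

section \<open>Vanishing of the coefficients of the L-function\<close>

context residue_closure
begin

section \<open>Monic polynomials and their roots modulo \<open>P\<close>\<close>

definition pol :: "'a multiset \<Rightarrow> 'a poly" where "pol M = (\<Prod>t\<in>#M. [:- t, 1:])"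

lemma pol_empty [simp]: "pol {#} = 1" and pol_add [simp]: "pol (add_mset t M) = [:- t, 1:] * pol M"
  by (simp_all add: pol_def)

lemma coeff_pol_add: "coeff (pol (add_mset t M)) i = - t * coeff (pol M) i + (if i = 0 then 0 else coeff (pol M) (i - 1))"
  by (cases i) auto

lemma degree_pol: "degree (pol M) \<le> size M"
proof (induction M)
  case (add t M)
  have "degree ([:- t, 1:] * pol M) \<le> degree [:- t, 1:] + degree (pol M)" by (rule degree_mult_le)
  also have "\<dots> \<le> Suc (size M)" using add by simp
  finally show ?case by simp
qed simp

lemma coeff_pol_gt: "i > size M \<Longrightarrow> coeff (pol M) i = 0"
  by (rule coeff_eq_0) (use degree_pol[of M] in linarith)

lemma coeff_pol_size: "coeff (pol M) (size M) = 1"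
proof (induction M)
  case (add t M)
  then show ?case using coeff_pol_gt[of M "Suc (size M)"] by (simp add: coeff_pol_add)
qed simp

lemma poly_pol_0: "t \<in># M \<Longrightarrow> poly (pol M) t = 0"
  by (induction M) auto

lemma poly_pol_in_P:
  assumes "poly (pol M) t \<in> P" "t \<in> Uall" "set_mset M \<subseteq> Uall"
  shows "t \<in># M"
  using assms(1,3)
proof (induction M)
  case empty then show ?case using one_notin by simp
next
  case (add s M)
  have "(t - s) * poly (pol M) t \<in> P" using add.prems by (simp add: algebra_simps)
  then have "t - s \<in> P \<or> poly (pol M) t \<in> P" by (rule prime_P)
  then show ?case
  proof
    assume "t - s \<in> P"
    then have "t = s" using Uall_inj[OF assms(2), of s] add.prems by (simp add: eqm_def)
    then show ?thesis by simp
  next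
    assume "poly (pol M) t \<in> P"
    then show ?thesis using add by simp
  qed
qed

lemma poly_altdef_le: "degree (F :: 'a poly) \<le> n \<Longrightarrow> poly F t = (\<Sum>i\<le>n. coeff F i * t ^ i)"
  unfolding poly_altdef by (rule sum.mono_neutral_left) (auto simp: coeff_eq_0)

lemma poly_eqm:
  assumes "\<And>i. coeff F i \<doteq> coeff G i"
  shows "poly F t \<doteq> poly G t"
proof -
  have 1: "poly F t = (\<Sum>i\<le>max (degree F) (degree G). coeff F i * t ^ i)"
    and 2: "poly G t = (\<Sum>i\<le>max (degree F) (degree G). coeff G i * t ^ i)"
    by (rule poly_altdef_le; simp)+
  show ?thesis unfolding 1 2 using assms by (intro eqm_sum eqm_mult eqm_refl)
qed

text \<open>X - t is monic and therefore cancellable modulo \<open>P\<close>: the coefficients are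
  compared from the top downwards, starting above both degrees, where they are 0.\<close>

lemma pol_cancel:
  assumes "\<And>i. coeff ([:- t, 1:] * F) i \<doteq> coeff ([:- t, 1:] * G) i"
  shows "coeff F i \<doteq> coeff G i"
proof -
  define D where "D = max (degree F) (degree G)"
  have "coeff F (D + 1 - j) \<doteq> coeff G (D + 1 - j)" for j
  proof (induction j)
    case 0
    then show ?case by (simp add: D_def coeff_eq_0)
  next
    case (Suc j)
    show ?case
    proof (cases "j \<ge> D + 1")
      case True then show ?thesis using Suc by simp
    next
      case False
      define i where "i = D + 1 - Suc j"
      have i: "D + 1 - j = Suc i" unfolding i_def using False by simp
      have "- t * coeff F (Suc i) + coeff F i \<doteq> - t * coeff G (Suc i) + coeff G i"
        using assms[of "Suc i"] by simp
      moreover have "- t * coeff F (Suc i) \<doteq> - t * coeff G (Suc i)" using Suc unfolding i by (rule eqm_mult[OF eqm_refl])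
      ultimately have "(- t * coeff F (Suc i) + coeff F i) - (- t * coeff F (Suc i)) \<doteq>
          (- t * coeff G (Suc i) + coeff G i) - (- t * coeff G (Suc i))" by (rule eqm_diff)
      then show ?thesis by (simp add: i_def)
    qed
  qed
  from this[of "D + 1 - i"] show ?thesis
  proof (cases "i \<le> D + 1")
    case False
    then have "degree F < i" "degree G < i" by (auto simp: D_def)
    then show ?thesis by (simp add: coeff_eq_0)
  qed (use \<open>coeff F (D + 1 - (D + 1 - i)) \<doteq> coeff G (D + 1 - (D + 1 - i))\<close> in simp)
qed

text \<open>Unique factorization for products of linear factors: a root of one product is a root of
  the other, hence one of its listed roots, and the common factor is cancelled.\<close>

lemma pol_inj:
  assumes "set_mset M \<subseteq> Uall" "set_mset N \<subseteq> Uall" "\<And>i. coeff (pol M) i \<doteq> coeff (pol N) i"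
  shows "M = N"
  using assms
proof (induction M arbitrary: N)
  case empty
  show ?case
  proof (rule ccontr)
    assume "{#} \<noteq> N"
    then have "coeff (pol {#}) (size N) = 0" by (simp add: nonempty_has_size)
    then have "0 \<doteq> (1::'a)" using empty.prems(3)[of "size N"] coeff_pol_size[of N] by simp
    then show False using eqm_sym[of 0 1] one_notin by (simp add: eqm_0_iff)
  qed
next
  case (add t M)
  have "poly (pol (add_mset t M)) t \<doteq> poly (pol N) t" by (rule poly_eqm[OF add.prems(3)])
  then have "poly (pol N) t \<in> P"
    using poly_pol_0[of t "add_mset t M"] eqm_sym eqm_0_iff by (metis union_single_eq_member)
  then have "t \<in># N" using poly_pol_in_P add.prems by auto
  then obtain N' where N: "N = add_mset t N'" by (metis insert_DiffM)
  have "coeff (pol M) i \<doteq> coeff (pol N') i" for i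
    by (rule pol_cancel[of t]) (use add.prems(3) in \<open>simp add: N\<close>)
  then have "M = N'" using add.IH add.prems by (auto simp: N)
  then show ?case by (simp add: N)
qed

lemma frob_coeff_pol: "coeff (pol (image_mset (\<lambda>t. t ^ p) M)) i \<doteq> coeff (pol M) i ^ p"
proof (induction M arbitrary: i)
  case empty
  then show ?case by (cases "i = 0") (auto simp: frob_0)
next
  case (add t M)
  define r where "r = (if i = 0 then 0 else coeff (pol M) (i - 1))"
  define r' where "r' = (if i = 0 then 0 else coeff (pol (image_mset (\<lambda>t. t ^ p) M)) (i - 1))"
  have r: "r' \<doteq> r ^ p" using add[of "i - 1"] by (simp add: r_def r'_def frob_0)
  have "(- t) ^ p * coeff (pol M) i ^ p \<doteq> - (t ^ p) * coeff (pol (image_mset (\<lambda>t. t ^ p) M)) i"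
    by (rule eqm_mult[OF frob_uminus eqm_sym[OF add]])
  then have "(- t * coeff (pol M) i) ^ p + r ^ p \<doteq> - (t ^ p) * coeff (pol (image_mset (\<lambda>t. t ^ p) M)) i + r'"
    unfolding power_mult_distrib by (rule eqm_add[OF _ eqm_sym[OF r]])
  then have "(- t * coeff (pol M) i + r) ^ p \<doteq> - (t ^ p) * coeff (pol (image_mset (\<lambda>t. t ^ p) M)) i + r'"
    using eqm_trans[OF frob_add] by blast
  then show ?case unfolding coeff_pol_add image_mset_add_mset r_def[symmetric] r'_def[symmetric] by (rule eqm_sym)
qed

lemma coeff_pol_Fp:
  assumes "M \<in> Inv d"
  shows "coeff (pol M) i \<in> Fp"
  using eqm_sym[OF frob_coeff_pol[of M i]] assms by (simp add: Fp_def Inv_def)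

lemma coeff_pol_0_notin:
  assumes "set_mset M \<subseteq> Uall"
  shows "coeff (pol M) 0 \<notin> P"
  using assms
proof (induction M)
  case empty then show ?case using one_notin by simp
next
  case (add t M)
  have "t * coeff (pol M) 0 \<notin> P" using prime_P[of t] Uall_notin_P[of t] add by auto
  then show ?case using uminus_in[of "- t * coeff (pol M) 0"] by (auto simp: coeff_pol_add)
qed

section \<open>Polynomials over the prime field as vectors of coefficients\<close>

definition cvec :: "nat \<Rightarrow> 'a multiset \<Rightarrow> nat \<Rightarrow> int" where
  "cvec d M = (\<lambda>i\<in>{..<d}. rs (coeff (pol M) i))"

text \<open>The leading coefficient 1 is not stored. The condition on the constant coefficient says
  that 0 is not a root, as the roots in question are units.\<close>

definition cvecs :: "nat \<Rightarrow> (nat \<Rightarrow> int) set" where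
  "cvecs d = {c \<in> {..<d} \<rightarrow>\<^sub>E {0..<int p}. c 0 \<noteq> 0}"

lemma finite_cvecs: "finite (cvecs d)"
  unfolding cvecs_def by (rule finite_subset[of _ "{..<d} \<rightarrow>\<^sub>E {0..<int p}"]) (auto intro: finite_PiE)

lemma card_cvecs:
  assumes "d > 0"
  shows "card (cvecs d) = p ^ d - p ^ (d - 1)"
proof -
  have "cvecs d = (\<Pi>\<^sub>E i\<in>{..<d}. if i = 0 then {1..<int p} else {0..<int p})"
  proof (intro equalityI subsetI)
    fix c assume "c \<in> cvecs d"
    then have c: "c \<in> {..<d} \<rightarrow>\<^sub>E {0..<int p}" "c 0 \<noteq> 0" by (auto simp: cvecs_def)
    show "c \<in> (\<Pi>\<^sub>E i\<in>{..<d}. if i = 0 then {1..<int p} else {0..<int p})"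
      using c(2) PiE_mem[OF c(1)] PiE_arb[OF c(1)] by (intro PiE_I) (force split: if_splits)+
  next
    fix c assume c: "c \<in> (\<Pi>\<^sub>E i\<in>{..<d}. if i = 0 then {1..<int p} else {0..<int p})"
    have "c i \<in> {0..<int p}" if "i < d" for i
      using PiE_mem[OF c, of i] that by (auto split: if_splits)
    moreover have "c 0 \<noteq> 0" using PiE_mem[OF c, of 0] assms by auto
    ultimately show "c \<in> cvecs d" using PiE_arb[OF c] unfolding cvecs_def by (auto intro!: PiE_I)
  qed
  then have "card (cvecs d) = (\<Prod>i\<in>{..<d}. card (if i = 0 then {1..<int p} else {0..<int p}))"
    by (simp add: card_PiE)
  also have "\<dots> = (\<Prod>i\<in>{..<d}. if i = 0 then p - 1 else p)"
    by (rule prod.cong) (auto simp: nat_diff_distrib)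
  also have "{..<d} = insert 0 (Suc ` {..<d - 1})"
    using assms lessThan_Suc_eq_insert_0[of "d - 1"] by simp
  also have "(\<Prod>i\<in>insert 0 (Suc ` {..<d - 1}). if i = 0 then p - 1 else p) = (p - 1) * p ^ (d - 1)"
    by (subst prod.insert) (auto simp: prod.reindex)
  also have "\<dots> = p ^ d - p ^ (d - 1)"
    using assms by (cases d) (auto simp: diff_mult_distrib)
  finally show ?thesis .
qed

lemma cvec_inj: "inj_on (cvec d) (Inv d)"
proof (rule inj_onI)
  fix M N assume MN: "M \<in> Inv d" "N \<in> Inv d" "cvec d M = cvec d N"
  have "coeff (pol M) i \<doteq> coeff (pol N) i" for i
  proof (cases "i < d")
    case True
    then have "rs (coeff (pol M) i) = rs (coeff (pol N) i)" using fun_cong[OF MN(3), of i] by (simp add: cvec_def)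
    then show ?thesis
      using rs(3)[OF coeff_pol_Fp[OF MN(1)], of i] eqm_sym[OF rs(3)[OF coeff_pol_Fp[OF MN(2)], of i]]
      by (metis eqm_trans)
  next
    case False
    then show ?thesis using MN coeff_pol_size[of M] coeff_pol_size[of N] coeff_pol_gt[of M i] coeff_pol_gt[of N i]
      by (cases "i = d") (auto simp: Inv_def)
  qed
  then show "M = N" using pol_inj[of M N] MN by (simp add: Inv_def)
qed

text \<open>The map is injective because the coefficients determine the roots, and surjective
  because both sides have the same cardinality by \<open>card_Inv\<close>. So every monic polynomial
  over the prime field with nonzero constant term splits, although no root is ever
  constructed.\<close>

lemma cvec_bij:
  assumes "d > 0"
  shows "bij_betw (cvec d) (Inv d) (cvecs d)"
proof -
  have sub: "cvec d ` Inv d \<subseteq> cvecs d"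
  proof (rule image_subsetI)
    fix M assume M: "M \<in> Inv d"
    have "rs (coeff (pol M) 0) \<noteq> 0"
    proof
      assume "rs (coeff (pol M) 0) = 0"
      then have "coeff (pol M) 0 \<doteq> 0" using rs(3)[OF coeff_pol_Fp[OF M], of 0] by simp
      then show False using coeff_pol_0_notin[of M] M by (simp add: eqm_0_iff Inv_def)
    qed
    then show "cvec d M \<in> cvecs d"
      using rs(1,2)[OF coeff_pol_Fp[OF M]] assms unfolding cvecs_def cvec_def by auto
  qed
  have "real (card (Inv d)) = real (card (cvecs d))"
    using card_Inv[OF assms] card_cvecs[OF assms] p_pos by (simp add: of_nat_diff power_increasing)
  then have "card (cvec d ` Inv d) = card (cvecs d)" using card_image[OF cvec_inj] by simp
  then have "cvec d ` Inv d = cvecs d" by (rule card_subset_eq[OF finite_cvecs sub])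
  then show ?thesis using cvec_inj by (simp add: bij_betw_def)
qed

text \<open>The coefficients of \<open>\<Prod>(1 - tX)\<close> are those of \<open>\<Prod>(X - t)\<close> read backwards.\<close>

definition rpol :: "'a multiset \<Rightarrow> 'a poly" where "rpol M = (\<Prod>t\<in>#M. [:1, - t:])"

lemma coeff_rpol_add: "coeff (rpol (add_mset t M)) i = coeff (rpol M) i - t * (if i = 0 then 0 else coeff (rpol M) (i - 1))"
  by (cases i) (auto simp: rpol_def)

lemma coeff_rpol_empty: "coeff (rpol {#}) i = (if i = 0 then 1 else 0)"
  by (auto simp: rpol_def)

lemma coeff_rpol: "j \<le> size M \<Longrightarrow> coeff (rpol M) j = coeff (pol M) (size M - j)"
proof (induction M arbitrary: j)
  case empty then show ?case by (simp add: rpol_def)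
next
  case (add t M)
  show ?case
  proof (cases j)
    case 0
    have "coeff (rpol M) 0 = 1" for M by (induction M) (auto simp: coeff_rpol_add coeff_rpol_empty)
    then show ?thesis using coeff_pol_size[of "add_mset t M"] by (simp add: 0)
  next
    case (Suc k)
    show ?thesis
    proof (cases "k = size M")
      case True
      have "coeff (rpol M) i = 0" if "i > size M" for i
        using that by (induction M arbitrary: i) (auto simp: coeff_rpol_add coeff_rpol_empty)
      then show ?thesis using add.IH[of k] True by (simp add: Suc coeff_rpol_add coeff_pol_add)
    next
      case False
      then have "size M - k = Suc (size M - Suc k)" using add.prems by (simp add: Suc)
      then show ?thesis using add.IH[of k] add.IH[of "Suc k"] add.prems False
        by (simp add: Suc coeff_rpol_add coeff_pol_add)
    qed
  qed
qed

lemma coeff_rpol_0: "coeff (rpol M) 0 = 1"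
  by (induction M) (auto simp: coeff_rpol_add coeff_rpol_empty)

text \<open>Newton's identity for the second power sum; coefficient j of \<open>rpol\<close> is
  (-1)^j times the elementary symmetric polynomial of degree j.\<close>

lemma newton_2: "(\<Sum>t\<in>#M. t ^ 2) = coeff (rpol M) 1 ^ 2 - 2 * coeff (rpol M) 2"
  by (induction M)
    (auto simp: coeff_rpol_add coeff_rpol_empty coeff_rpol_0 algebra_simps power2_eq_square numeral_2_eq_2)

lemma newton_3: "(\<Sum>t\<in>#M. t ^ 3) =
    - (coeff (rpol M) 1 ^ 3) + 3 * coeff (rpol M) 1 * coeff (rpol M) 2 - 3 * coeff (rpol M) 3"
proof (induction M)
  case (add t M)
  have "coeff (rpol (add_mset t M)) 1 = coeff (rpol M) 1 - t"
    "coeff (rpol (add_mset t M)) 2 = coeff (rpol M) 2 - t * coeff (rpol M) 1"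
    "coeff (rpol (add_mset t M)) 3 = coeff (rpol M) 3 - t * coeff (rpol M) 2"
    by (simp_all add: coeff_rpol_add coeff_rpol_0)
  note c = this
  have alg: "t ^ 3 + (- (x ^ 3) + 3 * x * y - 3 * z) =
      - ((x - t) ^ 3) + 3 * (x - t) * (y - t * x) - 3 * (z - t * y)" for x y z
    by (simp add: algebra_simps power3_eq_cube)
  show ?case unfolding c using alg add by simp
qed (simp add: coeff_rpol_empty)

text \<open>Each factor is rewritten as X - t = -t (1 - X / t); the product of the -t is the
  constant coefficient.\<close>

lemma pol_eq_rpol_tinv:
  assumes "set_mset M \<subseteq> Uall"
  shows "coeff (pol M) i = coeff (pol M) 0 * coeff (rpol (image_mset tinv M)) i"
  using assms
proof (induction M arbitrary: i)
  case empty then show ?case by (simp add: coeff_rpol_empty)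
next
  case (add t M)
  have t: "t * tinv t = 1" using add.prems tinv by simp
  have IH: "coeff (pol M) j = coeff (pol M) 0 * coeff (rpol (image_mset tinv M)) j" for j
    by (rule add.IH) (use add.prems in simp)
  have "coeff (pol (add_mset t M)) 0 * coeff (rpol (image_mset tinv (add_mset t M))) i =
      - t * (coeff (pol M) 0 * coeff (rpol (image_mset tinv M)) i) +
      (t * tinv t) * (if i = 0 then 0 else coeff (pol M) 0 * coeff (rpol (image_mset tinv M)) (i - 1))"
    by (simp add: coeff_pol_add coeff_rpol_add algebra_simps)
  also have "\<dots> = coeff (pol (add_mset t M)) i"
    unfolding t IH[symmetric] by (cases i) (simp_all add: coeff_pol_add)
  finally show ?case by simp
qed

text \<open>Newton's identity for the inverse roots, multiplied by the square of the constant
  coefficient to avoid division. The sum of the t^-2 thus depends on the three lowest coefficients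
  only, as the sum of the t^3 depends on the three coefficients below the leading one.\<close>

lemma sum_tinv_sq:
  assumes "set_mset M \<subseteq> Uall"
  shows "coeff (pol M) 0 ^ 2 * (\<Sum>t\<in>#M. tinv t ^ 2) = coeff (pol M) 1 ^ 2 - 2 * (coeff (pol M) 0 * coeff (pol M) 2)"
proof -
  define b where "b = coeff (pol M) 0"
  define r where "r = rpol (image_mset tinv M)"
  have c: "coeff (pol M) 1 = b * coeff r 1" "coeff (pol M) 2 = b * coeff r 2"
    unfolding b_def r_def by (rule pol_eq_rpol_tinv[OF assms])+
  have "(\<Sum>t\<in>#M. tinv t ^ 2) = coeff r 1 ^ 2 - 2 * coeff r 2"
    using newton_2[of "image_mset tinv M"] by (simp add: r_def multiset.map_comp o_def)
  then show ?thesis unfolding b_def[symmetric] c by (simp only:) (simp add: algebra_simps power2_eq_square)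
qed

section \<open>The character sums and the L-function\<close>

definition ff :: "int \<Rightarrow> int \<Rightarrow> 'a \<Rightarrow> 'a" where
  "ff m n t = of_int m * t ^ 3 + of_int n * tinv t ^ 2"

lemma ff_frob:
  assumes "t \<in> Uall"
  shows "ff m n t ^ (p ^ k) \<doteq> ff m n (t ^ (p ^ k))"
proof -
  have "ff m n t ^ (p ^ k) \<doteq> (of_int m * t ^ 3) ^ (p ^ k) + (of_int n * tinv t ^ 2) ^ (p ^ k)"
    unfolding ff_def by (rule frobk_add)
  also have "\<dots> = of_int m ^ (p ^ k) * (t ^ (p ^ k)) ^ 3 + of_int n ^ (p ^ k) * (tinv t ^ (p ^ k)) ^ 2"
    by (simp add: power_mult_distrib mult.commute flip: power_mult)
  also have "\<dots> \<doteq> of_int m * (t ^ (p ^ k)) ^ 3 + of_int n * (tinv t ^ (p ^ k)) ^ 2"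
    by (intro eqm_add eqm_mult frobk_of_int eqm_refl)
  finally show ?thesis by (simp add: ff_def tinv_pow[OF assms])
qed

lemma sum_ff_Fp:
  assumes "M \<in> Inv d"
  shows "(\<Sum>t\<in>#M. ff m n t) \<in> Fp"
proof -
  have "(\<Sum>t\<in>#M. ff m n t) ^ p \<doteq> (\<Sum>t\<in>#M. ff m n t ^ p)" by (rule frob_sum_mset)
  also have "\<dots> \<doteq> (\<Sum>t\<in>#M. ff m n (t ^ p))"
    using ff_frob[of _ m n 1] assms by (intro eqm_sum_mset) (auto simp: Inv_def)
  also have "\<dots> = (\<Sum>t\<in>#image_mset (\<lambda>t. t ^ p) M. ff m n t)" by (simp add: multiset.map_comp o_def)
  also have "image_mset (\<lambda>t. t ^ p) M = M" using assms by (simp add: Inv_def)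
  finally show ?thesis by (simp add: Fp_def)
qed

text \<open>On invariant multisets this is completely multiplicative (\<open>lam_add\<close>), so
  that its sum over all of them is an Euler product over Frobenius orbits.\<close>

definition lam :: "int \<Rightarrow> int \<Rightarrow> 'a multiset \<Rightarrow> complex" where
  "lam m n M = psi (\<Sum>t\<in>#M. ff m n t)"

lemma lam_add: "M \<in> Inv a \<Longrightarrow> N \<in> Inv b \<Longrightarrow> lam m n (M + N) = lam m n M * lam m n N"
  unfolding lam_def using sum_ff_Fp by (simp add: psi_add)

text \<open>\<open>VV\<close> are the coefficients of the L-function, \<open>WW\<close> the character sums over the field of order \<open>p^k\<close>.\<close>

definition VV :: "int \<Rightarrow> int \<Rightarrow> nat \<Rightarrow> complex" where
  "VV m n d = (\<Sum>M\<in>Inv d. lam m n M)"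

definition WW :: "int \<Rightarrow> int \<Rightarrow> nat \<Rightarrow> complex" where
  "WW m n k = (\<Sum>t\<in>U k. lam m n (orb k t))"

lemma VV_0: "VV m n 0 = 1"
  by (simp add: VV_def Inv_0 lam_def)

lemma VV_newton: "of_nat d * VV m n d = (\<Sum>k\<in>{1..d}. WW m n k * VV m n (d - k))"
  unfolding VV_def WW_def by (rule newton_identity[OF lam_add])

text \<open>Replacing the coefficient \<open>c\<^sub>3\<close> of \<open>X\<^sup>d + c\<^sub>1 X\<^sup>d\<^sup>-\<^sup>1 + \<dots>\<close> by \<open>c\<^sub>3 + 1\<close> permutes the polynomials of
  degree \<open>d \<ge> 6\<close> and multiplies each \<open>lam\<close> by the same root of unity, different from 1.\<close>

lemma VV_eq_0:
  assumes "d \<ge> 6" "\<not> int p dvd 3 * m"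
  shows "VV m n d = 0"
proof -
  \<comment> \<open>The position of the third coefficient below the leading one. For d >= 6 it lies
    above the positions 0, 1, 2, which determine the sum of the t^-2.\<close>
  define e where "e = d - 3"
  have d0: "d > 0" using assms by simp
  have ed: "e < d" "3 \<le> e" "d - e = 3" using assms by (auto simp: e_def)
  define sh where "sh c = c(e := (c e + 1) mod int p)" for c :: "nat \<Rightarrow> int"
  have sh_in: "sh c \<in> cvecs d" if "c \<in> cvecs d" for c
  proof -
    have c: "c \<in> {..<d} \<rightarrow>\<^sub>E {0..<int p}" "c 0 \<noteq> 0" using that by (auto simp: cvecs_def)
    have "sh c \<in> {..<d} \<rightarrow>\<^sub>E {0..<int p}"
      using ed p_pos PiE_mem[OF c(1)] PiE_arb[OF c(1)] unfolding sh_def by (intro PiE_I) auto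
    then show ?thesis using c ed by (simp add: cvecs_def sh_def)
  qed
  have sh_inj: "inj_on sh (cvecs d)"
  proof (rule inj_onI)
    fix c c' assume cc: "c \<in> cvecs d" "c' \<in> cvecs d" "sh c = sh c'"
    have "c \<in> {..<d} \<rightarrow>\<^sub>E {0..<int p}" "c' \<in> {..<d} \<rightarrow>\<^sub>E {0..<int p}" using cc(1,2) by (simp_all add: cvecs_def)
    then have r: "c e \<in> {0..<int p}" "c' e \<in> {0..<int p}" using ed(1) PiE_mem by fastforce+
    have "[c e + 1 = c' e + 1] (mod int p)" using fun_cong[OF cc(3), of e] unfolding sh_def fun_upd_same cong_def .
    then have "[c e = c' e] (mod int p)" by (simp only: cong_add_rcancel)
    then have "c e = c' e" using r by (simp add: cong_def)
    moreover have "c i = c' i" if "i \<noteq> e" for i using fun_cong[OF cc(3), of i] that by (simp add: sh_def)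
    ultimately show "c = c'" by (intro ext) metis
  qed
  have sh_bij: "bij_betw sh (cvecs d) (cvecs d)"
    unfolding bij_betw_def using sh_inj endo_inj_surj[OF finite_cvecs _ sh_inj] sh_in by blast
  \<comment> \<open>The shift of the coefficient, transported to multisets of roots through the
    bijection \<open>cvec\<close>.\<close>
  define g where "g = inv_into (Inv d) (cvec d) \<circ> sh \<circ> cvec d"
  have g_bij: "bij_betw g (Inv d) (Inv d)"
    unfolding g_def using bij_betw_trans[OF bij_betw_trans[OF cvec_bij[OF d0] sh_bij] bij_betw_inv_into[OF cvec_bij[OF d0]]]
    by (simp add: o_assoc)
  have lam_g: "lam m n (g M) = lam m n M * ee p (- (3 * m))" if M: "M \<in> Inv d" for M
  proof -
    define N where "N = g M"
    have N: "N \<in> Inv d" using g_bij M unfolding N_def bij_betw_def by blast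
    have "cvec d M \<in> cvecs d" using cvec_bij[OF d0] M unfolding bij_betw_def by blast
    then have cN: "cvec d N = sh (cvec d M)" unfolding N_def g_def o_def
      by (intro bij_betw_inv_into_right[OF cvec_bij[OF d0]] sh_in)
    have "coeff (pol N) i \<doteq> of_int (cvec d N i)" "coeff (pol M) i \<doteq> of_int (cvec d M i)" if "i < d" for i
      using rs(3)[OF coeff_pol_Fp[OF N], of i] rs(3)[OF coeff_pol_Fp[OF M], of i] that
      by (simp_all add: cvec_def)
    note rr = this[unfolded cN]
    have same: "coeff (pol N) i \<doteq> coeff (pol M) i" if "i < d" "i \<noteq> e" for i
    proof -
      have "sh (cvec d M) i = cvec d M i" using that by (simp add: sh_def)
      then show ?thesis using eqm_trans[OF _ eqm_sym[OF rr(2)[OF that(1)]]] rr(1)[OF that(1)] by simp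
    qed
    have "coeff (pol N) e \<doteq> of_int ((cvec d M e + 1) mod int p)"
      using rr(1)[OF ed(1)] unfolding sh_def fun_upd_same .
    moreover have "of_int ((cvec d M e + 1) mod int p) \<doteq> of_int (cvec d M e + 1)" unfolding of_int_eqm_iff by simp
    ultimately have "coeff (pol N) e \<doteq> of_int (cvec d M e + 1)" by (rule eqm_trans)
    moreover have "of_int (cvec d M e + 1) \<doteq> coeff (pol M) e + 1"
      using eqm_add[OF eqm_sym[OF rr(2)[OF ed(1)]] eqm_refl] by simp
    ultimately have shifted: "coeff (pol N) e \<doteq> coeff (pol M) e + 1" by (rule eqm_trans)
    have sN: "size N = d" "size M = d" and UN: "set_mset N \<subseteq> Uall" "set_mset M \<subseteq> Uall"
      using M N by (auto simp: Inv_def)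
    have rp: "coeff (rpol N) j = coeff (pol N) (d - j)" "coeff (rpol M) j = coeff (pol M) (d - j)" if "j \<le> 3" for j
      using coeff_rpol[of j N] coeff_rpol[of j M] sN that ed by simp_all
    have r1: "coeff (rpol N) 1 \<doteq> coeff (rpol M) 1"
      using rp[of 1] same[of "d - 1"] assms(1) by (simp add: e_def)
    have r2: "coeff (rpol N) 2 \<doteq> coeff (rpol M) 2"
      using rp[of 2] same[of "d - 2"] assms(1) by (simp add: e_def)
    have r3: "coeff (rpol N) 3 \<doteq> coeff (rpol M) 3 + 1"
      unfolding rp[of 3, simplified] using shifted by (simp add: e_def)
    \<comment> \<open>In Newton's identity the shifted coefficient occurs only in the term -3 c_3,
      so the sum of the cubes drops by 3 and the value of \<open>lam\<close> acquires the factor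
      \<open>ee p (- (3 * m))\<close>.\<close>
    have "(\<Sum>t\<in>#N. t ^ 3) \<doteq> - (coeff (rpol M) 1 ^ 3) + 3 * coeff (rpol M) 1 * coeff (rpol M) 2 - 3 * (coeff (rpol M) 3 + 1)"
      unfolding newton_3 by (intro eqm_diff eqm_add eqm_uminus eqm_mult eqm_power eqm_refl r1 r2 r3)
    also have "\<dots> = (\<Sum>t\<in>#M. t ^ 3) - 3" unfolding newton_3 by (simp add: algebra_simps)
    finally have S3: "(\<Sum>t\<in>#N. t ^ 3) \<doteq> (\<Sum>t\<in>#M. t ^ 3) - 3" .
    have b: "coeff (pol N) 0 \<doteq> coeff (pol M) 0" "coeff (pol N) 1 \<doteq> coeff (pol M) 1" "coeff (pol N) 2 \<doteq> coeff (pol M) 2"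
      using assms by (auto intro!: same simp: e_def)
    have "coeff (pol N) 0 ^ 2 * (\<Sum>t\<in>#N. tinv t ^ 2) \<doteq> coeff (pol M) 0 ^ 2 * (\<Sum>t\<in>#M. tinv t ^ 2)"
      unfolding sum_tinv_sq[OF UN(1)] sum_tinv_sq[OF UN(2)] by (intro eqm_diff eqm_mult eqm_power eqm_refl b)
    moreover have "coeff (pol N) 0 ^ 2 * (\<Sum>t\<in>#M. tinv t ^ 2) \<doteq> coeff (pol M) 0 ^ 2 * (\<Sum>t\<in>#M. tinv t ^ 2)"
      by (intro eqm_mult eqm_power eqm_refl b)
    ultimately have "coeff (pol N) 0 ^ 2 * (\<Sum>t\<in>#N. tinv t ^ 2) \<doteq> coeff (pol N) 0 ^ 2 * (\<Sum>t\<in>#M. tinv t ^ 2)"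
      by (rule eqm_trans[OF _ eqm_sym])
    then have "coeff (pol N) 0 ^ 2 * ((\<Sum>t\<in>#N. tinv t ^ 2) - (\<Sum>t\<in>#M. tinv t ^ 2)) \<in> P"
      by (simp add: eqm_def right_diff_distrib)
    then have S2: "(\<Sum>t\<in>#N. tinv t ^ 2) \<doteq> (\<Sum>t\<in>#M. tinv t ^ 2)"
      using prime_P[of "coeff (pol N) 0 ^ 2"] power_in_P[of "coeff (pol N) 0" 2] coeff_pol_0_notin[OF UN(1)]
      unfolding eqm_def by metis
    have sff: "(\<Sum>t\<in>#M. ff m n t) = of_int m * (\<Sum>t\<in>#M. t ^ 3) + of_int n * (\<Sum>t\<in>#M. tinv t ^ 2)" for M
      by (induction M) (auto simp: ff_def algebra_simps)
    have "(\<Sum>t\<in>#N. ff m n t) \<doteq> of_int m * ((\<Sum>t\<in>#M. t ^ 3) - 3) + of_int n * (\<Sum>t\<in>#M. tinv t ^ 2)"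
      unfolding sff[of N] by (intro eqm_add eqm_mult eqm_refl S2 S3)
    also have "\<dots> = (\<Sum>t\<in>#M. ff m n t) + of_int (- (3 * m))"
      unfolding sff[of M] by (simp add: algebra_simps)
    finally have "lam m n N = psi ((\<Sum>t\<in>#M. ff m n t) + of_int (- (3 * m)))"
      unfolding lam_def by (rule psi_cong) (rule sum_ff_Fp[OF N])
    also have "\<dots> = lam m n M * psi (of_int (- (3 * m)))"
      unfolding lam_def by (rule psi_add[OF sum_ff_Fp[OF M] of_int_in_Fp(1)])
    also have "psi (of_int (- (3 * m))) = ee p (- (3 * m))" by (rule psi_eqm_int) simp
    finally show ?thesis by (simp add: N_def)
  qed
  have "VV m n d = (\<Sum>M\<in>Inv d. lam m n (g M))"
    unfolding VV_def by (rule sum.reindex_bij_betw[OF g_bij, symmetric])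
  also have "\<dots> = VV m n d * ee p (- (3 * m))"
    unfolding VV_def sum_distrib_right using lam_g by (rule sum.cong[OF refl])
  finally have "VV m n d * (1 - ee p (- (3 * m))) = 0" by (simp add: algebra_simps)
  moreover have "ee p (- (3 * m)) \<noteq> 1" using ee_eq_1_imp_dvd[OF p_pos, of "- (3 * m)"] assms(2) by auto
  ultimately show ?thesis by simp
qed

end

section \<open>Stepanov's method\<close>

hide_const (open) module.smult

text \<open>Pigeonhole: there are more vectors of residues than possible values of the
  \<open>D\<close> linear forms, and the difference of two vectors with equal values is a solution
  that is nonzero modulo p.\<close>

lemma linear_system_mod_prime:
  fixes a :: "'i \<Rightarrow> nat \<Rightarrow> int"
  assumes "finite S" "D < card S" "p > 1"
  shows "\<exists>h. (\<exists>x\<in>S. \<not> int p dvd h x) \<and> (\<forall>k<D. int p dvd (\<Sum>x\<in>S. h x * a x k))"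
proof -
  define A where "A = (S \<rightarrow>\<^sub>E {0..<int p})"
  define B where "B = ({..<D} \<rightarrow>\<^sub>E {0..<int p})"
  define F where "F h = (\<lambda>k\<in>{..<D}. (\<Sum>x\<in>S. h x * a x k) mod int p)" for h
  have "card B = p ^ D" "card A = p ^ card S" using assms(1) by (simp_all add: A_def B_def card_funcsetE)
  then have "card B < card A" using assms by simp
  moreover have "F ` A \<subseteq> B" using assms(3) unfolding B_def F_def by (intro image_subsetI) (simp add: restrict_PiE_iff)
  moreover have "finite B" by (simp add: B_def finite_PiE)
  ultimately have "\<not> inj_on F A" using card_inj_on_le[of F A B] by linarith
  then obtain h1 h2 where h: "h1 \<in> A" "h2 \<in> A" "F h1 = F h2" "h1 \<noteq> h2" by (auto simp: inj_on_def)
  obtain x where x: "h1 x \<noteq> h2 x" using h(4) by auto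
  have xS: "x \<in> S" using x h(1,2) unfolding A_def by (metis PiE_arb)
  have "h1 x \<in> {0..<int p}" "h2 x \<in> {0..<int p}" using h(1,2) xS unfolding A_def by (auto dest: PiE_mem)
  then have "\<not> [h1 x = h2 x] (mod int p)" using x by (simp add: cong_def)
  then have "\<not> int p dvd h1 x - h2 x" by (simp add: cong_iff_dvd_diff)
  moreover have "int p dvd (\<Sum>x\<in>S. (h1 x - h2 x) * a x k)" if "k < D" for k
  proof -
    have "(\<Sum>x\<in>S. h1 x * a x k) mod int p = (\<Sum>x\<in>S. h2 x * a x k) mod int p"
      using fun_cong[OF h(3), of k] that by (simp add: F_def)
    then have "int p dvd (\<Sum>x\<in>S. h1 x * a x k) - (\<Sum>x\<in>S. h2 x * a x k)" by (simp add: mod_eq_dvd_iff)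
    then show ?thesis by (simp add: sum_subtractf left_diff_distrib)
  qed
  ultimately show ?thesis using xS by (intro exI[of _ "\<lambda>x. h1 x - h2 x"]) blast
qed

text \<open>The auxiliary polynomials of Stepanov's method have integer coefficients, so that their
  vanishing modulo p is plain divisibility; they are evaluated in the ring only through this
  map.\<close>

definition ev :: "'a::comm_ring_1 \<Rightarrow> int poly \<Rightarrow> 'a" where
  "ev t F = poly (map_poly of_int F) t"

lemma ev_pCons: "ev t (pCons a F) = of_int a + t * ev t F"
  by (simp add: ev_def map_poly_pCons)

lemma ev_0 [simp]: "ev t 0 = 0"
  by (simp add: ev_def)

lemma ev_add: "ev t (F + G) = ev t F + ev t G"
  by (induction F G rule: poly_induct2) (simp_all add: ev_pCons algebra_simps)

lemma ev_smult: "ev t (smult c F) = of_int c * ev t F"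
  by (induction F) (simp_all add: ev_pCons algebra_simps)

lemma ev_mult: "ev t (F * G) = ev t F * ev t G"
  by (induction F) (simp_all add: ev_pCons ev_add ev_smult algebra_simps)

lemma ev_1 [simp]: "ev t 1 = 1"
  by (simp add: ev_def)

lemma ev_power: "ev t (F ^ n) = ev t F ^ n"
  by (induction n) (simp_all add: ev_mult)

lemma ev_monom: "ev t (monom c n) = of_int c * t ^ n"
  by (induction n) (simp_all add: ev_pCons monom_Suc monom_0 algebra_simps)

lemma ev_diff: "ev t (F - G) = ev t F - ev t G"
  using ev_add[of t "F - G" G] by simp

lemma ev_sum: "ev t (\<Sum>i\<in>A. F i) = (\<Sum>i\<in>A. ev t (F i))"
  by (induction A rule: infinite_finite_induct) (simp_all add: ev_add)

context residue_closure
begin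

definition Tr :: "int \<Rightarrow> int \<Rightarrow> nat \<Rightarrow> 'a \<Rightarrow> 'a" where
  "Tr m n k t = (\<Sum>i<k. ff m n (t ^ (p ^ i)))"

lemma lam_orb: "lam m n (orb k t) = psi (Tr m n k t)"
  by (simp add: lam_def orb_def Tr_def multiset.map_comp o_def sum_unfold_sum_mset)

lemma Tr_in_Fp: "t \<in> U k \<Longrightarrow> Tr m n k t \<in> Fp"
  using sum_ff_Fp[OF orb_in_Inv, of t k m n]
  by (simp add: orb_def Tr_def multiset.map_comp o_def sum_unfold_sum_mset)

lemma ev_in_P:
  assumes "\<And>k. int p dvd coeff F k"
  shows "ev t F \<in> P"
proof -
  have "ev t F = (\<Sum>i\<le>degree (map_poly of_int F :: 'a poly). of_int (coeff F i) * t ^ i)"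
    unfolding ev_def poly_altdef by (simp add: coeff_map_poly)
  also have "\<dots> \<doteq> (\<Sum>i\<le>degree (map_poly of_int F :: 'a poly). 0)"
    using assms by (intro eqm_sum) (simp add: eqm_0_iff mult_in' of_int_in_P_iff)
  finally show ?thesis by (simp add: eqm_0_iff)
qed

text \<open>Stepanov's method. With \<open>s = p\<^sup>r\<close>, \<open>w = s / p\<close> and \<open>Y = f + f\<^sup>p + \<dots> + f\<^sup>w\<close> one has \<open>Tr f = Y + Y\<^sup>s\<close>,
  so on the set in question the \<open>s\<close>-th power of \<open>H = \<Sum> h\<^sub>i\<^sub>j\<^sub>l t\<^bsup>i + sj\<^esup> Y\<^sup>l\<close> equals
  \<open>R = \<Sum> h\<^sub>i\<^sub>j\<^sub>l t\<^bsup>is + j\<^esup> (c - Y)\<^sup>l\<close>. There are more \<open>h\<close> than coefficients of \<open>R\<close>, so \<open>R = 0\<close> can be achieved,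
  while \<open>H \<noteq> 0\<close> because its terms have different degrees. Both are multiplied by \<open>t\<^bsup>2w(p - 1)\<^esup>\<close>
  to clear denominators.\<close>

lemma stepanov:
  assumes p7: "p \<ge> 7" and m: "\<not> int p dvd m" and r: "r > 0"
  shows "card {t \<in> U (2 * r). Tr m n (2 * r) t \<doteq> of_int c} \<le> p ^ (2 * r - 1) + 12 * p ^ r"
proof -
  define T where "T = {t \<in> U (2 * r). Tr m n (2 * r) t \<doteq> of_int c}"
  define w where "w = p ^ (r - 1)"
  define s where "s = p ^ r"
  \<comment> \<open>The 7 ensures that there are more unknowns than equations: s J exceeds
    \<open>D\<close> = w s + J + 5 s by 2 s - w - 7, which is positive because s >= 7 w.\<close>
  define J where "J = w + 7"
  define D where "D = w * s + J + 5 * s"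
  define S where "S = {..<w} \<times> {..<J} \<times> {..<p}"
  have sw: "s = p * w" unfolding s_def w_def using r by (cases r) auto
  have w0: "w > 0" unfolding w_def using p_pos by simp
  have qw: "p ^ (2 * r - 1) = s * w" 
  proof -
    have "2 * r - 1 = r + (r - 1)" using r by simp
    then show ?thesis unfolding s_def w_def by (simp only: power_add)
  qed
  have qs: "p ^ (2 * r) = s * s" unfolding s_def by (simp add: mult_2 power_add)
  have pw: "p ^ i \<le> w" if "i < r" for i
    unfolding w_def using that p_pos by (intro power_increasing) auto
  have cardS: "card S = s * J" unfolding S_def sw by (simp add: mult.commute mult.left_commute)
  have "7 * w \<le> s" unfolding sw using p7 by simp
  then have DS: "D < card S" unfolding cardS D_def J_def using w0 by (simp add: algebra_simps)
  \<comment> \<open>Half of the trace, multiplied by t^(2w): since p^i <= w for i < r, all exponents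
    become nonnegative. The top degree 5 w is attained for i = r - 1 only.\<close>
  define Y :: "int poly" where "Y = (\<Sum>i<r. monom m (2 * w + 3 * p ^ i) + monom n (2 * w - 2 * p ^ i))"
  have degY: "degree Y \<le> 5 * w" unfolding Y_def
  proof (rule degree_sum_le)
    fix i assume "i \<in> {..<r}"
    then have "p ^ i \<le> w" using pw by simp
    then show "degree (monom m (2 * w + 3 * p ^ i) + monom n (2 * w - 2 * p ^ i)) \<le> 5 * w"
      by (intro degree_add_le order_trans[OF degree_monom_le]) auto
  qed simp
  have coeffY: "coeff Y (5 * w) = m"
  proof -
    have "coeff Y (5 * w) = (\<Sum>i<r. if i = r - 1 then m else 0)"
      unfolding Y_def coeff_sum
    proof (rule sum.cong)
      fix i assume i: "i \<in> {..<r}"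
      have "2 * w - 2 * p ^ i \<noteq> 5 * w" using w0 by linarith
      moreover have "2 * w + 3 * p ^ i = 5 * w \<longleftrightarrow> i = r - 1"
        unfolding w_def using p_gt1 power_inject_exp[of p i "r - 1"] by auto
      ultimately show "coeff (monom m (2 * w + 3 * p ^ i) + monom n (2 * w - 2 * p ^ i)) (5 * w) = (if i = r - 1 then m else 0)"
        by simp
    qed simp
    also have "\<dots> = m" using r by simp
    finally show ?thesis .
  qed
  have "m \<noteq> 0" using m by auto
  then have degY: "degree Y = 5 * w" using degY coeffY le_degree[of Y "5 * w"] by auto
  \<comment> \<open>A power \<open>Y ^ l\<close> carries t^(2wl) already; the additional exponent 2
    w (p - 1 - l) completes it to 2 w (p - 1) for every l, so that one common factor can be removed
    at the end.\<close>
  define bH where "bH x = (case x of (i, j, l) \<Rightarrow> monom 1 (i + s * j + 2 * w * (p - 1 - l)) * Y ^ l)" for x :: "nat \<times> nat \<times> nat"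
  define bR where "bR x = (case x of (i, j, l) \<Rightarrow> monom 1 (i * s + j + 2 * w * (p - 1 - l)) * (monom c (2 * w) - Y) ^ l)" for x :: "nat \<times> nat \<times> nat"
  obtain h where h: "\<exists>x\<in>S. \<not> int p dvd h x" "\<And>k. k < D \<Longrightarrow> int p dvd (\<Sum>x\<in>S. h x * coeff (bR x) k)"
    using linear_system_mod_prime[of S D p "\<lambda>x. coeff (bR x)"] DS p_gt1 by (auto simp: S_def)
  define R where "R = (\<Sum>x\<in>S. smult (h x) (bR x))"
  define H where "H = (\<Sum>x\<in>S. smult (h x) (bH x))"
  have sub: "2 * w * (p - 1 - l) + 5 * w * l = 2 * w * (p - 1) + 3 * w * l" if "l < p" for l
  proof -
    have "p - 1 = (p - 1 - l) + l" using that by simp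
    then have "2 * w * (p - 1) = 2 * w * (p - 1 - l) + 2 * w * l" by (metis add_mult_distrib2)
    then show ?thesis by (simp add: algebra_simps)
  qed
  have degR: "degree (bR x) < D" if "x \<in> S" for x
  proof -
    obtain i j l where x: "x = (i, j, l)" by (cases x)
    have l: "i < w" "j < J" "l < p" using that by (auto simp: S_def x)
    have "degree (monom c (2 * w) - Y) \<le> 5 * w"
      using degY by (intro degree_diff_le order_trans[OF degree_monom_le]) auto
    then have "degree ((monom c (2 * w) - Y) ^ l) \<le> 5 * w * l"
      by (intro order_trans[OF degree_power_le]) simp
    then have "degree (bR x) \<le> (i * s + j + 2 * w * (p - 1 - l)) + 5 * w * l"
      unfolding bR_def x prod.case
      using degree_mult_le[of "monom 1 (i * s + j + 2 * w * (p - 1 - l))" "(monom c (2 * w) - Y) ^ l"]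
        degree_monom_le[of "1::int" "i * s + j + 2 * w * (p - 1 - l)"] by linarith
    also have "\<dots> = i * s + j + (2 * w * (p - 1) + 3 * w * l)" using sub[OF l(3)] by simp
    also have "\<dots> < w * s + J + (2 * w * p + 3 * w * p)"
      using l by (intro add_less_le_mono add_le_less_mono mult_le_mono1 add_mono mult_le_mono2) auto
    also have "\<dots> = D" by (simp add: D_def sw algebra_simps)
    finally show ?thesis .
  qed
  have R0: "int p dvd coeff R k" for k
  proof (cases "k < D")
    case True
    then show ?thesis using h(2)[OF True] by (simp add: R_def coeff_sum)
  next
    case False
    have "coeff (bR x) k = 0" if "x \<in> S" for x using degR[OF that] False by (intro coeff_eq_0) simp
    then show ?thesis by (simp add: R_def coeff_sum)
  qed
  \<comment> \<open>The degree of the term with index x, diminished by the common 2 w (p - 1). The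
    degrees are distinct: i is the remainder modulo w, and l < p is then determined by 3 l modulo p,
    as p is not 3.\<close>
  define dl where "dl x = (case x of (i, j, l) \<Rightarrow> i + w * (p * j + 3 * l))" for x :: "nat \<times> nat \<times> nat"
  have dl_inj: "inj_on dl S"
  proof (rule inj_onI)
    fix x y assume xy: "x \<in> S" "y \<in> S" "dl x = dl y"
    obtain i j l i' j' l' where x: "x = (i, j, l)" and y: "y = (i', j', l')" by (cases x, cases y)
    have l: "i < w" "l < p" "i' < w" "l' < p" using xy by (auto simp: S_def x y)
    have e: "i + w * (p * j + 3 * l) = i' + w * (p * j' + 3 * l')" using xy(3) by (simp add: dl_def x y)
    have i: "i = i'" using arg_cong[OF e, of "\<lambda>z. z mod w"] l by simp
    then have e2: "p * j + 3 * l = p * j' + 3 * l'" using e w0 by simp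
    have "[3 * l = 3 * l'] (mod p)" using arg_cong[OF e2, of "\<lambda>z. z mod p"] by (simp add: cong_def)
    moreover have "coprime 3 p" using p7 prime_p primes_coprime[of 3 p] by auto
    ultimately have "[l = l'] (mod p)" by (simp add: cong_mult_lcancel_nat)
    then have "l = l'" using l by (simp add: cong_def)
    then show "x = y" using i e2 p_pos by (simp add: x y)
  qed
  have dH: "degree (bH x) \<le> dl x + 2 * w * (p - 1)" "coeff (bH x) (dl x + 2 * w * (p - 1)) = m ^ snd (snd x)"
    if "x \<in> S" for x
  proof -
    obtain i j l where x: "x = (i, j, l)" by (cases x)
    have l: "l < p" using that by (auto simp: S_def x)
    define N where "N = i + s * j + 2 * w * (p - 1 - l)"
    have dY: "degree (Y ^ l) = l * (5 * w)" using degY \<open>m \<noteq> 0\<close> coeffY by (subst degree_power_eq) auto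
    have N: "dl (i, j, l) + 2 * w * (p - 1) = N + l * (5 * w)"
      unfolding N_def dl_def prod.case using sub[OF l] by (simp add: sw algebra_simps)
    show "degree (bH x) \<le> dl x + 2 * w * (p - 1)" unfolding x N bH_def prod.case N_def[symmetric]
      using dY degree_mult_le[of "monom 1 N" "Y ^ l"] degree_monom_le[of "1::int" N] by linarith
    have "coeff (Y ^ l) (l * (5 * w)) = m ^ l"
      using lead_coeff_power[of Y l] dY degY coeffY by simp
    then show "coeff (bH x) (dl x + 2 * w * (p - 1)) = m ^ snd (snd x)"
      unfolding x N bH_def prod.case N_def[symmetric] by (simp add: coeff_monom_mult)
  qed
  \<comment> \<open>Among the terms with coefficient prime to p, the one of highest degree cannot
    cancel, so \<open>H\<close> does not vanish modulo p.\<close>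
  obtain x0 where x0: "x0 \<in> S" "\<not> int p dvd h x0" "\<And>x. x \<in> S \<Longrightarrow> \<not> int p dvd h x \<Longrightarrow> dl x \<le> dl x0"
  proof -
    define S' where "S' = {x \<in> S. \<not> int p dvd h x}"
    have "finite S'" "S' \<noteq> {}" using h(1) by (auto simp: S'_def S_def)
    then have "Max (dl ` S') \<in> dl ` S'" by (intro Max_in) auto
    then obtain x0 where "x0 \<in> S'" "Max (dl ` S') = dl x0" by blast
    then show ?thesis using that[of x0] Max_ge[of "dl ` S'"] \<open>finite S'\<close> by (auto simp: S'_def)
  qed
  have H_top: "\<not> int p dvd coeff H (dl x0 + 2 * w * (p - 1))"
  proof
    assume dv: "int p dvd coeff H (dl x0 + 2 * w * (p - 1))"
    have "coeff H (dl x0 + 2 * w * (p - 1)) = (\<Sum>x\<in>S. h x * coeff (bH x) (dl x0 + 2 * w * (p - 1)))"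
      by (simp add: H_def coeff_sum)
    also have "\<dots> = h x0 * m ^ snd (snd x0) + (\<Sum>x\<in>S - {x0}. h x * coeff (bH x) (dl x0 + 2 * w * (p - 1)))"
      using x0(1) dH(2)[OF x0(1)] by (subst sum.remove[of S x0]) (auto simp: S_def)
    finally have eq: "coeff H (dl x0 + 2 * w * (p - 1)) = \<dots>" .
    have "int p dvd (\<Sum>x\<in>S - {x0}. h x * coeff (bH x) (dl x0 + 2 * w * (p - 1)))"
    proof (rule dvd_sum)
      fix x assume x: "x \<in> S - {x0}"
      show "int p dvd h x * coeff (bH x) (dl x0 + 2 * w * (p - 1))"
      proof (cases "int p dvd h x")
        case False
        then have "dl x < dl x0" using x0(3)[of x] x inj_onD[OF dl_inj, of x x0] x0(1) by force
        then have "coeff (bH x) (dl x0 + 2 * w * (p - 1)) = 0"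
          using dH(1)[of x] x by (intro coeff_eq_0) auto
        then show ?thesis by simp
      qed simp
    qed
    then have "int p dvd h x0 * m ^ snd (snd x0)" using dv unfolding eq by (simp add: dvd_add_left_iff)
    then show False using x0(2) m prime_p
      by (metis prime_dvd_mult_iff prime_dvd_power prime_nat_int_transfer)
  qed
  have finT: "finite T" unfolding T_def using finite_U[of "2 * r"] r by simp
  define HH :: "'a poly" where "HH = map_poly of_int H"
  have vanish: "poly HH t \<in> P" if t: "t \<in> T" for t
  proof -
    have tU: "t \<in> U (2 * r)" and tr: "Tr m n (2 * r) t \<doteq> of_int c" using t by (auto simp: T_def)
    have tA: "t \<in> Uall" using U_sub_Uall[OF _ tU] r by simp
    define y where "y = (\<Sum>i<r. ff m n (t ^ (p ^ i)))"
    have evY: "ev t Y = t ^ (2 * w) * y"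
    proof -
      have "of_int m * t ^ (2 * w + 3 * p ^ i) + of_int n * t ^ (2 * w - 2 * p ^ i) = t ^ (2 * w) * ff m n (t ^ (p ^ i))"
        if "i < r" for i
      proof -
        have e: "2 * w = (2 * w - 2 * p ^ i) + p ^ i * 2" using pw[OF that] by simp
        have "t ^ (a + b) * tinv t ^ b = t ^ a * (t * tinv t) ^ b" for a b
          by (simp add: power_add power_mult_distrib mult.assoc)
        from this[of "2 * w - 2 * p ^ i" "p ^ i * 2", folded e]
        have "t ^ (2 * w - 2 * p ^ i) = t ^ (2 * w) * (tinv t ^ p ^ i) ^ 2"
          using tinv[OF tA] by (simp add: power_mult)
        then show ?thesis unfolding ff_def tinv_pow[OF tA]
          by (simp add: algebra_simps power_add mult.commute flip: power_mult)
      qed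
      then show ?thesis by (simp add: Y_def y_def ev_sum ev_add ev_monom sum_distrib_left)
    qed
    \<comment> \<open>The second half of the trace is the Frobenius power of the first half
      \<open>y\<close>, and the trace is \<open>c\<close>.\<close>
    have ys: "y ^ s \<doteq> of_int c - y"
    proof -
      have "y ^ s \<doteq> (\<Sum>i<r. ff m n (t ^ (p ^ i)) ^ (p ^ r))" unfolding y_def s_def by (rule frobk_sum)
      also have "\<dots> \<doteq> (\<Sum>i<r. ff m n ((t ^ (p ^ i)) ^ (p ^ r)))"
        by (intro eqm_sum ff_frob Uall_pow tA)
      also have "\<dots> = (\<Sum>i<r. ff m n (t ^ (p ^ (r + i))))"
        by (simp add: power_add mult.commute flip: power_mult)
      also have "\<dots> = Tr m n (2 * r) t - y"
      proof -
        have "(\<Sum>i<r + k. g i) = (\<Sum>i<r. g i) + (\<Sum>i<k. g (r + i))" for g :: "nat \<Rightarrow> 'a" and k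
          by (induction k) (simp_all add: add.assoc)
        then show ?thesis unfolding Tr_def y_def mult_2 by simp
      qed
      also have "\<dots> \<doteq> of_int c - y" by (rule eqm_diff[OF tr eqm_refl])
      finally show ?thesis .
    qed
    define H0 where "H0 = (\<Sum>(i, j, l)\<in>S. of_int (h (i, j, l)) * (t ^ (i + s * j) * y ^ l))"
    define R0 where "R0 = (\<Sum>(i, j, l)\<in>S. of_int (h (i, j, l)) * (t ^ (i * s + j) * (of_int c - y) ^ l))"
    have clear: "t ^ (2 * w * (p - 1 - l)) * (t ^ (2 * w) * z) ^ l = t ^ (2 * w * (p - 1)) * z ^ l" if "l < p" for l z
    proof -
      have "p - 1 = (p - 1 - l) + l" using that by simp
      then have "2 * w * (p - 1) = 2 * w * (p - 1 - l) + 2 * w * l" by (metis add_mult_distrib2)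
      then have "t ^ (2 * w * (p - 1)) = t ^ (2 * w * (p - 1 - l)) * (t ^ (2 * w)) ^ l"
        by (simp only: power_add power_mult)
      then show ?thesis by (simp only: power_mult_distrib mult.assoc)
    qed
    have evH: "ev t H = t ^ (2 * w * (p - 1)) * H0"
      unfolding H_def H0_def ev_sum sum_distrib_left
    proof (rule sum.cong)
      fix x assume "x \<in> S"
      then obtain i j l where x: "x = (i, j, l)" and l: "l < p" by (auto simp: S_def)
      have "ev t (smult (h x) (bH x)) = of_int (h x) * (t ^ (i + s * j) * (t ^ (2 * w * (p - 1 - l)) * (t ^ (2 * w) * y) ^ l))"
        unfolding x bH_def prod.case by (simp add: ev_smult ev_mult ev_monom ev_power evY power_add algebra_simps)
      also have "\<dots> = t ^ (2 * w * (p - 1)) * (of_int (h x) * (t ^ (i + s * j) * y ^ l))"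
        unfolding clear[OF l] by (simp add: algebra_simps)
      finally show "ev t (smult (h x) (bH x)) = t ^ (2 * w * (p - 1)) * (case x of (i, j, l) \<Rightarrow> of_int (h (i, j, l)) * (t ^ (i + s * j) * y ^ l))"
        by (simp add: x)
    qed simp
    have evR: "ev t R = t ^ (2 * w * (p - 1)) * R0"
      unfolding R_def R0_def ev_sum sum_distrib_left
    proof (rule sum.cong)
      fix x assume "x \<in> S"
      then obtain i j l where x: "x = (i, j, l)" and l: "l < p" by (auto simp: S_def)
      have "ev t (monom c (2 * w) - Y) = t ^ (2 * w) * (of_int c - y)"
        by (simp add: ev_diff ev_monom evY algebra_simps)
      then have "ev t (smult (h x) (bR x)) = of_int (h x) * (t ^ (i * s + j) * (t ^ (2 * w * (p - 1 - l)) * (t ^ (2 * w) * (of_int c - y)) ^ l))"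
        unfolding x bR_def prod.case by (simp only: ev_smult ev_mult ev_monom ev_power power_add) (simp add: mult.assoc)
      also have "\<dots> = t ^ (2 * w * (p - 1)) * (of_int (h x) * (t ^ (i * s + j) * (of_int c - y) ^ l))"
        unfolding clear[OF l] by (simp add: mult.left_commute)
      finally show "ev t (smult (h x) (bR x)) = t ^ (2 * w * (p - 1)) * (case x of (i, j, l) \<Rightarrow> of_int (h (i, j, l)) * (t ^ (i * s + j) * (of_int c - y) ^ l))"
        by (simp add: x)
    qed simp
    have "t ^ (2 * w * (p - 1)) * R0 \<in> P" unfolding evR[symmetric] using R0 by (rule ev_in_P)
    then have "R0 \<in> P" using prime_P Uall_notin_P[OF Uall_pow[OF tA]] by blast
    moreover have "H0 ^ s \<doteq> R0"
    proof -
      have "H0 ^ s \<doteq> (\<Sum>x\<in>S. (case x of (i, j, l) \<Rightarrow> of_int (h (i, j, l)) * (t ^ (i + s * j) * y ^ l)) ^ (p ^ r))"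
        unfolding H0_def s_def by (rule frobk_sum)
      also have "\<dots> \<doteq> R0" unfolding R0_def
      proof (rule eqm_sum)
        fix x assume "x \<in> S"
        obtain i j l where x: "x = (i, j, l)" by (cases x)
        have "t ^ (s * s) = t" using U_power[OF tU] by (simp add: qs)
        moreover have "(i + s * j) * s = i * s + (s * s) * j" by (simp add: algebra_simps)
        then have "(t ^ (i + s * j)) ^ s = t ^ (i * s) * (t ^ (s * s)) ^ j"
          by (metis power_add power_mult)
        ultimately have ts: "(t ^ (i + s * j)) ^ s = t ^ (i * s + j)" by (simp add: power_add)
        have "(of_int (h x) * (t ^ (i + s * j) * y ^ l)) ^ (p ^ r) =
            of_int (h x) ^ (p ^ r) * ((t ^ (i + s * j)) ^ s * (y ^ s) ^ l)"
          by (simp only: power_mult_distrib s_def[symmetric] power_mult[symmetric] mult.commute[of s l])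
        also have "\<dots> = of_int (h x) ^ (p ^ r) * (t ^ (i * s + j) * (y ^ s) ^ l)"
          unfolding ts ..
        also have "\<dots> \<doteq> of_int (h x) * (t ^ (i * s + j) * (of_int c - y) ^ l)"
          by (intro eqm_mult eqm_power frobk_of_int eqm_refl ys)
        finally show "(case x of (i, j, l) \<Rightarrow> of_int (h (i, j, l)) * (t ^ (i + s * j) * y ^ l)) ^ (p ^ r) \<doteq>
            (case x of (i, j, l) \<Rightarrow> of_int (h (i, j, l)) * (t ^ (i * s + j) * (of_int c - y) ^ l))"
          by (simp add: x)
      qed
      finally show ?thesis .
    qed
    ultimately have "H0 ^ s \<in> P" by (rule eqm_mem[rotated])
    then have "H0 \<in> P" by (rule power_in_P)
    then show ?thesis using evH unfolding ev_def HH_def by (simp add: mult_in)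
  qed
  have "card T \<le> degree HH"
  proof (rule ccontr)
    assume "\<not> ?thesis"
    then have gt: "card T > degree HH" by simp
    have inj: "t = u" if "t \<in> T" "u \<in> T" "t \<doteq> u" for t u
      using Uall_inj[of t u] that U_sub_Uall[of "2 * r"] r by (auto simp: T_def)
    have "coeff HH (dl x0 + 2 * w * (p - 1)) \<in> P"
      by (rule root_bound[OF finT vanish inj gt])
    then show False using H_top of_int_in_P_iff by (simp add: HH_def coeff_map_poly)
  qed
  also have "degree HH \<le> degree H" unfolding HH_def by (rule map_poly_degree_leq)
  \<comment> \<open>The main part s w = p^(2r-1) comes from the largest j; the seven extra values of
    j, the powers of \<open>Y\<close> and the cleared denominators contribute multiples of s
    only.\<close>
  also have "degree H \<le> s * w + 12 * s" unfolding H_def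
  proof (rule degree_sum_le)
    show "finite S" by (simp add: S_def)
    fix x assume x: "x \<in> S"
    then obtain i j l where xx: "x = (i, j, l)" "i < w" "j < J" "l < p" by (auto simp: S_def)
    have "degree (smult (h x) (bH x)) \<le> dl x + 2 * w * (p - 1)"
      using dH(1)[OF x] degree_smult_le order_trans by blast
    also have "\<dots> = i + s * j + 3 * (w * l) + 2 * (w * (p - 1))" by (simp add: dl_def xx sw algebra_simps)
    also have "\<dots> \<le> w + s * (w + 6) + 3 * (w * p) + 2 * (w * p)"
      using xx by (intro add_mono mult_le_mono) (auto simp: J_def)
    also have "\<dots> \<le> s * w + 12 * s"
      using p_pos by (simp add: sw algebra_simps)
    finally show "degree (smult (h x) (bH x)) \<le> s * w + 12 * s" .
  qed
  finally show ?thesis unfolding T_def qw s_def .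
qed

end

section \<open>The Weil bound\<close>

definition units_mod :: "nat \<Rightarrow> int set" where
  "units_mod q = {t. 0 \<le> t \<and> t < int q \<and> coprime t (int q)}"

definition expsum :: "nat \<Rightarrow> int \<Rightarrow> int \<Rightarrow> complex" where
  "expsum q m n = (\<Sum>t\<in>units_mod q. ee q (m * t ^ 3 + n * (modular_inverse (int q) t) ^ 2))"

section \<open>Power sums of complex numbers\<close>

lemma sum_mset_eq_sum_count:
  assumes "finite S" "set_mset M \<subseteq> S"
  shows "(\<Sum>y\<in>#M. f y) = (\<Sum>y\<in>S. of_nat (count M y) * (f y :: 'b::comm_semiring_1))"
  using assms(2)
proof (induction M)
  case (add x M)
  have "(\<Sum>y\<in>S. of_nat (count (add_mset x M) y) * f y) =
      (\<Sum>y\<in>S. (if y = x then f y else 0) + of_nat (count M y) * f y)"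
    by (rule sum.cong) (auto simp: algebra_simps)
  also have "\<dots> = f x + (\<Sum>y\<in>#M. f y)" using add assms(1) by (simp add: sum.distrib)
  finally show ?case by simp
qed simp

text \<open>A polynomial \<open>Q\<close> that vanishes at all elements other than z isolates z:
  combining consecutive power sums with the coefficients of \<open>Q\<close> leaves the multiplicity
  of z times z^r Q(z). The combination is bounded independently of r, so the powers of z are
  bounded.\<close>

lemma bounded_power_sums_imp_le_1:
  fixes M :: "complex multiset"
  assumes bd: "\<And>r. r > 0 \<Longrightarrow> norm (\<Sum>z\<in>#M. z ^ r) \<le> C" and z: "z \<in># M"
  shows "norm z \<le> 1"
proof (rule ccontr)
  assume "\<not> norm z \<le> 1"
  then have z1: "norm z > 1" by simp
  define Q where "Q = (\<Prod>y\<in>set_mset M - {z}. [:- y, 1:])"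
  have Qy: "poly Q y = 0" if "y \<in> set_mset M - {z}" for y
    unfolding Q_def poly_prod using that by (intro prod_zero) auto
  have Qz: "poly Q z \<noteq> 0" unfolding Q_def poly_prod by (subst prod_zero_iff) auto
  define B where "B = (\<Sum>i\<le>degree Q. norm (coeff Q i) * C)"
  have key: "norm (of_nat (count M z) * z ^ r * poly Q z) \<le> B" if r: "r > 0" for r
  proof -
    have "(\<Sum>i\<le>degree Q. coeff Q i * (\<Sum>y\<in>#M. y ^ (r + i))) =
        (\<Sum>i\<le>degree Q. \<Sum>y\<in>set_mset M. of_nat (count M y) * y ^ r * (coeff Q i * y ^ i))"
      by (intro sum.cong refl, subst sum_mset_eq_sum_count[OF finite_set_mset subset_refl])
        (simp add: sum_distrib_left power_add algebra_simps)
    also have "\<dots> = (\<Sum>y\<in>set_mset M. of_nat (count M y) * y ^ r * poly Q y)"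
      by (subst sum.swap) (simp add: poly_altdef sum_distrib_left)
    also have "\<dots> = of_nat (count M z) * z ^ r * poly Q z"
      using Qy z by (subst sum.remove[of _ z]) auto
    finally have eq: "of_nat (count M z) * z ^ r * poly Q z = (\<Sum>i\<le>degree Q. coeff Q i * (\<Sum>y\<in>#M. y ^ (r + i)))" by simp
    show ?thesis unfolding eq B_def using bd r
      by (intro sum_norm_le) (auto simp: norm_mult intro: mult_left_mono)
  qed
  have "count M z > 0" using z by simp
  define A where "A = norm (of_nat (count M z) * poly Q z)"
  have A: "A > 0" unfolding A_def using Qz \<open>count M z > 0\<close> by simp
  obtain r where r: "norm z ^ r > B / A" using real_arch_pow[OF z1] by blast
  have "norm z ^ r * A \<le> norm z ^ Suc r * A"
    using z1 A by (intro mult_right_mono power_increasing) auto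
  also have "\<dots> \<le> B" using key[of "Suc r"] by (simp add: A_def norm_mult norm_power mult_ac)
  finally show False using r A by (simp add: field_simps)
qed

text \<open>Induction on the multiset: a further factor 1 - w X changes the right-hand side by terms
  that telescope.\<close>

lemma newton_power_sums:
  fixes M :: "'a::comm_ring_1 multiset"
  defines "c \<equiv> \<lambda>M d. coeff (\<Prod>z\<in>#M. [:1, - z:]) d"
  assumes "d > 0"
  shows "of_nat d * c M d = - (\<Sum>k\<in>{1..d}. (\<Sum>z\<in>#M. z ^ k) * c M (d - k))"
  using assms(2)
proof (induction M arbitrary: d)
  case empty
  then show ?case by (simp add: c_def)
next
  case (add w M)
  have c0: "c (add_mset w M) 0 = c M 0" by (simp add: c_def)
  have cS: "c (add_mset w M) (Suc i) = c M (Suc i) - w * c M i" for i by (simp add: c_def)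
  obtain e where d: "d = Suc e" using add.prems by (cases d) auto
  define s where "s k = (\<Sum>z\<in>#M. z ^ k)" for k
  have "(\<Sum>k\<in>{1..d}. (s k + w ^ k) * c (add_mset w M) (d - k)) =
      (\<Sum>k\<in>{1..e}. (s k + w ^ k) * (c M (d - k) - w * c M (e - k))) + (s d + w ^ d) * c M 0"
  proof -
    have "(\<Sum>k\<in>{1..e}. (s k + w ^ k) * c (add_mset w M) (d - k)) = (\<Sum>k\<in>{1..e}. (s k + w ^ k) * (c M (d - k) - w * c M (e - k)))"
    proof (rule sum.cong)
      fix k assume "k \<in> {1..e}"
      then have "d - k = Suc (e - k)" by (simp add: d Suc_diff_le)
      then show "(s k + w ^ k) * c (add_mset w M) (d - k) = (s k + w ^ k) * (c M (d - k) - w * c M (e - k))"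
        by (simp add: cS)
    qed simp
    then show ?thesis by (simp add: d c0)
  qed
  also have "\<dots> = (\<Sum>k\<in>{1..e}. s k * c M (d - k)) + s d * c M 0 - w * (\<Sum>k\<in>{1..e}. s k * c M (e - k))
      + ((\<Sum>k\<in>{1..e}. w ^ k * c M (Suc e - k) - w ^ Suc k * c M (Suc e - Suc k)) + w ^ Suc e * c M 0)"
    by (simp add: d algebra_simps sum.distrib sum_subtractf sum_distrib_left)
  also have "(\<Sum>k\<in>{1..e}. w ^ k * c M (Suc e - k) - w ^ Suc k * c M (Suc e - Suc k)) = w * c M e - w ^ Suc e * c M 0"
  proof -
    have "(\<Sum>k\<in>{1..n}. g k - g (Suc k)) = g 1 - g (Suc n)" for g :: "nat \<Rightarrow> 'a" and n
      by (induction n) auto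
    from this[of "\<lambda>k. w ^ k * c M (Suc e - k)" e] show ?thesis by simp
  qed
  also have "(\<Sum>k\<in>{1..e}. s k * c M (d - k)) + s d * c M 0 = (\<Sum>k\<in>{1..d}. s k * c M (d - k))"
    by (simp add: d)
  also have "\<dots> = - (of_nat d * c M d)" using add.IH[OF add.prems] by (simp add: s_def)
  also have "(\<Sum>k\<in>{1..e}. s k * c M (e - k)) = - (of_nat e * c M e)"
  proof (cases "e = 0")
    case False then show ?thesis using add.IH[of e] by (simp add: s_def)
  qed simp
  finally have "(\<Sum>k\<in>{1..d}. (s k + w ^ k) * c (add_mset w M) (d - k)) = - (of_nat d * c (add_mset w M) d)"
    by (simp add: d cS algebra_simps)
  then show ?case by (simp add: s_def add.commute)
qed

text \<open>The polynomial with coefficients \<open>V\<close> has constant term 1 and factors over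
  the complex numbers as a product of 1 - z T; as Newton's identity determines \<open>W\<close> from
  \<open>V\<close>, it must consist of the negative power sums. If the degree is smaller than N,
  some z are 0, so that their number is always N.\<close>

lemma exists_power_sum_roots:
  fixes V W :: "nat \<Rightarrow> complex"
  assumes V0: "V 0 = 1" and Vd: "\<And>d. d > N \<Longrightarrow> V d = 0"
    and newton: "\<And>d. of_nat d * V d = (\<Sum>k\<in>{1..d}. W k * V (d - k))"
  shows "\<exists>M. size M = N \<and> (\<forall>k>0. W k = - (\<Sum>z\<in>#M. z ^ k))"
proof -
  define G where "G = (\<Sum>d\<le>N. monom (V d) (N - d))"
  have cG: "coeff G (N - j) = V j" if "j \<le> N" for j
  proof -
    have "coeff G (N - j) = (\<Sum>d\<le>N. if d = j then V d else 0)"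
      unfolding G_def coeff_sum using that by (intro sum.cong) auto
    then show ?thesis using that by simp
  qed
  have dG: "degree G \<le> N" unfolding G_def by (intro degree_sum_le order_trans[OF degree_monom_le]) auto
  have lG: "coeff G N = 1" using cG[of 0] V0 by simp
  then have dG: "degree G = N" using dG le_degree[of G N] by simp
  obtain M where M: "size M = N" "G = (\<Prod>z\<in>#M. [:- z, 1:])"
  proof -
    show ?thesis using that[of "proots G"] complex_poly_decompose_multiset[of G] size_proots_complex[of G] dG lG
      by simp
  qed
  define c where "c = (\<lambda>d. coeff (\<Prod>z\<in>#M. [:1, - z:]) d)"
  have rev: "\<And>j. (j \<le> size M \<longrightarrow> coeff (\<Prod>z\<in>#M. [:1, - z:]) j = coeff (\<Prod>z\<in>#M. [:- z, 1:]) (size M - j)) \<and>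
      (j > size M \<longrightarrow> coeff (\<Prod>z\<in>#M. [:1, - z:]) j = 0 \<and> coeff (\<Prod>z\<in>#M. [:- z, 1:]) j = 0)" for M :: "complex multiset"
  proof (induction M)
    case (add w M)
    show ?case
    proof (cases j)
      case 0
      then show ?thesis using add[of 0] add[of "Suc (size M)"] by simp
    next
      case (Suc k)
      consider "k < size M" | "k = size M" | "k > size M" by linarith
      then show ?thesis
      proof cases
        case 1
        then have "size M - k = Suc (size M - Suc k)" by simp
        then show ?thesis using add[of k] add[of "Suc k"] 1 by (simp add: Suc)
      next
        case 2
        then show ?thesis using add[of k] add[of "Suc k"] add[of 0] by (simp add: Suc)
      next
        case 3
        then show ?thesis using add[of k] add[of "Suc k"] by (simp add: Suc)
      qed
    qed
  qed auto
  have cV: "c d = V d" for d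
    using rev[of d M] cG[of d] Vd[of d] M by (cases "d \<le> N") (auto simp: c_def)
  have "W k = - (\<Sum>z\<in>#M. z ^ k)" if "k > 0" for k
    using that
  proof (induction k rule: less_induct)
    case (less d)
    have "(\<Sum>k\<in>{1..d}. W k * V (d - k)) = (\<Sum>k\<in>{1..d}. - (\<Sum>z\<in>#M. z ^ k) * V (d - k))"
      using newton[of d] newton_power_sums[of d M] less.prems unfolding c_def[symmetric] cV
      by (simp add: cV[unfolded c_def] sum_negf)
    moreover have "{1..d} = insert d {1..<d}" using less.prems by auto
    ultimately have "W d * V 0 + (\<Sum>k\<in>{1..<d}. W k * V (d - k)) =
        - (\<Sum>z\<in>#M. z ^ d) * V 0 + (\<Sum>k\<in>{1..<d}. - (\<Sum>z\<in>#M. z ^ k) * V (d - k))"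
      by simp
    moreover have "(\<Sum>k\<in>{1..<d}. W k * V (d - k)) = (\<Sum>k\<in>{1..<d}. - (\<Sum>z\<in>#M. z ^ k) * V (d - k))"
      using less.IH by (intro sum.cong) auto
    ultimately show ?case using V0 by simp
  qed
  then show ?thesis using M(1) by blast
qed

lemma sum_ee_full:
  assumes "q > 0" "\<not> int q dvd k"
  shows "(\<Sum>a\<in>{0..<int q}. ee q (k * a)) = 0"
proof -
  define z where "z = ee q k"
  have z: "z \<noteq> 1" using ee_eq_1_imp_dvd[OF assms(1)] assms(2) by (auto simp: z_def)
  have zn: "ee q (k * int n) = z ^ n" for n
    by (induction n) (simp_all add: z_def ee_add distrib_left)
  have "z ^ q = 1" using zn[of q] ee_mult_self[OF assms(1), of k] by (simp add: mult.commute)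
  have "(\<Sum>a\<in>{0..<int q}. ee q (k * a)) = (\<Sum>n<q. ee q (k * int n))"
    by (rule sum.reindex_bij_witness[of _ int nat]) auto
  also have "\<dots> = (\<Sum>n<q. z ^ n)" by (simp add: zn)
  also have "\<dots> = 0" using geometric_sum[OF z, of q] \<open>z ^ q = 1\<close> by simp
  finally show ?thesis .
qed

section \<open>The bound for the character sums over a finite field\<close>

context residue_closure
begin

text \<open>Each fibre of the trace has at most \<open>B\<close> elements by Stepanov's method. A
  constant fibre size would give the sum 0, so only the deficits count; they are nonnegative, and
  their total is known because the fibres together exhaust the p^(2r) - 1 units.\<close>

lemma WW_even_bound:
  assumes "p \<ge> 7" "\<not> int p dvd m" "r > 0"
  shows "norm (WW m n (2 * r)) \<le> 13 * real p * real p ^ r"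
proof -
  define T where "T c = {t \<in> U (2 * r). Tr m n (2 * r) t \<doteq> of_int c}" for c
  define B where "B = p ^ (2 * r - 1) + 12 * p ^ r"
  have r2: "2 * r > 0" using assms by simp
  have fin: "finite (U (2 * r))" by (rule finite_U[OF r2])
  have rsT: "rs (Tr m n (2 * r) t) \<in> {0..<int p}" "t \<in> T (rs (Tr m n (2 * r) t))" if "t \<in> U (2 * r)" for t
    using rs[OF Tr_in_Fp[OF that, of m n]] that by (auto simp: T_def)
  have Trs: "{t \<in> U (2 * r). rs (Tr m n (2 * r) t) = c} = T c" if c: "c \<in> {0..<int p}" for c
  proof (intro equalityI subsetI)
    fix t assume "t \<in> T c"
    then have t: "t \<in> U (2 * r)" "Tr m n (2 * r) t \<doteq> of_int c" by (auto simp: T_def)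
    have "of_int (rs (Tr m n (2 * r) t)) \<doteq> of_int c"
      using eqm_trans[OF eqm_sym[OF rs(3)[OF Tr_in_Fp[OF t(1)]]] t(2)] .
    then have "rs (Tr m n (2 * r) t) = c" using rsT(1)[OF t(1)] c by (simp add: of_int_eqm_iff cong_def)
    then show "t \<in> {t \<in> U (2 * r). rs (Tr m n (2 * r) t) = c}" using t by simp
  qed (use rsT in auto)
  have grp: "(\<Sum>t\<in>U (2 * r). g (rs (Tr m n (2 * r) t))) = (\<Sum>c\<in>{0..<int p}. of_nat (card (T c)) * g c)"
    for g :: "int \<Rightarrow> complex"
  proof -
    have "(\<Sum>t\<in>U (2 * r). g (rs (Tr m n (2 * r) t))) =
        (\<Sum>c\<in>{0..<int p}. \<Sum>t\<in>{t \<in> U (2 * r). rs (Tr m n (2 * r) t) = c}. g (rs (Tr m n (2 * r) t)))"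
      by (rule sum.group[symmetric]) (use fin rsT in auto)
    also have "\<dots> = (\<Sum>c\<in>{0..<int p}. of_nat (card (T c)) * g c)"
      using Trs by (intro sum.cong) (auto simp flip: Trs)
    finally show ?thesis .
  qed
  have "complex_of_nat (card (U (2 * r))) = of_nat (\<Sum>c\<in>{0..<int p}. card (T c))"
    using grp[of "\<lambda>_. 1"] by simp
  then have cs: "(\<Sum>c\<in>{0..<int p}. card (T c)) = p ^ (2 * r) - 1"
    using card_U'[OF r2] by (simp only: of_nat_eq_iff)
  have TB: "card (T c) \<le> B" for c unfolding T_def B_def by (rule stepanov[OF assms])
  have "WW m n (2 * r) = (\<Sum>c\<in>{0..<int p}. of_nat (card (T c)) * ee p c)"
    unfolding WW_def lam_orb psi_def by (rule grp)
  also have "\<dots> = (\<Sum>c\<in>{0..<int p}. of_nat B * ee p c) - (\<Sum>c\<in>{0..<int p}. of_nat (B - card (T c)) * ee p c)"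
    using TB by (simp add: of_nat_diff algebra_simps flip: sum_subtractf)
  also have "(\<Sum>c\<in>{0..<int p}. of_nat B * ee p c) = 0"
    using sum_ee_full[OF p_pos, of 1] p_gt1 by (simp flip: sum_distrib_left)
  finally have "norm (WW m n (2 * r)) = norm (\<Sum>c\<in>{0..<int p}. of_nat (B - card (T c)) * ee p c)" by simp
  also have "\<dots> \<le> (\<Sum>c\<in>{0..<int p}. real (B - card (T c)))"
    by (rule sum_norm_le) (simp add: norm_mult)
  also have "\<dots> = real p * real B - real (\<Sum>c\<in>{0..<int p}. card (T c))"
    using TB by (simp add: of_nat_diff sum_subtractf)
  also have "\<dots> = real p * real B - (real p ^ (2 * r) - 1)"
    unfolding cs using p_pos by (simp add: of_nat_diff)
  also have "real p * real B = real p ^ (2 * r) + 12 * (real p * real p ^ r)"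
    unfolding B_def using assms(3) by (cases r) (simp_all add: algebra_simps)
  also have "real p ^ (2 * r) + 12 * (real p * real p ^ r) - (real p ^ (2 * r) - 1) \<le> 13 * real p * real p ^ r"
  proof -
    have "1 \<le> real p * real p ^ r" using p_pos one_le_power[of "real p" "Suc r"] by simp
    then show ?thesis by linarith
  qed
  finally show ?thesis .
qed

text \<open>The coefficients of the L-function vanish beyond degree 5, so the character sums are
  negative power sums of five numbers z. The bounds for even degrees are bounds for the power sums
  of z^2 / p, which force the norm of z to be at most the square root of p.\<close>

lemma norm_WW_1:
  assumes "p \<ge> 7" "\<not> int p dvd m"
  shows "norm (WW m n 1) \<le> 5 * sqrt (real p)"
proof -
  have "\<not> int p dvd 3 * m"
  proof
    assume "int p dvd 3 * m"
    then have "int p dvd 3" using assms(2) prime_p by (auto simp: prime_dvd_mult_iff)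
    then show False using assms(1) zdvd_imp_le by fastforce
  qed
  then have "\<exists>M. size M = 5 \<and> (\<forall>k>0. WW m n k = - (\<Sum>z\<in>#M. z ^ k))"
    by (intro exists_power_sum_roots[of "VV m n"] VV_0 VV_newton VV_eq_0) auto
  then obtain M where M: "size M = 5" "\<And>k. k > 0 \<Longrightarrow> WW m n k = - (\<Sum>z\<in>#M. z ^ k)" by blast
  have small: "norm z \<le> sqrt (real p)" if z: "z \<in># M" for z
  proof -
    define M' where "M' = image_mset (\<lambda>z. z ^ 2 / of_nat p) M"
    have "norm (\<Sum>y\<in>#M'. y ^ r) \<le> 13 * real p" if r: "r > 0" for r
    proof -
      have "(\<Sum>y\<in>#M'. y ^ r) = (\<Sum>z\<in>#M. z ^ (2 * r)) / of_nat p ^ r"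
        unfolding M'_def by (induction M) (simp_all add: power_divide add_divide_distrib power_mult)
      also have "\<dots> = - WW m n (2 * r) / of_nat p ^ r" using M(2)[of "2 * r"] r by simp
      finally have "norm (\<Sum>y\<in>#M'. y ^ r) = norm (WW m n (2 * r)) / real p ^ r"
        by (simp add: norm_divide norm_power)
      also have "\<dots> \<le> 13 * real p"
        using WW_even_bound[OF assms r, of n] p_pos by (simp add: divide_le_eq)
      finally show ?thesis .
    qed
    moreover have "z ^ 2 / of_nat p \<in># M'" using z unfolding M'_def set_image_mset by (rule imageI)
    ultimately have "norm (z ^ 2 / of_nat p) \<le> 1" by (rule bounded_power_sums_imp_le_1)
    then have "norm z ^ 2 \<le> real p" using p_pos by (simp add: norm_divide norm_power divide_le_eq)
    then show ?thesis by (rule real_le_rsqrt)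
  qed
  have "norm (WW m n 1) = norm (\<Sum>z\<in>#M. z)" using M(2)[of 1] by simp
  also have "\<dots> \<le> real (size M) * sqrt (real p)"
    using small
  proof (induction M)
    case (add x M)
    have "norm (x + (\<Sum>z\<in>#M. z)) \<le> norm x + norm (\<Sum>z\<in>#M. z)" by (rule norm_triangle_ineq)
    also have "\<dots> \<le> sqrt (real p) + real (size M) * sqrt (real p)" using add by (intro add_mono) auto
    finally show ?case by (simp add: algebra_simps)
  qed simp
  finally show ?thesis by (simp add: M(1))
qed

text \<open>Over the prime field an orbit of length 1 is a single element, and reduction identifies
  \<open>U 1\<close> with the units modulo p.\<close>

lemma WW_1_eq_expsum: "WW m n 1 = expsum p m n"
proof -
  have up: "units_mod p = {1..<int p}"
  proof (intro equalityI subsetI)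
    fix t assume t: "t \<in> units_mod p"
    then have "t \<noteq> 0" using p_gt1 by (auto simp: units_mod_def)
    then show "t \<in> {1..<int p}" using t by (auto simp: units_mod_def)
  next
    fix t assume t: "t \<in> {1..<int p}"
    then have "\<not> int p dvd t" using zdvd_not_zless by auto
    then have "coprime (int p) t" using prime_p by (intro prime_imp_coprime) auto
    then show "t \<in> units_mod p" using t by (auto simp: units_mod_def coprime_commute)
  qed
  have U1: "t \<in> Fp" "t \<in> Uall" if "t \<in> U 1" for t
    using U_power[OF that] U_sub_Uall[OF _ that] by (auto simp: Fp_def)
  have rs_in: "rs t \<in> units_mod p" if "t \<in> U 1" for t
  proof -
    have "rs t \<noteq> 0"
    proof
      assume "rs t = 0"
      then have "t \<in> P" using rs(3)[OF U1(1)[OF that]] by (simp add: eqm_0_iff)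
      then show False using Uall_notin_P U1(2)[OF that] by blast
    qed
    then show ?thesis unfolding up using rs(1,2)[OF U1(1)[OF that]] by auto
  qed
  have inj: "inj_on rs (U 1)"
  proof (rule inj_onI)
    fix t s assume ts: "t \<in> U 1" "s \<in> U 1" "rs t = rs s"
    have "t \<doteq> s" using eqm_trans[OF rs(3)[OF U1(1)[OF ts(1)]] eqm_sym[OF rs(3)[OF U1(1)[OF ts(2)], folded ts(3)]]] .
    then show "t = s" using Uall_inj U1(2) ts by blast
  qed
  have "rs ` U 1 = units_mod p"
  proof (rule card_subset_eq)
    show "finite (units_mod p)" unfolding up by simp
    show "rs ` U 1 \<subseteq> units_mod p" using rs_in by auto
    show "card (rs ` U 1) = card (units_mod p)" unfolding up using card_image[OF inj] card_U'[of 1] p_pos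
      by (simp add: nat_diff_distrib)
  qed
  then have bij: "bij_betw rs (U 1) (units_mod p)" using inj by (simp add: bij_betw_def)
  have "lam m n (orb 1 t) = ee p (m * rs t ^ 3 + n * (modular_inverse (int p) (rs t)) ^ 2)" if t: "t \<in> U 1" for t
  proof -
    define b where "b = modular_inverse (int p) (rs t)"
    have "[rs t * b = 1] (mod int p)" unfolding b_def
      using rs_in[OF t] by (intro cong_modular_inverse1) (auto simp: units_mod_def)
    then have "of_int (rs t * b) \<doteq> (of_int 1 :: 'a)" by (simp only: of_int_eqm_iff)
    then have "of_int (rs t) * of_int b \<doteq> 1" by simp
    then have "t * of_int b \<doteq> 1" using eqm_trans[OF eqm_mult[OF rs(3)[OF U1(1)[OF t]] eqm_refl]] by blast
    then have "tinv t * (t * of_int b) \<doteq> tinv t * 1" by (intro eqm_mult eqm_refl)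
    moreover have "tinv t * (t * of_int b) = of_int b"
      using tinv[OF U1(2)[OF t]] by (metis mult.assoc mult.commute mult_1)
    ultimately have b: "tinv t \<doteq> of_int b" using eqm_sym by simp
    have "ff m n t \<doteq> of_int m * of_int (rs t) ^ 3 + of_int n * of_int b ^ 2"
      unfolding ff_def by (intro eqm_add eqm_mult eqm_power eqm_refl b rs(3) U1(1) t)
    then have "ff m n t \<doteq> of_int (m * rs t ^ 3 + n * b ^ 2)" by simp
    then have "psi (ff m n t) = ee p (m * rs t ^ 3 + n * b ^ 2)" by (rule psi_eqm_int)
    then show ?thesis unfolding lam_orb b_def Tr_def by simp
  qed
  then have "WW m n 1 = (\<Sum>t\<in>U 1. ee p (m * rs t ^ 3 + n * (modular_inverse (int p) (rs t)) ^ 2))"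
    unfolding WW_def by (rule sum.cong[OF refl])
  also have "\<dots> = expsum p m n" unfolding expsum_def by (rule sum.reindex_bij_betw[OF bij])
  finally show ?thesis .
qed

end

theorem weil_bound_prime:
  assumes "prime p" "p \<ge> 7" "\<not> int p dvd m"
  shows "norm (expsum p m n) \<le> 5 * sqrt (real p)"
proof -
  obtain P :: "cyc set" where "residue_closure P p" using ex_residue_closure[OF assms(1)] by blast
  then interpret residue_closure P p .
  show ?thesis using norm_WW_1[OF assms(2,3), of n] unfolding WW_1_eq_expsum .
qed

section \<open>Congruences modulo prime powers\<close>

lemma prime_power_induct [consumes 1, case_names one prime_power]:
  fixes q :: nat
  assumes "q > 0" "P 1"
    and step: "\<And>p k r. prime p \<Longrightarrow> k > 0 \<Longrightarrow> r > 0 \<Longrightarrow> \<not> p dvd r \<Longrightarrow> P r \<Longrightarrow> P (p ^ k * r)"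
  shows "P q"
  using assms(1)
proof (induction q rule: less_induct)
  case (less q)
  show ?case
  proof (cases "q = 1")
    case False
    then obtain p where p: "prime p" "p dvd q" using prime_factor_nat by blast
    obtain r where r: "q = p ^ multiplicity p q * r" "\<not> p dvd r"
      using multiplicity_decompose'[of q p] p less.prems by (metis not_prime_unit neq0_conv)
    have k: "multiplicity p q > 0" using p less.prems by (simp add: prime_multiplicity_gt_zero_iff)
    have "r > 0" using r less.prems by (cases "r = 0") auto
    moreover have "r < q"
    proof -
      have "1 < p ^ multiplicity p q" using p(1) k by (intro one_less_power prime_gt_1_nat)
      then have "1 * r < p ^ multiplicity p q * r" using \<open>r > 0\<close> by (rule mult_strict_right_mono)
      then show ?thesis using r(1) by simp
    qed
    ultimately have "P r" using less.IH by blast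
    then have "P (p ^ multiplicity p q * r)" using step[OF p(1) k \<open>r > 0\<close> r(2)] by blast
    then show ?thesis using r(1) by simp
  qed (use assms(2) in simp)
qed

definition omega :: "nat \<Rightarrow> nat" where "omega q = card (prime_factors q)"

lemma omega_1 [simp]: "omega (Suc 0) = 0"
  by (simp add: omega_def)

lemma omega_prime_power_mult:
  assumes "prime p" "k > 0" "r > 0" "\<not> p dvd r"
  shows "omega (p ^ k * r) = Suc (omega r)"
proof -
  have "prime_factors (p ^ k * r) = insert p (prime_factors r)"
    using assms by (simp add: prime_factors_product prime_factorization_prime_power prime_gt_0_nat prime_factors_power prime_prime_factors)
  moreover have "p \<notin> prime_factors r" using assms(4) by auto
  ultimately show ?thesis by (simp add: omega_def)
qed

text \<open>Within one class of \<kappa> the elements agree modulo d, and an interval of length N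
  contains at most N / d of them. It is applied with \<kappa> the reduction modulo p or p^2.\<close>

lemma card_le_classes:
  fixes Z :: "int set"
  assumes Z: "Z \<subseteq> {0..<int N}" and d: "d > 0" "d dvd N" and K: "finite K" "\<kappa> ` Z \<subseteq> K"
    and eq: "\<And>t t'. t \<in> Z \<Longrightarrow> t' \<in> Z \<Longrightarrow> \<kappa> t = \<kappa> t' \<Longrightarrow> int d dvd t - t'"
  shows "card Z \<le> card K * (N div d)"
proof -
  have fZ: "finite Z" using Z finite_subset by blast
  have "Z = (\<Union>k\<in>K. {t\<in>Z. \<kappa> t = k})" using K by auto
  then have "card Z \<le> (\<Sum>k\<in>K. card {t\<in>Z. \<kappa> t = k})" using card_UN_le[OF K(1)] by metis
  also have "\<dots> \<le> (\<Sum>k\<in>K. N div d)"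
  proof (rule sum_mono)
    fix k assume "k \<in> K"
    have "inj_on (\<lambda>t. nat (t div int d)) {t\<in>Z. \<kappa> t = k}"
    proof (rule inj_onI)
      fix t t' assume t: "t \<in> {t\<in>Z. \<kappa> t = k}" "t' \<in> {t\<in>Z. \<kappa> t = k}" "nat (t div int d) = nat (t' div int d)"
      have "t \<ge> 0" "t' \<ge> 0" using t Z by auto
      then have "t div int d = t' div int d" using t(3) d by (metis eq_nat_nat_iff pos_imp_zdiv_nonneg_iff of_nat_0_less_iff)
      moreover have "t mod int d = t' mod int d" using eq[of t t'] t by (simp add: mod_eq_dvd_iff)
      ultimately show "t = t'" by (metis div_mult_mod_eq)
    qed
    moreover have "(\<lambda>t. nat (t div int d)) ` {t\<in>Z. \<kappa> t = k} \<subseteq> {..<N div d}"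
    proof (rule image_subsetI)
      fix t assume "t \<in> {t\<in>Z. \<kappa> t = k}"
      then have t: "0 \<le> t" "t < int N" using Z by auto
      obtain e where e: "N = d * e" using d(2) by auto
      have "int d * (t div int d) \<le> t" using d(1) by (simp add: minus_mod_eq_mult_div[symmetric])
      then have "int d * (t div int d) < int d * int e" using t(2) unfolding e by simp
      then have "t div int d < int e" using d(1) by simp
      moreover have "0 \<le> t div int d" using t(1) d(1) by (simp add: pos_imp_zdiv_nonneg_iff)
      ultimately show "nat (t div int d) \<in> {..<N div d}" using d(1) e by (simp add: nat_less_iff)
    qed
    ultimately show "card {t\<in>Z. \<kappa> t = k} \<le> N div d" using card_inj_on_le[of _ _ "{..<N div d}"] by fastforce
  qed
  finally show ?thesis by simp
qed

text \<open>A factor that contains p at most once costs at most one power of p.\<close>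

lemma prime_power_dvd_mult_cancel:
  fixes D S :: int
  assumes "prime p" "\<not> int p ^ 2 dvd S" "int p ^ a dvd S * D"
  shows "int p ^ (a - 1) dvd D"
proof (cases "a = 0")
  case False
  have pp: "prime (int p)" using assms(1) by simp
  show ?thesis
  proof (cases "int p dvd S")
    case False
    then have "coprime (int p ^ a) S" using pp by (simp add: prime_imp_coprime)
    then have "int p ^ a dvd D" using assms(3) coprime_dvd_mult_right_iff by blast
    then show ?thesis using dvd_trans[OF le_imp_power_dvd[of "a - 1" a "int p"]] by simp
  next
    case True
    then obtain S' where S': "S = int p * S'" by auto
    have "\<not> int p dvd S'" using assms(2) unfolding S' power2_eq_square using pp by auto
    then have "coprime (int p ^ (a - 1)) S'" using pp by (simp add: prime_imp_coprime)
    moreover have "int p * int p ^ (a - 1) dvd int p * (S' * D)"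
      using assms(3) \<open>a \<noteq> 0\<close> unfolding S' by (simp add: mult.assoc flip: power_Suc)
    then have "int p ^ (a - 1) dvd S' * D" using pp by (subst (asm) dvd_mult_cancel_left) auto
    ultimately show ?thesis using coprime_dvd_mult_right_iff by blast
  qed
qed simp

lemma power_diff_factor_cong:
  fixes x y M :: int
  assumes "[x = y] (mod M)"
  shows "[(\<Sum>i<r. y ^ (r - Suc i) * x ^ i) = int r * y ^ (r - 1)] (mod M)"
proof -
  have "[(\<Sum>i<r. y ^ (r - Suc i) * x ^ i) = (\<Sum>i<r. y ^ (r - 1))] (mod M)"
  proof (rule cong_sum)
    fix i assume "i \<in> {..<r}"
    then have "y ^ (r - 1) = y ^ (r - Suc i) * y ^ i" by (simp flip: power_add)
    then show "[y ^ (r - Suc i) * x ^ i = y ^ (r - 1)] (mod M)"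
      using assms by (simp add: cong_scalar_left cong_pow)
  qed
  then show ?thesis by simp
qed

lemma power_diff_factor: "(x::int) ^ r - y ^ r = (\<Sum>i<r. y ^ (r - Suc i) * x ^ i) * (x - y)"
  using power_diff_sumr2[of x r y] by (simp add: mult.commute)

text \<open>Uniqueness in Hensel's lemma: the cofactor of x - y in x^r - y^r is r y^(r-1) modulo p,
  which is a unit.\<close>

lemma power_cong_imp_cong:
  assumes "prime p" "\<not> p dvd r" "\<not> int p dvd y" "[x = y] (mod int p)" "int p ^ a dvd x ^ r - y ^ r"
  shows "int p ^ a dvd x - y"
proof -
  define S where "S = (\<Sum>i<r. y ^ (r - Suc i) * x ^ i)"
  have pp: "prime (int p)" using assms(1) by simp
  have "[S = int r * y ^ (r - 1)] (mod int p)" unfolding S_def by (rule power_diff_factor_cong[OF assms(4)])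
  moreover have "\<not> int p dvd int r * y ^ (r - 1)"
    using pp assms(2,3) prime_dvd_power[OF pp, of y "r - 1"] by (auto simp: prime_dvd_mult_iff)
  ultimately have "\<not> int p dvd S" using cong_dvd_iff by blast
  then have "coprime (int p ^ a) S" using pp by (simp add: prime_imp_coprime)
  then show ?thesis using assms(5) unfolding power_diff_factor S_def[symmetric]
    using coprime_dvd_mult_right_iff by blast
qed

text \<open>For p = r the derivative r y^(r-1) is no longer a unit but contains p exactly once.
  Congruence modulo p^2 at the start makes the cofactor share this property, so only one power of p
  is lost.\<close>

lemma power_cong_imp_cong_weak:
  assumes "prime p" "prime r" "\<not> int p dvd y" "[x = y] (mod int (p ^ 2))" "int p ^ a dvd x ^ r - y ^ r"
  shows "int p ^ (a - 1) dvd x - y"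
proof -
  define S where "S = (\<Sum>i<r. y ^ (r - Suc i) * x ^ i)"
  have pp: "prime (int p)" using assms(1) by simp
  have c: "[S = int r * y ^ (r - 1)] (mod int (p ^ 2))" unfolding S_def by (rule power_diff_factor_cong[OF assms(4)])
  have "\<not> int (p ^ 2) dvd int r * y ^ (r - 1)"
  proof
    assume *: "int (p ^ 2) dvd int r * y ^ (r - 1)"
    have "coprime (int p) y" using pp assms(3) by (simp add: prime_imp_coprime)
    then have "coprime (int (p ^ 2)) (y ^ (r - 1))" by simp
    then have "int (p ^ 2) dvd int r" using * coprime_dvd_mult_left_iff by blast
    then have "p ^ 2 dvd r" by (simp only: int_dvd_int_iff)
    then have "p ^ 2 = 1 \<or> p ^ 2 = r" using assms(2) by (auto simp: prime_nat_iff)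
    then show False using assms(1,2) by (auto simp: prime_power_iff)
  qed
  then have "\<not> int (p ^ 2) dvd S" using c cong_dvd_iff by blast
  then have "\<not> int p ^ 2 dvd S" by simp
  then show ?thesis using assms(5) unfolding power_diff_factor S_def[symmetric]
    by (rule prime_power_dvd_mult_cancel[OF assms(1)])
qed

lemma card_roots_mod_prime_int:
  assumes "prime p" "r > 0"
  shows "card {x::int. 0 \<le> x \<and> x < int p \<and> [x ^ r = c] (mod int p)} \<le> r"
proof -
  have p0: "p > 0" using assms(1) by (simp add: prime_gt_0_nat)
  define d where "d = nat (c mod int p)"
  have dc: "[int d = c] (mod int p)" unfolding d_def using p0 by (simp add: cong_def)
  have "bij_betw int {x\<in>{..<p}. [x ^ r = d] (mod p)} {x::int. 0 \<le> x \<and> x < int p \<and> [x ^ r = c] (mod int p)}"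
  proof (rule bij_betwI[of _ _ _ nat])
    show "int \<in> {x\<in>{..<p}. [x ^ r = d] (mod p)} \<rightarrow> {x. 0 \<le> x \<and> x < int p \<and> [x ^ r = c] (mod int p)}"
    proof
      fix x assume x: "x \<in> {x\<in>{..<p}. [x ^ r = d] (mod p)}"
      then have "[int (x ^ r) = int d] (mod int p)" by (simp only: cong_int_iff mem_Collect_eq)
      then show "int x \<in> {x. 0 \<le> x \<and> x < int p \<and> [x ^ r = c] (mod int p)}" using x dc cong_trans by auto
    qed
    show "nat \<in> {x. 0 \<le> x \<and> x < int p \<and> [x ^ r = c] (mod int p)} \<rightarrow> {x\<in>{..<p}. [x ^ r = d] (mod p)}"
    proof
      fix x assume x: "x \<in> {x. 0 \<le> x \<and> x < int p \<and> [x ^ r = c] (mod int p)}"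
      then have "[int (nat x ^ r) = int d] (mod int p)" using dc cong_sym cong_trans by (simp) blast
      then have "[nat x ^ r = d] (mod p)" by (simp only: cong_int_iff)
      then show "nat x \<in> {x\<in>{..<p}. [x ^ r = d] (mod p)}" using x by auto
    qed
  qed auto
  then have "card {x::int. 0 \<le> x \<and> x < int p \<and> [x ^ r = c] (mod int p)} = card {x\<in>{..<p}. [x ^ r = d] (mod p)}"
    by (rule bij_betw_same_card[symmetric])
  then show ?thesis using roots_mod_prime_bound[OF assms, of d] by simp
qed

lemma prime_not_dvd_unit: "prime p \<Longrightarrow> j > 0 \<Longrightarrow> t \<in> units_mod (p ^ j) \<Longrightarrow> \<not> int p dvd t"
  by (auto simp: units_mod_def coprime_power_right_iff dest: coprime_common_divisor)

lemma finite_units_mod [simp]: "finite (units_mod q)"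
  by (rule finite_subset[of _ "{0..<int q}"]) (auto simp: units_mod_def)

definition Nr :: "nat \<Rightarrow> int \<Rightarrow> nat \<Rightarrow> nat" where
  "Nr r n q = card {x \<in> units_mod q. [x ^ r = n] (mod int q)}"

text \<open>If p differs from r, there are at most r roots modulo p and each lifts in at most one
  way. If p = r, there are at most p^2 classes modulo p^2 and each contains at most p
  solutions.\<close>

lemma Nr_prime_power:
  assumes "prime p" "prime r" "k > 0"
  shows "Nr r n (p ^ k) \<le> r ^ 3"
proof -
  define Z where "Z = {x \<in> units_mod (p ^ k). [x ^ r = n] (mod int (p ^ k))}"
  have p0: "p > 0" using assms(1) by (simp add: prime_gt_0_nat)
  have r0: "r > 0" using assms(2) by (simp add: prime_gt_0_nat)
  have Zs: "Z \<subseteq> {0..<int (p ^ k)}" by (auto simp: Z_def units_mod_def)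
  have Zd: "int p ^ k dvd t ^ r - t' ^ r" if "t \<in> Z" "t' \<in> Z" for t t'
  proof -
    have "[t ^ r = t' ^ r] (mod int (p ^ k))" using that cong_trans cong_sym unfolding Z_def by blast
    then show ?thesis by (simp add: cong_iff_dvd_diff)
  qed
  have Zu: "\<not> int p dvd t" if "t \<in> Z" for t using that prime_not_dvd_unit[OF assms(1,3)] by (simp add: Z_def)
  show ?thesis
  proof (cases "p dvd r")
    case True
    then have pr: "p = r" using assms(1,2) primes_dvd_imp_eq by blast
    have "card Z \<le> card {0..<int (p ^ 2)} * (p ^ k div p ^ (k - 1))"
    proof (rule card_le_classes[OF Zs, of _ _ "\<lambda>t. t mod int (p ^ 2)"])
      fix t t' assume t: "t \<in> Z" "t' \<in> Z" "t mod int (p ^ 2) = t' mod int (p ^ 2)"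
      then have "int p ^ (k - 1) dvd t - t'"
        by (intro power_cong_imp_cong_weak[OF assms(1,2) Zu _ Zd]) (auto simp: cong_def)
      then show "int (p ^ (k - 1)) dvd t - t'" by simp
    qed (use p0 in \<open>auto intro: le_imp_power_dvd\<close>)
    also have "p ^ k div p ^ (k - 1) = p" using assms(3) p0 by (cases k) auto
    finally show ?thesis using pr p0 by (simp add: Z_def Nr_def power2_eq_square power3_eq_cube nat_mult_distrib)
  next
    case False
    have "card Z \<le> card {x::int. 0 \<le> x \<and> x < int p \<and> [x ^ r = n] (mod int p)} * (p ^ k div p ^ k)"
    proof (rule card_le_classes[OF Zs, of _ _ "\<lambda>t. t mod int p"])
      show "(\<lambda>t. t mod int p) ` Z \<subseteq> {x. 0 \<le> x \<and> x < int p \<and> [x ^ r = n] (mod int p)}"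
      proof (rule image_subsetI)
        fix t assume "t \<in> Z"
        then have "[t ^ r = n] (mod int (p ^ k))" by (simp add: Z_def)
        then have "[t ^ r = n] (mod int p)" using assms(3) by (rule_tac cong_dvd_modulus) (auto intro: dvd_power)
        then have "[(t mod int p) ^ r = n] (mod int p)" by (simp add: cong_def power_mod)
        then show "t mod int p \<in> {x. 0 \<le> x \<and> x < int p \<and> [x ^ r = n] (mod int p)}" using p0 by simp
      qed
      show "finite {x. 0 \<le> x \<and> x < int p \<and> [x ^ r = n] (mod int p)}"
        by (rule finite_subset[of _ "{0..<int p}"]) auto
      fix t t' assume t: "t \<in> Z" "t' \<in> Z" "t mod int p = t' mod int p"
      then have "int p ^ k dvd t - t'"
        by (intro power_cong_imp_cong[OF assms(1) False Zu _ Zd]) (auto simp: cong_def)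
      then show "int (p ^ k) dvd t - t'" by simp
    qed (use p0 in auto)
    also have "\<dots> \<le> r" using card_roots_mod_prime_int[OF assms(1) r0, of n] p0 by simp
    also have "\<dots> \<le> r ^ 3" using r0 by (simp add: self_le_power)
    finally show ?thesis by (simp add: Z_def Nr_def)
  qed
qed

lemma Nr_mult_le:
  assumes "q1 > 0" "q2 > 0" "coprime q1 q2"
  shows "Nr r n (q1 * q2) \<le> Nr r n q1 * Nr r n q2"
proof -
  let ?A = "\<lambda>q. {x \<in> units_mod q. [x ^ r = n] (mod int q)}"
  have "inj_on (\<lambda>x. (x mod int q1, x mod int q2)) (?A (q1 * q2))"
  proof (rule inj_onI)
    fix x y assume xy: "x \<in> ?A (q1 * q2)" "y \<in> ?A (q1 * q2)" "(x mod int q1, x mod int q2) = (y mod int q1, y mod int q2)"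
    then have "[x = y] (mod int q1)" "[x = y] (mod int q2)" by (auto simp: cong_def)
    then have "[x = y] (mod int q1 * int q2)" using assms(3) by (intro coprime_cong_mult) auto
    then show "x = y" using xy by (simp add: cong_def units_mod_def)
  qed
  moreover have "(\<lambda>x. (x mod int q1, x mod int q2)) ` ?A (q1 * q2) \<subseteq> ?A q1 \<times> ?A q2"
  proof (rule image_subsetI)
    fix x assume x: "x \<in> ?A (q1 * q2)"
    have "[x ^ r = n] (mod int q1)" "[x ^ r = n] (mod int q2)"
      using x by (auto intro: cong_dvd_modulus)
    then show "(x mod int q1, x mod int q2) \<in> ?A q1 \<times> ?A q2"
      using x assms by (auto simp: units_mod_def cong_def power_mod coprime_commute)
  qed
  ultimately have "card (?A (q1 * q2)) \<le> card (?A q1 \<times> ?A q2)" by (rule card_inj_on_le) simp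
  then show ?thesis by (simp add: Nr_def card_cartesian_product)
qed

lemma Nr_le:
  assumes "prime r" "q > 0"
  shows "Nr r n q \<le> (r ^ 3) ^ omega q"
  using assms(2)
proof (induction q rule: prime_power_induct)
  case one
  have "Nr r n 1 \<le> card {0::int}" unfolding Nr_def by (intro card_mono) (auto simp: units_mod_def)
  then show ?case by simp
next
  case (prime_power p k s)
  have "coprime (p ^ k) s" using prime_power by (simp add: prime_imp_coprime)
  then have "Nr r n (p ^ k * s) \<le> Nr r n (p ^ k) * Nr r n s"
    using prime_power prime_gt_0_nat by (intro Nr_mult_le) auto
  also have "\<dots> \<le> r ^ 3 * (r ^ 3) ^ omega s"
    using prime_power Nr_prime_power[OF _ assms(1)] by (intro mult_mono) auto
  finally show ?case using prime_power by (simp add: omega_prime_power_mult)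
qed

text \<open>A prime above C^(1/\<epsilon>) pays for its factor C by its own power p^\<epsilon>; the
  boundedly many smaller primes go into the constant.\<close>

lemma power_omega_le:
  fixes C \<epsilon> :: real
  assumes "C \<ge> 1" "\<epsilon> > 0"
  shows "\<exists>K>0. \<forall>q>0. C ^ omega q \<le> K * real q powr \<epsilon>"
proof -
  define B where "B = nat \<lceil>C powr (1 / \<epsilon>)\<rceil>"
  have big: "C \<le> real p powr \<epsilon>" if "p > B" for p
  proof -
    have "C powr (1 / \<epsilon>) \<le> real p" using that unfolding B_def by linarith
    then have "(C powr (1 / \<epsilon>)) powr \<epsilon> \<le> real p powr \<epsilon>" using assms by (intro powr_mono2) auto
    then show ?thesis using assms by (simp add: powr_powr)
  qed
  have "C ^ omega q \<le> C ^ card {p. p \<le> B \<and> p \<in> prime_factors q} * real q powr \<epsilon>" if "q > 0" for q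
    using that
  proof (induction q rule: prime_power_induct)
    case (prime_power p k r)
    have fin: "finite {l. l \<le> B \<and> l \<in> prime_factors r}" by simp
    have pf: "prime_factors (p ^ k * r) = insert p (prime_factors r)"
      using prime_power by (simp add: prime_factors_product prime_gt_0_nat prime_factors_power prime_prime_factors)
    have pk: "1 \<le> real (p ^ k) powr \<epsilon>" using prime_power assms by (intro ge_one_powr_ge_zero) (auto simp: prime_gt_0_nat Suc_le_eq)
    have pr: "p \<notin> prime_factors r" using prime_power by auto
    have rr: "real (p ^ k * r) powr \<epsilon> = real (p ^ k) powr \<epsilon> * real r powr \<epsilon>"
      by (simp add: powr_mult)
    show ?case
    proof (cases "p \<le> B")
      case True
      then have "{l. l \<le> B \<and> l \<in> prime_factors (p ^ k * r)} = insert p {l. l \<le> B \<and> l \<in> prime_factors r}"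
        unfolding pf by auto
      then have c: "card {l. l \<le> B \<and> l \<in> prime_factors (p ^ k * r)} = Suc (card {l. l \<le> B \<and> l \<in> prime_factors r})"
        using pr fin by simp
      have "C * (C ^ omega r * 1) \<le> C * ((C ^ card {l. l \<le> B \<and> l \<in> prime_factors r} * real r powr \<epsilon>) * real (p ^ k) powr \<epsilon>)"
        using prime_power assms pk by (intro mult_left_mono mult_mono) auto
      then show ?thesis unfolding c rr omega_prime_power_mult[OF prime_power(1-4)] by (simp add: mult_ac)
    next
      case False
      then have "{l. l \<le> B \<and> l \<in> prime_factors (p ^ k * r)} = {l. l \<le> B \<and> l \<in> prime_factors r}"
        unfolding pf by auto
      moreover have "C \<le> real (p ^ k) powr \<epsilon>"
      proof -
        have "real p \<le> real (p ^ k)" using prime_power prime_gt_0_nat[of p] by (simp add: self_le_power Suc_le_eq)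
        then have "real p powr \<epsilon> \<le> real (p ^ k) powr \<epsilon>" using assms by (intro powr_mono2) auto
        then show ?thesis using big[of p] False by linarith
      qed
      then have "C * C ^ omega r \<le> real (p ^ k) powr \<epsilon> * (C ^ card {l. l \<le> B \<and> l \<in> prime_factors r} * real r powr \<epsilon>)"
        using prime_power assms by (intro mult_mono) auto
      ultimately show ?thesis unfolding rr omega_prime_power_mult[OF prime_power(1-4)] by (simp add: mult_ac)
    qed
  qed simp
  moreover have "C ^ card {p. p \<le> B \<and> p \<in> prime_factors q} \<le> C ^ Suc B" for q
  proof (rule power_increasing)
    have "card {p. p \<le> B \<and> p \<in> prime_factors q} \<le> card {..B}" by (rule card_mono) auto
    then show "card {p. p \<le> B \<and> p \<in> prime_factors q} \<le> Suc B" by simp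
  qed (use assms in auto)
  ultimately have "\<forall>q>0. C ^ omega q \<le> C ^ Suc B * real q powr \<epsilon>"
    by (meson mult_right_mono order_trans powr_ge_zero)
  then show ?thesis using assms by (intro exI[of _ "C ^ Suc B"]) auto
qed

section \<open>Stationary phase and Gauss sums\<close>

lemma mult_mod_units_bij:
  assumes "q > 0" "coprime c (int q)"
  shows "bij_betw (\<lambda>t. (c * t) mod int q) (units_mod q) (units_mod q)"
proof -
  have inj: "inj_on (\<lambda>t. (c * t) mod int q) (units_mod q)"
  proof (rule inj_onI)
    fix x y assume xy: "x \<in> units_mod q" "y \<in> units_mod q" "(c * x) mod int q = (c * y) mod int q"
    then have "[c * x = c * y] (mod int q)" by (simp add: cong_def)
    then have "[x = y] (mod int q)" using assms(2) by (simp add: cong_mult_lcancel)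
    then show "x = y" using xy by (simp add: cong_def units_mod_def)
  qed
  have "(\<lambda>t. (c * t) mod int q) ` units_mod q \<subseteq> units_mod q"
    using assms by (auto simp: units_mod_def)
  then show ?thesis unfolding bij_betw_def using inj endo_inj_surj[OF finite_units_mod _ inj] by blast
qed

lemma ee_inverse_indep:
  assumes "q > 0" "[t * u = 1] (mod int q)"
  shows "ee q (m * t ^ 3 + n * (modular_inverse (int q) t) ^ 2) = ee q (m * t ^ 3 + n * u ^ 2)"
proof -
  have "coprime (t * u) (int q)" using assms(2) by (metis cong_imp_coprime cong_sym coprime_1_left)
  then have ct: "coprime t (int q)" by simp
  define v where "v = modular_inverse (int q) t"
  have "[t * v = t * u] (mod int q)"
    using cong_trans[OF cong_modular_inverse1[OF ct] cong_sym[OF assms(2)]] by (simp add: v_def)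
  then have "[v = u] (mod int q)" using ct by (simp add: cong_mult_lcancel)
  then show ?thesis unfolding v_def[symmetric]
    by (intro ee_cong assms(1) cong_add cong_scalar_left cong_pow) auto
qed

definition inv_mod :: "nat \<Rightarrow> int \<Rightarrow> int" where
  "inv_mod q t = modular_inverse (int q) t"

lemma inv_mod: "t \<in> units_mod q \<Longrightarrow> [t * inv_mod q t = 1] (mod int q)"
  unfolding inv_mod_def by (rule cong_modular_inverse1) (simp add: units_mod_def)

definition ff_mod :: "nat \<Rightarrow> int \<Rightarrow> int \<Rightarrow> int \<Rightarrow> int" where
  "ff_mod q m n t = m * t ^ 3 + n * inv_mod q t ^ 2"

lemma expsum_eq: "expsum q m n = (\<Sum>t\<in>units_mod q. ee q (ff_mod q m n t))"
  by (simp add: expsum_def ff_mod_def inv_mod_def)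

lemma ff_mod_scale:
  assumes "q > 0" "[c * c' = 1] (mod int q)" "t \<in> units_mod q"
  shows "ee q (ff_mod q m n ((c * t) mod int q)) = ee q (m * (c * t) ^ 3 + n * (c' * inv_mod q t) ^ 2)"
proof -
  have "[(c * t) mod int q * (c' * inv_mod q t) = (c * t) * (c' * inv_mod q t)] (mod int q)"
    by (simp add: cong_def mod_mult_left_eq)
  also have "(c * t) * (c' * inv_mod q t) = (c * c') * (t * inv_mod q t)" by simp
  also have "[(c * c') * (t * inv_mod q t) = 1 * 1] (mod int q)" by (intro cong_mult assms inv_mod)
  finally have 1: "[(c * t) mod int q * (c' * inv_mod q t) = 1] (mod int q)" by simp
  have "ee q (ff_mod q m n ((c * t) mod int q)) = ee q (m * ((c * t) mod int q) ^ 3 + n * (c' * inv_mod q t) ^ 2)"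
    unfolding ff_mod_def inv_mod_def[of q "(c * t) mod int q"] by (rule ee_inverse_indep[OF assms(1) 1])
  also have "\<dots> = ee q (m * (c * t) ^ 3 + n * (c' * inv_mod q t) ^ 2)"
    by (intro ee_cong assms(1) cong_add cong_scalar_left cong_pow) auto
  finally show ?thesis .
qed

text \<open>The inverse \<open>c'\<close> of the multiplier is supplied explicitly, so that the
  inverse of c t can be expanded in powers of the perturbation.\<close>

lemma sum_units_scale:
  assumes "q > 0" "[c * c' = 1] (mod int q)" and Z: "Z \<subseteq> units_mod q"
    and inv: "\<And>t. t \<in> Z \<Longrightarrow> (c * t) mod int q \<in> Z"
  shows "(\<Sum>t\<in>Z. ee q (ff_mod q m n t)) = (\<Sum>t\<in>Z. ee q (m * (c * t) ^ 3 + n * (c' * inv_mod q t) ^ 2))"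
proof -
  have "coprime (c * c') (int q)" using assms(2) by (metis cong_imp_coprime cong_sym coprime_1_left)
  then have "coprime c (int q)" by simp
  then have inj: "inj_on (\<lambda>t. (c * t) mod int q) Z"
    using mult_mod_units_bij[OF assms(1)] Z inj_on_subset unfolding bij_betw_def by blast
  have "(\<lambda>t. (c * t) mod int q) ` Z = Z"
    using endo_inj_surj[OF finite_subset[OF Z finite_units_mod] _ inj] inv by blast
  then have "bij_betw (\<lambda>t. (c * t) mod int q) Z Z" using inj by (simp add: bij_betw_def)
  then have "(\<Sum>t\<in>Z. ee q (ff_mod q m n t)) = (\<Sum>t\<in>Z. ee q (ff_mod q m n ((c * t) mod int q)))"
    by (rule sum.reindex_bij_betw[symmetric])
  also have "\<dots> = (\<Sum>t\<in>Z. ee q (m * (c * t) ^ 3 + n * (c' * inv_mod q t) ^ 2))"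
    using ff_mod_scale[OF assms(1,2)] Z by (intro sum.cong) auto
  finally show ?thesis .
qed

lemma ee_scale: "k > 0 \<Longrightarrow> ee (k * q) (int k * x) = ee q x"
  by (simp add: ee_def mult.assoc)

lemma sum_ee:
  assumes "q > 0"
  shows "(\<Sum>a\<in>{0..<int q}. ee q (k * a)) = (if int q dvd k then of_nat q else 0)"
proof (cases "int q dvd k")
  case True
  then obtain j where j: "k = int q * j" by auto
  have "ee q (k * a) = 1" for a using ee_mult_self[OF assms, of "j * a"] by (simp add: j mult.assoc)
  then show ?thesis using True by simp
qed (use sum_ee_full[OF assms] in simp)

lemma sum_periodic_shift:
  fixes F :: "int \<Rightarrow> complex"
  assumes "q > 0" "\<And>x y. [x = y] (mod int q) \<Longrightarrow> F x = F y"
  shows "(\<Sum>x\<in>{0..<int q}. F (x + h)) = (\<Sum>x\<in>{0..<int q}. F x)"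
proof -
  have "(\<Sum>x\<in>{0..<int q}. F (x + h)) = (\<Sum>x\<in>{0..<int q}. F ((x + h) mod int q))"
    by (intro sum.cong assms(2)) (auto simp: cong_def)
  also have "\<dots> = (\<Sum>x\<in>{0..<int q}. F x)"
    by (rule sum.reindex_bij_witness[of _ "\<lambda>x. (x - h) mod int q" "\<lambda>x. (x + h) mod int q"])
      (use assms(1) in \<open>auto simp: mod_diff_left_eq mod_add_left_eq\<close>)
  finally show ?thesis .
qed

text \<open>In the square of the absolute value the substitution x = h + y turns the phase into one
  that is linear in y with slope 2 \<alpha> h, so only h = 0 survives.\<close>

lemma norm_quadratic_gauss_sum:
  assumes "prime p" "p > 2" "\<not> int p dvd \<alpha>"
  shows "norm (\<Sum>x\<in>{0..<int p}. ee p (\<alpha> * x ^ 2 + \<beta> * x)) = sqrt (real p)"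
proof -
  have p0: "p > 0" using assms by simp
  define F where "F x = ee p (\<alpha> * x ^ 2 + \<beta> * x)" for x
  define S where "S = (\<Sum>x\<in>{0..<int p}. F x)"
  have Fc: "F x = F y" if "[x = y] (mod int p)" for x y
    unfolding F_def using that by (intro ee_cong p0 cong_add cong_scalar_left cong_pow)
  have cnj: "cnj (ee p x) = ee p (- x)" for x by (simp add: ee_def cis_cnj)
  have "S * cnj S = (\<Sum>y\<in>{0..<int p}. S * cnj (F y))" unfolding S_def by (simp add: sum_distrib_left)
  also have "\<dots> = (\<Sum>y\<in>{0..<int p}. \<Sum>h\<in>{0..<int p}. F (h + y) * cnj (F y))"
  proof (rule sum.cong)
    fix y
    have "S = (\<Sum>h\<in>{0..<int p}. F (h + y))" unfolding S_def by (rule sum_periodic_shift[OF p0 Fc, symmetric])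
    then show "S * cnj (F y) = (\<Sum>h\<in>{0..<int p}. F (h + y) * cnj (F y))" by (simp add: sum_distrib_right)
  qed simp
  also have "\<dots> = (\<Sum>h\<in>{0..<int p}. \<Sum>y\<in>{0..<int p}. F h * ee p ((2 * \<alpha> * h) * y))"
  proof (subst sum.swap, intro sum.cong refl)
    fix h y
    have "\<alpha> * (h + y) ^ 2 + \<beta> * (h + y) + - (\<alpha> * y ^ 2 + \<beta> * y) = (\<alpha> * h ^ 2 + \<beta> * h) + 2 * \<alpha> * h * y"
      by (simp add: algebra_simps power2_eq_square)
    then show "F (h + y) * cnj (F y) = F h * ee p (2 * \<alpha> * h * y)"
      unfolding F_def cnj ee_add[symmetric] by simp
  qed
  also have "\<dots> = (\<Sum>h\<in>{0..<int p}. F h * (if int p dvd 2 * \<alpha> * h then of_nat p else 0))"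
    by (simp only: sum_distrib_left[symmetric] sum_ee[OF p0])
  also have "\<dots> = (\<Sum>h\<in>{0..<int p}. if h = 0 then of_nat p else 0)"
  proof (rule sum.cong)
    fix h assume h: "h \<in> {0..<int p}"
    have "\<not> int p dvd 2" using assms(2) zdvd_imp_le[of "int p" 2] by auto
    then have "int p dvd 2 * \<alpha> * h \<longleftrightarrow> int p dvd h"
      using assms(1,3) by (simp add: prime_dvd_mult_iff)
    also have "\<dots> \<longleftrightarrow> h = 0" using h zdvd_not_zless[of h "int p"] by fastforce
    finally show "F h * (if int p dvd 2 * \<alpha> * h then of_nat p else 0) = (if h = 0 then of_nat p else 0)"
      by (auto simp: F_def)
  qed simp
  also have "\<dots> = of_nat p" using p0 by simp
  finally have "of_real ((norm S) ^ 2) = complex_of_nat p" by (simp only: complex_norm_square)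
  then have "complex_of_real ((norm S) ^ 2) = complex_of_real (real p)" by (simp only: of_real_of_nat_eq)
  then have "(norm S) ^ 2 = real p" by (simp only: of_real_eq_iff)
  then have "sqrt (real p) = norm S" by (intro real_sqrt_unique) auto
  then show ?thesis unfolding S_def F_def by simp
qed

lemma norm_expsum_trivial: "norm (expsum q m n) \<le> real q"
proof -
  have "norm (expsum q m n) \<le> (\<Sum>t\<in>units_mod q. 1)" unfolding expsum_def by (rule sum_norm_le) simp
  also have "\<dots> \<le> real (card {0..<int q})"
    by (simp only: sum_constant mult_1_right of_nat_le_iff, rule card_mono) (auto simp: units_mod_def)
  finally show ?thesis by simp
qed

text \<open>Stationary phase: averaging over the substitutions \<open>t \<mapsto> (1 + p\<^sup>b x)t\<close> leaves the critical points
  of \<open>m t\<^sup>3 + n t\<^sup>-\<^sup>2\<close> modulo \<open>p\<^sup>a\<close>.\<close>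

lemma stationary_phase:
  fixes p a b :: nat and m n :: int
  defines "q \<equiv> p ^ (a + b)"
  defines "Z \<equiv> {t \<in> units_mod q. int (p ^ a) dvd 3 * m * t ^ 3 - 2 * n * inv_mod q t ^ 2}"
  assumes p: "p > 0" and ab: "a \<le> b"
  shows "expsum q m n = (\<Sum>t\<in>Z. ee q (ff_mod q m n t))"
proof -
  have q0: "q > 0" using p by (simp add: q_def)
  \<comment> \<open>This is t f'(t) for f(t) = m t^3 + n t^-2, the coefficient of w x in f((1 + w x)
    t).\<close>
  define g where "g t = 3 * m * t ^ 3 - 2 * n * inv_mod q t ^ 2" for t
  define w where "w = int p ^ b"
  have w2: "int q dvd w ^ 2" unfolding q_def w_def using ab by (simp add: le_imp_power_dvd flip: power_mult)
  have sh: "expsum q m n = (\<Sum>t\<in>units_mod q. ee q (ff_mod q m n t) * ee (p ^ a) (g t * x))" for x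
  proof -
    \<comment> \<open>Since q divides w^2, the inverse of 1 + w x is 1 - w x, and the expansion of
      the phase stops after the linear term.\<close>
    have "(1 + w * x) * (1 - w * x) = 1 - w ^ 2 * x ^ 2" by (simp add: algebra_simps power2_eq_square)
    moreover have "[1 - w ^ 2 * x ^ 2 = 1] (mod int q)" using w2 by (simp add: cong_iff_dvd_diff)
    ultimately have cc: "[(1 + w * x) * (1 - w * x) = 1] (mod int q)" by simp
    have "coprime ((1 + w * x) * (1 - w * x)) (int q)" using cc by (metis cong_imp_coprime cong_sym coprime_1_left)
    then have cu: "coprime (1 + w * x) (int q)" by simp
    have "expsum q m n = (\<Sum>t\<in>units_mod q. ee q (m * ((1 + w * x) * t) ^ 3 + n * ((1 - w * x) * inv_mod q t) ^ 2))"
      unfolding expsum_eq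
    proof (rule sum_units_scale[OF q0 cc])
      fix t assume "t \<in> units_mod q"
      then show "((1 + w * x) * t) mod int q \<in> units_mod q"
        using mult_mod_units_bij[OF q0 cu] unfolding bij_betw_def by blast
    qed simp
    also have "\<dots> = (\<Sum>t\<in>units_mod q. ee q (ff_mod q m n t) * ee (p ^ a) (g t * x))"
    proof (rule sum.cong)
      fix t assume "t \<in> units_mod q"
      define u where "u = inv_mod q t"
      have "m * ((1 + w * x) * t) ^ 3 + n * ((1 - w * x) * u) ^ 2 - (ff_mod q m n t + w * (g t * x)) =
          w ^ 2 * (m * t ^ 3 * x ^ 2 * (3 + w * x) + n * u ^ 2 * x ^ 2)"
        by (simp add: ff_mod_def g_def u_def algebra_simps power2_eq_square power3_eq_cube)
      then have "[m * ((1 + w * x) * t) ^ 3 + n * ((1 - w * x) * u) ^ 2 = ff_mod q m n t + w * (g t * x)] (mod int q)"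
        using w2 by (simp add: cong_iff_dvd_diff)
      then have "ee q (m * ((1 + w * x) * t) ^ 3 + n * ((1 - w * x) * u) ^ 2) = ee q (ff_mod q m n t) * ee q (w * (g t * x))"
        unfolding ee_add[symmetric] by (rule ee_cong[OF q0])
      moreover have "ee q (w * (g t * x)) = ee (p ^ a) (g t * x)"
        using ee_scale[of "p ^ b" "p ^ a" "g t * x"] p by (simp add: q_def w_def power_add mult.commute)
      ultimately show "ee q (m * ((1 + w * x) * t) ^ 3 + n * ((1 - w * x) * inv_mod q t) ^ 2) = ee q (ff_mod q m n t) * ee (p ^ a) (g t * x)"
        by (simp add: u_def)
    qed simp
    finally show ?thesis .
  qed
  have pa: "p ^ a > 0" using p by simp
  have "of_nat (p ^ a) * expsum q m n = (\<Sum>x\<in>{0..<int (p ^ a)}. expsum q m n)" by simp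
  also have "\<dots> = (\<Sum>x\<in>{0..<int (p ^ a)}. \<Sum>t\<in>units_mod q. ee q (ff_mod q m n t) * ee (p ^ a) (g t * x))"
    by (intro sum.cong refl sh)
  also have "\<dots> = (\<Sum>t\<in>units_mod q. ee q (ff_mod q m n t) * (\<Sum>x\<in>{0..<int (p ^ a)}. ee (p ^ a) (g t * x)))"
    by (subst sum.swap) (simp add: sum_distrib_left)
  also have "\<dots> = (\<Sum>t\<in>units_mod q. if int (p ^ a) dvd g t then of_nat (p ^ a) * ee q (ff_mod q m n t) else 0)"
    unfolding sum_ee[OF pa] by (intro sum.cong) auto
  also have "\<dots> = (\<Sum>t\<in>Z. of_nat (p ^ a) * ee q (ff_mod q m n t))"
    unfolding Z_def g_def by (rule sum.inter_filter[symmetric]) simp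
  also have "\<dots> = of_nat (p ^ a) * (\<Sum>t\<in>Z. ee q (ff_mod q m n t))" by (simp add: sum_distrib_left)
  finally have "of_nat (p ^ a) * expsum q m n = of_nat (p ^ a) * (\<Sum>t\<in>Z. ee q (ff_mod q m n t))" .
  moreover have "of_nat (p ^ a) \<noteq> (0::complex)" using pa by (simp only: of_nat_eq_0_iff)
  ultimately show ?thesis by (simp only: mult_cancel_left) simp
qed

text \<open>Multiplication by the unit t^2 removes the inverse.\<close>

lemma critical_iff:
  assumes "t \<in> units_mod q" "d dvd q"
  shows "int d dvd 3 * m * t ^ 3 - 2 * n * inv_mod q t ^ 2 \<longleftrightarrow> int d dvd 3 * m * t ^ 5 - 2 * n"
proof -
  define u where "u = inv_mod q t"
  have dq: "int d dvd int q" using assms(2) by simp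
  have tu: "[t * u = 1] (mod int d)" using cong_dvd_modulus[OF inv_mod[OF assms(1)] dq] by (simp add: u_def)
  have "coprime t (int q)" using assms(1) by (simp add: units_mod_def)
  then have ct: "coprime (int d) (t ^ 2)"
    using dq by (meson coprime_commute coprime_divisors coprime_power_left_iff dvd_refl coprime_power_right_iff)
  have "t ^ 2 * (3 * m * t ^ 3 - 2 * n * u ^ 2) = 3 * m * t ^ 5 - 2 * n * (t * u) ^ 2"
    by (simp add: algebra_simps power2_eq_square power3_eq_cube eval_nat_numeral)
  also have "[\<dots> = 3 * m * t ^ 5 - 2 * n * 1 ^ 2] (mod int d)"
    by (intro cong_diff cong_refl cong_scalar_left cong_pow tu)
  finally have "[t ^ 2 * (3 * m * t ^ 3 - 2 * n * u ^ 2) = 3 * m * t ^ 5 - 2 * n] (mod int d)" by simp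
  then have "int d dvd t ^ 2 * (3 * m * t ^ 3 - 2 * n * u ^ 2) \<longleftrightarrow> int d dvd 3 * m * t ^ 5 - 2 * n"
    by (rule cong_dvd_iff)
  then show ?thesis using ct unfolding u_def by (simp add: coprime_dvd_mult_right_iff)
qed

text \<open>The critical points solve 3 m t^5 = 2 n modulo p^a. For p >= 7 there are at most 5
  solutions modulo p, each lifting in at most one way. For p <= 5 the coefficient 3 m and the
  exponent 5 may each cost one power of p; counting p^2 classes modulo p^2, each with at most
  p^(b+2) elements, leads to the factor p^4 <= 625.\<close>

lemma card_critical:
  fixes p a b :: nat and m n :: int
  defines "q \<equiv> p ^ (a + b)"
  defines "Z \<equiv> {t \<in> units_mod q. int (p ^ a) dvd 3 * m * t ^ 3 - 2 * n * inv_mod q t ^ 2}"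
  assumes p: "prime p" and a0: "a > 0" and prim: "\<not> (int p dvd m \<and> int p dvd n)"
  shows "p \<ge> 7 \<Longrightarrow> card Z \<le> 5 * p ^ b" "p < 7 \<Longrightarrow> card Z \<le> 625 * p ^ b"
proof -
  have p0: "p > 0" using p by (simp add: prime_gt_0_nat)
  have pp: "prime (int p)" using p by simp
  have Zs: "Z \<subseteq> {0..<int q}" by (auto simp: Z_def units_mod_def)
  have Zu: "\<not> int p dvd t" if "t \<in> Z" for t
    using that prime_not_dvd_unit[OF p, of "a + b"] a0 by (simp add: Z_def q_def)
  have pa: "p ^ a dvd q" by (simp add: q_def power_add)
  have crit: "int (p ^ a) dvd 3 * m * t ^ 5 - 2 * n" if "t \<in> Z" for t
    using that critical_iff[OF _ pa, of t m n] by (simp add: Z_def)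
  have Zd: "int p ^ a dvd 3 * m * (t ^ 5 - t' ^ 5)" if "t \<in> Z" "t' \<in> Z" for t t'
    using dvd_diff[OF crit[OF that(1)] crit[OF that(2)]] by (simp add: algebra_simps)
  show "card Z \<le> 5 * p ^ b" if p7: "p \<ge> 7"
  proof (cases "Z = {}")
    case False
    then obtain t0 where t0: "t0 \<in> Z" by blast
    have "\<not> int p dvd m"
    proof
      assume pm: "int p dvd m"
      have "int p dvd int p ^ a" using a0 by simp
      then have "int p dvd 3 * m * t0 ^ 5 - 2 * n" using crit[OF t0] dvd_trans by simp
      moreover have "int p dvd 3 * m * t0 ^ 5" using pm by simp
      ultimately have "int p dvd 2 * n" using dvd_diff_right_iff by blast
      moreover have "\<not> int p dvd 2" using p7 zdvd_imp_le[of "int p" 2] by auto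
      ultimately have "int p dvd n" using pp by (simp add: prime_dvd_mult_iff)
      then show False using prim pm by simp
    qed
    moreover have "\<not> int p dvd 3" using p7 zdvd_imp_le[of "int p" 3] by auto
    ultimately have "\<not> int p dvd 3 * m" using pp by (simp add: prime_dvd_mult_iff)
    then have "coprime (int p) (3 * m)" using pp by (intro prime_imp_coprime)
    then have cop: "coprime (int p ^ a) (3 * m)" by simp
    have Zd': "int p ^ a dvd t ^ 5 - t' ^ 5" if "t \<in> Z" "t' \<in> Z" for t t'
      using Zd[OF that] cop coprime_dvd_mult_right_iff by blast
    have p5: "\<not> p dvd 5" using p7 by (auto dest: dvd_imp_le)
    have "card Z \<le> card {x::int. 0 \<le> x \<and> x < int p \<and> [x ^ 5 = t0 ^ 5] (mod int p)} * (q div p ^ a)"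
    proof (rule card_le_classes[OF Zs, of _ _ "\<lambda>t. t mod int p"])
      show "(\<lambda>t. t mod int p) ` Z \<subseteq> {x. 0 \<le> x \<and> x < int p \<and> [x ^ 5 = t0 ^ 5] (mod int p)}"
      proof (rule image_subsetI)
        fix t assume t: "t \<in> Z"
        have "int p dvd int p ^ a" using a0 by simp
        then have "int p dvd t ^ 5 - t0 ^ 5" using Zd'[OF t t0] dvd_trans by blast
        then have "[(t mod int p) ^ 5 = t0 ^ 5] (mod int p)" by (simp add: cong_def power_mod mod_eq_dvd_iff)
        then show "t mod int p \<in> {x. 0 \<le> x \<and> x < int p \<and> [x ^ 5 = t0 ^ 5] (mod int p)}" using p0 by simp
      qed
      show "finite {x. 0 \<le> x \<and> x < int p \<and> [x ^ 5 = t0 ^ 5] (mod int p)}"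
        by (rule finite_subset[of _ "{0..<int p}"]) auto
      fix t t' assume t: "t \<in> Z" "t' \<in> Z" "t mod int p = t' mod int p"
      then have "int p ^ a dvd t - t'"
        by (intro power_cong_imp_cong[OF p p5 Zu _ Zd']) (auto simp: cong_def)
      then show "int (p ^ a) dvd t - t'" by simp
    qed (use p0 pa in auto)
    also have "\<dots> \<le> 5 * p ^ b"
      using card_roots_mod_prime_int[OF p, of 5 "t0 ^ 5"] p0 by (simp add: q_def power_add)
    finally show ?thesis .
  qed simp
  show "card Z \<le> 625 * p ^ b" if p7: "p < 7"
  proof -
    have Zd2: "int p ^ (a - 1) dvd t ^ 5 - t' ^ 5" if t: "t \<in> Z" "t' \<in> Z" for t t'
    proof (cases "a \<ge> 2")
      case True
      \<comment> \<open>If p^2 divided 3 m, it would divide 2 n as well; since 2 and 3 are primes, p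
        would then divide both m and n.\<close>
      have "\<not> int p ^ 2 dvd 3 * m"
      proof
        assume p3m: "int p ^ 2 dvd 3 * m"
        have "int p ^ 2 dvd int p ^ a" using True by (rule le_imp_power_dvd)
        then have "int p ^ 2 dvd 3 * m * t ^ 5 - 2 * n" using crit[OF t(1)] dvd_trans by simp
        moreover have "int p ^ 2 dvd 3 * m * t ^ 5" using p3m by simp
        ultimately have p2n: "int p ^ 2 dvd 2 * n" using dvd_diff_right_iff by blast
        have *: "int p dvd x" if "int p ^ 2 dvd int l * x" "prime l" for l x
        proof -
          have "int p dvd int l \<Longrightarrow> p = l" using primes_dvd_imp_eq[OF p that(2)] by simp
          show ?thesis
          proof (cases "p = l")
            case True
            then show ?thesis using that p0 by (simp add: power2_eq_square)
          next
            case False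
            then have "\<not> int p dvd int l" using primes_dvd_imp_eq[OF p that(2)] by auto
            moreover have "int p dvd int l * x" using that(1) by (meson dvd_trans dvd_power pos2)
            ultimately show ?thesis using pp by (simp add: prime_dvd_mult_iff)
          qed
        qed
        have "int p dvd m" using *[of 3 m] p3m by simp
        moreover have "int p dvd n" using *[of 2 n] p2n by simp
        ultimately show False using prim by simp
      qed
      then show ?thesis using prime_power_dvd_mult_cancel[OF p _ Zd[OF t]] by simp
    qed (use a0 in simp)
    have "card Z \<le> card {0..<int (p ^ 2)} * (q div p ^ (a - 2))"
    proof (rule card_le_classes[OF Zs, of _ _ "\<lambda>t. t mod int (p ^ 2)"])
      fix t t' assume t: "t \<in> Z" "t' \<in> Z" "t mod int (p ^ 2) = t' mod int (p ^ 2)"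
      then have "int p ^ (a - 1 - 1) dvd t - t'"
        by (intro power_cong_imp_cong_weak[of p 5] p Zu Zd2) (auto simp: cong_def)
      then show "int (p ^ (a - 2)) dvd t - t'" by (simp add: numeral_2_eq_2)
    next
      show "p ^ (a - 2) dvd q" unfolding q_def by (rule le_imp_power_dvd) simp
    qed (use p0 in auto)
    also have "\<dots> \<le> p ^ 2 * (p ^ 2 * p ^ b)"
    proof -
      have "q \<le> p ^ (a - 2) * (p ^ 2 * p ^ b)" unfolding q_def power_add[symmetric]
        using p0 by (intro power_increasing) auto
      then have "q div p ^ (a - 2) \<le> p ^ 2 * p ^ b" using p0
        by (metis div_le_mono nonzero_mult_div_cancel_left power_not_zero less_not_refl2)
      moreover have "card {0..<int (p ^ 2)} = p ^ 2" by (simp only: card_atLeastLessThan_int diff_zero nat_int)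
      ultimately show ?thesis by (metis mult_le_mono2)
    qed
    also have "\<dots> \<le> 625 * p ^ b"
    proof -
      have "p \<noteq> 6" using p prime_odd_nat[of p] by auto
      then have "p \<le> 5" using p7 by simp
      then have "p ^ 2 * p ^ 2 \<le> 5 ^ 2 * 5 ^ 2" by (intro mult_mono power_mono) auto
      then have "p ^ 2 * p ^ 2 * p ^ b \<le> 625 * p ^ b" by (intro mult_right_mono) auto
      then show ?thesis by (simp add: mult.assoc)
    qed
    finally show ?thesis .
  qed
qed

section \<open>Bounds for the exponential sums\<close>

text \<open>The substitution t -> (1 + p^a x) t permutes the critical points, and q divides the cube
  of p^a, so a phase quadratic in x modulo p remains. Its Gauss sum has absolute value the square
  root of p, which saves this factor over the number of critical points.\<close>

lemma stationary_phase_odd: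
  fixes p a :: nat and m n :: int
  defines "q \<equiv> p ^ (a + (a + 1))"
  defines "Z \<equiv> {t \<in> units_mod q. int (p ^ a) dvd 3 * m * t ^ 3 - 2 * n * inv_mod q t ^ 2}"
  assumes p: "prime p" "p \<ge> 7" and a0: "a > 0" and prim: "\<not> (int p dvd m \<and> int p dvd n)"
  shows "sqrt (real p) * norm (\<Sum>t\<in>Z. ee q (ff_mod q m n t)) \<le> real (card Z)"
proof -
  have p0: "p > 0" using p by simp
  have pp: "prime (int p)" using p by simp
  have q0: "q > 0" using p0 by (simp add: q_def)
  have Zu: "Z \<subseteq> units_mod q" by (auto simp: Z_def)
  define g where "g t = 3 * m * t ^ 3 - 2 * n * inv_mod q t ^ 2" for t
  define k where "k t = m * t ^ 3 + n * inv_mod q t ^ 2" for t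
  define w where "w = int p ^ a"
  have w3: "int q dvd w ^ 3"
    unfolding q_def w_def of_nat_power power_mult[symmetric] using a0 by (intro le_imp_power_dvd) simp
  have qw: "q = p ^ (2 * a) * p" by (simp add: q_def power_add mult_2)
  have wg: "w dvd g t" if "t \<in> Z" for t using that by (simp add: Z_def g_def w_def)
  have paq: "p ^ a dvd q" by (simp add: q_def power_add)
  define S where "S = (\<Sum>t\<in>Z. ee q (ff_mod q m n t))"
  have sh: "S = (\<Sum>t\<in>Z. ee q (ff_mod q m n t) * ee p (3 * k t * x ^ 2 + (g t div w) * x))" for x
  proof -
    define c where "c = 1 + w * x"
    \<comment> \<open>The inverse of 1 + w x up to the term w^3 x^3, which is divisible by
      q.\<close>
    define c' where "c' = 1 - w * x + w ^ 2 * x ^ 2"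
    have "c * c' = 1 + w ^ 3 * x ^ 3" by (simp add: c_def c'_def algebra_simps power2_eq_square power3_eq_cube)
    moreover have "[1 + w ^ 3 * x ^ 3 = 1] (mod int q)" using w3 by (simp add: cong_iff_dvd_diff)
    ultimately have cc: "[c * c' = 1] (mod int q)" by simp
    have "coprime (c * c') (int q)" using cc by (metis cong_imp_coprime cong_sym coprime_1_left)
    then have cu: "coprime c (int q)" by simp
    have "S = (\<Sum>t\<in>Z. ee q (m * (c * t) ^ 3 + n * (c' * inv_mod q t) ^ 2))"
      unfolding S_def
    proof (rule sum_units_scale[OF q0 cc Zu])
      fix t assume t: "t \<in> Z"
      define s where "s = (c * t) mod int q"
      have s: "s \<in> units_mod q" using mult_mod_units_bij[OF q0 cu] t Zu unfolding bij_betw_def s_def by blast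
      have "[s = c * t] (mod int q)" by (simp add: s_def)
      then have "[s = c * t] (mod w)" using paq by (rule_tac cong_dvd_modulus) (auto simp: w_def simp flip: of_nat_power)
      also have "[c * t = t] (mod w)" by (simp add: c_def cong_iff_dvd_diff algebra_simps)
      finally have "[s = t] (mod int (p ^ a))" by (simp add: w_def)
      then have "[3 * m * s ^ 5 - 2 * n = 3 * m * t ^ 5 - 2 * n] (mod int (p ^ a))"
        by (intro cong_diff cong_refl cong_scalar_left cong_pow)
      moreover have "int (p ^ a) dvd 3 * m * t ^ 5 - 2 * n"
        using t critical_iff[OF _ paq, of t m n] by (simp add: Z_def)
      ultimately have "int (p ^ a) dvd 3 * m * s ^ 5 - 2 * n" using cong_dvd_iff by blast
      then show "(c * t) mod int q \<in> Z" using s critical_iff[OF s paq, of m n] by (simp add: Z_def s_def)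
    qed
    also have "\<dots> = (\<Sum>t\<in>Z. ee q (ff_mod q m n t) * ee p (3 * k t * x ^ 2 + (g t div w) * x))"
    proof (rule sum.cong)
      fix t assume t: "t \<in> Z"
      define u where "u = inv_mod q t"
      obtain g' where g': "g t = w * g'" using wg[OF t] by auto
      have "w \<noteq> 0" using p0 by (simp add: w_def)
      then have gd: "g t div w = g'" by (simp add: g')
      define y where "y = 3 * k t * x ^ 2 + g' * x"
      have "m * (c * t) ^ 3 + n * (c' * u) ^ 2 - (ff_mod q m n t + (w * x * g t + w ^ 2 * (3 * k t * x ^ 2))) =
          w ^ 3 * (x ^ 3 * (m * t ^ 3 - 2 * n * u ^ 2) + w * x ^ 4 * n * u ^ 2)"
        by (simp add: ff_mod_def g_def k_def u_def c_def c'_def algebra_simps power2_eq_square power3_eq_cube eval_nat_numeral)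
      moreover have "w * x * g t + w ^ 2 * (3 * k t * x ^ 2) = w ^ 2 * y"
        by (simp add: g' y_def algebra_simps power2_eq_square)
      ultimately have "[m * (c * t) ^ 3 + n * (c' * u) ^ 2 = ff_mod q m n t + w ^ 2 * y] (mod int q)"
        using w3 by (simp add: cong_iff_dvd_diff)
      then have "ee q (m * (c * t) ^ 3 + n * (c' * u) ^ 2) = ee q (ff_mod q m n t) * ee q (w ^ 2 * y)"
        unfolding ee_add[symmetric] by (rule ee_cong[OF q0])
      moreover have "ee q (w ^ 2 * y) = ee p y"
        using ee_scale[of "p ^ (2 * a)" p y] p0 by (simp add: qw w_def mult.commute flip: power_mult)
      ultimately show "ee q (m * (c * t) ^ 3 + n * (c' * inv_mod q t) ^ 2) =
          ee q (ff_mod q m n t) * ee p (3 * k t * x ^ 2 + (g t div w) * x)"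
        by (simp add: u_def gd y_def)
    qed simp
    finally show ?thesis .
  qed
  \<comment> \<open>The quadratic coefficient is 3 f(t), and 3 f(t) - t f'(t) = 5 n t^-2. At a
    critical point where it vanished modulo p, first n and then m would be divisible by p.\<close>
  have nd: "\<not> int p dvd 3 * k t" if t: "t \<in> Z" for t
  proof
    assume *: "int p dvd 3 * k t"
    define u where "u = inv_mod q t"
    have pw: "int p dvd w" using a0 by (simp add: w_def)
    then have pg: "int p dvd g t" using wg[OF t] dvd_trans by blast
    have "int p dvd 3 * k t - g t" using * pg by simp
    moreover have "3 * k t - g t = 5 * n * u ^ 2" by (simp add: k_def g_def u_def)
    ultimately have "int p dvd 5 * n * u ^ 2" by simp
    moreover have "\<not> int p dvd 5" using p(2) zdvd_imp_le[of "int p" 5] by auto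
    moreover have pq: "int p dvd int q" by (simp add: qw)
    have "[t * u = 1] (mod int p)"
      using cong_dvd_modulus[OF inv_mod pq] t Zu by (auto simp: u_def)
    then have "\<not> int p dvd t * u" using cong_dvd_iff[of "t * u" 1 "int p"] pp by auto
    then have "\<not> int p dvd t" "\<not> int p dvd u" by auto
    then have tu: "\<not> int p dvd t ^ 3" "\<not> int p dvd u ^ 2" using prime_dvd_power[OF pp] by blast+
    ultimately have pn: "int p dvd n" using pp by (auto simp: prime_dvd_mult_iff)
    have "int p dvd g t + 2 * n * u ^ 2" using pg pn by simp
    then have "int p dvd 3 * m * t ^ 3" by (simp add: g_def u_def)
    moreover have "\<not> int p dvd 3" using p(2) zdvd_imp_le[of "int p" 3] by auto
    ultimately have "int p dvd m" using pp tu by (auto simp: prime_dvd_mult_iff)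
    then show False using prim pn by simp
  qed
  have "of_nat p * S = (\<Sum>x\<in>{0..<int p}. S)" by simp
  also have "\<dots> = (\<Sum>x\<in>{0..<int p}. \<Sum>t\<in>Z. ee q (ff_mod q m n t) * ee p (3 * k t * x ^ 2 + (g t div w) * x))"
    by (intro sum.cong refl sh)
  also have "\<dots> = (\<Sum>t\<in>Z. ee q (ff_mod q m n t) * (\<Sum>x\<in>{0..<int p}. ee p (3 * k t * x ^ 2 + (g t div w) * x)))"
    by (subst sum.swap) (simp add: sum_distrib_left)
  finally have eq: "of_nat p * S = \<dots>" .
  have "real p * norm S = norm (of_nat p * S)" by (simp add: norm_mult)
  also have "\<dots> \<le> (\<Sum>t\<in>Z. sqrt (real p))" unfolding eq
  proof (rule sum_norm_le)
    fix t assume t: "t \<in> Z"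
    show "norm (ee q (ff_mod q m n t) * (\<Sum>x\<in>{0..<int p}. ee p (3 * k t * x ^ 2 + (g t div w) * x))) \<le> sqrt (real p)"
      using norm_quadratic_gauss_sum[OF p(1) _ nd[OF t], of "g t div w"] p(2) by (simp add: norm_mult)
  qed
  also have "\<dots> = real (card Z) * sqrt (real p)" by simp
  finally have le: "real p * norm S \<le> real (card Z) * sqrt (real p)" .
  define s where "s = sqrt (real p)"
  have s: "s > 0" "real p = s * s" using p0 by (simp_all add: s_def)
  have "s * (s * norm S) \<le> s * real (card Z)"
    using le s(1) unfolding s_def[symmetric] s(2) by (simp add: mult_ac)
  then have "s * norm S \<le> real (card Z)" using s(1) by simp
  then show ?thesis by (simp add: S_def s_def)
qed

text \<open>Modulo p the cubic term drops out; in terms of the inverse of t the sum is a quadratic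
  Gauss sum without its term at 0.\<close>

lemma norm_expsum_prime_0:
  assumes p: "prime p" "p > 2" and m: "int p dvd m" and n: "\<not> int p dvd n"
  shows "norm (expsum p m n) \<le> 2 * sqrt (real p)"
proof -
  have p0: "p > 0" using p by simp
  have inv_u: "inv_mod p t \<in> units_mod p" if "t \<in> units_mod p" for t
    using that p0 modular_inverse_int_nonneg[of "int p" t] modular_inverse_int_less[of "int p" t]
    by (auto simp: units_mod_def inv_mod_def)
  have inj: "inj_on (inv_mod p) (units_mod p)"
  proof (rule inj_onI)
    fix x y assume xy: "x \<in> units_mod p" "y \<in> units_mod p" "inv_mod p x = inv_mod p y"
    have "[x * inv_mod p x = y * inv_mod p x] (mod int p)"
      using cong_trans[OF inv_mod[OF xy(1)] cong_sym[OF inv_mod[OF xy(2)]]] xy(3) by simp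
    moreover have "coprime (inv_mod p x) (int p)" using inv_u[OF xy(1)] by (simp add: units_mod_def)
    ultimately have "[x = y] (mod int p)" by (simp add: cong_mult_rcancel)
    then show "x = y" using xy by (simp add: units_mod_def cong_def)
  qed
  have "inv_mod p ` units_mod p = units_mod p"
    using endo_inj_surj[OF finite_units_mod _ inj] inv_u by blast
  then have bij: "bij_betw (inv_mod p) (units_mod p) (units_mod p)" using inj by (simp add: bij_betw_def)
  have up: "{0..<int p} = insert 0 (units_mod p)" "0 \<notin> units_mod p"
  proof -
    show "0 \<notin> units_mod p" using p by (auto simp: units_mod_def)
    show "{0..<int p} = insert 0 (units_mod p)"
    proof (intro equalityI subsetI)
      fix x assume x: "x \<in> {0..<int p}"
      show "x \<in> insert 0 (units_mod p)"
      proof (cases "x = 0")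
        case False
        then have "\<not> int p dvd x" using x zdvd_not_zless[of x "int p"] by auto
        then have "coprime (int p) x" using p(1) by (intro prime_imp_coprime) auto
        then show ?thesis using x by (simp add: units_mod_def coprime_commute)
      qed simp
    qed (use p0 in \<open>auto simp: units_mod_def\<close>)
  qed
  have "expsum p m n = (\<Sum>t\<in>units_mod p. ee p (n * inv_mod p t ^ 2))"
    unfolding expsum_eq ff_mod_def
  proof (intro sum.cong refl ee_cong p0)
    fix t show "[m * t ^ 3 + n * inv_mod p t ^ 2 = n * inv_mod p t ^ 2] (mod int p)"
      using m by (simp add: cong_iff_dvd_diff)
  qed
  also have "\<dots> = (\<Sum>s\<in>units_mod p. ee p (n * s ^ 2))"
    by (rule sum.reindex_bij_betw[OF bij])
  also have "\<dots> = (\<Sum>s\<in>{0..<int p}. ee p (n * s ^ 2 + 0 * s)) - 1" unfolding up(1) using up(2) by simp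
  finally have "norm (expsum p m n) \<le> norm (\<Sum>s\<in>{0..<int p}. ee p (n * s ^ 2 + 0 * s)) + norm (1::complex)"
    by (simp only: norm_triangle_ineq4)
  also have "\<dots> = sqrt (real p) + 1" using norm_quadratic_gauss_sum[OF p n, of 0] by simp
  also have "\<dots> \<le> 2 * sqrt (real p)" using p0 real_sqrt_ge_1_iff[of "real p"] by simp
  finally show ?thesis .
qed

text \<open>The constant comes from p <= 5: there are at most 625 p^b critical points, and p^b is at
  most 3 sqrt q because b - a <= 1. For p >= 7 the constants are 2 and 5, from Gauss sums, Weil's
  bound and stationary phase.\<close>

lemma norm_expsum_primitive:
  assumes p: "prime p" and j: "j > 0" and prim: "\<not> (int p dvd m \<and> int p dvd n)"
  shows "norm (expsum (p ^ j) m n) \<le> 1875 * sqrt (real (p ^ j))"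
proof (cases "j = 1")
  case True
  show ?thesis
  proof (cases "p \<ge> 7")
    case p7: True
    show ?thesis
    proof (cases "int p dvd m")
      case True
      have "norm (expsum p m n) \<le> 2 * sqrt (real p)"
        by (rule norm_expsum_prime_0) (use p p7 True prim in auto)
      also have "\<dots> \<le> 1875 * sqrt (real p)" by (rule mult_right_mono) auto
      finally show ?thesis using \<open>j = 1\<close> by simp
    next
      case False
      have "norm (expsum p m n) \<le> 5 * sqrt (real p)" by (rule weil_bound_prime[OF p p7 False])
      also have "\<dots> \<le> 1875 * sqrt (real p)" by (rule mult_right_mono) auto
      finally show ?thesis using \<open>j = 1\<close> by simp
    qed
  next
    case False
    have "norm (expsum p m n) \<le> real p" by (rule norm_expsum_trivial)
    also have "real p = sqrt (real p) * sqrt (real p)" by simp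
    also have "\<dots> \<le> 1875 * sqrt (real p)"
    proof (rule mult_right_mono)
      have "sqrt (real p) \<le> sqrt (1875 ^ 2)" using False by (subst real_sqrt_le_iff) simp
      then show "sqrt (real p) \<le> 1875" by simp
    qed simp
    finally show ?thesis using True by simp
  qed
next
  case False
  define a where "a = j div 2"
  define b where "b = j - a"
  have ab: "a > 0" "a \<le> b" "j = a + b" "b = a \<or> b = a + 1" using j False by (auto simp: a_def b_def)
  have p0: "p > 0" using p by (simp add: prime_gt_0_nat)
  define q where "q = p ^ (a + b)"
  define Z where "Z = {t \<in> units_mod q. int (p ^ a) dvd 3 * m * t ^ 3 - 2 * n * inv_mod q t ^ 2}"
  have W: "expsum q m n = (\<Sum>t\<in>Z. ee q (ff_mod q m n t))"
    unfolding q_def Z_def by (rule stationary_phase[OF p0 ab(2)])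
  have triv: "norm (expsum q m n) \<le> real (card Z)"
    unfolding W using sum_norm_le[of Z "\<lambda>t. ee q (ff_mod q m n t)" "\<lambda>_. 1"] by simp
  have "norm (expsum q m n) \<le> 1875 * sqrt (real q)"
  proof (cases "p \<ge> 7")
    case p7: True
    have cZ: "real (card Z) \<le> 5 * real p ^ b"
      using card_critical(1)[OF p ab(1) prim p7, of b] unfolding Z_def q_def by (simp flip: of_nat_power of_nat_mult)
    show ?thesis
    proof (cases "b = a")
      case True
      have "sqrt (real q) = real p ^ a" unfolding q_def True by (rule real_sqrt_unique) (auto simp: power_add power2_eq_square)
      then show ?thesis using triv cZ True by (simp add: power_increasing)
    next
      case False
      then have b: "b = a + 1" using ab by simp
      have "sqrt (real p) * norm (expsum q m n) \<le> real (card Z)"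
        unfolding W unfolding Z_def q_def b by (rule stationary_phase_odd[OF p p7 ab(1) prim])
      also have "\<dots> \<le> 5 * real p ^ b" by (rule cZ)
      also have "\<dots> = sqrt (real p) * (5 * (sqrt (real p) * real p ^ a))" 
      proof -
        have "5 * real p ^ b = 5 * ((sqrt (real p) * sqrt (real p)) * real p ^ a)" using b by simp
        then show ?thesis by (simp only: mult_ac)
      qed
      finally have "norm (expsum q m n) \<le> 5 * (sqrt (real p) * real p ^ a)" using p0 by simp
      also have "sqrt (real p) * real p ^ a = sqrt (real q)"
      proof (rule real_sqrt_unique[symmetric])
        show "(sqrt (real p) * real p ^ a) ^ 2 = real q"
          by (simp add: q_def b power_mult_distrib power_add power2_eq_square)
      qed simp
      also have "5 * sqrt (real q) \<le> 1875 * sqrt (real q)" by (rule mult_right_mono) auto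
      finally show ?thesis .
    qed
  next
    case False
    have cZ: "real (card Z) \<le> 625 * real p ^ b"
      using card_critical(2)[OF p ab(1) prim, of b] False unfolding Z_def q_def by (simp flip: of_nat_power of_nat_mult)
    have "real p ^ b \<le> 3 * sqrt (real q)"
    proof (rule power2_le_imp_le)
      have "p ^ (2 * b) \<le> p ^ (a + b + 1)" using ab p0 by (intro power_increasing) auto
      also have "\<dots> \<le> 9 * q" unfolding q_def using False by simp
      finally have "real (p ^ (2 * b)) \<le> real (9 * q)" by (simp only: of_nat_le_iff)
      then show "(real p ^ b) ^ 2 \<le> (3 * sqrt (real q)) ^ 2"
        by (simp add: power_mult_distrib mult.commute flip: power_mult)
    qed simp
    then show ?thesis using triv cZ by linarith
  qed
  then show ?thesis using ab(3) by (simp add: q_def)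
qed

text \<open>A common factor p^i of m and n lowers the modulus to p^(j-i), and each unit modulo
  p^(j-i) has p^i lifts.\<close>

lemma expsum_pull_out:
  assumes p: "prime p" and ij: "i < j"
  shows "expsum (p ^ j) (int p ^ i * m) (int p ^ i * n) = of_nat (p ^ i) * expsum (p ^ (j - i)) m n"
proof -
  define q' where "q' = p ^ (j - i)"
  have p0: "p > 0" using p by (simp add: prime_gt_0_nat)
  have q': "q' > 0" using p0 by (simp add: q'_def)
  have q: "p ^ j = p ^ i * q'" unfolding q'_def using ij by (simp flip: power_add)
  define F where "F s = ee q' (ff_mod q' m n s)" for s
  have red: "t mod int q' \<in> units_mod q' \<longleftrightarrow> coprime t (int p ^ j)" for t
    using ij q' by (simp add: units_mod_def) (simp add: q'_def)
  have "expsum (p ^ j) (int p ^ i * m) (int p ^ i * n) = (\<Sum>t\<in>units_mod (p ^ j). F (t mod int q'))"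
    unfolding expsum_eq
  proof (rule sum.cong)
    fix t assume t: "t \<in> units_mod (p ^ j)"
    define u where "u = inv_mod (p ^ j) t"
    have d: "int q' dvd int (p ^ j)" unfolding q by simp
    have "[t * u = 1] (mod int q')" using cong_dvd_modulus[OF inv_mod[OF t] d] by (simp add: u_def)
    moreover have "[t mod int q' * u = t * u] (mod int q')" by (simp add: cong_def mod_mult_left_eq)
    ultimately have tu: "[t mod int q' * u = 1] (mod int q')" using cong_trans by blast
    have "F (t mod int q') = ee q' (m * (t mod int q') ^ 3 + n * u ^ 2)"
      unfolding F_def ff_mod_def inv_mod_def by (rule ee_inverse_indep[OF q' tu])
    also have "\<dots> = ee q' (m * t ^ 3 + n * u ^ 2)"
      by (intro ee_cong q' cong_add cong_scalar_left cong_pow cong_refl) (simp add: cong_def)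
    also have "\<dots> = ee (p ^ i * q') (int (p ^ i) * (m * t ^ 3 + n * u ^ 2))"
      using p0 by (intro ee_scale[symmetric]) simp
    finally show "ee (p ^ j) (ff_mod (p ^ j) (int p ^ i * m) (int p ^ i * n) t) = F (t mod int q')"
      by (simp add: ff_mod_def u_def q algebra_simps)
  qed simp
  also have "\<dots> = (\<Sum>(s, v)\<in>units_mod q' \<times> {0..<int (p ^ i)}. F s)"
  proof (rule sum.reindex_bij_witness[of _ "\<lambda>(s, v). s + int q' * v" "\<lambda>t. (t mod int q', t div int q')"])
    fix t assume t: "t \<in> units_mod (p ^ j)"
    then have "t div int q' < int (p ^ i)"
    proof -
      have "int q' * (t div int q') \<le> t" using q' by (simp add: minus_mod_eq_mult_div[symmetric])
      also have "t < int (p ^ j)" using t by (simp add: units_mod_def)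
      also have "int (p ^ j) = int q' * int (p ^ i)" by (simp only: q of_nat_mult mult.commute)
      finally show ?thesis using q' by simp
    qed
    moreover have "0 \<le> t div int q'" using t q' by (simp add: units_mod_def pos_imp_zdiv_nonneg_iff)
    ultimately show "(t mod int q', t div int q') \<in> units_mod q' \<times> {0..<int (p ^ i)}"
      using red[of t] t by (simp add: units_mod_def)
  next
    fix x assume x: "x \<in> units_mod q' \<times> {0..<int (p ^ i)}"
    obtain s v where sv: "x = (s, v)" by (cases x)
    have s: "s \<in> units_mod q'" "0 \<le> v" "v < int (p ^ i)" using x by (auto simp: sv)
    have sm: "0 \<le> s" "s < int q'" using s by (auto simp: units_mod_def)
    then have "(s + int q' * v) mod int q' = s" "(s + int q' * v) div int q' = v" using q' by auto
    then show "(\<lambda>t. (t mod int q', t div int q')) ((\<lambda>(s, v). s + int q' * v) x) = x" by (simp add: sv)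
    have "v + 1 \<le> int (p ^ i)" using s by simp
    then have "int q' * (v + 1) \<le> int q' * int (p ^ i)" by (rule mult_left_mono) simp
    then have "s + int q' * v < int (p ^ j)" using sm by (simp add: q algebra_simps)
    then show "(\<lambda>(s, v). s + int q' * v) x \<in> units_mod (p ^ j)"
      using red[of "s + int q' * v"] s sm by (simp add: sv units_mod_def)
  qed auto
  also have "\<dots> = of_nat (p ^ i) * (\<Sum>s\<in>units_mod q'. F s)"
    by (simp add: sum_distrib_left sum.cartesian_product[symmetric])
  finally show ?thesis by (simp add: F_def expsum_eq q'_def)
qed

text \<open>If the gcd is p^i with i < j, pulling it out leaves a primitive sum of modulus p^(j-i),
  and p^i sqrt(p^(j-i)) = sqrt(p^j) sqrt(p^i). For i = j the trivial bound is already of this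
  shape.\<close>

lemma norm_expsum_prime_power:
  assumes p: "prime p" and j: "j > 0"
  shows "norm (expsum (p ^ j) m n) \<le> 1875 * sqrt (real (p ^ j)) * sqrt (real_of_int (gcd (gcd m n) (int (p ^ j))))"
proof -
  define G where "G = gcd (gcd m n) (int (p ^ j))"
  have p0: "p > 0" using p by (simp add: prime_gt_0_nat)
  have "nat G dvd p ^ j" unfolding G_def by (metis gcd_dvd2 gcd_ge_0_int int_dvd_int_iff nat_0_le)
  then obtain i where i: "i \<le> j" "nat G = p ^ i" using divides_primepow_nat[OF p] by auto
  have G: "G = int p ^ i" using i(2) G_def by (metis gcd_ge_0_int nat_0_le of_nat_power)
  show ?thesis
  proof (cases "i = j")
    case True
    have "norm (expsum (p ^ j) m n) \<le> real (p ^ j)" by (rule norm_expsum_trivial)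
    also have "\<dots> = sqrt (real (p ^ j)) * sqrt (real (p ^ j))" by simp
    also have "\<dots> \<le> 1875 * sqrt (real (p ^ j)) * sqrt (real (p ^ j))"
      by (intro mult_right_mono) auto
    finally show ?thesis unfolding G_def[symmetric] G True by simp
  next
    case False
    then have ij: "i < j" using i by simp
    have "G dvd m" "G dvd n" unfolding G_def by (metis dvd_trans gcd_dvd1 gcd_dvd2)+
    then obtain m' n' where mn: "m = int p ^ i * m'" "n = int p ^ i * n'" unfolding G by (auto elim!: dvdE)
    have prim: "\<not> (int p dvd m' \<and> int p dvd n')"
    proof
      assume *: "int p dvd m' \<and> int p dvd n'"
      have "int p ^ Suc i dvd m" "int p ^ Suc i dvd n" using * unfolding mn by (auto simp: mult.commute intro: mult_dvd_mono)
      moreover have "int p ^ Suc i dvd int (p ^ j)" using ij by (simp add: le_imp_power_dvd Suc_le_eq del: power_Suc)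
      ultimately have "int p ^ Suc i dvd int p ^ i" unfolding G[symmetric] G_def by (simp del: power_Suc)
      then have "p ^ Suc i dvd p ^ i" by (simp only: of_nat_power[symmetric] int_dvd_int_iff)
      then show False using p prime_gt_1_nat[OF p] power_dvd_imp_le[of p "Suc i" i] by simp
    qed
    have "norm (expsum (p ^ j) m n) = real (p ^ i) * norm (expsum (p ^ (j - i)) m' n')"
      unfolding mn expsum_pull_out[OF p ij] by (simp add: norm_mult norm_power)
    also have "\<dots> \<le> real (p ^ i) * (1875 * sqrt (real (p ^ (j - i))))"
      using norm_expsum_primitive[OF p _ prim, of "j - i"] ij by (intro mult_left_mono) auto
    also have "real (p ^ i) = sqrt (real (p ^ i)) * sqrt (real (p ^ i))" by simp
    also have "sqrt (real (p ^ i)) * sqrt (real (p ^ i)) * (1875 * sqrt (real (p ^ (j - i)))) =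
        1875 * sqrt (real (p ^ i) * real (p ^ (j - i))) * sqrt (real (p ^ i))"
      by (simp only: real_sqrt_mult mult_ac)
    also have "real (p ^ i) * real (p ^ (j - i)) = real (p ^ j)" using ij by (simp flip: power_add)
    finally show ?thesis unfolding G_def[symmetric] G by simp
  qed
qed

text \<open>Modulo integers, 1 / (q1 q2) equals x2 / q1 + x1 / q2, so the character splits into a
  product, and so do the units by the Chinese remainder theorem.\<close>

lemma expsum_crt:
  assumes q: "q1 > 0" "q2 > 0" "coprime q1 q2"
    and x: "[int q2 * x2 = 1] (mod int q1)" "[int q1 * x1 = 1] (mod int q2)"
  shows "expsum (q1 * q2) m n = expsum q1 (m * x2) (n * x2) * expsum q2 (m * x1) (n * x1)"
proof -
  define A where "A s = ee q1 (ff_mod q1 (m * x2) (n * x2) s)" for s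
  define B where "B s = ee q2 (ff_mod q2 (m * x1) (n * x1) s)" for s
  have q0: "q1 * q2 > 0" using q by simp
  have ci: "coprime (int q1) (int q2)" using q(3) by simp
  have one: "[int q2 * x2 + int q1 * x1 = 1] (mod int (q1 * q2))"
  proof -
    have "[int q2 * x2 + int q1 * x1 = 1 + 0] (mod int q1)" by (intro cong_add x) (simp add: cong_def)
    moreover have "[int q2 * x2 + int q1 * x1 = 0 + 1] (mod int q2)" by (intro cong_add x) (simp add: cong_def)
    ultimately show ?thesis using coprime_cong_mult[OF _ _ ci] by simp
  qed
  have split: "ee (q1 * q2) y = ee q1 (y * x2) * ee q2 (y * x1)" for y
  proof -
    have "[y * 1 = y * (int q2 * x2 + int q1 * x1)] (mod int (q1 * q2))"
      by (rule cong_scalar_left[OF cong_sym[OF one]])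
    then have "ee (q1 * q2) y = ee (q1 * q2) (int q2 * (y * x2) + int q1 * (y * x1))"
      by (intro ee_cong q0) (simp add: algebra_simps)
    also have "\<dots> = ee (q2 * q1) (int q2 * (y * x2)) * ee (q1 * q2) (int q1 * (y * x1))"
      by (simp add: ee_add mult.commute)
    finally show ?thesis using q by (simp only: ee_scale)
  qed
  have loc: "ee r (ff_mod r m' n' (t mod int r)) = ee r (m' * t ^ 3 + n' * inv_mod (q1 * q2) t ^ 2)"
    if t: "t \<in> units_mod (q1 * q2)" and r: "r > 0" "int r dvd int (q1 * q2)" for r t m' n'
  proof -
    define u where "u = inv_mod (q1 * q2) t"
    have "[t * u = 1] (mod int r)" using cong_dvd_modulus[OF inv_mod[OF t] r(2)] by (simp add: u_def)
    moreover have "[t mod int r * u = t * u] (mod int r)" by (simp add: cong_def mod_mult_left_eq)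
    ultimately have tu: "[t mod int r * u = 1] (mod int r)" using cong_trans by blast
    have "ee r (ff_mod r m' n' (t mod int r)) = ee r (m' * (t mod int r) ^ 3 + n' * u ^ 2)"
      unfolding ff_mod_def inv_mod_def[of r] by (rule ee_inverse_indep[OF r(1) tu])
    also have "\<dots> = ee r (m' * t ^ 3 + n' * u ^ 2)"
      by (intro ee_cong r cong_add cong_scalar_left cong_pow cong_refl) (simp add: cong_def)
    finally show ?thesis by (simp add: u_def)
  qed
  have bij: "bij_betw (\<lambda>t. (t mod int q1, t mod int q2)) (units_mod (q1 * q2)) (units_mod q1 \<times> units_mod q2)"
    unfolding bij_betw_def
  proof
    show "inj_on (\<lambda>t. (t mod int q1, t mod int q2)) (units_mod (q1 * q2))"
    proof (rule inj_onI)
      fix x y assume xy: "x \<in> units_mod (q1 * q2)" "y \<in> units_mod (q1 * q2)"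
        "(x mod int q1, x mod int q2) = (y mod int q1, y mod int q2)"
      then have "[x = y] (mod int q1)" "[x = y] (mod int q2)" by (auto simp: cong_def)
      then have "[x = y] (mod int q1 * int q2)" using ci by (intro coprime_cong_mult) auto
      then show "x = y" using xy by (simp add: cong_def units_mod_def)
    qed
    show "(\<lambda>t. (t mod int q1, t mod int q2)) ` units_mod (q1 * q2) = units_mod q1 \<times> units_mod q2"
    proof (intro equalityI subsetI)
      fix z assume "z \<in> units_mod q1 \<times> units_mod q2"
      then obtain s1 s2 where z: "z = (s1, s2)" "s1 \<in> units_mod q1" "s2 \<in> units_mod q2" by auto
      define t where "t = (s1 * (int q2 * x2) + s2 * (int q1 * x1)) mod int (q1 * q2)"
      have "[t = s1 * (int q2 * x2) + s2 * (int q1 * x1)] (mod int (q1 * q2))" by (simp add: t_def cong_def)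
      then have c: "[t = s1 * (int q2 * x2) + s2 * (int q1 * x1)] (mod int q1)"
        "[t = s1 * (int q2 * x2) + s2 * (int q1 * x1)] (mod int q2)"
        by (auto elim: cong_dvd_modulus)
      have "[s1 * (int q2 * x2) + s2 * (int q1 * x1) = s1 * 1 + 0] (mod int q1)"
        by (intro cong_add cong_scalar_left x) (simp add: cong_def)
      from cong_trans[OF c(1) this] have "[t = s1] (mod int q1)" by simp
      then have t1: "t mod int q1 = s1" using z by (simp add: cong_def units_mod_def)
      have "[s1 * (int q2 * x2) + s2 * (int q1 * x1) = 0 + s2 * 1] (mod int q2)"
        by (intro cong_add cong_scalar_left x) (simp add: cong_def)
      from cong_trans[OF c(2) this] have "[t = s2] (mod int q2)" by simp
      then have t2: "t mod int q2 = s2" using z by (simp add: cong_def units_mod_def)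
      have "coprime (t mod int q1) (int q1)" "coprime (t mod int q2) (int q2)"
        unfolding t1 t2 using z by (auto simp: units_mod_def)
      then have "coprime t (int q1)" "coprime t (int q2)" using q by simp_all
      moreover have "0 \<le> t" "t < int (q1 * q2)" unfolding t_def using q0 by simp_all
      ultimately have "t \<in> units_mod (q1 * q2)" by (simp add: units_mod_def)
      then show "z \<in> (\<lambda>t. (t mod int q1, t mod int q2)) ` units_mod (q1 * q2)"
        using z t1 t2 by (intro image_eqI[of _ _ t]) auto
    qed (use q in \<open>auto simp: units_mod_def\<close>)
  qed
  have "expsum (q1 * q2) m n = (\<Sum>t\<in>units_mod (q1 * q2). (\<lambda>(s1, s2). A s1 * B s2) (t mod int q1, t mod int q2))"
    unfolding expsum_eq
  proof (rule sum.cong)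
    fix t assume t: "t \<in> units_mod (q1 * q2)"
    have "ee (q1 * q2) (ff_mod (q1 * q2) m n t) = A (t mod int q1) * B (t mod int q2)"
    proof -
      have d: "int q1 dvd int (q1 * q2)" "int q2 dvd int (q1 * q2)" by simp_all
      show ?thesis unfolding A_def B_def split loc[OF t q(1) d(1)] loc[OF t q(2) d(2)]
        by (simp add: ff_mod_def algebra_simps)
    qed
    then show "ee (q1 * q2) (ff_mod (q1 * q2) m n t) = (\<lambda>(s1, s2). A s1 * B s2) (t mod int q1, t mod int q2)" by simp
  qed simp
  also have "\<dots> = (\<Sum>(s1, s2)\<in>units_mod q1 \<times> units_mod q2. A s1 * B s2)"
    by (rule sum.reindex_bij_betw[OF bij])
  also have "\<dots> = expsum q1 (m * x2) (n * x2) * expsum q2 (m * x1) (n * x1)"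
    by (simp add: expsum_eq A_def B_def sum_product sum.cartesian_product)
  finally show ?thesis .
qed

text \<open>The constants of the prime powers multiply to a power with exponent
  \<open>omega q\<close>. The twists by \<open>x1\<close> and \<open>x2\<close> are by units and
  leave the gcds unchanged.\<close>

theorem norm_expsum_le:
  assumes "q > 0"
  shows "norm (expsum q m n) \<le> 1875 ^ omega q * sqrt (real q) * sqrt (real_of_int (gcd (gcd m n) (int q)))"
  using assms
proof (induction q arbitrary: m n rule: prime_power_induct)
  case one
  show ?case using norm_expsum_trivial[of 1 m n] by simp
next
  case (prime_power p k r)
  define q1 where "q1 = p ^ k"
  have q1: "q1 > 0" using prime_power by (simp add: q1_def prime_gt_0_nat)
  have cop: "coprime q1 r" unfolding q1_def using prime_power by (simp add: prime_imp_coprime)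
  then have c: "coprime (int r) (int q1)" "coprime (int q1) (int r)" by (simp_all add: coprime_commute)
  obtain x2 x1 where x2: "[int r * x2 = 1] (mod int q1)" and x1: "[int q1 * x1 = 1] (mod int r)"
    using cong_solve_coprime_int[OF c(1)] cong_solve_coprime_int[OF c(2)] by blast
  have g: "gcd (gcd (m * x) (n * x)) s = gcd (gcd m n) s" if "[y * x = 1] (mod s)" for x y s :: int
  proof -
    have "coprime (y * x) s" using that by (metis cong_imp_coprime cong_sym coprime_1_left)
    then have cx: "coprime x s" by simp
    have "d dvd z * x \<longleftrightarrow> d dvd z" if "d dvd s" for d z
      using coprime_divisors[OF dvd_refl that cx] by (simp add: coprime_dvd_mult_left_iff coprime_commute)
    note key = this
    have eq: "d dvd gcd (gcd (m * x) (n * x)) s \<longleftrightarrow> d dvd gcd (gcd m n) s" for d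
      unfolding gcd_greatest_iff using key[of d m] key[of d n] by blast
    show ?thesis
    proof (rule zdvd_antisym_nonneg)
      show "gcd (gcd (m * x) (n * x)) s dvd gcd (gcd m n) s" using eq[of "gcd (gcd (m * x) (n * x)) s"] by (simp only: dvd_refl)
      show "gcd (gcd m n) s dvd gcd (gcd (m * x) (n * x)) s" using eq[of "gcd (gcd m n) s"] by (simp only: dvd_refl)
    qed simp_all
  qed
  have "norm (expsum (q1 * r) m n) = norm (expsum q1 (m * x2) (n * x2)) * norm (expsum r (m * x1) (n * x1))"
    unfolding expsum_crt[OF q1 prime_power(3) cop x2 x1] by (rule norm_mult)
  also have "\<dots> \<le> (1875 * sqrt (real q1) * sqrt (real_of_int (gcd (gcd m n) (int q1)))) *
      (1875 ^ omega r * sqrt (real r) * sqrt (real_of_int (gcd (gcd m n) (int r))))"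
    using norm_expsum_prime_power[OF prime_power(1,2), of "m * x2" "n * x2"] prime_power.IH[of "m * x1" "n * x1"]
    unfolding q1_def[symmetric] g[OF x2] g[OF x1] by (intro mult_mono) auto
  also have "\<dots> = 1875 ^ Suc (omega r) * (sqrt (real q1) * sqrt (real r)) *
      (sqrt (real_of_int (gcd (gcd m n) (int q1))) * sqrt (real_of_int (gcd (gcd m n) (int r))))"
    by simp
  also have "sqrt (real q1) * sqrt (real r) = sqrt (real (q1 * r))" by (simp add: real_sqrt_mult)
  also have "sqrt (real_of_int (gcd (gcd m n) (int q1))) * sqrt (real_of_int (gcd (gcd m n) (int r))) \<le>
      sqrt (real_of_int (gcd (gcd m n) (int (q1 * r))))"
  proof -
    have "gcd (gcd m n) (int q1) * gcd (gcd m n) (int r) dvd gcd m n"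
      by (rule divides_mult[OF gcd_dvd1 gcd_dvd1 coprime_divisors[OF gcd_dvd2 gcd_dvd2 c(2)]])
    then have "gcd (gcd m n) (int q1) * gcd (gcd m n) (int r) dvd gcd (gcd m n) (int (q1 * r))"
      unfolding of_nat_mult by (rule gcd_greatest[OF _ mult_dvd_mono[OF gcd_dvd2 gcd_dvd2]])
    moreover have "gcd (gcd m n) (int (q1 * r)) > 0" using q1 prime_power(3) by simp
    ultimately have "gcd (gcd m n) (int q1) * gcd (gcd m n) (int r) \<le> gcd (gcd m n) (int (q1 * r))"
      by (rule zdvd_imp_le)
    then show ?thesis by (simp only: real_sqrt_mult[symmetric] of_int_mult[symmetric] real_sqrt_le_iff of_int_le_iff)
  qed
  finally show ?case unfolding omega_prime_power_mult[OF prime_power(1-4)] q1_def by (simp add: mult_left_mono)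
qed

section \<open>Fourier analysis of residue classes\<close>

lemma sum_inverse_le_ln:
  assumes "q > 0"
  shows "(\<Sum>k\<in>{1..q}. 1 / real k) \<le> 1 + ln (real q)"
  using euler_mascheroni_sequence_decreasing[of 1 q] assms by (simp add: harm_def inverse_eq_divide)

text \<open>Each prime contributes a geometric series with ratio p^(-1/2) <= 3/4, whose sum is at
  most 4.\<close>

lemma sum_divisors_rsqrt_le:
  assumes "q > 0"
  shows "(\<Sum>d\<in>{d. d dvd q}. 1 / sqrt (real d)) \<le> 4 ^ omega q"
  using assms
proof (induction q rule: prime_power_induct)
  case one
  then show ?case by simp
next
  case (prime_power p k r)
  have p1: "p > 1" using prime_power prime_gt_1_nat by simp
  define f where "f d = 1 / sqrt (real d)" for d :: nat
  have f0: "f d \<ge> 0" for d by (simp add: f_def)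
  have fm: "f (a * b) = f a * f b" for a b by (simp add: f_def real_sqrt_mult)
  have sub: "{d. d dvd p ^ k * r} \<subseteq> (\<lambda>(i, d). p ^ i * d) ` ({..k} \<times> {d. d dvd r})"
  proof
    fix d assume "d \<in> {d. d dvd p ^ k * r}"
    then have "d dvd p ^ k * r" by simp
    from division_decomp[OF this] obtain a b where ab: "d = a * b" "a dvd p ^ k" "b dvd r" by blast
    then obtain i where "i \<le> k" "a = p ^ i" using divides_primepow_nat[OF prime_power(1)] by auto
    then show "d \<in> (\<lambda>(i, d). p ^ i * d) ` ({..k} \<times> {d. d dvd r})"
      using ab by (intro image_eqI[of _ _ "(i, b)"]) auto
  qed
  have fin: "finite ({..k} \<times> {d. d dvd r})" using prime_power by simp
  have "(\<Sum>d\<in>{d. d dvd p ^ k * r}. f d) \<le> (\<Sum>d\<in>(\<lambda>(i, d). p ^ i * d) ` ({..k} \<times> {d. d dvd r}). f d)"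
    using fin sub f0 by (intro sum_mono2) auto
  also have "\<dots> \<le> (\<Sum>x\<in>{..k} \<times> {d. d dvd r}. f (case x of (i, d) \<Rightarrow> p ^ i * d))"
    using sum_image_le[OF fin, of f "\<lambda>(i, d). p ^ i * d"] f0 by (simp add: o_def)
  also have "\<dots> = (\<Sum>i\<le>k. f (p ^ i)) * (\<Sum>d\<in>{d. d dvd r}. f d)"
    by (simp add: sum_product sum.cartesian_product fm case_prod_unfold)
  also have "\<dots> \<le> 4 * 4 ^ omega r"
  proof (rule mult_mono)
    have "(\<Sum>i\<le>k. f (p ^ i)) = (\<Sum>i\<le>k. (f p) ^ i)" by (simp add: f_def real_sqrt_power power_divide)
    also have "\<dots> \<le> (\<Sum>i\<le>k. (3 / 4) ^ i)"
    proof (intro sum_mono power_mono f0)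
      have "(4 / 3) ^ 2 \<le> real p" using p1 by (simp add: power2_eq_square)
      then have "4 / 3 \<le> sqrt (real p)" by (rule real_le_rsqrt)
      then have "1 / sqrt (real p) \<le> 1 / (4 / 3)" using p1 by (intro divide_left_mono) auto
      then show "f p \<le> 3 / 4" unfolding f_def by simp
    qed
    also have "\<dots> \<le> 4"
    proof -
      have "(\<Sum>i\<le>n. (3 / 4 :: real) ^ i) = 4 - 3 * (3 / 4) ^ n" for n by (induction n) (auto simp: field_simps)
      then show ?thesis by simp
    qed
    finally show "(\<Sum>i\<le>k. f (p ^ i)) \<le> 4" .
    show "(\<Sum>d\<in>{d. d dvd r}. f d) \<le> 4 ^ omega r" using prime_power.IH by (simp add: f_def)
  qed (simp_all add: sum_nonneg f0)
  finally show ?case unfolding omega_prime_power_mult[OF prime_power(1-4)] by (simp add: f_def)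
qed

text \<open>The root of the gcd is bounded by the sum of sqrt d over all common divisors d of h and
  q. Writing h = d k then leaves d^(-1/2) times a harmonic sum.\<close>

lemma sum_gcd_div_le:
  assumes "q > 0"
  shows "(\<Sum>h\<in>{1..<q}. sqrt (real (gcd h q)) / real h) \<le> 4 ^ omega q * (1 + ln (real q))"
proof -
  have fd: "finite {d. d dvd q}" using assms by simp
  have "(\<Sum>h\<in>{1..<q}. sqrt (real (gcd h q)) / real h) \<le> (\<Sum>h\<in>{1..<q}. \<Sum>d\<in>{d. d dvd q}. if d dvd h then sqrt (real d) / real h else 0)"
  proof (rule sum_mono)
    fix h
    have "(if gcd h q dvd h then sqrt (real (gcd h q)) / real h else 0) \<le>
        (\<Sum>d\<in>{d. d dvd q}. if d dvd h then sqrt (real d) / real h else 0)"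
      using fd by (intro member_le_sum) auto
    then show "sqrt (real (gcd h q)) / real h \<le> (\<Sum>d\<in>{d. d dvd q}. if d dvd h then sqrt (real d) / real h else 0)" by simp
  qed
  also have "\<dots> = (\<Sum>d\<in>{d. d dvd q}. \<Sum>h\<in>{1..<q}. if d dvd h then sqrt (real d) / real h else 0)"
    by (rule sum.swap)
  also have "\<dots> \<le> (\<Sum>d\<in>{d. d dvd q}. 1 / sqrt (real d) * (1 + ln (real q)))"
  proof (rule sum_mono)
    fix d assume "d \<in> {d. d dvd q}"
    then have d: "d > 0" using assms by (auto intro: Nat.gr0I)
    have "(\<Sum>h\<in>{1..<q}. if d dvd h then sqrt (real d) / real h else 0) = (\<Sum>h\<in>{h\<in>{1..<q}. d dvd h}. sqrt (real d) / real h)"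
      by (rule sum.inter_filter[symmetric]) simp
    also have "\<dots> \<le> (\<Sum>h\<in>(\<lambda>k. d * k) ` {1..q}. sqrt (real d) / real h)"
    proof (rule sum_mono2)
      show "{h \<in> {1..<q}. d dvd h} \<subseteq> (\<lambda>k. d * k) ` {1..q}"
      proof
        fix h assume h: "h \<in> {h \<in> {1..<q}. d dvd h}"
        then obtain k where k: "h = d * k" by auto
        then have "k \<ge> 1" using h by (cases k) auto
        moreover have "k \<le> h" unfolding k using d by simp
        moreover have "h < q" using h by simp
        ultimately have "k \<in> {1..q}" unfolding atLeastAtMost_iff by linarith
        then show "h \<in> (\<lambda>k. d * k) ` {1..q}" unfolding k by (rule imageI)
      qed
    qed auto
    also have "\<dots> = (\<Sum>k\<in>{1..q}. sqrt (real d) / real (d * k))"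
      using d by (subst sum.reindex) (auto simp: inj_on_def)
    also have "\<dots> = (\<Sum>k\<in>{1..q}. 1 / sqrt (real d) * (1 / real k))"
    proof (rule sum.cong)
      fix k
      have "sqrt (real d) / real d = 1 / sqrt (real d)" using d by (simp add: real_div_sqrt field_simps)
      then show "sqrt (real d) / real (d * k) = 1 / sqrt (real d) * (1 / real k)"
        by (simp only: of_nat_mult divide_divide_eq_left[symmetric]) simp
    qed simp
    also have "\<dots> = 1 / sqrt (real d) * (\<Sum>k\<in>{1..q}. 1 / real k)" by (simp only: sum_distrib_left)
    also have "\<dots> \<le> 1 / sqrt (real d) * (1 + ln (real q))"
      by (intro mult_left_mono sum_inverse_le_ln assms) simp
    finally show "(\<Sum>h\<in>{1..<q}. if d dvd h then sqrt (real d) / real h else 0) \<le> 1 / sqrt (real d) * (1 + ln (real q))" .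
  qed
  also have "\<dots> = (\<Sum>d\<in>{d. d dvd q}. 1 / sqrt (real d)) * (1 + ln (real q))" by (simp only: sum_distrib_right)
  also have "\<dots> \<le> 4 ^ omega q * (1 + ln (real q))"
    using assms by (intro mult_right_mono sum_divisors_rsqrt_le) auto
  finally show ?thesis .
qed

section \<open>Incomplete geometric sums\<close>

lemma sin_ge_third:
  fixes x :: real
  assumes "0 \<le> x" "x \<le> 2"
  shows "sin x \<ge> x / 3"
proof -
  have "\<bar>sin x - (\<Sum>m<3. sin_coeff m * x ^ m)\<bar> \<le> inverse (fact 3) * \<bar>x\<bar> ^ 3"
    by (rule Maclaurin_sin_bound)
  then have "sin x \<ge> x - x ^ 3 / 6"
    using assms by (simp add: sin_coeff_def eval_nat_numeral abs_if split: if_splits)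
  moreover have "x ^ 3 \<le> 4 * x"
  proof -
    have "x * x \<le> 2 * 2" using assms by (intro mult_mono) auto
    then have "x * (x * x) \<le> x * 4" using assms by (intro mult_left_mono) auto
    then show ?thesis by (simp add: power3_eq_cube)
  qed
  ultimately show ?thesis by linarith
qed

text \<open>The norm is twice the sine of pi h / q, which is bounded below by the distance of h to
  the nearest multiple of q. The minimum of h and q - h is traded for a sum of two terms that are
  exchanged by h -> q - h.\<close>

lemma norm_ee_minus_1_ge:
  assumes "0 < h" "h < q"
  shows "2 / norm (1 - ee q (int h)) \<le> real q / real h + real q / real (q - h)"
proof -
  define x where "x = pi * real h / real q"
  have q: "real q > 0" using assms by simp
  have "(norm (1 - ee q (int h))) ^ 2 = (1 - cos (2 * x)) ^ 2 + (sin (2 * x)) ^ 2"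
    by (simp add: cmod_power2 ee_def x_def mult.assoc)
  also have "\<dots> = 2 - 2 * cos (2 * x)" by (simp add: sin_squared_eq power2_eq_square algebra_simps)
  also have "\<dots> = (2 * sin x) ^ 2" unfolding cos_double_sin by (simp add: power2_eq_square)
  finally have n2: "(norm (1 - ee q (int h))) ^ 2 = (2 * sin x) ^ 2" .
  have "x > 0" using assms q by (simp add: x_def)
  moreover have "x < pi" using assms q by (simp add: x_def divide_less_eq)
  note xpi = calculation this
  have "sin x > 0" using xpi by (rule sin_gt_zero)
  then have n: "norm (1 - ee q (int h)) = 2 * sin x" using n2 by (intro power2_eq_imp_eq[OF n2]) simp_all
  have "sin x \<ge> min (real h) (real (q - h)) / real q"
  proof (cases "2 * h \<le> q")
    case True
    have "2 * real h \<le> real q" using True by linarith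
    then have "pi * (2 * real h) \<le> pi * real q" by (rule mult_left_mono) simp
    then have "x \<le> pi / 2" using q by (simp add: x_def divide_le_eq)
    then have "sin x \<ge> x / 3" using xpi pi_half_less_two by (intro sin_ge_third) linarith+
    moreover have "3 * real h \<le> pi * real h" using pi_gt3 by (intro mult_right_mono) auto
    then have "3 * real h / real q \<le> pi * real h / real q" by (rule divide_right_mono) simp
    then have "x / 3 \<ge> real h / real q" by (simp add: x_def)
    moreover have "min (real h) (real (q - h)) / real q \<le> real h / real q" by (intro divide_right_mono) auto
    ultimately show ?thesis by linarith
  next
    case False
    have y: "pi - x = pi * real (q - h) / real q"
      using assms q by (simp add: x_def of_nat_diff right_diff_distrib diff_divide_distrib)
    have "2 * real (q - h) \<le> real q" using False assms by linarith
    then have "pi * (2 * real (q - h)) \<le> pi * real q" by (rule mult_left_mono) simp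
    then have "pi - x \<le> pi / 2" using q unfolding y by (simp add: divide_le_eq)
    then have "sin (pi - x) \<ge> (pi - x) / 3" using xpi pi_half_less_two by (intro sin_ge_third) linarith+
    moreover have "3 * real (q - h) \<le> pi * real (q - h)" using pi_gt3 by (intro mult_right_mono) auto
    then have "3 * real (q - h) / real q \<le> pi * real (q - h) / real q" by (rule divide_right_mono) simp
    then have "(pi - x) / 3 \<ge> real (q - h) / real q" unfolding y by simp
    moreover have "min (real h) (real (q - h)) / real q \<le> real (q - h) / real q" by (intro divide_right_mono) auto
    ultimately have "sin (pi - x) \<ge> min (real h) (real (q - h)) / real q" by linarith
    then show ?thesis by (simp only: sin_pi_minus)
  qed
  moreover have mpos: "min (real h) (real (q - h)) / real q > 0" using assms by simp
  ultimately have "2 / norm (1 - ee q (int h)) \<le> 2 / (2 * (min (real h) (real (q - h)) / real q))"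
    unfolding n using \<open>sin x > 0\<close> by (intro divide_left_mono mult_left_mono mult_pos_pos) linarith+
  also have "\<dots> = real q / min (real h) (real (q - h))" by simp
  also have "\<dots> \<le> real q / real h + real q / real (q - h)"
    by (cases "real h \<le> real (q - h)") (auto simp: min_def)
  finally show ?thesis .
qed

lemma norm_sum_ee_interval:
  assumes "0 < h" "h < q"
  shows "norm (\<Sum>a\<in>{i<..j::nat}. ee q (int h * int a)) \<le> real q / real h + real q / real (q - h)"
proof -
  define z where "z = ee q (int h)"
  have "\<not> int q dvd int h" using assms by (simp add: nat_dvd_not_less)
  then have z1: "z \<noteq> 1" using ee_eq_1_imp_dvd[of q "int h"] assms by (auto simp: z_def)
  have zn: "ee q (int h * int a) = z ^ a" for a
    by (induction a) (simp_all add: z_def ee_add distrib_left)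
  have nz: "norm z = 1" by (simp add: z_def)
  define R where "R j = (if i < j then z ^ Suc i - z ^ Suc j else 0)" for j
  have e: "(1 - z) * (\<Sum>a\<in>{i<..j}. z ^ a) = R j"
  proof (induction j)
    case (Suc j)
    show ?case
    proof (cases "i < Suc j")
      case True
      then have "{i<..Suc j} = insert (Suc j) {i<..j}" by auto
      then have "(1 - z) * (\<Sum>a\<in>{i<..Suc j}. z ^ a) = (1 - z) * z ^ Suc j + (1 - z) * (\<Sum>a\<in>{i<..j}. z ^ a)"
        by (simp only:) (simp add: distrib_left)
      also have "\<dots> = (z ^ Suc j - z ^ Suc (Suc j)) + R j"
        unfolding Suc by (simp add: left_diff_distrib)
      also have "\<dots> = R (Suc j)"
        using True by (cases "i = j") (simp_all add: R_def)
      finally show ?thesis .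
    qed (simp add: R_def)
  qed (simp add: R_def)
  have "norm (1 - z) * norm (\<Sum>a\<in>{i<..j}. z ^ a) = norm ((1 - z) * (\<Sum>a\<in>{i<..j}. z ^ a))"
    by (rule norm_mult[symmetric])
  also have "\<dots> = norm (R j)" unfolding e ..
  also have "\<dots> \<le> 2"
  proof (cases "i < j")
    case True
    have "norm (z ^ Suc i - z ^ Suc j) \<le> norm (z ^ Suc i) + norm (z ^ Suc j)" by (rule norm_triangle_ineq4)
    also have "\<dots> = 2" unfolding norm_power nz by simp
    finally show ?thesis using True by (simp only: R_def if_True)
  qed (simp add: R_def)
  finally have "norm (\<Sum>a\<in>{i<..j}. z ^ a) \<le> 2 / norm (1 - z)"
    using z1 by (simp add: le_divide_eq mult.commute)
  also have "\<dots> \<le> real q / real h + real q / real (q - h)"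
    unfolding z_def by (rule norm_ee_minus_1_ge[OF assms])
  finally show ?thesis by (simp add: zn)
qed

section \<open>Intervals and residue classes\<close>

definition cnt :: "nat \<Rightarrow> nat \<Rightarrow> nat \<Rightarrow> int \<Rightarrow> nat" where
  "cnt q i j x = card {a \<in> {i<..j}. [int a = x] (mod int q)}"

definition dev :: "nat \<Rightarrow> nat \<Rightarrow> nat \<Rightarrow> int \<Rightarrow> real" where
  "dev q i j x = real (cnt q i j x) - real (j - i) / real q"

text \<open>Orthogonality of the additive characters; the frequency h = 0 is the expected value and
  has been subtracted.\<close>

lemma dev_fourier:
  assumes "q > 0"
  shows "complex_of_real (dev q i j x) =
    (\<Sum>h\<in>{1..<q}. (\<Sum>a\<in>{i<..j}. ee q (int h * int a)) * ee q (- (int h * x))) / of_nat q"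
proof -
  define T where "T h = (\<Sum>a\<in>{i<..j}. ee q (int h * int a)) * ee q (- (int h * x))" for h :: nat
  have "of_nat q * complex_of_real (real (cnt q i j x)) = (\<Sum>a\<in>{i<..j}. if [int a = x] (mod int q) then of_nat q else 0)"
    unfolding cnt_def by (simp add: sum.inter_filter[symmetric])
  also have "\<dots> = (\<Sum>a\<in>{i<..j}. \<Sum>h\<in>{0..<int q}. ee q ((int a - x) * h))"
    by (simp add: sum_ee[OF assms] cong_iff_dvd_diff)
  also have "\<dots> = (\<Sum>a\<in>{i<..j}. \<Sum>h<q. ee q ((int a - x) * int h))"
    by (intro sum.cong refl, rule sum.reindex_bij_witness[of _ int nat]) auto
  also have "\<dots> = (\<Sum>h<q. T h)"
  proof (subst sum.swap, rule sum.cong)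
    fix h
    have "ee q ((int a - x) * int h) = ee q (int h * int a) * ee q (- (int h * x))" for a
      unfolding ee_add[symmetric] by (simp add: algebra_simps)
    then show "(\<Sum>a\<in>{i<..j}. ee q ((int a - x) * int h)) = T h" by (simp add: T_def sum_distrib_right)
  qed simp
  also have "{..<q} = insert 0 {1..<q}" using assms by auto
  also have "sum T (insert 0 {1..<q}) = of_nat (j - i) + (\<Sum>h\<in>{1..<q}. T h)" by (simp add: T_def)
  finally have *: "of_nat q * complex_of_real (real (cnt q i j x)) = of_nat (j - i) + (\<Sum>h\<in>{1..<q}. T h)" .
  have "complex_of_real (dev q i j x) = (of_nat q * complex_of_real (real (cnt q i j x)) - of_nat (j - i)) / of_nat q"
    unfolding dev_def using assms by (simp add: field_simps)
  also have "\<dots> = (\<Sum>h\<in>{1..<q}. T h) / of_nat q" unfolding * by simp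
  finally show ?thesis by (simp add: T_def)
qed

text \<open>With k the integer part of j / q, every residue class is met k or k + 1 times, and j / q
  lies between the same two integers.\<close>

lemma abs_dev_le_1:
  assumes "q > 0"
  shows "\<bar>dev q 0 j x\<bar> \<le> 1"
proof -
  define r where "r = nat (x mod int q)"
  have r: "r < q" "[int r = x] (mod int q)" using assms by (auto simp: r_def cong_def nat_less_iff)
  have iff: "[int a = x] (mod int q) \<longleftrightarrow> a mod q = r" for a
  proof -
    have "[int a = x] (mod int q) \<longleftrightarrow> [int a = int r] (mod int q)" using r(2) cong_sym cong_trans by blast
    also have "\<dots> \<longleftrightarrow> a mod q = r" using r(1) unfolding cong_int_iff by (simp add: cong_def)
    finally show ?thesis .
  qed
  have bd: "real (card {a \<in> {0<..j}. a mod q = r}) \<le> real j / real q + 1 \<and> real (card {a \<in> {0<..j}. a mod q = r}) \<ge> real j / real q - 1"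
  proof -
    define k where "k = j div q"
    have j: "k * q \<le> j" "j < (k + 1) * q" using assms by (auto simp: k_def dividend_less_div_times)
    \<comment> \<open>The interval omits 0, so the residue 0 is first attained at a = q, that is,
      for i = 1.\<close>
    have up: "{a \<in> {0<..j}. a mod q = r} \<subseteq> (\<lambda>i. i * q + r) ` {(if r = 0 then 1 else 0)..<(if r = 0 then k + 1 else k + 1)}"
    proof
      fix a assume a: "a \<in> {a \<in> {0<..j}. a mod q = r}"
      define i where "i = a div q"
      have ai: "a = i * q + r" using a by (simp add: i_def) (metis div_mult_mod_eq)
      have "i < k + 1" using a unfolding i_def k_def by (simp add: div_le_mono less_Suc_eq_le)
      moreover have "r = 0 \<longrightarrow> i \<ge> 1" using a ai by (cases i) auto
      ultimately show "a \<in> (\<lambda>i. i * q + r) ` {(if r = 0 then 1 else 0)..<(if r = 0 then k + 1 else k + 1)}" using ai by auto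
    qed
    have lo: "(\<lambda>i. i * q + r) ` {(if r = 0 then 1 else 0)..<(if r = 0 then k + 1 else k)} \<subseteq> {a \<in> {0<..j}. a mod q = r}"
    proof (rule image_subsetI)
      fix i assume i: "i \<in> {(if r = 0 then 1 else 0)..<(if r = 0 then k + 1 else k)}"
      have "i * q + r \<le> k * q"
      proof (cases "r = 0")
        case True then show ?thesis using i by simp
      next
        case False
        then have "(i + 1) * q \<le> k * q" using i by (intro mult_right_mono) auto
        then show ?thesis using r(1) by simp
      qed
      then show "i * q + r \<in> {a \<in> {0<..j}. a mod q = r}" using i j r(1) assms by (auto split: if_splits)
    qed
    have inj: "inj_on (\<lambda>i. i * q + r) A" for A using assms by (auto simp: inj_on_def)
    have "card {a \<in> {0<..j}. a mod q = r} \<le> k + 1"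
      using card_mono[OF _ up] card_image[OF inj, of "{(if r = 0 then 1 else 0)..<(if r = 0 then k + 1 else k + 1)}"]
      by (auto split: if_splits)
    moreover have "k \<le> card {a \<in> {0<..j}. a mod q = r}"
      using card_mono[OF _ lo] card_image[OF inj, of "{(if r = 0 then 1 else 0)..<(if r = 0 then k + 1 else k)}"]
      by (auto split: if_splits)
    moreover have "real k \<le> real j / real q" using j(1) assms by (simp add: le_divide_eq flip: of_nat_mult)
    moreover have "real j / real q \<le> real k + 1"
    proof -
      have "real j \<le> real ((k + 1) * q)" using j(2) by (simp only: of_nat_le_iff)
      then show ?thesis using assms by (simp add: divide_le_eq algebra_simps)
    qed
    ultimately show ?thesis by linarith
  qed
  then show ?thesis unfolding dev_def cnt_def iff by (auto simp: abs_le_iff)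
qed

section \<open>Solutions in boxes\<close>

lemma inv_mod_bij:
  assumes "q > 0"
  shows "bij_betw (inv_mod q) (units_mod q) (units_mod q)"
proof -
  have inv_u: "inv_mod q t \<in> units_mod q" if "t \<in> units_mod q" for t
    using that assms modular_inverse_int_nonneg[of "int q" t] modular_inverse_int_less[of "int q" t]
    by (auto simp: units_mod_def inv_mod_def)
  have inj: "inj_on (inv_mod q) (units_mod q)"
  proof (rule inj_onI)
    fix x y assume xy: "x \<in> units_mod q" "y \<in> units_mod q" "inv_mod q x = inv_mod q y"
    have "[x * inv_mod q x = y * inv_mod q x] (mod int q)"
      using cong_trans[OF inv_mod[OF xy(1)] cong_sym[OF inv_mod[OF xy(2)]]] xy(3) by simp
    moreover have "coprime (inv_mod q x) (int q)" using inv_u[OF xy(1)] by (simp add: units_mod_def)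
    ultimately have "[x = y] (mod int q)" by (simp add: cong_mult_rcancel)
    then show "x = y" using xy by (simp add: units_mod_def cong_def)
  qed
  have "inv_mod q ` units_mod q = units_mod q"
    using endo_inj_surj[OF finite_units_mod _ inj] inv_u by blast
  then show ?thesis using inj by (simp add: bij_betw_def)
qed

lemma card_units_mod:
  assumes "q > 0"
  shows "card (units_mod q) = totient q"
proof (cases "q = 1")
  case True
  have "units_mod 1 = {0}" by (auto simp: units_mod_def)
  then show ?thesis by (simp add: True)
next
  case False
  have "bij_betw nat (units_mod q) (totatives q)"
  proof (rule bij_betwI[of _ _ _ int])
    show "nat \<in> units_mod q \<rightarrow> totatives q"
    proof
      fix t assume t: "t \<in> units_mod q"
      then have "t \<noteq> 0" using False by (auto simp: units_mod_def)
      moreover obtain n where n: "t = int n" using t by (auto simp: units_mod_def elim: nonneg_int_cases)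
      ultimately have "n > 0" "n \<le> q" "coprime n q" using t by (simp_all add: units_mod_def)
      then show "nat t \<in> totatives q" using n by (simp add: totatives_def)
    qed
    show "int \<in> totatives q \<rightarrow> units_mod q"
      using False totatives_less[of _ q] assms by (auto simp: units_mod_def totatives_def)
  qed (auto simp: units_mod_def)
  then show ?thesis by (simp add: bij_betw_same_card totient_def)
qed

lemma N2_eq_Nr: "N2 n q = Nr 2 n q" and N3_eq_Nr: "N3 n q = Nr 3 n q"
  unfolding N2_def N3_def Nr_def units_mod_def by (rule arg_cong[of _ _ card], auto)+

section \<open>Parametrization of the solutions\<close>

locale residue_class =
  fixes q :: nat and l l' :: int
  assumes q_pos: "q > 0" and l_inv: "[l * l' = 1] (mod int q)"
begin

text \<open>The constants are such that, modulo q, the product of \<open>ca t\<close> and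
  \<open>cb t\<close> is t, and the square of the first times the cube of the second is l.\<close>

definition ca :: "int \<Rightarrow> int" where "ca t = l' * t ^ 3"
definition cb :: "int \<Rightarrow> int" where "cb t = l * inv_mod q t ^ 2"

lemma coprime_l: "coprime l (int q)" "coprime l' (int q)"
proof -
  have "coprime (l * l') (int q)" using l_inv by (metis cong_imp_coprime cong_sym coprime_1_left)
  then show "coprime l (int q)" "coprime l' (int q)" by simp_all
qed

lemma N3_eq: "N3 (l * a) q = card {t \<in> units_mod q. [a = ca t] (mod int q)}"
proof -
  have "[a = l' * t ^ 3] (mod int q) \<longleftrightarrow> [t ^ 3 = l * a] (mod int q)" for t
  proof -
    have "[a = l' * t ^ 3] (mod int q) \<longleftrightarrow> [l * a = l * (l' * t ^ 3)] (mod int q)"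
      using coprime_l(1) by (simp add: cong_mult_lcancel)
    also have "\<dots> \<longleftrightarrow> [l * a = t ^ 3] (mod int q)"
    proof -
      have c: "[l * (l' * t ^ 3) = t ^ 3] (mod int q)"
        using cong_scalar_right[OF l_inv, of "t ^ 3"] by (simp add: mult.assoc)
      show ?thesis using cong_trans[OF _ c] cong_trans[OF _ cong_sym[OF c]] by blast
    qed
    finally show ?thesis by (simp add: cong_sym_eq)
  qed
  then show ?thesis by (simp add: N3_eq_Nr Nr_def ca_def)
qed

text \<open>As t runs over the units, so does x = l / t, and x^2 = l b holds exactly when b = l
  t^-2.\<close>

lemma N2_eq: "N2 (l * b) q = card {t \<in> units_mod q. [b = cb t] (mod int q)}"
proof -
  define g where "g t = (l * inv_mod q t) mod int q" for t
  have "bij_betw ((\<lambda>t. (l * t) mod int q) \<circ> inv_mod q) (units_mod q) (units_mod q)"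
    by (rule bij_betw_trans[OF inv_mod_bij[OF q_pos] mult_mod_units_bij[OF q_pos coprime_l(1)]])
  then have bij: "bij_betw g (units_mod q) (units_mod q)" by (simp add: g_def[abs_def] o_def)
  have iff: "[g t ^ 2 = l * b] (mod int q) \<longleftrightarrow> [b = cb t] (mod int q)" for t
  proof -
    have c: "[g t ^ 2 = (l * inv_mod q t) ^ 2] (mod int q)" unfolding g_def by (intro cong_pow) simp
    then have "[g t ^ 2 = l * b] (mod int q) \<longleftrightarrow> [(l * inv_mod q t) ^ 2 = l * b] (mod int q)"
      using cong_trans[OF c] cong_trans[OF cong_sym[OF c]] by blast
    also have "\<dots> \<longleftrightarrow> [l * cb t = l * b] (mod int q)"
      by (simp add: cb_def power_mult_distrib power2_eq_square mult_ac)
    also have "\<dots> \<longleftrightarrow> [cb t = b] (mod int q)" using coprime_l(1) by (simp add: cong_mult_lcancel)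
    finally show ?thesis by (simp add: cong_sym_eq)
  qed
  have "bij_betw g {t \<in> units_mod q. [b = cb t] (mod int q)} {x \<in> units_mod q. [x ^ 2 = l * b] (mod int q)}"
    unfolding bij_betw_def
  proof
    show "inj_on g {t \<in> units_mod q. [b = cb t] (mod int q)}"
      using bij by (auto simp: bij_betw_def inj_on_def)
    show "g ` {t \<in> units_mod q. [b = cb t] (mod int q)} = {x \<in> units_mod q. [x ^ 2 = l * b] (mod int q)}"
    proof (intro equalityI subsetI)
      fix x assume x: "x \<in> {x \<in> units_mod q. [x ^ 2 = l * b] (mod int q)}"
      then have "x \<in> g ` units_mod q" using bij by (simp add: bij_betw_def)
      then obtain t where t: "t \<in> units_mod q" "x = g t" by blast
      then have "t \<in> {t \<in> units_mod q. [b = cb t] (mod int q)}" using x iff by simp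
      then show "x \<in> g ` {t \<in> units_mod q. [b = cb t] (mod int q)}" using t(2) by blast
    next
      fix x assume "x \<in> g ` {t \<in> units_mod q. [b = cb t] (mod int q)}"
      then obtain t where t: "t \<in> units_mod q" "[b = cb t] (mod int q)" "x = g t" by blast
      have "g t \<in> units_mod q" using bij t(1) unfolding bij_betw_def by blast
      then show "x \<in> {x \<in> units_mod q. [x ^ 2 = l * b] (mod int q)}" using t iff by simp
    qed
  qed
  then show ?thesis by (simp add: N2_eq_Nr Nr_def bij_betw_same_card)
qed

text \<open>The solutions of \<open>a\<^sup>2 b\<^sup>3 \<equiv> l\<close> are parametrized by the unit \<open>t = ab\<close>.\<close>

lemma solution_iff:
  "of_bool [a ^ 2 * b ^ 3 = l] (mod int q) =
    (\<Sum>t\<in>units_mod q. of_bool [a = ca t] (mod int q) * of_bool [b = cb t] (mod int q) :: nat)"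
proof (cases "[a ^ 2 * b ^ 3 = l] (mod int q)")
  case True
  have "coprime (a ^ 2 * b ^ 3) (int q)" using True coprime_l(1) cong_imp_coprime cong_sym by blast
  then have cab: "coprime a (int q)" "coprime b (int q)" by simp_all
  define t0 where "t0 = (a * b) mod int q"
  have t0: "t0 \<in> units_mod q" "[t0 = a * b] (mod int q)" using cab q_pos by (auto simp: t0_def units_mod_def)
  have uniq: "t = t0" if t: "t \<in> units_mod q" "[a = ca t] (mod int q)" "[b = cb t] (mod int q)" for t
  proof -
    define u where "u = inv_mod q t"
    have tu: "[t * u = 1] (mod int q)" unfolding u_def by (rule inv_mod[OF t(1)])
    have "[a * b = ca t * cb t] (mod int q)" by (rule cong_mult[OF t(2,3)])
    also have "ca t * cb t = (l * l') * (t * (t * u) ^ 2)"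
      by (simp add: ca_def cb_def u_def power2_eq_square power3_eq_cube algebra_simps)
    also have "[\<dots> = 1 * (t * 1 ^ 2)] (mod int q)"
      by (intro cong_mult l_inv cong_refl cong_pow tu)
    finally have "[a * b = t] (mod int q)" by simp
    then have "[t = t0] (mod int q)" using t0(2) cong_sym cong_trans by blast
    then show ?thesis using t t0 by (simp add: units_mod_def cong_def)
  qed
  have a0: "[a = ca t0] (mod int q)"
  proof -
    have "[l' * t0 ^ 3 = l' * (a * b) ^ 3] (mod int q)" by (intro cong_scalar_left cong_pow t0)
    also have "l' * (a * b) ^ 3 = a * (l' * (a ^ 2 * b ^ 3))" by (simp add: power_mult_distrib power2_eq_square power3_eq_cube)
    also have "[\<dots> = a * (l' * l)] (mod int q)" by (intro cong_scalar_left True)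
    also have "[a * (l' * l) = a * 1] (mod int q)" using l_inv by (intro cong_scalar_left) (simp add: mult.commute)
    finally show ?thesis by (simp add: ca_def cong_sym_eq)
  qed
  have b0: "[b = cb t0] (mod int q)"
  proof -
    define u where "u = inv_mod q t0"
    have tu: "[t0 * u = 1] (mod int q)" unfolding u_def by (rule inv_mod[OF t0(1)])
    have "[t0 ^ 2 * b = (a * b) ^ 2 * b] (mod int q)" by (intro cong_scalar_right cong_pow t0)
    also have "(a * b) ^ 2 * b = a ^ 2 * b ^ 3" by (simp add: power_mult_distrib power2_eq_square power3_eq_cube)
    also have "[\<dots> = l * 1 ^ 2] (mod int q)" using True by simp
    also have "[l * 1 ^ 2 = l * (t0 * u) ^ 2] (mod int q)" by (intro cong_scalar_left cong_pow cong_sym[OF tu])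
    also have "l * (t0 * u) ^ 2 = t0 ^ 2 * cb t0" by (simp add: cb_def u_def power_mult_distrib)
    finally have "[t0 ^ 2 * b = t0 ^ 2 * cb t0] (mod int q)" .
    moreover have "coprime (t0 ^ 2) (int q)" using t0(1) by (simp add: units_mod_def)
    ultimately show ?thesis by (simp add: cong_mult_lcancel)
  qed
  have "(\<Sum>t\<in>units_mod q. of_bool [a = ca t] (mod int q) * of_bool [b = cb t] (mod int q) :: nat) =
      (\<Sum>t\<in>units_mod q. if t = t0 then 1 else 0)"
  proof (rule sum.cong)
    fix t assume t: "t \<in> units_mod q"
    show "of_bool [a = ca t] (mod int q) * of_bool [b = cb t] (mod int q) = (if t = t0 then 1 else (0::nat))"
    proof (cases "t = t0")
      case True
      then show ?thesis using a0 b0 by simp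
    next
      case False
      then have "\<not> [a = ca t] (mod int q) \<or> \<not> [b = cb t] (mod int q)" using uniq[OF t] by blast
      then show ?thesis using False by (elim disjE) simp_all
    qed
  qed simp
  also have "\<dots> = 1" using t0(1) by simp
  finally show ?thesis using True by simp
next
  case False
  have "\<not> ([a = ca t] (mod int q) \<and> [b = cb t] (mod int q))" if t: "t \<in> units_mod q" for t
  proof
    assume ab: "[a = ca t] (mod int q) \<and> [b = cb t] (mod int q)"
    define u where "u = inv_mod q t"
    have tu: "[t * u = 1] (mod int q)" unfolding u_def by (rule inv_mod[OF t])
    have "[a ^ 2 * b ^ 3 = ca t ^ 2 * cb t ^ 3] (mod int q)" using ab by (intro cong_mult cong_pow) auto
    also have "ca t ^ 2 * cb t ^ 3 = l * ((l * l') ^ 2 * (t * u) ^ 6)"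
      by (simp add: ca_def cb_def u_def eval_nat_numeral algebra_simps)
    also have "[\<dots> = l * (1 ^ 2 * 1 ^ 6)] (mod int q)" by (intro cong_mult cong_refl cong_pow l_inv tu)
    finally show False using False by simp
  qed
  then have "(\<Sum>t\<in>units_mod q. of_bool [a = ca t] (mod int q) * of_bool [b = cb t] (mod int q) :: nat) = (\<Sum>t\<in>units_mod q. 0)"
    by (intro sum.cong refl) auto
  then show ?thesis using False by simp
qed

section \<open>Counting in boxes, columns and rows\<close>

definition box :: "nat \<Rightarrow> nat \<Rightarrow> nat \<Rightarrow> nat \<Rightarrow> nat" where
  "box i j i' j' = card {(a, b). a \<in> {i<..j} \<and> b \<in> {i'<..j'} \<and> [int (a ^ 2 * b ^ 3) = l] (mod int q)}"

lemma cnt_sum: "real (cnt q i j x) = (\<Sum>a\<in>{i<..j}. of_bool [int a = x] (mod int q))"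
  by (simp add: cnt_def Int_def)

lemma box_eq_sum: "real (box i j i' j') = (\<Sum>a\<in>{i<..j}. \<Sum>b\<in>{i'<..j'}. of_bool [int (a ^ 2 * b ^ 3) = l] (mod int q))"
proof -
  have "{(a, b). a \<in> {i<..j} \<and> b \<in> {i'<..j'} \<and> [int (a ^ 2 * b ^ 3) = l] (mod int q)} =
      {x \<in> {i<..j} \<times> {i'<..j'}. [int (fst x ^ 2 * snd x ^ 3) = l] (mod int q)}" by auto
  then have "real (box i j i' j') = (\<Sum>x\<in>{i<..j} \<times> {i'<..j'}. of_bool [int (fst x ^ 2 * snd x ^ 3) = l] (mod int q))"
    by (simp add: box_def Int_def)
  then show ?thesis unfolding sum.cartesian_product by (simp only: case_prod_unfold)
qed

text \<open>Once t is fixed, the conditions on a and b are independent, so the count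
  factors.\<close>

lemma box_eq: "real (box i j i' j') = (\<Sum>t\<in>units_mod q. real (cnt q i j (ca t)) * real (cnt q i' j' (cb t)))"
proof -
  have ob: "of_bool [int (a ^ 2 * b ^ 3) = l] (mod int q) =
      (\<Sum>t\<in>units_mod q. of_bool [int a = ca t] (mod int q) * of_bool [int b = cb t] (mod int q) :: real)" for a b
    using arg_cong[OF solution_iff[of "int a" "int b"], of real] by simp
  have "real (box i j i' j') = (\<Sum>a\<in>{i<..j}. \<Sum>b\<in>{i'<..j'}. \<Sum>t\<in>units_mod q. of_bool [int a = ca t] (mod int q) * of_bool [int b = cb t] (mod int q))"
    unfolding box_eq_sum ob ..
  also have "\<dots> = (\<Sum>a\<in>{i<..j}. \<Sum>t\<in>units_mod q. \<Sum>b\<in>{i'<..j'}. of_bool [int a = ca t] (mod int q) * of_bool [int b = cb t] (mod int q))"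
    by (intro sum.cong refl sum.swap)
  also have "\<dots> = (\<Sum>t\<in>units_mod q. \<Sum>a\<in>{i<..j}. \<Sum>b\<in>{i'<..j'}. of_bool [int a = ca t] (mod int q) * of_bool [int b = cb t] (mod int q))"
    by (rule sum.swap)
  finally show ?thesis by (simp only: cnt_sum sum_product)
qed

lemma sum_N2: "(\<Sum>b\<in>{i<..j}. real (N2 (l * int b) q)) = (\<Sum>t\<in>units_mod q. real (cnt q i j (cb t)))"
  unfolding cnt_sum by (subst sum.swap) (simp add: N2_eq Int_def)

lemma sum_N3: "(\<Sum>a\<in>{i<..j}. real (N3 (l * int a) q)) = (\<Sum>t\<in>units_mod q. real (cnt q i j (ca t)))"
  unfolding cnt_sum by (subst sum.swap) (simp add: N3_eq Int_def)

lemma sum_ee_classes: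
  "(\<Sum>t\<in>units_mod q. ee q (- (h * ca t) - k * cb t)) = expsum q (- (h * l')) (- (k * l))"
  unfolding expsum_eq by (rule sum.cong) (simp_all add: ff_mod_def ca_def cb_def algebra_simps)

lemma gcd_l: "gcd (gcd (- (int h * l')) (- (int k * l))) (int q) = int (gcd (gcd h k) q)"
proof -
  have cx: "d dvd z * x \<longleftrightarrow> d dvd z" if "d dvd int q" "coprime x (int q)" for d z x
    using coprime_divisors[OF dvd_refl that] by (simp add: coprime_dvd_mult_left_iff coprime_commute)
  have eq: "d dvd gcd (gcd (- (int h * l')) (- (int k * l))) (int q) \<longleftrightarrow> d dvd gcd (gcd (int h) (int k)) (int q)" for d
    unfolding gcd_greatest_iff dvd_minus_iff using cx[of d l' "int h"] cx[of d l "int k"] coprime_l by blast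
  have "gcd (gcd (- (int h * l')) (- (int k * l))) (int q) = gcd (gcd (int h) (int k)) (int q)"
  proof (rule zdvd_antisym_nonneg)
    show "gcd (gcd (- (int h * l')) (- (int k * l))) (int q) dvd gcd (gcd (int h) (int k)) (int q)"
      using eq[of "gcd (gcd (- (int h * l')) (- (int k * l))) (int q)"] by (simp only: dvd_refl)
    show "gcd (gcd (int h) (int k)) (int q) dvd gcd (gcd (- (int h * l')) (- (int k * l))) (int q)"
      using eq[of "gcd (gcd (int h) (int k)) (int q)"] by (simp only: dvd_refl)
  qed simp_all
  then show ?thesis by simp
qed

text \<open>The error of a count in a box, up to a factor depending on its width. The base 7500 is
  1875 from the exponential sums times 4 from the sum over gcds; each coordinate contributes a
  factor 2 and one logarithm from the weights \<open>wt\<close>.\<close>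

definition Delta :: real where
  "Delta = 4 * 7500 ^ omega q * sqrt (real q) * (1 + ln (real q)) ^ 2"

text \<open>The bound of \<open>norm_sum_ee_interval\<close> for an incomplete geometric sum of
  frequency h.\<close>

definition wt :: "nat \<Rightarrow> real" where "wt h = real q / real h + real q / real (q - h)"

lemma wt_nonneg: "wt h \<ge> 0"
  by (simp add: wt_def)

lemma ln_q: "1 + ln (real q) \<ge> 1"
  using q_pos by simp

lemma sum_wt_gcd: "(\<Sum>h\<in>{1..<q}. wt h * sqrt (real (gcd h q))) \<le> real q * (2 * (4 ^ omega q * (1 + ln (real q))))"
proof -
  have gs: "gcd (q - h) q = gcd h q" if "h < q" for h
  proof -
    have "gcd (q - h) ((q - h) + h) = gcd (q - h) h" "gcd h (h + (q - h)) = gcd h (q - h)" by (rule gcd_add2)+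
    then show ?thesis using that by (simp add: gcd.commute)
  qed
  have "(\<Sum>h\<in>{1..<q}. real q / real (q - h) * sqrt (real (gcd h q))) = (\<Sum>h\<in>{1..<q}. real q / real h * sqrt (real (gcd h q)))"
    by (rule sum.reindex_bij_witness[of _ "\<lambda>h. q - h" "\<lambda>h. q - h"]) (auto simp: gs)
  then have "(\<Sum>h\<in>{1..<q}. wt h * sqrt (real (gcd h q))) = 2 * (\<Sum>h\<in>{1..<q}. real q / real h * sqrt (real (gcd h q)))"
    by (simp add: wt_def distrib_right sum.distrib)
  also have "\<dots> = 2 * (real q * (\<Sum>h\<in>{1..<q}. sqrt (real (gcd h q)) / real h))"
    by (simp add: sum_distrib_left mult_ac)
  also have "\<dots> \<le> 2 * (real q * (4 ^ omega q * (1 + ln (real q))))"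
    by (intro mult_left_mono sum_gcd_div_le q_pos) auto
  finally show ?thesis by (simp add: mult_ac)
qed

lemma sum_wt: "(\<Sum>h\<in>{1..<q}. wt h) \<le> real q * (2 * (1 + ln (real q)))"
proof -
  have "(\<Sum>h\<in>{1..<q}. real q / real (q - h)) = (\<Sum>h\<in>{1..<q}. real q / real h)"
    by (rule sum.reindex_bij_witness[of _ "\<lambda>h. q - h" "\<lambda>h. q - h"]) auto
  then have "(\<Sum>h\<in>{1..<q}. wt h) = 2 * (real q * (\<Sum>h\<in>{1..<q}. 1 / real h))"
    by (simp add: wt_def sum.distrib sum_distrib_left)
  also have "\<dots> \<le> 2 * (real q * (\<Sum>h\<in>{1..q}. 1 / real h))"
    by (intro mult_left_mono sum_mono2) auto
  also have "\<dots> \<le> 2 * (real q * (1 + ln (real q)))"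
    by (intro mult_left_mono sum_inverse_le_ln q_pos) auto
  finally show ?thesis by (simp add: mult_ac)
qed

lemma Delta_ge: "1875 ^ omega q * sqrt (real q) * (2 * (4 ^ omega q * (1 + ln (real q)))) \<le> Delta"
proof -
  have "1875 ^ omega q * sqrt (real q) * (2 * (4 ^ omega q * (1 + ln (real q)))) = 2 * (1875 * 4) ^ omega q * sqrt (real q) * (1 + ln (real q))"
    unfolding power_mult_distrib by (simp add: mult_ac)
  also have "\<dots> \<le> 4 * 7500 ^ omega q * sqrt (real q) * (1 + ln (real q)) ^ 2"
    using ln_q by (intro mult_mono) (auto simp: power2_eq_square intro: mult_right_mono)
  finally show ?thesis by (simp add: Delta_def)
qed

lemma Delta_pos: "Delta > 0"
proof -
  have "1 + ln (real q) > 0" using ln_q by linarith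
  then show ?thesis unfolding Delta_def using q_pos by (intro mult_pos_pos zero_less_power) auto
qed

text \<open>\<open>A\<close> and \<open>B\<close> are the two coordinate deviations; expanding both in Fourier series leads to the
  exponential sums \<open>expsum\<close>.\<close>

lemma sum_dev_ca: "\<bar>\<Sum>t\<in>units_mod q. dev q i j (ca t)\<bar> \<le> Delta"
  and sum_dev_cb: "\<bar>\<Sum>t\<in>units_mod q. dev q i j (cb t)\<bar> \<le> Delta"
proof -
  have gen: "\<bar>\<Sum>t\<in>units_mod q. dev q i j (c t)\<bar> \<le> Delta"
    if E: "\<And>h. norm (\<Sum>t\<in>units_mod q. ee q (- (int h * c t))) \<le> 1875 ^ omega q * sqrt (real q) * sqrt (real (gcd h q))" for c
  proof -
    have "complex_of_real (\<Sum>t\<in>units_mod q. dev q i j (c t)) =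
        (\<Sum>t\<in>units_mod q. \<Sum>h\<in>{1..<q}. (\<Sum>a\<in>{i<..j}. ee q (int h * int a)) * ee q (- (int h * c t)) / of_nat q)"
      unfolding of_real_sum dev_fourier[OF q_pos] by (simp add: sum_divide_distrib)
    also have "\<dots> = (\<Sum>h\<in>{1..<q}. (\<Sum>a\<in>{i<..j}. ee q (int h * int a)) * (\<Sum>t\<in>units_mod q. ee q (- (int h * c t)))) / of_nat q"
      by (subst sum.swap) (simp add: sum_distrib_left sum_divide_distrib)
    finally have eq: "complex_of_real (\<Sum>t\<in>units_mod q. dev q i j (c t)) = \<dots>" .
    have "\<bar>\<Sum>t\<in>units_mod q. dev q i j (c t)\<bar> = norm (complex_of_real (\<Sum>t\<in>units_mod q. dev q i j (c t)))"
      by (simp only: norm_of_real)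
    also have "\<dots> =
        norm (\<Sum>h\<in>{1..<q}. (\<Sum>a\<in>{i<..j}. ee q (int h * int a)) * (\<Sum>t\<in>units_mod q. ee q (- (int h * c t)))) / real q"
      unfolding eq by (simp only: norm_divide norm_of_nat)
    also have "\<dots> \<le> (\<Sum>h\<in>{1..<q}. wt h * (1875 ^ omega q * sqrt (real q) * sqrt (real (gcd h q)))) / real q"
    proof (intro divide_right_mono sum_norm_le)
      fix h assume h: "h \<in> {1..<q}"
      show "norm ((\<Sum>a\<in>{i<..j}. ee q (int h * int a)) * (\<Sum>t\<in>units_mod q. ee q (- (int h * c t)))) \<le>
          wt h * (1875 ^ omega q * sqrt (real q) * sqrt (real (gcd h q)))"
        unfolding norm_mult wt_def using h by (intro mult_mono E norm_sum_ee_interval) auto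
    qed simp
    also have "\<dots> = 1875 ^ omega q * sqrt (real q) * ((\<Sum>h\<in>{1..<q}. wt h * sqrt (real (gcd h q))) / real q)"
      by (simp add: sum_distrib_left sum_divide_distrib mult_ac)
    also have "\<dots> \<le> 1875 ^ omega q * sqrt (real q) * (2 * (4 ^ omega q * (1 + ln (real q))))"
    proof (rule mult_left_mono)
      show "(\<Sum>h\<in>{1..<q}. wt h * sqrt (real (gcd h q))) / real q \<le> 2 * (4 ^ omega q * (1 + ln (real q)))"
        using sum_wt_gcd q_pos by (simp add: divide_le_eq mult.commute)
    qed simp
    also have "\<dots> \<le> Delta" by (rule Delta_ge)
    finally show ?thesis .
  qed
  show "\<bar>\<Sum>t\<in>units_mod q. dev q i j (ca t)\<bar> \<le> Delta"
  proof (rule gen)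
    fix h show "norm (\<Sum>t\<in>units_mod q. ee q (- (int h * ca t))) \<le> 1875 ^ omega q * sqrt (real q) * sqrt (real (gcd h q))"
      using norm_expsum_le[OF q_pos, of "- (int h * l')" 0] gcd_l[of h 0] sum_ee_classes[of "int h" 0] by simp
  qed
  show "\<bar>\<Sum>t\<in>units_mod q. dev q i j (cb t)\<bar> \<le> Delta"
  proof (rule gen)
    fix h show "norm (\<Sum>t\<in>units_mod q. ee q (- (int h * cb t))) \<le> 1875 ^ omega q * sqrt (real q) * sqrt (real (gcd h q))"
      using norm_expsum_le[OF q_pos, of 0 "- (int h * l)"] gcd_l[of 0 h] sum_ee_classes[of 0 "int h"] by simp
  qed
qed

lemma sum_dev_dev: "\<bar>\<Sum>t\<in>units_mod q. dev q i j (ca t) * dev q i' j' (cb t)\<bar> \<le> Delta"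
proof -
  define I where "I h = (\<Sum>a\<in>{i<..j}. ee q (int h * int a))" for h :: nat
  define I' where "I' k = (\<Sum>a\<in>{i'<..j'}. ee q (int k * int a))" for k :: nat
  define E where "E h k = expsum q (- (int h * l')) (- (int k * l))" for h k :: nat
  define M where "M = 1875 ^ omega q * sqrt (real q)"
  have M0: "M \<ge> 0" by (simp add: M_def)
  \<comment> \<open>Dropping k from the gcd of h, k and q decouples the sums over the two
    frequencies.\<close>
  have E: "norm (E h k) \<le> M * sqrt (real (gcd h q))" if "h \<in> {1..<q}" for h k
  proof -
    have "gcd (gcd h k) q dvd gcd h q" by (meson dvd_trans gcd_dvd1 gcd_dvd2 gcd_greatest)
    then have "gcd (gcd h k) q \<le> gcd h q" using q_pos by (intro dvd_imp_le) auto
    then have "M * sqrt (real (gcd (gcd h k) q)) \<le> M * sqrt (real (gcd h q))" using M0 by (intro mult_left_mono) auto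
    moreover have "norm (E h k) \<le> M * sqrt (real (gcd (gcd h k) q))"
      using norm_expsum_le[OF q_pos, of "- (int h * l')" "- (int k * l)"] unfolding E_def M_def gcd_l by simp
    ultimately show ?thesis by linarith
  qed
  have "complex_of_real (\<Sum>t\<in>units_mod q. dev q i j (ca t) * dev q i' j' (cb t)) =
      (\<Sum>t\<in>units_mod q. (\<Sum>h\<in>{1..<q}. I h * ee q (- (int h * ca t))) * (\<Sum>k\<in>{1..<q}. I' k * ee q (- (int k * cb t)))) / of_nat q ^ 2"
    unfolding of_real_sum of_real_mult dev_fourier[OF q_pos] I_def I'_def
    by (simp only: sum_divide_distrib[symmetric] times_divide_times_eq power2_eq_square)
  also have "(\<Sum>t\<in>units_mod q. (\<Sum>h\<in>{1..<q}. I h * ee q (- (int h * ca t))) * (\<Sum>k\<in>{1..<q}. I' k * ee q (- (int k * cb t)))) =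
      (\<Sum>t\<in>units_mod q. \<Sum>h\<in>{1..<q}. \<Sum>k\<in>{1..<q}. I h * I' k * ee q (- (int h * ca t) - int k * cb t))"
  proof (rule sum.cong)
    fix t
    have "ee q (- (int h * ca t) - int k * cb t) = ee q (- (int h * ca t)) * ee q (- (int k * cb t))" for h k
      using ee_add[of q "- (int h * ca t)" "- (int k * cb t)"] by simp
    then show "(\<Sum>h\<in>{1..<q}. I h * ee q (- (int h * ca t))) * (\<Sum>k\<in>{1..<q}. I' k * ee q (- (int k * cb t))) =
        (\<Sum>h\<in>{1..<q}. \<Sum>k\<in>{1..<q}. I h * I' k * ee q (- (int h * ca t) - int k * cb t))"
      by (simp add: sum_product mult_ac)
  qed simp
  also have "\<dots> = (\<Sum>h\<in>{1..<q}. \<Sum>t\<in>units_mod q. \<Sum>k\<in>{1..<q}. I h * I' k * ee q (- (int h * ca t) - int k * cb t))"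
    by (rule sum.swap)
  also have "\<dots> = (\<Sum>h\<in>{1..<q}. \<Sum>k\<in>{1..<q}. I h * I' k * E h k)"
    by (intro sum.cong refl, subst sum.swap) (simp add: E_def sum_ee_classes[symmetric] sum_distrib_left)
  finally have eq: "complex_of_real (\<Sum>t\<in>units_mod q. dev q i j (ca t) * dev q i' j' (cb t)) =
      (\<Sum>h\<in>{1..<q}. \<Sum>k\<in>{1..<q}. I h * I' k * E h k) / of_nat q ^ 2" .
  have "\<bar>\<Sum>t\<in>units_mod q. dev q i j (ca t) * dev q i' j' (cb t)\<bar> =
      norm (complex_of_real (\<Sum>t\<in>units_mod q. dev q i j (ca t) * dev q i' j' (cb t)))"
    by (simp only: norm_of_real)
  also have "\<dots> =
      norm (\<Sum>h\<in>{1..<q}. \<Sum>k\<in>{1..<q}. I h * I' k * E h k) / real q ^ 2"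
    unfolding eq by (simp only: norm_divide norm_power norm_of_nat)
  also have "\<dots> \<le> (\<Sum>h\<in>{1..<q}. \<Sum>k\<in>{1..<q}. wt h * wt k * (M * sqrt (real (gcd h q)))) / real q ^ 2"
  proof (intro divide_right_mono sum_norm_le)
    fix h k assume hk: "h \<in> {1..<q}" "k \<in> {1..<q}"
    have "norm (I h) \<le> wt h" "norm (I' k) \<le> wt k"
      unfolding I_def I'_def wt_def using hk by (intro norm_sum_ee_interval; simp)+
    then show "norm (I h * I' k * E h k) \<le> wt h * wt k * (M * sqrt (real (gcd h q)))"
      unfolding norm_mult using E[OF hk(1)] wt_nonneg by (intro mult_mono) auto
  qed simp
  also have "\<dots> = M * ((\<Sum>h\<in>{1..<q}. wt h * sqrt (real (gcd h q))) / real q) * ((\<Sum>k\<in>{1..<q}. wt k) / real q)"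
  proof -
    have "(\<Sum>h\<in>{1..<q}. \<Sum>k\<in>{1..<q}. wt h * wt k * (M * sqrt (real (gcd h q)))) =
        M * ((\<Sum>h\<in>{1..<q}. wt h * sqrt (real (gcd h q))) * (\<Sum>k\<in>{1..<q}. wt k))"
    proof -
      have e: "wt h * wt k * (M * sqrt (real (gcd h q))) = M * (wt h * sqrt (real (gcd h q)) * wt k)" for h k
        by (simp only: mult_ac)
      have "(\<Sum>h\<in>{1..<q}. wt h * sqrt (real (gcd h q))) * (\<Sum>k\<in>{1..<q}. wt k) =
          (\<Sum>h\<in>{1..<q}. \<Sum>k\<in>{1..<q}. wt h * sqrt (real (gcd h q)) * wt k)" by (rule sum_product)
      then show ?thesis by (simp only: e sum_distrib_left)
    qed
    then show ?thesis by (simp add: power2_eq_square)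
  qed
  also have "\<dots> \<le> M * (2 * (4 ^ omega q * (1 + ln (real q)))) * (2 * (1 + ln (real q)))"
  proof (intro mult_mono mult_left_mono)
    show "(\<Sum>h\<in>{1..<q}. wt h * sqrt (real (gcd h q))) / real q \<le> 2 * (4 ^ omega q * (1 + ln (real q)))"
      using sum_wt_gcd q_pos by (simp add: divide_le_eq mult.commute)
    show "(\<Sum>k\<in>{1..<q}. wt k) / real q \<le> 2 * (1 + ln (real q))"
      using sum_wt q_pos by (simp add: divide_le_eq mult.commute)
  qed (use M0 ln_q wt_nonneg in \<open>auto intro!: mult_nonneg_nonneg sum_nonneg divide_nonneg_nonneg\<close>)
  also have "\<dots> = 4 * (1875 * 4) ^ omega q * sqrt (real q) * (1 + ln (real q)) ^ 2"
    unfolding power_mult_distrib M_def by (simp add: power2_eq_square mult_ac)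
  finally show ?thesis by (simp add: Delta_def)
qed

lemma sum_N2_bound: "\<bar>(\<Sum>b\<in>{i<..j}. real (N2 (l * int b) q)) - real (totient q) / real q * real (j - i)\<bar> \<le> Delta"
  using sum_dev_cb[of i j] unfolding sum_N2 dev_def sum_subtractf by (simp add: card_units_mod[OF q_pos])

lemma sum_N3_bound: "\<bar>(\<Sum>a\<in>{i<..j}. real (N3 (l * int a) q)) - real (totient q) / real q * real (j - i)\<bar> \<le> Delta"
  using sum_dev_ca[of i j] unfolding sum_N3 dev_def sum_subtractf by (simp add: card_units_mod[OF q_pos])

text \<open>With expected values \<alpha>, \<beta> and deviations A, B the count is the sum of
  (\<alpha> + A)(\<beta> + B). The sum over \<open>N2\<close> absorbs \<alpha> (\<beta> + B); what
  remains is A B, bounded by \<open>sum_dev_dev\<close>, and \<beta> A, bounded by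
  \<open>sum_dev_ca\<close>.\<close>

lemma box_bound:
  "\<bar>real (box i j i' j') - real (j - i) / real q * (\<Sum>b\<in>{i'<..j'}. real (N2 (l * int b) q))\<bar> \<le>
    Delta * (1 + real (j' - i') / real q)"
proof -
  define \<alpha> where "\<alpha> = real (j - i) / real q"
  define \<beta> where "\<beta> = real (j' - i') / real q"
  have b0: "\<beta> \<ge> 0" by (simp add: \<beta>_def)
  have "real (box i j i' j') - \<alpha> * (\<Sum>b\<in>{i'<..j'}. real (N2 (l * int b) q)) =
      (\<Sum>t\<in>units_mod q. dev q i j (ca t) * dev q i' j' (cb t) + \<beta> * dev q i j (ca t))"
    unfolding box_eq sum_N2 sum_distrib_left sum_subtractf[symmetric]
    by (intro sum.cong refl) (simp add: dev_def \<alpha>_def[symmetric] \<beta>_def[symmetric] algebra_simps)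
  also have "\<dots> = (\<Sum>t\<in>units_mod q. dev q i j (ca t) * dev q i' j' (cb t)) + \<beta> * (\<Sum>t\<in>units_mod q. dev q i j (ca t))"
    by (simp add: sum.distrib sum_distrib_left)
  finally have eq: "real (box i j i' j') - \<alpha> * (\<Sum>b\<in>{i'<..j'}. real (N2 (l * int b) q)) = \<dots>" .
  have "\<bar>\<beta> * (\<Sum>t\<in>units_mod q. dev q i j (ca t))\<bar> \<le> \<beta> * Delta"
    unfolding abs_mult using b0 sum_dev_ca[of i j] by (simp add: mult_left_mono)
  moreover have "Delta * (1 + \<beta>) = Delta + \<beta> * Delta" by (simp add: distrib_left mult.commute)
  ultimately show ?thesis unfolding \<alpha>_def[symmetric] eq \<beta>_def[symmetric]
    using sum_dev_dev[of i j i' j'] by linarith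
qed

text \<open>For fixed b only the t with b = \<open>cb t\<close> occur; there are
  \<open>N2 (l * int b) q\<close> of them, and each fixes a residue class for a, with error at most
  1.\<close>

lemma column_bound:
  "\<bar>real (card {a \<in> {0<..j}. [int (a ^ 2 * b ^ 3) = l] (mod int q)}) - real (N2 (l * int b) q) * real j / real q\<bar> \<le> real (N2 (l * int b) q)"
proof -
  let ?U = "{t \<in> units_mod q. [int b = cb t] (mod int q)}"
  have ob: "of_bool [int (a ^ 2 * b ^ 3) = l] (mod int q) =
      (\<Sum>t\<in>units_mod q. of_bool [int a = ca t] (mod int q) * of_bool [int b = cb t] (mod int q) :: real)" for a
    using arg_cong[OF solution_iff[of "int a" "int b"], of real] by simp
  have "real (card {a \<in> {0<..j}. [int (a ^ 2 * b ^ 3) = l] (mod int q)}) = (\<Sum>a\<in>{0<..j}. of_bool [int (a ^ 2 * b ^ 3) = l] (mod int q))"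
    by (simp add: Int_def)
  also have "\<dots> = (\<Sum>t\<in>units_mod q. real (cnt q 0 j (ca t)) * of_bool [int b = cb t] (mod int q))"
    unfolding ob cnt_sum by (subst sum.swap) (simp add: sum_distrib_right)
  also have "\<dots> = (\<Sum>t\<in>?U. real (cnt q 0 j (ca t)))"
    by (simp add: sum.inter_filter of_bool_def if_distrib cong: if_cong)
  finally have "real (card {a \<in> {0<..j}. [int (a ^ 2 * b ^ 3) = l] (mod int q)}) - real (N2 (l * int b) q) * real j / real q =
      (\<Sum>t\<in>?U. dev q 0 j (ca t))"
    by (simp add: N2_eq dev_def sum_subtractf)
  also have "\<bar>\<dots>\<bar> \<le> (\<Sum>t\<in>?U. 1)"
    using abs_dev_le_1[OF q_pos] by (intro order_trans[OF sum_abs] sum_mono) auto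
  finally show ?thesis by (simp add: N2_eq)
qed

lemma row_bound:
  "\<bar>real (card {b \<in> {0<..j}. [int (a ^ 2 * b ^ 3) = l] (mod int q)}) - real (N3 (l * int a) q) * real j / real q\<bar> \<le> real (N3 (l * int a) q)"
proof -
  let ?U = "{t \<in> units_mod q. [int a = ca t] (mod int q)}"
  have ob: "of_bool [int (a ^ 2 * b ^ 3) = l] (mod int q) =
      (\<Sum>t\<in>units_mod q. of_bool [int b = cb t] (mod int q) * of_bool [int a = ca t] (mod int q) :: real)" for b
    using arg_cong[OF solution_iff[of "int a" "int b"], of real] by (simp add: mult.commute)
  have "real (card {b \<in> {0<..j}. [int (a ^ 2 * b ^ 3) = l] (mod int q)}) = (\<Sum>b\<in>{0<..j}. of_bool [int (a ^ 2 * b ^ 3) = l] (mod int q))"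
    by (simp add: Int_def)
  also have "\<dots> = (\<Sum>t\<in>units_mod q. real (cnt q 0 j (cb t)) * of_bool [int a = ca t] (mod int q))"
    unfolding ob cnt_sum by (subst sum.swap) (simp add: sum_distrib_right)
  also have "\<dots> = (\<Sum>t\<in>?U. real (cnt q 0 j (cb t)))"
    by (simp add: sum.inter_filter of_bool_def if_distrib cong: if_cong)
  finally have "real (card {b \<in> {0<..j}. [int (a ^ 2 * b ^ 3) = l] (mod int q)}) - real (N3 (l * int a) q) * real j / real q =
      (\<Sum>t\<in>?U. dev q 0 j (cb t))"
    by (simp add: N3_eq dev_def sum_subtractf)
  also have "\<bar>\<dots>\<bar> \<le> (\<Sum>t\<in>?U. 1)"
    using abs_dev_le_1[OF q_pos] by (intro order_trans[OF sum_abs] sum_mono) auto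
  finally show ?thesis by (simp add: N3_eq)
qed

end

section \<open>The main terms\<close>

text \<open>Partial summation; the differences of the decreasing weights telescope.\<close>

lemma abel_bound:
  fixes e w :: "nat \<Rightarrow> real"
  assumes E: "\<And>j. \<bar>\<Sum>b\<in>{k<..j}. e b\<bar> \<le> D" and w: "\<And>b. b > k \<Longrightarrow> w (Suc b) \<le> w b" "\<And>b. b > k \<Longrightarrow> w b \<ge> 0"
  shows "\<bar>\<Sum>b\<in>{k<..j}. e b * w b\<bar> \<le> D * w (Suc k)"
proof (cases "k \<le> j")
  case True
  define S where "S j = (\<Sum>b\<in>{k<..j}. e b)" for j
  have ins: "{k<..Suc j} = insert (Suc j) {k<..j}" if "k \<le> j" for j using that by auto
  have S_Suc: "S (Suc j) = S j + e (Suc j)" if "k \<le> j" for j unfolding S_def ins[OF that] by simp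
  have D0: "D \<ge> 0" using E[of 0] by linarith
  have id: "(\<Sum>b\<in>{k<..j}. e b * w b) = S j * w (Suc j) + (\<Sum>b\<in>{k<..j}. S b * (w b - w (Suc b)))"
    using True
  proof (induction j rule: dec_induct)
    case base
    then show ?case by (simp add: S_def)
  next
    case (step j)
    have "(\<Sum>b\<in>{k<..Suc j}. e b * w b) = e (Suc j) * w (Suc j) + (\<Sum>b\<in>{k<..j}. e b * w b)"
      unfolding ins[OF step(1)] by simp
    also have "\<dots> = S (Suc j) * w (Suc (Suc j)) + (S (Suc j) * (w (Suc j) - w (Suc (Suc j))) + (\<Sum>b\<in>{k<..j}. S b * (w b - w (Suc b))))"
      unfolding step(3) S_Suc[OF step(1)] by (simp add: algebra_simps)
    also have "\<dots> = S (Suc j) * w (Suc (Suc j)) + (\<Sum>b\<in>{k<..Suc j}. S b * (w b - w (Suc b)))"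
      unfolding ins[OF step(1)] by simp
    finally show ?case .
  qed
  have tele: "(\<Sum>b\<in>{k<..j}. w b - w (Suc b)) = w (Suc k) - w (Suc j)"
    using True
  proof (induction j rule: dec_induct)
    case (step j)
    then show ?case unfolding ins[OF step(1)] by simp
  qed simp
  have "\<bar>\<Sum>b\<in>{k<..j}. S b * (w b - w (Suc b))\<bar> \<le> (\<Sum>b\<in>{k<..j}. D * (w b - w (Suc b)))"
  proof (rule order_trans[OF sum_abs sum_mono])
    fix b assume "b \<in> {k<..j}"
    then show "\<bar>S b * (w b - w (Suc b))\<bar> \<le> D * (w b - w (Suc b))"
      using w(1)[of b] E[of b] by (simp add: abs_mult S_def mult_right_mono)
  qed
  also have "\<dots> = D * (w (Suc k) - w (Suc j))" using tele by (simp add: sum_distrib_left[symmetric])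
  finally have 1: "\<bar>\<Sum>b\<in>{k<..j}. S b * (w b - w (Suc b))\<bar> \<le> D * (w (Suc k) - w (Suc j))" .
  have "\<bar>S j * w (Suc j)\<bar> \<le> D * w (Suc j)"
    using E[of j] w(2)[of "Suc j"] True by (simp add: abs_mult S_def mult_right_mono)
  moreover have "D * w (Suc j) + D * (w (Suc k) - w (Suc j)) = D * w (Suc k)" by (simp add: right_diff_distrib)
  ultimately show ?thesis using 1 unfolding id by linarith
next
  case False
  have "D \<ge> 0" using E[of 0] by linarith
  then show ?thesis using False w(2)[of "Suc k"] by simp
qed

lemma powr_minus_frac: "x powr (-3/2) = 1 / x powr (3/2)" "x powr (-5/3) = 1 / x powr (5/3)" for x :: real
  using powr_minus_divide[of x "3/2"] powr_minus_divide[of x "5/3"] by simp_all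

lemma rsqrt_step:
  assumes "b > 0"
  shows "2 * real b powr (-1/2) - 2 * real (Suc b) powr (-1/2) \<le> real b powr (-3/2)"
    and "real (Suc b) powr (-3/2) \<le> 2 * real b powr (-1/2) - 2 * real (Suc b) powr (-1/2)"
proof -
  define f where "f x = - 2 * x powr (-1/2)" for x :: real
  have d: "(f has_real_derivative x powr (-3/2)) (at x)" if "x > 0" for x
    unfolding f_def using that by (auto intro!: derivative_eq_intros)
  have lt: "real b < real (Suc b)" by simp
  obtain z where z: "real b < z" "z < real (Suc b)" "f (real (Suc b)) - f (real b) = (real (Suc b) - real b) * z powr (-3/2)"
    using MVT2[OF lt, of f "\<lambda>x. x powr (-3/2)"] d assms by (smt (verit, best) of_nat_0_less_iff)
  have eq: "2 * real b powr (-1/2) - 2 * real (Suc b) powr (-1/2) = z powr (-3/2)"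
    using z(3) by (simp add: f_def)
  show "2 * real b powr (-1/2) - 2 * real (Suc b) powr (-1/2) \<le> real b powr (-3/2)"
    unfolding eq using z assms by (intro powr_mono2') auto
  show "real (Suc b) powr (-3/2) \<le> 2 * real b powr (-1/2) - 2 * real (Suc b) powr (-1/2)"
    unfolding eq using z assms by (intro powr_mono2') auto
qed

text \<open>Comparison with the integral of x^(-3/2). The rounding of V to k costs a term of size
  V^(-3/2); the term with j disappears in the limit.\<close>

lemma sum_powr_tail:
  fixes V :: real
  assumes V: "V \<ge> 1" and k: "k = nat \<lfloor>V\<rfloor>" and kj: "k \<le> j"
  shows "\<bar>(\<Sum>b\<in>{k<..j}. real b powr (-3/2)) - 2 * V powr (-1/2)\<bar> \<le> V powr (-3/2) + 2 * real (Suc j) powr (-1/2)"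
proof -
  have kV: "real k \<le> V" "V < real (Suc k)" "k \<ge> 1" using V k by linarith+
  define W where "W j = (\<Sum>b\<in>{k<..j}. real b powr (-3/2))" for j
  have ins: "{k<..Suc j} = insert (Suc j) {k<..j}" if "k \<le> j" for j using that by auto
  have lo: "2 * real (Suc k) powr (-1/2) - 2 * real (Suc j) powr (-1/2) \<le> W j" using kj
  proof (induction j rule: dec_induct)
    case (step j)
    then show ?case using rsqrt_step(1)[of "Suc j"] unfolding W_def ins[OF step(1)] by simp
  qed (simp add: W_def)
  have hi: "W j \<le> real (Suc k) powr (-3/2) + 2 * real (Suc k) powr (-1/2)"
  proof -
    have "W j \<le> (if j = k then 0 else real (Suc k) powr (-3/2) + 2 * real (Suc k) powr (-1/2) - 2 * real j powr (-1/2))"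
      using kj
    proof (induction j rule: dec_induct)
      case (step j)
      show ?case
      proof (cases "j = k")
        case True
        have "{k<..Suc k} = {Suc k}" by auto
        then show ?thesis using True by (simp add: W_def)
      next
        case False
        then have "j > 0" using step by simp
        have "W (Suc j) = W j + real (Suc j) powr (-3/2)" unfolding W_def ins[OF step(1)] by simp
        also have "\<dots> \<le> (real (Suc k) powr (-3/2) + 2 * real (Suc k) powr (-1/2) - 2 * real j powr (-1/2)) +
            (2 * real j powr (-1/2) - 2 * real (Suc j) powr (-1/2))"
          using step(3) False rsqrt_step(2)[OF \<open>j > 0\<close>] by (intro add_mono) simp_all
        finally show ?thesis using step by simp
      qed
    qed (simp add: W_def)
    then show ?thesis by (smt (verit) powr_ge_zero)
  qed
  have h1: "real (Suc k) powr (-3/2) \<le> V powr (-3/2)" "real (Suc k) powr (-1/2) \<le> V powr (-1/2)"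
    using kV V by (intro powr_mono2'; simp)+
  have h2: "V powr (-1/2) - real (Suc k) powr (-1/2) \<le> V powr (-3/2) / 2"
  proof -
    define f where "f x = x powr (-1/2)" for x :: real
    have d: "(f has_real_derivative - (1/2) * x powr (-3/2)) (at x)" if "x > 0" for x
      unfolding f_def using that by (auto intro!: derivative_eq_intros)
    obtain z where z: "V < z" "z < real (Suc k)" "f (real (Suc k)) - f V = (real (Suc k) - V) * (- (1/2) * z powr (-3/2))"
      using MVT2[OF kV(2), of f "\<lambda>x. - (1/2) * x powr (-3/2)"] d V by (smt (verit, best))
    have "(real (Suc k) - V) * z powr (-3/2) \<le> 1 * V powr (-3/2)"
      using kV z V by (intro mult_mono powr_mono2') auto
    then show ?thesis using z(3) by (simp add: f_def)
  qed
  have "W j - 2 * V powr (-1/2) \<le> V powr (-3/2)" using hi h1 by linarith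
  moreover have "2 * V powr (-1/2) - W j \<le> V powr (-3/2) + 2 * real (Suc j) powr (-1/2)" using lo h2 by linarith
  moreover have "real (Suc j) powr (-1/2) \<ge> 0" by simp
  ultimately show ?thesis unfolding W_def by linarith
qed

lemma set_integral_powr:
  fixes a U c :: real
  assumes "0 < a" "a \<le> U" "c \<noteq> -1"
  shows "set_integrable lborel {a..U} (\<lambda>u. u powr c)"
    and "(LINT u:{a..U}|lborel. u powr c) = (U powr (c + 1) - a powr (c + 1)) / (c + 1)"
proof -
  have "continuous_on {a..U} (\<lambda>u. u powr c)" using assms(1) by (auto intro!: continuous_intros)
  then show int: "set_integrable lborel {a..U} (\<lambda>u. u powr c)"
    unfolding set_integrable_def by (intro borel_integrable_compact) auto
  have "((\<lambda>u. u powr c) has_integral U powr (c + 1) / (c + 1) - a powr (c + 1) / (c + 1)) {a..U}"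
  proof (rule fundamental_theorem_of_calculus[OF assms(2)])
    fix x assume "x \<in> {a..U}"
    then have x: "x > 0" using assms(1) by auto
    have "((\<lambda>u. u powr (c + 1) / (c + 1)) has_real_derivative x powr c) (at x within {a..U})"
      using x assms(3) by (auto intro!: derivative_eq_intros)
    then show "((\<lambda>u. u powr (c + 1) / (c + 1)) has_vector_derivative x powr c) (at x within {a..U})"
      by (simp add: has_real_derivative_iff_has_vector_derivative)
  qed
  then have "integral {a..U} (\<lambda>u. u powr c) = (U powr (c + 1) - a powr (c + 1)) / (c + 1)"
    by (simp add: integral_unique diff_divide_distrib)
  then show "(LINT u:{a..U}|lborel. u powr c) = (U powr (c + 1) - a powr (c + 1)) / (c + 1)"
    using set_borel_integral_eq_integral(2)[OF int] by simp
qed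

lemma set_integral_powr_inf:
  fixes a c :: real
  assumes "0 < a" "c < -1"
  shows "set_integrable lborel {a..} (\<lambda>u. u powr c)"
    and "(LINT u:{a..}|lborel. u powr c) = - (a powr (c + 1)) / (c + 1)"
proof -
  have hi: "((\<lambda>u. u powr c) has_integral - (a powr (c + 1)) / (c + 1)) {a..}"
    using has_integral_powr_to_inf[of c a] assms by simp
  then have "(\<lambda>u. u powr c) absolutely_integrable_on {a..}"
    by (intro nonnegative_absolutely_integrable_1) (auto simp: integrable_on_def)
  then show int: "set_integrable lborel {a..} (\<lambda>u. u powr c)"
    unfolding set_integrable_def by (subst (asm) integrable_completion) auto
  show "(LINT u:{a..}|lborel. u powr c) = - (a powr (c + 1)) / (c + 1)"
    using set_borel_integral_eq_integral(2)[OF int] hi by (simp add: integral_unique)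
qed

context residue_class
begin

text \<open>The common mean value of \<open>n2\<close> and \<open>n3\<close> over a period.\<close>

definition \<rho> :: real where "\<rho> = real (totient q) / real q"
definition n2 :: "nat \<Rightarrow> real" where "n2 b = real (N2 (l * int b) q)"
definition n3 :: "nat \<Rightarrow> real" where "n3 a = real (N3 (l * int a) q)"
text \<open>A pointwise bound for \<open>n2\<close> and \<open>n3\<close>: 27 = 3^3 comes from the
  cube roots modulo powers of 3 and also covers the 2^3 for square roots.\<close>

definition \<eta> :: real where "\<eta> = 27 ^ omega q"

lemma rho_bounds: "0 \<le> \<rho>" "\<rho> \<le> 1"
  using q_pos totient_le[of q] by (auto simp: \<rho>_def divide_le_eq)

lemma n_bounds: "0 \<le> n2 b" "n2 b \<le> \<eta>" "0 \<le> n3 b" "n3 b \<le> \<eta>"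
proof -
  have "N2 (l * int b) q \<le> (2 ^ 3) ^ omega q" "N3 (l * int b) q \<le> (3 ^ 3) ^ omega q"
    unfolding N2_eq_Nr N3_eq_Nr using q_pos by (intro Nr_le; simp)+
  moreover have "(2 ^ 3 :: nat) ^ omega q \<le> 27 ^ omega q" by (intro power_mono) auto
  ultimately have "N2 (l * int b) q \<le> 27 ^ omega q" "N3 (l * int b) q \<le> 27 ^ omega q" by simp_all
  then have "real (N2 (l * int b) q) \<le> real (27 ^ omega q)" "real (N3 (l * int b) q) \<le> real (27 ^ omega q)"
    by (simp_all only: of_nat_le_iff)
  then show "n2 b \<le> \<eta>" "n3 b \<le> \<eta>" by (simp_all add: n2_def n3_def \<eta>_def)
qed (simp_all add: n2_def n3_def)

lemma n2_dev: "\<bar>\<Sum>b\<in>{i<..j}. n2 b - \<rho>\<bar> \<le> Delta"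
  using sum_N2_bound[of i j] by (simp add: n2_def \<rho>_def sum_subtractf mult.commute)

lemma n3_dev: "\<bar>\<Sum>a\<in>{i<..j}. n3 a - \<rho>\<bar> \<le> Delta"
  using sum_N3_bound[of i j] by (simp add: n3_def \<rho>_def sum_subtractf mult.commute)

text \<open>In the tail of the series \<open>n2\<close> is replaced by its mean \<rho>. The
  deviation from the mean has partial sums bounded by \<open>Delta\<close> and is handled by partial
  summation; the mean itself yields 2 \<rho> V^(-1/2).\<close>

lemma Cq_tail:
  fixes V :: real
  assumes V: "V \<ge> 1" and k: "k = nat \<lfloor>V\<rfloor>"
  shows "\<bar>Cq q l - (\<Sum>b\<in>{0<..k}. n2 b * real b powr (-3/2)) - 2 * \<rho> * V powr (-1/2)\<bar> \<le> (Delta + 1) * V powr (-3/2)"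
proof -
  define w where "w b = real b powr (-3/2)" for b :: nat
  have term_eq: "real (N2 (l * int (Suc b)) q) / real (Suc b) powr (3/2) = n2 (Suc b) * w (Suc b)" for b
    unfolding n2_def w_def powr_minus_frac by simp
  have "summable (\<lambda>n. real n powr (-3/2))" by (subst summable_real_powr_iff) simp
  then have "summable (\<lambda>n. \<eta> * real (Suc n) powr (-3/2))" by (subst summable_cmult_iff, subst summable_Suc_iff) simp
  then have "summable (\<lambda>b. n2 (Suc b) * w (Suc b))"
    by (rule summable_comparison_test'[where N = 0]) (use n_bounds in \<open>auto simp: w_def intro: mult_right_mono\<close>)
  then have "(\<lambda>N. \<Sum>b<N. n2 (Suc b) * w (Suc b)) \<longlonglongrightarrow> Cq q l"
    unfolding Cq_def term_eq by (rule summable_LIMSEQ)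
  moreover have "(\<Sum>b<N. n2 (Suc b) * w (Suc b)) = (\<Sum>b\<in>{0<..N}. n2 b * w b)" for N
    by (rule sum.reindex_bij_witness[of _ "\<lambda>b. b - 1" Suc]) auto
  ultimately have lim: "(\<lambda>N. \<Sum>b\<in>{0<..N}. n2 b * w b) \<longlonglongrightarrow> Cq q l" by simp
  define P where "P = (\<Sum>b\<in>{0<..k}. n2 b * w b)"
  have "(\<lambda>N. 2 * real (Suc N) powr (-1/2)) \<longlonglongrightarrow> 2 * 0"
    by (intro tendsto_mult tendsto_const LIMSEQ_Suc) (rule tendsto_neg_powr; simp add: filterlim_real_sequentially)
  then have lim2: "(\<lambda>N. (Delta + 1) * V powr (-3/2) + 2 * real (Suc N) powr (-1/2)) \<longlonglongrightarrow> (Delta + 1) * V powr (-3/2) + 0"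
    by (intro tendsto_add tendsto_const) simp
  have lim1: "(\<lambda>N. \<bar>(\<Sum>b\<in>{0<..N}. n2 b * w b) - P - 2 * \<rho> * V powr (-1/2)\<bar>) \<longlonglongrightarrow> \<bar>Cq q l - P - 2 * \<rho> * V powr (-1/2)\<bar>"
    by (intro tendsto_intros lim)
  have "\<bar>(\<Sum>b\<in>{0<..N}. n2 b * w b) - P - 2 * \<rho> * V powr (-1/2)\<bar> \<le> (Delta + 1) * V powr (-3/2) + 2 * real (Suc N) powr (-1/2)"
    if N: "N \<ge> k" for N
  proof -
    have "{0<..N} = {0<..k} \<union> {k<..N}" using N by auto
    have "(\<Sum>b\<in>{0<..N}. n2 b * w b) - P = (\<Sum>b\<in>{k<..N}. n2 b * w b)"
    proof -
      have "(\<Sum>b\<in>{0<..k} \<union> {k<..N}. n2 b * w b) = P + (\<Sum>b\<in>{k<..N}. n2 b * w b)"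
        unfolding P_def by (rule sum.union_disjoint) auto
      then show ?thesis using \<open>{0<..N} = {0<..k} \<union> {k<..N}\<close> by simp
    qed
    also have "\<dots> = (\<Sum>b\<in>{k<..N}. (n2 b - \<rho>) * w b) + \<rho> * (\<Sum>b\<in>{k<..N}. w b)"
      by (simp add: sum_distrib_left algebra_simps flip: sum.distrib)
    finally have eq: "(\<Sum>b\<in>{0<..N}. n2 b * w b) - P - 2 * \<rho> * V powr (-1/2) =
        (\<Sum>b\<in>{k<..N}. (n2 b - \<rho>) * w b) + \<rho> * ((\<Sum>b\<in>{k<..N}. w b) - 2 * V powr (-1/2))"
      by (simp add: algebra_simps)
    have "V < real (Suc k)" using V k by linarith
    then have wk: "w (Suc k) \<le> V powr (-3/2)" unfolding w_def using V by (intro powr_mono2') auto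
    have "\<bar>\<Sum>b\<in>{k<..N}. (n2 b - \<rho>) * w b\<bar> \<le> Delta * w (Suc k)"
      by (rule abel_bound[OF n2_dev]) (auto simp: w_def intro!: powr_mono2')
    also have "\<dots> \<le> Delta * V powr (-3/2)" using wk Delta_pos by (intro mult_left_mono) auto
    finally have 1: "\<bar>\<Sum>b\<in>{k<..N}. (n2 b - \<rho>) * w b\<bar> \<le> Delta * V powr (-3/2)" .
    have "\<bar>\<rho> * ((\<Sum>b\<in>{k<..N}. w b) - 2 * V powr (-1/2))\<bar> \<le> 1 * (V powr (-3/2) + 2 * real (Suc N) powr (-1/2))"
      unfolding abs_mult using sum_powr_tail[OF V k N] rho_bounds unfolding w_def by (intro mult_mono) auto
    then show ?thesis using 1 unfolding eq by (simp add: algebra_simps abs_le_iff)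
  qed
  then have "\<bar>Cq q l - P - 2 * \<rho> * V powr (-1/2)\<bar> \<le> (Delta + 1) * V powr (-3/2) + 0"
    by (intro LIMSEQ_le[OF lim1 lim2]) blast
  then show ?thesis by (simp add: P_def w_def)
qed

section \<open>The constant \<open>Dq\<close> as an integral over a remainder\<close>

definition R3 :: "real \<Rightarrow> real" where "R3 u = (\<Sum>a\<in>{1..nat \<lfloor>u\<rfloor>}. n3 a) - \<rho> * u"

lemma R3_bound: "u \<ge> 0 \<Longrightarrow> \<bar>R3 u\<bar> \<le> Delta + 1"
proof -
  assume u: "u \<ge> 0"
  have "R3 u = (\<Sum>a\<in>{0<..nat \<lfloor>u\<rfloor>}. n3 a - \<rho>) + \<rho> * (real (nat \<lfloor>u\<rfloor>) - u)"
    by (simp add: R3_def sum_subtractf algebra_simps atLeastSucAtMost_greaterThanAtMost)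
  moreover have "\<bar>\<rho> * (real (nat \<lfloor>u\<rfloor>) - u)\<bar> \<le> 1 * 1"
  proof -
    have "\<bar>real (nat \<lfloor>u\<rfloor>) - u\<bar> \<le> 1" using u by linarith
    then show ?thesis unfolding abs_mult using rho_bounds by (intro mult_mono) auto
  qed
  ultimately show ?thesis using n3_dev[of 0 "nat \<lfloor>u\<rfloor>"] by linarith
qed

lemma R3_measurable: "R3 \<in> borel_measurable borel"
proof -
  have "(\<lambda>u. \<Sum>a\<in>{1..nat \<lfloor>u\<rfloor>}. n3 a) = (\<lambda>k. \<Sum>a\<in>{1..nat k}. n3 a) \<circ> (\<lambda>u::real. \<lfloor>u\<rfloor>)" by (simp add: o_def)
  moreover have "(\<lambda>k::int. \<Sum>a\<in>{1..nat k}. n3 a) \<circ> (\<lambda>u::real. \<lfloor>u\<rfloor>) \<in> borel_measurable borel"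
    by (rule measurable_comp[of _ _ "count_space UNIV"]) auto
  ultimately show ?thesis unfolding R3_def[abs_def] by measurable
qed

lemma Dq_integrable: "set_integrable lborel {1..} (\<lambda>u. R3 u / u powr (5/3))"
proof (rule set_integrable_bound)
  show "set_integrable lborel {1..} (\<lambda>u. (Delta + 1) * u powr (-5/3))"
    by (intro set_integrable_mult_right set_integral_powr_inf(1)) auto
  show "set_borel_measurable lborel {1..} (\<lambda>u. R3 u / u powr (5/3))"
    unfolding set_borel_measurable_def using R3_measurable by measurable
  show "AE x in lborel. x \<in> {1..} \<longrightarrow> norm (R3 x / x powr (5/3)) \<le> norm ((Delta + 1) * x powr (-5/3))"
  proof (intro AE_I2 impI)
    fix x :: real assume "x \<in> {1..}"
    then have "\<bar>R3 x\<bar> * x powr (-5/3) \<le> \<bar>Delta + 1\<bar> * x powr (-5/3)" using R3_bound[of x] by (intro mult_right_mono) auto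
    then show "norm (R3 x / x powr (5/3)) \<le> norm ((Delta + 1) * x powr (-5/3))"
      unfolding powr_minus_frac by (simp add: abs_mult)
  qed
qed

lemma Dq_eq: "Dq q l = - 2 * \<rho> + 2/3 * (LINT u:{1..}|lborel. R3 u / u powr (5/3))"
  unfolding Dq_def R3_def n3_def \<rho>_def ..

lemma abs_tail_Dq:
  assumes "S \<subseteq> {U..}" "U \<ge> 1" "S \<in> sets borel"
  shows "\<bar>LINT u:S|lborel. R3 u / u powr (5/3)\<bar> \<le> (Delta + 1) * (3/2) * U powr (-2/3)"
proof -
  have sI: "set_integrable lborel S (\<lambda>u. R3 u / u powr (5/3))"
    using assms by (intro set_integrable_subset[OF Dq_integrable]) auto
  have pI: "set_integrable lborel {U..} (\<lambda>u. (Delta + 1) * u powr (-5/3))"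
    using assms by (intro set_integrable_mult_right set_integral_powr_inf(1)) auto
  have "norm (LINT u:S|lborel. R3 u / u powr (5/3)) \<le> (LINT u:{U..}|lborel. (Delta + 1) * u powr (-5/3))"
    unfolding set_lebesgue_integral_def
  proof (rule order_trans[OF integral_norm_bound integral_mono])
    show "integrable lborel (\<lambda>x. norm (indicator S x *\<^sub>R (R3 x / x powr (5/3))))"
      using sI unfolding set_integrable_def by (rule integrable_norm)
    show "integrable lborel (\<lambda>x. indicator {U..} x *\<^sub>R ((Delta + 1) * x powr (-5/3)))"
      using pI unfolding set_integrable_def .
    fix x :: real
    show "norm (indicator S x *\<^sub>R (R3 x / x powr (5/3))) \<le> indicator {U..} x *\<^sub>R ((Delta + 1) * x powr (-5/3))"
    proof (cases "x \<in> S")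
      case True
      then have x: "x \<ge> U" "x \<ge> 1" using assms by auto
      have "\<bar>R3 x\<bar> * x powr (-5/3) \<le> (Delta + 1) * x powr (-5/3)" using R3_bound[of x] x by (intro mult_right_mono) auto
      then show ?thesis using True x unfolding powr_minus_frac by simp
    next
      case False
      then show ?thesis using Delta_pos by (simp add: indicator_def)
    qed
  qed
  also have "\<dots> = (Delta + 1) * (LINT u:{U..}|lborel. u powr (-5/3))" by (rule set_integral_mult_right)
  also have "(LINT u:{U..}|lborel. u powr (-5/3)) = (3/2) * U powr (-2/3)"
    using assms set_integral_powr_inf(2)[of U "-5/3"] by simp
  finally show ?thesis by (simp only: real_norm_def mult.assoc)
qed

lemma abs_Dq_le: "\<bar>Dq q l\<bar> \<le> Delta + 3"
proof -
  have "\<bar>LINT u:{1..}|lborel. R3 u / u powr (5/3)\<bar> \<le> (Delta + 1) * (3/2) * 1 powr (-2/3)"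
    by (rule abs_tail_Dq) auto
  then show ?thesis unfolding Dq_eq using rho_bounds by simp
qed

text \<open>The weight of a is 2/3 times the integral of u^(-5/3) from a to U, so the sum is an
  integral of the summatory function of \<open>n3\<close>. Writing that function as
  \<open>R3 u\<close> + \<rho> u, the first part gives the integral in \<open>Dq\<close> up to a
  tail. The second gives 2 \<rho> (U^(1/3) - 1), which explains the constant -2 \<rho> in
  \<open>Dq\<close>.\<close>

lemma Dq_partial:
  fixes U :: real
  assumes U: "U \<ge> 1" and N: "N = nat \<lfloor>U\<rfloor>"
  shows "\<bar>(\<Sum>a\<in>{0<..N}. n3 a * (real a powr (-2/3) - U powr (-2/3))) - Dq q l - 2 * \<rho> * U powr (1/3)\<bar> \<le> (Delta + 1) * U powr (-2/3)"
proof -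
  define h where "h u = R3 u / u powr (5/3)" for u
  have sI: "set_integrable lborel S h" if "S \<subseteq> {1..}" "S \<in> sets borel" for S
    unfolding h_def using that by (intro set_integrable_subset[OF Dq_integrable]) auto
  have "{1..} = {1..U} \<union> {U<..}" using U by auto
  then have split: "(LINT u:{1..}|lborel. h u) = (LINT u:{1..U}|lborel. h u) + (LINT u:{U<..}|lborel. h u)"
    using U by (simp only:) (rule set_integral_Un; (intro sI)?; auto)
  have tail: "\<bar>LINT u:{U<..}|lborel. h u\<bar> \<le> (Delta + 1) * (3/2) * U powr (-2/3)"
    unfolding h_def using U by (intro abs_tail_Dq) auto
  have pw: "set_integrable lborel {real a..U} (\<lambda>u. u powr (-5/3))"
    "(LINT u:{real a..U}|lborel. u powr (-5/3)) = (3/2) * (real a powr (-2/3) - U powr (-2/3))" if "a \<in> {0<..N}" for a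
  proof -
    have a: "0 < real a" "real a \<le> U" using that N by auto linarith
    show "set_integrable lborel {real a..U} (\<lambda>u. u powr (-5/3))" by (rule set_integral_powr(1)[OF a]) simp
    have "(LINT u:{real a..U}|lborel. u powr (-5/3)) = (U powr (-5/3 + 1) - real a powr (-5/3 + 1)) / (-5/3 + 1)"
      by (rule set_integral_powr(2)[OF a]) simp
    also have "(-5/3 + 1 :: real) = -2/3" by simp
    finally have eq: "(LINT u:{real a..U}|lborel. u powr (-5/3)) = (U powr (-2/3) - real a powr (-2/3)) / (-2/3)" .
    have "(x - y) / (-2/3) = (3/2) * (y - x)" for x y :: real by (simp add: field_simps)
    then show "(LINT u:{real a..U}|lborel. u powr (-5/3)) = (3/2) * (real a powr (-2/3) - U powr (-2/3))"
      unfolding eq .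
  qed
  \<comment> \<open>The condition a <= u moves from the range of summation to the interval of
    integration.\<close>
  have hU: "indicator {1..U} u *\<^sub>R h u = (\<Sum>a\<in>{0<..N}. n3 a * (indicator {real a..U} u *\<^sub>R u powr (-5/3))) -
      \<rho> * (indicator {1..U} u *\<^sub>R u powr (-2/3))" for u
  proof (cases "u \<in> {1..U}")
    case True
    have "{1..nat \<lfloor>u\<rfloor>} = {a\<in>{0<..N}. real a \<le> u}" using True N by (auto simp: le_nat_iff le_floor_iff)
    then have "(\<Sum>a\<in>{1..nat \<lfloor>u\<rfloor>}. n3 a) = (\<Sum>a\<in>{0<..N}. if real a \<le> u then n3 a else 0)"
      by (simp only: sum.inter_filter[OF finite_greaterThanAtMost])
    also have "\<dots> = (\<Sum>a\<in>{0<..N}. n3 a * indicator {real a..U} u)"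
      using True by (intro sum.cong) (auto simp: indicator_def)
    finally have "h u = ((\<Sum>a\<in>{0<..N}. n3 a * indicator {real a..U} u) - \<rho> * u) * u powr (-5/3)"
      unfolding powr_minus_frac by (simp add: h_def R3_def)
    moreover have "u * u powr (-5/3) = u powr (-2/3)"
    proof -
      have "u powr 1 * u powr (-5/3) = u powr (-2/3)" by (subst powr_add[symmetric]) simp
      then show ?thesis using True by simp
    qed
    ultimately have "h u = (\<Sum>a\<in>{0<..N}. n3 a * (indicator {real a..U} u * u powr (-5/3))) - \<rho> * u powr (-2/3)"
      by (simp only: left_diff_distrib sum_distrib_right mult.assoc)
    moreover have "indicator {1..U} u = (1::real)" using True by simp
    ultimately show ?thesis by (simp only: scaleR_one real_scaleR_def mult_1_left)
  next
    case False
    have "indicator {real a..U} u = (0::real)" if "a \<in> {0<..N}" for a using False that by (auto simp: indicator_def)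
    then show ?thesis using False by simp
  qed
  have I2: "set_integrable lborel {1..U} (\<lambda>u. u powr (-2/3))" "(LINT u:{1..U}|lborel. u powr (-2/3)) = 3 * (U powr (1/3) - 1)"
    using set_integral_powr[of 1 U "-2/3"] U by simp_all
  have "(LINT u:{1..U}|lborel. h u) = (\<Sum>a\<in>{0<..N}. n3 a * (LINT u:{real a..U}|lborel. u powr (-5/3))) -
      \<rho> * (LINT u:{1..U}|lborel. u powr (-2/3))"
    unfolding set_lebesgue_integral_def hU
    using pw(1) I2(1) unfolding set_integrable_def
    by (subst Bochner_Integration.integral_diff) (auto intro!: Bochner_Integration.integrable_sum simp: Bochner_Integration.integral_sum)
  also have "\<dots> = (3/2) * (\<Sum>a\<in>{0<..N}. n3 a * (real a powr (-2/3) - U powr (-2/3))) - \<rho> * (3 * (U powr (1/3) - 1))"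
  proof -
    have "(\<Sum>a\<in>{0<..N}. n3 a * (LINT u:{real a..U}|lborel. u powr (-5/3))) =
        (\<Sum>a\<in>{0<..N}. n3 a * ((3/2) * (real a powr (-2/3) - U powr (-2/3))))"
      by (rule sum.cong[OF refl]) (simp only: pw(2))
    then show ?thesis unfolding I2(2) by (simp only: sum_distrib_left mult.left_commute)
  qed
  finally have "(\<Sum>a\<in>{0<..N}. n3 a * (real a powr (-2/3) - U powr (-2/3))) - Dq q l - 2 * \<rho> * U powr (1/3) =
      - (2/3) * (LINT u:{U<..}|lborel. h u)"
    unfolding Dq_eq h_def[symmetric] split by (simp add: algebra_simps)
  moreover have "\<bar>- (2/3) * (LINT u:{U<..}|lborel. h u)\<bar> = (2/3) * \<bar>LINT u:{U<..}|lborel. h u\<bar>" by (simp add: abs_mult)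
  moreover have "(Delta + 1) * (3/2) * U powr (-2/3) = (3/2) * ((Delta + 1) * U powr (-2/3))" by simp
  ultimately show ?thesis using tail by linarith
qed

end

section \<open>The hyperbola method\<close>

lemma le_nat_floor_iff: "x \<ge> 0 \<Longrightarrow> a \<le> nat \<lfloor>x\<rfloor> \<longleftrightarrow> real a \<le> x"
  by (auto simp: le_nat_iff le_floor_iff)

lemma nat_floor_bounds:
  fixes x :: real
  assumes "x \<ge> 0"
  shows "real (nat \<lfloor>x\<rfloor>) \<le> x" "x - 1 \<le> real (nat \<lfloor>x\<rfloor>)"
  using assms by linarith+

lemma sum_telescope_intervals:
  fixes g :: "nat \<Rightarrow> real" and k :: "nat \<Rightarrow> nat"
  assumes "\<And>i. k i \<le> k (Suc i)"
  shows "(\<Sum>b\<in>{k 0<..k n}. g b) = (\<Sum>i<n. \<Sum>b\<in>{k i<..k (Suc i)}. g b)"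
proof (induction n)
  case (Suc n)
  have "k 0 \<le> k n" using assms by (rule lift_Suc_mono_le) simp
  then have "{k 0<..k (Suc n)} = {k 0<..k n} \<union> {k n<..k (Suc n)}" using assms[of n] by auto
  then have "(\<Sum>b\<in>{k 0<..k (Suc n)}. g b) = (\<Sum>b\<in>{k 0<..k n}. g b) + (\<Sum>b\<in>{k n<..k (Suc n)}. g b)"
    by (simp only:) (rule sum.union_disjoint; auto)
  then show ?case using Suc by simp
qed simp

text \<open>\<open>B\<close> plays the role of X^\<mu>; the inequality B^5 <= X is the form in which
  \<mu> < 1/5 enters.\<close>

locale hyperbola = residue_class +
  fixes X B :: real
  assumes B1: "B \<ge> 1" and BX: "B ^ 5 \<le> X"
begin

text \<open>The boundary curve a^2 b^3 = X, solved for a here and for b in \<open>y\<close>.\<close>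

definition u :: "real \<Rightarrow> real" where "u v = X powr (1/2) * v powr (-3/2)"
definition y :: "real \<Rightarrow> real" where "y a = X powr (1/3) * a powr (-2/3)"
text \<open>The exponent 1/3 is chosen such that the height of the curve drops by the factor sqrt q
  between \<open>B\<close> and \<open>V\<close>, see \<open>U_eq\<close>.\<close>

definition V :: real where "V = B * real q powr (1/3)"
definition A :: real where "A = u B"
definition U :: real where "U = u V"

abbreviation ok :: "nat \<Rightarrow> nat \<Rightarrow> bool" where
  "ok a b \<equiv> [int (a ^ 2 * b ^ 3) = l] (mod int q)"

definition col :: "nat \<Rightarrow> nat" where "col b = card {a \<in> {0<..nat \<lfloor>u (real b)\<rfloor>}. ok a b}"
definition row :: "nat \<Rightarrow> nat \<Rightarrow> nat" where "row a j = card {b \<in> {0<..j}. ok a b}"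

lemma X1: "X \<ge> 1"
  using one_le_power[OF B1, of 5] BX by linarith

lemma q1: "real q \<ge> 1"
  using q_pos by simp

lemma V_ge: "V \<ge> B" "V \<ge> 1"
proof -
  have "real q powr (1/3) \<ge> 1" using q1 by (intro ge_one_powr_ge_zero) auto
  then have "B * 1 \<le> V" unfolding V_def using B1 by (intro mult_left_mono) auto
  then show "V \<ge> B" "V \<ge> 1" using B1 by auto
qed

lemma u_pos: "v > 0 \<Longrightarrow> u v > 0"
  unfolding u_def using X1 by simp

lemma u_antimono: "0 < v \<Longrightarrow> v \<le> w \<Longrightarrow> u w \<le> u v"
  unfolding u_def by (intro mult_left_mono powr_mono2') auto

lemma AU_pos: "A > 0" "U > 0"
  unfolding A_def U_def using u_pos B1 V_ge by auto

lemma u_sq: "v > 0 \<Longrightarrow> u v ^ 2 = X / v ^ 3"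
proof -
  assume v: "v > 0"
  have "(v powr (-3/2)) ^ 2 = v powr (-3)" using powr_power[of v "-3/2" 2] v by simp
  also have "\<dots> = 1 / v ^ 3" using v powr_minus_divide[of v 3] by simp
  finally show ?thesis unfolding u_def power_mult_distrib using X1 by (simp add: powr_power)
qed

lemma y_cube: "a > 0 \<Longrightarrow> y a ^ 3 = X / a ^ 2"
proof -
  assume a: "a > 0"
  have "(a powr (-2/3)) ^ 3 = a powr (-2)" using powr_power[of a "-2/3" 3] a by simp
  also have "\<dots> = 1 / a ^ 2" using a powr_minus_divide[of a 2] by simp
  finally show ?thesis unfolding y_def power_mult_distrib using X1 by (simp add: powr_power)
qed

lemma le_u_iff: "a \<ge> 0 \<Longrightarrow> b > 0 \<Longrightarrow> a \<le> u b \<longleftrightarrow> a ^ 2 * b ^ 3 \<le> X"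
proof -
  assume ab: "a \<ge> 0" "b > 0"
  have "a \<le> u b \<longleftrightarrow> a ^ 2 \<le> u b ^ 2" using ab u_pos[of b] by (intro power_mono_iff[symmetric]) auto
  also have "\<dots> \<longleftrightarrow> a ^ 2 * b ^ 3 \<le> X" unfolding u_sq[OF ab(2)] using ab by (simp add: pos_le_divide_eq)
  finally show ?thesis .
qed

lemma le_y_iff: "a > 0 \<Longrightarrow> b \<ge> 0 \<Longrightarrow> b \<le> y a \<longleftrightarrow> a ^ 2 * b ^ 3 \<le> X"
proof -
  assume ab: "a > 0" "b \<ge> 0"
  have "y a \<ge> 0" by (simp add: y_def)
  then have "b \<le> y a \<longleftrightarrow> b ^ 3 \<le> y a ^ 3" using ab by (intro power_mono_iff[symmetric]) auto
  also have "\<dots> \<longleftrightarrow> a ^ 2 * b ^ 3 \<le> X" unfolding y_cube[OF ab(1)] using ab by (simp add: pos_le_divide_eq mult.commute)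
  finally show ?thesis .
qed

lemma U_eq: "U = A / sqrt (real q)"
proof -
  have "V powr (-3/2) = B powr (-3/2) * (real q powr (1/3)) powr (-3/2)"
    unfolding V_def by (rule powr_mult)
  also have "(real q powr (1/3)) powr (-3/2) = real q powr (- (1/2))" by (simp add: powr_powr)
  also have "\<dots> = 1 / sqrt (real q)" using powr_minus_divide[of "real q" "1/2"] powr_half_sqrt[of "real q"] by simp
  finally show ?thesis by (simp add: U_def A_def u_def)
qed

lemma powr_UV: "X powr (1/3) = V * U powr (2/3)" "X powr (1/3) * U powr (-2/3) = V"
  "X powr (1/2) * V powr (-3/2) = U" "X powr (1/2) * V powr (-1/2) = U * V"
  "X powr (1/2) * V powr (-1/2) = X powr (1/3) * U powr (1/3)"
proof -
  have V0: "V > 0" and X0: "X > 0" using V_ge X1 by auto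
  have Up: "U powr c = X powr (c/2) * V powr (-3/2 * c)" for c
    unfolding U_def u_def using V0 X0 by (simp add: powr_mult powr_powr)
  have Vadd: "V powr c * V powr d = V powr (c + d)" "X powr c * X powr d = X powr (c + d)" for c d
    by (simp_all add: powr_add)
  have "V * U powr (2/3) = X powr (1/3) * (V powr 1 * V powr (-1))" unfolding Up using V0 by (simp add: mult_ac)
  then show 1: "X powr (1/3) = V * U powr (2/3)" unfolding Vadd using V0 by simp
  have "X powr (1/3) * U powr (-2/3) = (X powr (1/3) * X powr (-(1/3))) * V powr 1" unfolding Up by (simp add: mult.assoc)
  then show "X powr (1/3) * U powr (-2/3) = V" unfolding Vadd using V0 X0 by simp
  show "X powr (1/2) * V powr (-3/2) = U" by (simp add: U_def u_def)
  have "U * V = X powr (1/2) * (V powr (-3/2) * V powr 1)" using V0 by (simp add: U_def u_def mult.assoc)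
  then show "X powr (1/2) * V powr (-1/2) = U * V" unfolding Vadd by simp
  have "X powr (1/3) * U powr (1/3) = (X powr (1/3) * X powr (1/6)) * V powr (-1/2)" unfolding Up by (simp add: mult.assoc)
  then show "X powr (1/2) * V powr (-1/2) = X powr (1/3) * U powr (1/3)" unfolding Vadd by simp
qed

text \<open>Solutions with b <= V are collected by columns. Those with b > V satisfy a <= u b <= U
  and are collected by rows, from which the part up to V is subtracted.\<close>

lemma Sq_decomp:
  defines "k \<equiv> nat \<lfloor>V\<rfloor>"
  shows "real (Sq q X l) = (\<Sum>b\<in>{0<..k}. real (col b)) + (\<Sum>a\<in>{0<..nat \<lfloor>U\<rfloor>}. real (row a (nat \<lfloor>y (real a)\<rfloor>)) - real (row a k))"
proof -
  define S1 where "S1 = (SIGMA b:{0<..k}. {a \<in> {0<..nat \<lfloor>u (real b)\<rfloor>}. ok a b})"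
  define S2 where "S2 = (SIGMA a:{0<..nat \<lfloor>U\<rfloor>}. {b \<in> {k<..nat \<lfloor>y (real a)\<rfloor>}. ok a b})"
  define Sol where "Sol = {(a::nat, b::nat). a > 0 \<and> b > 0 \<and> real (a ^ 2 * b ^ 3) \<le> X \<and> ok a b}"
  have ua: "a \<le> nat \<lfloor>u (real b)\<rfloor> \<longleftrightarrow> real (a ^ 2 * b ^ 3) \<le> X" if "b > 0" for a b
    using that u_pos[of "real b"] le_u_iff[of "real a" "real b"] le_nat_floor_iff[of "u (real b)" a] by simp
  have yb: "b \<le> nat \<lfloor>y (real a)\<rfloor> \<longleftrightarrow> real (a ^ 2 * b ^ 3) \<le> X" if "a > 0" for a b
    using that le_y_iff[of "real a" "real b"] le_nat_floor_iff[of "y (real a)" b] by (simp add: y_def)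
  have aU: "a \<le> nat \<lfloor>U\<rfloor>" if "real (a ^ 2 * b ^ 3) \<le> X" "b > k" for a b
  proof -
    have "real b > V" using that(2) V_ge unfolding k_def by linarith
    then have "u (real b) \<le> U" unfolding U_def using V_ge by (intro u_antimono) auto
    moreover have "real a \<le> u (real b)" using that le_u_iff[of "real a" "real b"] by simp
    ultimately show ?thesis using le_nat_floor_iff[of U a] AU_pos by simp
  qed
  have "Sol = prod.swap ` S1 \<union> S2"
  proof (intro equalityI subsetI)
    fix z assume "z \<in> Sol"
    then obtain a b where z: "z = (a, b)" "a > 0" "b > 0" "real (a ^ 2 * b ^ 3) \<le> X" "ok a b" by (auto simp: Sol_def)
    show "z \<in> prod.swap ` S1 \<union> S2"
    proof (cases "b \<le> k")
      case True
      then have "(b, a) \<in> S1" using z ua[of b a] by (simp add: S1_def)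
      then show ?thesis using z(1) by (intro UnI1 image_eqI[of _ _ "(b, a)"]) auto
    next
      case False
      then have "(a, b) \<in> S2" using z yb[of a b] aU[of a b] by (simp add: S2_def)
      then show ?thesis using z(1) by simp
    qed
  next
    fix z assume "z \<in> prod.swap ` S1 \<union> S2"
    then show "z \<in> Sol"
    proof
      assume "z \<in> prod.swap ` S1"
      then obtain a b where z: "z = (a, b)" "(b, a) \<in> S1" by auto
      then show ?thesis using ua[of b a] by (simp add: S1_def Sol_def)
    next
      assume "z \<in> S2"
      then obtain a b where z: "z = (a, b)" "(a, b) \<in> S2" by (cases z) auto
      then show ?thesis using yb[of a b] by (simp add: S2_def Sol_def)
    qed
  qed
  moreover have "prod.swap ` S1 \<inter> S2 = {}" by (auto simp: S1_def S2_def)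
  moreover have fin: "finite S1" "finite S2" unfolding S1_def S2_def by auto
  ultimately have "card Sol = card (prod.swap ` S1) + card S2" by (simp add: card_Un_disjoint)
  also have "card (prod.swap ` S1) = card S1" by (rule card_image) simp
  also have "card S1 = (\<Sum>b\<in>{0<..k}. col b)" unfolding S1_def col_def by (subst card_SigmaI) auto
  also have "card S2 = (\<Sum>a\<in>{0<..nat \<lfloor>U\<rfloor>}. card {b \<in> {k<..nat \<lfloor>y (real a)\<rfloor>}. ok a b})"
    unfolding S2_def by (subst card_SigmaI) auto
  finally have "real (Sq q X l) = (\<Sum>b\<in>{0<..k}. real (col b)) + (\<Sum>a\<in>{0<..nat \<lfloor>U\<rfloor>}. real (card {b \<in> {k<..nat \<lfloor>y (real a)\<rfloor>}. ok a b}))"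
    unfolding Sq_def Sol_def by simp
  also have "(\<Sum>a\<in>{0<..nat \<lfloor>U\<rfloor>}. real (card {b \<in> {k<..nat \<lfloor>y (real a)\<rfloor>}. ok a b})) =
      (\<Sum>a\<in>{0<..nat \<lfloor>U\<rfloor>}. real (row a (nat \<lfloor>y (real a)\<rfloor>)) - real (row a k))"
  proof (rule sum.cong)
    fix a assume a: "a \<in> {0<..nat \<lfloor>U\<rfloor>}"
    then have a': "real a \<le> U" "a > 0" using le_nat_floor_iff[of U a] AU_pos by auto
    then have "V \<le> y (real a)"
      using le_u_iff[of "real a" V] le_y_iff[of "real a" V] V_ge unfolding U_def by simp
    then have "k \<le> nat \<lfloor>y (real a)\<rfloor>" unfolding k_def by (intro nat_mono floor_mono)
    then have "{b \<in> {0<..nat \<lfloor>y (real a)\<rfloor>}. ok a b} = {b \<in> {0<..k}. ok a b} \<union> {b \<in> {k<..nat \<lfloor>y (real a)\<rfloor>}. ok a b}"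
      by auto
    then have "row a (nat \<lfloor>y (real a)\<rfloor>) = card ({b \<in> {0<..k}. ok a b} \<union> {b \<in> {k<..nat \<lfloor>y (real a)\<rfloor>}. ok a b})"
      by (simp only: row_def)
    also have "\<dots> = row a k + card {b \<in> {k<..nat \<lfloor>y (real a)\<rfloor>}. ok a b}"
      unfolding row_def by (rule card_Un_disjoint) auto
    finally show "real (card {b \<in> {k<..nat \<lfloor>y (real a)\<rfloor>}. ok a b}) = real (row a (nat \<lfloor>y (real a)\<rfloor>)) - real (row a k)"
      by simp
  qed simp
  finally show ?thesis .
qed

text \<open>One unit of error for each residue class of a comes from the count, a second one from
  rounding \<open>u (real b)\<close>.\<close>

lemma col_bound: "b > 0 \<Longrightarrow> \<bar>real (col b) - n2 b * u (real b) / real q\<bar> \<le> 2 * n2 b"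
proof -
  assume b: "b > 0"
  define j where "j = nat \<lfloor>u (real b)\<rfloor>"
  have j: "\<bar>real j - u (real b)\<bar> \<le> 1" using nat_floor_bounds[of "u (real b)"] u_pos[of "real b"] b unfolding j_def by linarith
  have "\<bar>real (col b) - n2 b * real j / real q\<bar> \<le> n2 b"
    using column_bound[of j b] by (simp add: col_def j_def n2_def)
  moreover have "\<bar>n2 b * real j / real q - n2 b * u (real b) / real q\<bar> \<le> n2 b"
  proof -
    have "n2 b * real j / real q - n2 b * u (real b) / real q = n2 b * (real j - u (real b)) / real q"
      by (simp add: right_diff_distrib diff_divide_distrib)
    also have "\<bar>\<dots>\<bar> = n2 b * (\<bar>real j - u (real b)\<bar> / real q)" using n_bounds by (simp add: abs_mult)
    also have "\<dots> \<le> n2 b * 1" using j q1 n_bounds by (intro mult_left_mono) (auto simp: divide_le_eq)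
    finally show ?thesis by simp
  qed
  ultimately show ?thesis by linarith
qed

lemma row_bound': "v \<ge> 0 \<Longrightarrow> \<bar>real (row a (nat \<lfloor>v\<rfloor>)) - n3 a * v / real q\<bar> \<le> 2 * n3 a"
proof -
  assume v: "v \<ge> 0"
  define j where "j = nat \<lfloor>v\<rfloor>"
  have j: "\<bar>real j - v\<bar> \<le> 1" using nat_floor_bounds[OF v] unfolding j_def by linarith
  have "\<bar>real (row a j) - n3 a * real j / real q\<bar> \<le> n3 a"
    using row_bound[of j a] by (simp add: row_def n3_def)
  moreover have "\<bar>n3 a * real j / real q - n3 a * v / real q\<bar> \<le> n3 a"
  proof -
    have "n3 a * real j / real q - n3 a * v / real q = n3 a * (real j - v) / real q"
      by (simp add: right_diff_distrib diff_divide_distrib)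
    also have "\<bar>\<dots>\<bar> = n3 a * (\<bar>real j - v\<bar> / real q)" using n_bounds by (simp add: abs_mult)
    also have "\<dots> \<le> n3 a * 1" using j q1 n_bounds by (intro mult_left_mono) (auto simp: divide_le_eq)
    finally show ?thesis by simp
  qed
  ultimately show ?thesis unfolding j_def by linarith
qed

lemma eta_pos: "\<eta> \<ge> 1"
  by (simp add: \<eta>_def)

lemma columns_to_B: "\<bar>\<Sum>b\<in>{0<..nat \<lfloor>B\<rfloor>}. real (col b) - n2 b * u (real b) / real q\<bar> \<le> 2 * \<eta> * B"
proof -
  have "\<bar>\<Sum>b\<in>{0<..nat \<lfloor>B\<rfloor>}. real (col b) - n2 b * u (real b) / real q\<bar> \<le> (\<Sum>b\<in>{0<..nat \<lfloor>B\<rfloor>}. 2 * \<eta>)"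
  proof (rule order_trans[OF sum_abs sum_mono])
    fix b assume "b \<in> {0<..nat \<lfloor>B\<rfloor>}"
    then show "\<bar>real (col b) - n2 b * u (real b) / real q\<bar> \<le> 2 * \<eta>" using col_bound[of b] n_bounds(2)[of b] by simp
  qed
  also have "\<dots> = 2 * \<eta> * real (nat \<lfloor>B\<rfloor>)" by simp
  also have "\<dots> \<le> 2 * \<eta> * B" using nat_floor_bounds[of B] B1 eta_pos by (intro mult_left_mono) auto
  finally show ?thesis .
qed

lemma rows_above_V:
  "\<bar>(\<Sum>a\<in>{0<..nat \<lfloor>U\<rfloor>}. real (row a (nat \<lfloor>y (real a)\<rfloor>)) - real (row a (nat \<lfloor>V\<rfloor>))) -
    (\<Sum>a\<in>{0<..nat \<lfloor>U\<rfloor>}. n3 a * (y (real a) - V) / real q)\<bar> \<le> 4 * \<eta> * U"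
proof -
  have "\<bar>\<Sum>a\<in>{0<..nat \<lfloor>U\<rfloor>}. real (row a (nat \<lfloor>y (real a)\<rfloor>)) - real (row a (nat \<lfloor>V\<rfloor>)) - n3 a * (y (real a) - V) / real q\<bar> \<le> (\<Sum>a\<in>{0<..nat \<lfloor>U\<rfloor>}. 4 * \<eta>)"
  proof (rule order_trans[OF sum_abs sum_mono])
    fix a assume "a \<in> {0<..nat \<lfloor>U\<rfloor>}"
    have "y (real a) \<ge> 0" by (simp add: y_def)
    have V0: "V \<ge> 0" using V_ge by simp
    have triangle: "\<bar>r - s - t\<bar> \<le> 4 * e" if "\<bar>r - c\<bar> \<le> 2 * n" "\<bar>s - d\<bar> \<le> 2 * n" "t = c - d" "n \<le> e"
      for r s t c d n e :: real
      using that by linarith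
    have "n3 a * (y (real a) - V) / real q = n3 a * y (real a) / real q - n3 a * V / real q"
      by (simp add: right_diff_distrib diff_divide_distrib)
    then show "\<bar>real (row a (nat \<lfloor>y (real a)\<rfloor>)) - real (row a (nat \<lfloor>V\<rfloor>)) - n3 a * (y (real a) - V) / real q\<bar> \<le> 4 * \<eta>"
      by (rule triangle[OF row_bound'[OF \<open>y (real a) \<ge> 0\<close>] row_bound'[OF V0] _ n_bounds(4)])
  qed
  also have "\<dots> = 4 * \<eta> * real (nat \<lfloor>U\<rfloor>)" by simp
  also have "\<dots> \<le> 4 * \<eta> * U" using nat_floor_bounds[of U] AU_pos eta_pos by (intro mult_left_mono) auto
  finally show ?thesis by (simp only: sum_subtractf)
qed

lemma Delta_ge_4: "Delta \<ge> 4"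
proof -
  have "4 * 1 * 1 * 1 \<le> Delta" unfolding Delta_def using ln_q q1 by (intro mult_mono one_le_power) auto
  then show ?thesis by simp
qed

lemma box_cols: "real (box 0 j k k') = (\<Sum>b\<in>{k<..k'}. real (card {a \<in> {0<..j}. ok a b}))"
  unfolding box_eq_sum by (subst sum.swap) (simp add: Int_def)

text \<open>Both the number of points and its main term are enclosed between those of the boxes of
  heights \<open>u v'\<close> and \<open>u v\<close>. The gap is the difference of the heights times
  \<open>G\<close> / q, and \<open>G\<close> exceeds the width by at most \<open>Delta\<close> +
  1.\<close>

lemma strip:
  assumes v: "1 \<le> v" "v \<le> v'"
  shows "\<bar>\<Sum>b\<in>{nat \<lfloor>v\<rfloor><..nat \<lfloor>v'\<rfloor>}. real (col b) - n2 b * u (real b) / real q\<bar> \<le>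
    (u v - u v') * (v' - v) / real q + 2 * Delta * (u v - u v') / real q + 2 * Delta * (v' - v) / real q + 4 * Delta"
proof -
  define k where "k = nat \<lfloor>v\<rfloor>"
  define k' where "k' = nat \<lfloor>v'\<rfloor>"
  define G where "G = (\<Sum>b\<in>{k<..k'}. n2 b)"
  define \<delta> where "\<delta> = u v - u v'"
  define d where "d = v' - v"
  have dd: "\<delta> \<ge> 0" "d \<ge> 0" unfolding \<delta>_def d_def using u_antimono[of v v'] v by auto
  have b_in: "v < real b" "real b \<le> v'" "b > 0" if "b \<in> {k<..k'}" for b
    using that v unfolding k_def k'_def by (auto simp: le_nat_iff le_floor_iff) linarith+
  have kk: "real (k' - k) \<le> d + 1"
  proof -
    have "k \<le> k'" unfolding k_def k'_def using v by (intro nat_mono floor_mono)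
    then have "real (k' - k) = real k' - real k" by (rule of_nat_diff)
    then show ?thesis using nat_floor_bounds[of v] nat_floor_bounds[of v'] v unfolding d_def k_def k'_def by linarith
  qed
  have G0: "G \<ge> 0" unfolding G_def using n_bounds by (intro sum_nonneg) auto
  have G: "G \<le> d + 1 + Delta"
  proof -
    have "G = (\<Sum>b\<in>{k<..k'}. n2 b - \<rho>) + \<rho> * real (k' - k)" by (simp add: G_def sum_subtractf mult.commute)
    moreover have "\<rho> * real (k' - k) \<le> 1 * real (k' - k)" using rho_bounds by (intro mult_right_mono) auto
    ultimately show ?thesis using n2_dev[of k k'] kk by linarith
  qed
  have bx: "\<bar>real (box 0 j k k') - real j / real q * G\<bar> \<le> Delta * (1 + (d + 1) / real q)" for j
  proof -
    have "Delta * (1 + real (k' - k) / real q) \<le> Delta * (1 + (d + 1) / real q)"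
      using kk Delta_pos q1 by (intro mult_left_mono add_mono divide_right_mono) auto
    then show ?thesis using box_bound[of 0 j k k'] by (simp add: G_def n2_def)
  qed
  define M where "M = (\<Sum>b\<in>{k<..k'}. n2 b * u (real b) / real q)"
  define C where "C = (\<Sum>b\<in>{k<..k'}. real (col b))"
  have M1: "M \<le> u v * G / real q" unfolding M_def G_def sum_distrib_left sum_divide_distrib
  proof (rule sum_mono)
    fix b assume b: "b \<in> {k<..k'}"
    have "n2 b * u (real b) \<le> n2 b * u v" using b_in[OF b] v n_bounds by (intro mult_left_mono u_antimono) auto
    then show "n2 b * u (real b) / real q \<le> u v * n2 b / real q" by (simp add: mult.commute divide_right_mono)
  qed
  have M2: "u v' * G / real q \<le> M" unfolding M_def G_def sum_distrib_left sum_divide_distrib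
  proof (rule sum_mono)
    fix b assume b: "b \<in> {k<..k'}"
    have "n2 b * u v' \<le> n2 b * u (real b)" using b_in[OF b] v n_bounds by (intro mult_left_mono u_antimono) auto
    then show "u v' * n2 b / real q \<le> n2 b * u (real b) / real q" by (simp add: mult.commute divide_right_mono)
  qed
  have C1: "C \<le> real (box 0 (nat \<lfloor>u v\<rfloor>) k k')" unfolding C_def box_cols
  proof (rule sum_mono)
    fix b assume b: "b \<in> {k<..k'}"
    have "nat \<lfloor>u (real b)\<rfloor> \<le> nat \<lfloor>u v\<rfloor>" using b_in[OF b] v by (intro nat_mono floor_mono u_antimono) auto
    then show "real (col b) \<le> real (card {a \<in> {0<..nat \<lfloor>u v\<rfloor>}. ok a b})"
      unfolding col_def of_nat_le_iff by (intro card_mono) auto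
  qed
  have C2: "real (box 0 (nat \<lfloor>u v'\<rfloor>) k k') \<le> C" unfolding C_def box_cols
  proof (rule sum_mono)
    fix b assume b: "b \<in> {k<..k'}"
    have "nat \<lfloor>u v'\<rfloor> \<le> nat \<lfloor>u (real b)\<rfloor>" using b_in[OF b] v by (intro nat_mono floor_mono u_antimono) auto
    then show "real (card {a \<in> {0<..nat \<lfloor>u v'\<rfloor>}. ok a b}) \<le> real (col b)"
      unfolding col_def of_nat_le_iff by (intro card_mono) auto
  qed
  have fl: "real (nat \<lfloor>u v\<rfloor>) \<le> u v" "u v' - 1 \<le> real (nat \<lfloor>u v'\<rfloor>)"
    using nat_floor_bounds[of "u v"] nat_floor_bounds[of "u v'"] u_pos[of v] u_pos[of v'] v by auto
  have F1: "real (nat \<lfloor>u v\<rfloor>) / real q * G \<le> u v * G / real q"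
    using fl G0 q1 by (simp add: divide_right_mono mult_right_mono)
  have F2: "(u v' - 1) * G / real q \<le> real (nat \<lfloor>u v'\<rfloor>) / real q * G"
    using fl G0 q1 by (simp add: divide_right_mono mult_right_mono)
  have e1: "u v * G / real q - u v' * G / real q = \<delta> * G / real q" "(u v' - 1) * G / real q = u v' * G / real q - G / real q"
    by (simp_all add: \<delta>_def left_diff_distrib diff_divide_distrib)
  have "\<bar>C - M\<bar> \<le> \<delta> * G / real q + G / real q + Delta * (1 + (d + 1) / real q)"
  proof -
    have "C - M \<le> \<delta> * G / real q + Delta * (1 + (d + 1) / real q)" using C1 bx[of "nat \<lfloor>u v\<rfloor>"] F1 M2 e1 by linarith
    moreover have "M - C \<le> \<delta> * G / real q + G / real q + Delta * (1 + (d + 1) / real q)" using C2 bx[of "nat \<lfloor>u v'\<rfloor>"] F2 M1 e1 by linarith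
    moreover have "G / real q \<ge> 0" using G0 q1 by simp
    ultimately show ?thesis by linarith
  qed
  also have "\<dots> \<le> \<delta> * (d + 2 * Delta) / real q + (d + 2 * Delta) / real q + Delta * (1 + (d + 1) / real q)"
    using G Delta_ge_4 dd q1 by (intro add_mono divide_right_mono mult_left_mono) auto
  also have "\<dots> = \<delta> * d / real q + 2 * Delta * \<delta> / real q + d / real q + Delta * d / real q + (3 * Delta) / real q + Delta"
    by (simp add: add_divide_distrib distrib_left mult.commute)
  also have "\<dots> \<le> \<delta> * d / real q + 2 * Delta * \<delta> / real q + Delta * d / real q + Delta * d / real q + 3 * Delta + Delta"
  proof -
    have "1 * d / real q \<le> Delta * d / real q" using Delta_ge_4 dd by (intro divide_right_mono mult_right_mono) auto
    moreover have "3 * Delta / real q \<le> 3 * Delta" using Delta_pos q1 by (simp add: divide_le_eq)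
    ultimately show ?thesis by linarith
  qed
  also have "\<dots> = \<delta> * d / real q + 2 * Delta * \<delta> / real q + 2 * Delta * d / real q + 4 * Delta" by simp
  finally show ?thesis by (simp add: C_def M_def sum_subtractf k_def k'_def \<delta>_def d_def)
qed

text \<open>Between \<open>B\<close> and \<open>V\<close> the region under the curve is cut into \<open>n\<close> strips in geometric progression, each
  compared with a box.\<close>

lemma columns_grid:
  assumes n: "n > 0" "1 + ln (real q) \<le> real n"
  shows "\<bar>\<Sum>b\<in>{nat \<lfloor>B\<rfloor><..nat \<lfloor>V\<rfloor>}. real (col b) - n2 b * u (real b) / real q\<bar> \<le>
    A * B * (1 + ln (real q)) ^ 2 / (real n * real q) + 2 * Delta * A / real q + 2 * Delta * V / real q + 4 * Delta * real n"
proof -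
  \<comment> \<open>The logarithm of the ratio of consecutive nodes, which lead from
    \<open>B\<close> to \<open>V\<close> in n steps; the lower bound for n makes it at most
    1.\<close>
  define x where "x = ln (real q) / (3 * real n)"
  define v where "v i = B * exp (x * real i)" for i :: nat
  have lq: "ln (real q) \<ge> 0" using q1 by simp
  have x: "0 \<le> x" "x \<le> 1" using n lq by (auto simp: x_def divide_le_eq)
  have v0: "v 0 = B" by (simp add: v_def)
  have "exp (x * real n) = real q powr (1/3)" using n q1 by (simp add: x_def powr_def)
  then have vn: "v n = V" by (simp add: v_def V_def)
  have v1: "v i \<ge> 1" for i
  proof -
    have "1 * 1 \<le> B * exp (x * real i)" using B1 x by (intro mult_mono) auto
    then show ?thesis by (simp add: v_def)
  qed
  have vmono: "v i \<le> v (Suc i)" for i unfolding v_def using B1 x by (intro mult_left_mono) (auto intro: mult_left_mono)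
  have uv: "u (v i) = A * exp (- (3/2 * x * real i))" for i
  proof -
    have "v i powr (-3/2) = B powr (-3/2) * exp (x * real i) powr (-3/2)" unfolding v_def by (rule powr_mult)
    also have "exp (x * real i) powr (-3/2) = exp (- (3/2 * x * real i))" by (simp add: powr_def)
    finally show ?thesis by (simp add: u_def A_def)
  qed
  \<comment> \<open>The product of v and u(v) is proportional to v^(-1/2) and hence at most A B;
    each of the two differences contributes a factor of order x.\<close>
  have prod: "(u (v i) - u (v (Suc i))) * (v (Suc i) - v i) \<le> 3 * A * B * x ^ 2" for i
  proof -
    have "u (v i) - u (v (Suc i)) = A * exp (- (3/2 * x * real i)) * (1 - exp (- (3/2 * x)))"
      unfolding uv by (simp add: algebra_simps flip: exp_add)
    moreover have "v (Suc i) - v i = B * exp (x * real i) * (exp x - 1)"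
      unfolding v_def by (simp add: algebra_simps flip: exp_add)
    ultimately have "(u (v i) - u (v (Suc i))) * (v (Suc i) - v i) =
        (A * B) * ((exp (- (3/2 * x * real i)) * exp (x * real i)) * ((1 - exp (- (3/2 * x))) * (exp x - 1)))"
      by (simp only: mult_ac)
    also have "\<dots> \<le> (A * B) * (1 * ((3/2 * x) * (2 * x)))"
    proof (intro mult_left_mono mult_mono)
      have "- (3/2 * x * real i) + x * real i \<le> 0" using x by (simp add: mult_right_mono)
      then show "exp (- (3/2 * x * real i)) * exp (x * real i) \<le> 1" by (simp flip: exp_add)
      show "1 - exp (- (3/2 * x)) \<le> 3/2 * x" using exp_ge_add_one_self[of "- (3/2 * x)"] by linarith
      have "exp x \<le> 1 + x + x ^ 2" using x by (intro exp_bound) auto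
      moreover have "x ^ 2 \<le> x" using x by (simp add: power2_eq_square mult_left_le)
      ultimately show "exp x - 1 \<le> 2 * x" by linarith
    qed (use x AU_pos B1 in auto)
    also have "\<dots> = 3 * A * B * x ^ 2" by (simp add: power2_eq_square)
    finally show ?thesis .
  qed
  have split: "(\<Sum>b\<in>{nat \<lfloor>B\<rfloor><..nat \<lfloor>V\<rfloor>}. real (col b) - n2 b * u (real b) / real q) =
      (\<Sum>i<n. \<Sum>b\<in>{nat \<lfloor>v i\<rfloor><..nat \<lfloor>v (Suc i)\<rfloor>}. real (col b) - n2 b * u (real b) / real q)"
    using sum_telescope_intervals[of "\<lambda>i. nat \<lfloor>v i\<rfloor>" "\<lambda>b. real (col b) - n2 b * u (real b) / real q" n]
    unfolding v0 vn by (simp add: nat_mono floor_mono vmono)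
  have "\<bar>\<Sum>b\<in>{nat \<lfloor>B\<rfloor><..nat \<lfloor>V\<rfloor>}. real (col b) - n2 b * u (real b) / real q\<bar> \<le> (\<Sum>i<n. 3 * A * B * x ^ 2 / real q + 2 * Delta / real q * (u (v i) - u (v (Suc i))) +
      2 * Delta / real q * (v (Suc i) - v i) + 4 * Delta)"
    unfolding split
  proof (rule order_trans[OF sum_abs sum_mono])
    fix i
    have "(u (v i) - u (v (Suc i))) * (v (Suc i) - v i) / real q \<le> 3 * A * B * x ^ 2 / real q"
      by (rule divide_right_mono[OF prod]) simp
    then show "\<bar>\<Sum>b\<in>{nat \<lfloor>v i\<rfloor><..nat \<lfloor>v (Suc i)\<rfloor>}. real (col b) - n2 b * u (real b) / real q\<bar> \<le>
        3 * A * B * x ^ 2 / real q + 2 * Delta / real q * (u (v i) - u (v (Suc i))) + 2 * Delta / real q * (v (Suc i) - v i) + 4 * Delta"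
      using strip[OF v1 vmono, of i] by simp
  qed
  also have "\<dots> = real n * (3 * A * B * x ^ 2 / real q) + 2 * Delta / real q * (A - U) +
      2 * Delta / real q * (V - B) + real n * (4 * Delta)"
  proof -
    have "(\<Sum>i<n. u (v i) - u (v (Suc i))) = A - U"
      using sum_lessThan_telescope'[of "\<lambda>i. u (v i)" n] by (simp add: v0 vn A_def U_def)
    moreover have "(\<Sum>i<n. v (Suc i) - v i) = V - B"
      using sum_lessThan_telescope[of v n] by (simp add: v0 vn)
    ultimately show ?thesis
      unfolding sum.distrib sum_distrib_left[symmetric, of "2 * Delta / real q"] by simp
  qed
  also have "real n * (3 * A * B * x ^ 2 / real q) + 2 * Delta / real q * (A - U) + 2 * Delta / real q * (V - B) + real n * (4 * Delta) \<le>
      A * B * (1 + ln (real q)) ^ 2 / (real n * real q) + 2 * Delta / real q * A + 2 * Delta / real q * V + real n * (4 * Delta)"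
  proof (intro add_mono mult_left_mono order_refl)
    have "real n * (3 * A * B * x ^ 2 / real q) = A * B * ((ln (real q)) ^ 2 / 3) / (real n * real q)"
      using n q1 by (simp add: x_def power_divide power2_eq_square)
    also have "\<dots> \<le> A * B * (1 + ln (real q)) ^ 2 / (real n * real q)"
    proof (intro divide_right_mono mult_left_mono)
      have "(ln (real q)) ^ 2 \<le> (1 + ln (real q)) ^ 2" using lq by (intro power_mono) auto
      moreover have "(ln (real q)) ^ 2 \<ge> 0" by simp
      ultimately show "(ln (real q)) ^ 2 / 3 \<le> (1 + ln (real q)) ^ 2" by linarith
    qed (use AU_pos B1 in auto)
    finally show "real n * (3 * A * B * x ^ 2 / real q) \<le> A * B * (1 + ln (real q)) ^ 2 / (real n * real q)" .
  qed (use AU_pos B1 Delta_pos in auto)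
  finally show ?thesis by (simp add: mult_ac)
qed

text \<open>The number n of strips balances A B / (n q) against n \<open>Delta\<close>. The balanced
  value is the geometric mean of \<open>Delta\<close> A / q and B and is bounded by their
  sum.\<close>

lemma columns_B_to_V:
  "\<bar>\<Sum>b\<in>{nat \<lfloor>B\<rfloor><..nat \<lfloor>V\<rfloor>}. real (col b) - n2 b * u (real b) / real q\<bar> \<le>
    5 * (1 + ln (real q)) ^ 2 * (Delta * A / real q + B) + 8 * (1 + ln (real q)) ^ 2 * Delta + 2 * Delta * A / real q + 2 * Delta * V / real q"
proof -
  define L where "L = 1 + ln (real q)"
  have L: "L \<ge> 1" using ln_q by (simp add: L_def)
  have L2: "L \<le> L ^ 2" "1 \<le> L ^ 2" using L self_le_power[of L 2] one_le_power[of L 2] by simp_all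
  \<comment> \<open>The optimal number of strips, up to logarithms. Adding \<open>L\<close> to it
    before rounding up makes the result admissible in \<open>columns_grid\<close>.\<close>
  define s where "s = sqrt (A * B / (real q * Delta))"
  have s2: "s ^ 2 = A * B / (real q * Delta)" unfolding s_def using AU_pos B1 q1 Delta_pos by simp
  have s0: "s > 0" unfolding s_def using AU_pos B1 q1 Delta_pos by simp
  define n where "n = nat \<lceil>L + s\<rceil>"
  have n: "L + s \<le> real n" "real n \<le> L + s + 1" using L s0 unfolding n_def by linarith+
  have n0: "n > 0" using n L s0 by (cases n) auto
  have sD: "s * Delta \<le> Delta * A / real q + B"
  proof (rule power2_le_imp_le)
    have "(s * Delta) ^ 2 = s ^ 2 * (Delta * Delta)" by (simp add: power_mult_distrib power2_eq_square)
    also have "\<dots> = (Delta * A / real q) * B" unfolding s2 using Delta_pos q1 by (simp add: field_simps)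
    also have "\<dots> \<le> (Delta * A / real q + B) ^ 2"
    proof -
      define z where "z = Delta * A / real q"
      have "z \<ge> 0" using Delta_pos AU_pos by (simp add: z_def)
      then have "z * B \<ge> 0" using B1 by simp
      moreover have "(z + B) ^ 2 = z ^ 2 + 2 * (z * B) + B ^ 2" by (simp add: power2_eq_square algebra_simps)
      ultimately show ?thesis unfolding z_def[symmetric] by (smt (verit) zero_le_power2)
    qed
    finally show "(s * Delta) ^ 2 \<le> (Delta * A / real q + B) ^ 2" .
    show "0 \<le> Delta * A / real q + B" using Delta_pos AU_pos B1 by simp
  qed
  have "A * B * L ^ 2 / (real n * real q) \<le> A * B * L ^ 2 / (s * real q)"
    using n s0 L q1 AU_pos B1 by (intro divide_left_mono mult_right_mono mult_pos_pos) auto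
  also have "\<dots> = L ^ 2 * (s * Delta)"
  proof -
    have "A * B = s ^ 2 * (real q * Delta)" unfolding s2 using q1 Delta_pos by simp
    then show ?thesis using s0 q1 by (simp add: power2_eq_square)
  qed
  finally have t1: "A * B * L ^ 2 / (real n * real q) \<le> L ^ 2 * (s * Delta)" .
  have "4 * Delta * real n \<le> 4 * Delta * (2 * L + s)" using n L Delta_pos by (intro mult_left_mono) auto
  also have "\<dots> = 8 * (L * Delta) + 4 * (1 * (s * Delta))" by (simp add: algebra_simps)
  also have "\<dots> \<le> 8 * (L ^ 2 * Delta) + 4 * (L ^ 2 * (s * Delta))"
    using L2 Delta_pos s0 by (intro add_mono mult_left_mono mult_right_mono) auto
  finally have t2: "4 * Delta * real n \<le> 8 * (L ^ 2 * Delta) + 4 * (L ^ 2 * (s * Delta))" .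
  have "L ^ 2 * (s * Delta) \<le> L ^ 2 * (Delta * A / real q + B)" by (rule mult_left_mono[OF sD]) simp
  moreover have "L \<le> real n" using n s0 by linarith
  ultimately show ?thesis using columns_grid[of n] n0 t1 t2 unfolding L_def[symmetric] by linarith
qed

text \<open>\<open>Delta\<close> without its square root of q; it is smaller than any fixed power of
  q up to a constant.\<close>

definition \<kappa> :: real where "\<kappa> = 4 * 7500 ^ omega q * (1 + ln (real q)) ^ 2"

lemma Delta_eq: "Delta = \<kappa> * sqrt (real q)"
  by (simp add: Delta_def \<kappa>_def)

lemma kappa_ge: "\<kappa> \<ge> 4" "\<eta> \<le> \<kappa>"
proof -
  have L: "(1 + ln (real q)) ^ 2 \<ge> 1" using ln_q by (intro one_le_power) auto
  have "4 * 1 * 1 \<le> \<kappa>" unfolding \<kappa>_def using L by (intro mult_mono) auto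
  then show "\<kappa> \<ge> 4" by simp
  have "1 * 27 ^ omega q * 1 \<le> \<kappa>" unfolding \<kappa>_def using L by (intro mult_mono power_mono) auto
  then show "\<eta> \<le> \<kappa>" by (simp add: \<eta>_def)
qed

text \<open>Completing the series for \<open>Cq\<close> and the partial sum for \<open>Dq\<close>
  produces the same secondary term 2 \<rho> X^(1/2) V^(-1/2) = 2 \<rho> X^(1/3) U^(1/3) with
  opposite signs, and it cancels. For U < 1 there are no rows; then X^(1/3) <= V, so the whole term
  with \<open>Dq\<close> is small enough to count as an error.\<close>

lemma main_terms:
  "\<bar>(\<Sum>b\<in>{0<..nat \<lfloor>V\<rfloor>}. n2 b * u (real b) / real q) + (\<Sum>a\<in>{0<..nat \<lfloor>U\<rfloor>}. n3 a * (y (real a) - V) / real q) -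
    (Cq q l * (X powr (1/2) / real q) + Dq q l * (X powr (1/3) / real q))\<bar> \<le>
    U * (Delta + 1) / real q + (Delta + 5) * V / real q"
proof -
  define T where "T = Cq q l - (\<Sum>b\<in>{0<..nat \<lfloor>V\<rfloor>}. n2 b * real b powr (-3/2))"
  define H where "H = (\<Sum>a\<in>{0<..nat \<lfloor>U\<rfloor>}. n3 a * (real a powr (-2/3) - U powr (-2/3)))"
  define x2 where "x2 = X powr (1/2)"
  define x3 where "x3 = X powr (1/3)"
  have x0: "x2 \<ge> 0" "x3 \<ge> 0" by (simp_all add: x2_def x3_def)
  have T: "\<bar>T - 2 * \<rho> * V powr (-1/2)\<bar> \<le> (Delta + 1) * V powr (-3/2)"
    unfolding T_def by (rule Cq_tail[OF V_ge(2) refl])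
  have tail: "\<bar>x2 * T - 2 * \<rho> * (x2 * V powr (-1/2))\<bar> \<le> U * (Delta + 1)"
  proof -
    have "\<bar>x2 * (T - 2 * \<rho> * V powr (-1/2))\<bar> \<le> x2 * ((Delta + 1) * V powr (-3/2))"
      unfolding abs_mult using x0 T by (simp add: mult_left_mono)
    also have "\<dots> = U * (Delta + 1)" using powr_UV(3) by (simp add: x2_def mult_ac)
    finally show ?thesis by (simp add: right_diff_distrib mult_ac)
  qed
  have s2: "(\<Sum>b\<in>{0<..nat \<lfloor>V\<rfloor>}. n2 b * u (real b) / real q) = x2 * (Cq q l - T) / real q"
    by (simp add: T_def x2_def u_def sum_distrib_left sum_divide_distrib mult_ac)
  have s3: "(\<Sum>a\<in>{0<..nat \<lfloor>U\<rfloor>}. n3 a * (y (real a) - V) / real q) = x3 * H / real q"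
  proof -
    have "y (real a) - V = x3 * (real a powr (-2/3) - U powr (-2/3))" for a
      unfolding y_def x3_def using powr_UV(2) by (simp add: right_diff_distrib)
    then show ?thesis by (simp add: H_def sum_distrib_left sum_divide_distrib mult_ac)
  qed
  have key: "\<bar>x3 * H - x2 * T - x3 * Dq q l\<bar> \<le> U * (Delta + 1) + (Delta + 5) * V"
  proof (cases "U \<ge> 1")
    case True
    have "\<bar>H - Dq q l - 2 * \<rho> * U powr (1/3)\<bar> \<le> (Delta + 1) * U powr (-2/3)"
      unfolding H_def by (rule Dq_partial[OF True refl])
    then have "x3 * \<bar>H - Dq q l - 2 * \<rho> * U powr (1/3)\<bar> \<le> x3 * ((Delta + 1) * U powr (-2/3))"
      using x0 by (intro mult_left_mono) auto
    also have "\<dots> = (Delta + 1) * V" using powr_UV(2) by (simp add: x3_def mult_ac)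
    finally have "\<bar>x3 * (H - Dq q l - 2 * \<rho> * U powr (1/3))\<bar> \<le> (Delta + 1) * V"
      using x0 by (simp add: abs_mult)
    moreover have "x3 * (H - Dq q l - 2 * \<rho> * U powr (1/3)) = x3 * H - x3 * Dq q l - 2 * \<rho> * (x2 * V powr (-1/2))"
    proof -
      have "x3 * (H - Dq q l - 2 * \<rho> * U powr (1/3)) = x3 * H - x3 * Dq q l - 2 * \<rho> * (x3 * U powr (1/3))"
        by (simp add: right_diff_distrib)
      then show ?thesis using powr_UV(5) by (simp add: x2_def x3_def)
    qed
    moreover have "(Delta + 1) * V \<le> (Delta + 5) * V" using V_ge by (intro mult_right_mono) auto
    ultimately show ?thesis using tail by linarith
  next
    case False
    then have "nat \<lfloor>U\<rfloor> = 0" by simp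
    then have H0: "H = 0" by (simp add: H_def)
    have "2 * \<rho> * (x2 * V powr (-1/2)) \<le> 2 * 1 * (1 * V)"
      unfolding x2_def powr_UV(4) using rho_bounds AU_pos V_ge False by (intro mult_mono) auto
    moreover have "2 * \<rho> * (x2 * V powr (-1/2)) \<ge> 0" using rho_bounds x0 by simp
    ultimately have "\<bar>x2 * T\<bar> \<le> U * (Delta + 1) + 2 * V" using tail by linarith
    moreover have "\<bar>x3 * Dq q l\<bar> \<le> V * (Delta + 3)"
    proof -
      have "U powr (2/3) \<le> 1" using AU_pos False by (intro powr_le1) auto
      then have "V * U powr (2/3) \<le> V * 1" using V_ge by (intro mult_left_mono) auto
      then have "x3 \<le> V" unfolding x3_def powr_UV(1) by simp
      then show ?thesis unfolding abs_mult using x0 abs_Dq_le V_ge by (intro mult_mono) auto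
    qed
    moreover have "V * (Delta + 3) + 2 * V = (Delta + 5) * V" by (simp add: algebra_simps)
    moreover have "x3 * H = 0" using H0 by simp
    ultimately show ?thesis by linarith
  qed
  have "(\<Sum>b\<in>{0<..nat \<lfloor>V\<rfloor>}. n2 b * u (real b) / real q) + (\<Sum>a\<in>{0<..nat \<lfloor>U\<rfloor>}. n3 a * (y (real a) - V) / real q) -
      (Cq q l * (X powr (1/2) / real q) + Dq q l * (X powr (1/3) / real q)) = (x3 * H - x2 * T - x3 * Dq q l) / real q"
  proof -
    have "x2 * (Cq q l - T) / real q + x3 * H / real q - (Cq q l * (x2 / real q) + Dq q l * (x3 / real q)) =
        (x2 * (Cq q l - T) + x3 * H - (Cq q l * x2 + Dq q l * x3)) / real q"
      by (simp add: diff_divide_distrib add_divide_distrib)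
    also have "x2 * (Cq q l - T) + x3 * H - (Cq q l * x2 + Dq q l * x3) = x3 * H - x2 * T - x3 * Dq q l"
      by (simp add: right_diff_distrib)
    finally show ?thesis unfolding s2 s3 x2_def[symmetric] x3_def[symmetric] .
  qed
  also have "\<bar>\<dots>\<bar> \<le> (U * (Delta + 1) + (Delta + 5) * V) / real q"
    unfolding abs_divide using key by (simp add: divide_right_mono)
  finally show ?thesis by (simp add: add_divide_distrib)
qed

text \<open>All error terms reduce to three quantities: \<open>Delta\<close> A / q equals \<kappa>
  U, \<open>Delta\<close> V / q is at most \<kappa> B since 1/2 + 1/3 < 1, and \<open>Delta\<close>
  itself is \<kappa> sqrt q.\<close>

theorem asymptotic:
  "\<bar>real (Sq q X l) - (Cq q l * (X powr (1/2) / real q) + Dq q l * (X powr (1/3) / real q))\<bar> \<le>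
    13 * ((1 + ln (real q)) ^ 2 * \<kappa>) * (B + U + sqrt (real q))"
proof -
  define L2 where "L2 = (1 + ln (real q)) ^ 2"
  have L2: "L2 \<ge> 1" unfolding L2_def using ln_q by (intro one_le_power) auto
  define e where "e b = real (col b) - n2 b * u (real b) / real q" for b
  have Bk: "nat \<lfloor>B\<rfloor> \<le> nat \<lfloor>V\<rfloor>" using V_ge by (intro nat_mono floor_mono)
  then have "{0<..nat \<lfloor>V\<rfloor>} = {0<..nat \<lfloor>B\<rfloor>} \<union> {nat \<lfloor>B\<rfloor><..nat \<lfloor>V\<rfloor>}" by auto
  then have es: "(\<Sum>b\<in>{0<..nat \<lfloor>V\<rfloor>}. e b) = (\<Sum>b\<in>{0<..nat \<lfloor>B\<rfloor>}. e b) + (\<Sum>b\<in>{nat \<lfloor>B\<rfloor><..nat \<lfloor>V\<rfloor>}. e b)"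
    by (simp only:) (rule sum.union_disjoint; auto)
  have ec: "(\<Sum>b\<in>{0<..nat \<lfloor>V\<rfloor>}. e b) = (\<Sum>b\<in>{0<..nat \<lfloor>V\<rfloor>}. real (col b)) - (\<Sum>b\<in>{0<..nat \<lfloor>V\<rfloor>}. n2 b * u (real b) / real q)"
    by (simp add: e_def sum_subtractf)
  define E where "E = 2 * \<eta> * B + (5 * L2 * (Delta * A / real q + B) + 8 * L2 * Delta + 2 * Delta * A / real q + 2 * Delta * V / real q) +
      4 * \<eta> * U + (U * (Delta + 1) / real q + (Delta + 5) * V / real q)"
  have "\<bar>real (Sq q X l) - (Cq q l * (X powr (1/2) / real q) + Dq q l * (X powr (1/3) / real q))\<bar> \<le> E"
  proof -
    have triangle: "\<bar>C + R - M\<bar> \<le> p1 + p2 + p3 + p4"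
      if "\<bar>S1\<bar> \<le> p1" "\<bar>S2\<bar> \<le> p2" "\<bar>R - R'\<bar> \<le> p3" "\<bar>N + R' - M\<bar> \<le> p4" "S1 + S2 = C - N"
      for C R M S1 S2 R' N p1 p2 p3 p4 :: real
      using that by linarith
    show ?thesis unfolding Sq_decomp E_def
      by (rule triangle[OF _ _ rows_above_V main_terms])
        (use columns_to_B columns_B_to_V es ec in \<open>simp_all only: e_def L2_def\<close>)
  qed
  also have "E \<le> 13 * (L2 * \<kappa>) * (B + U + sqrt (real q))"
  proof -
    define r where "r = sqrt (real q)"
    have r: "r \<ge> 1" "real q = r * r" using q1 by (simp_all add: r_def)
    have DA: "Delta * A / real q = \<kappa> * U" unfolding Delta_eq U_eq r_def[symmetric] r(2) using r(1) by (simp add: field_simps)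
    have V1: "V / real q \<le> B"
    proof -
      have "real q powr (1/3) \<le> real q powr 1" using q1 by (intro powr_mono) auto
      then have "V \<le> B * real q" unfolding V_def using B1 q1 by (intro mult_left_mono) auto
      then show ?thesis using q1 by (simp add: divide_le_eq)
    qed
    have DV: "Delta * V / real q \<le> \<kappa> * B"
    proof -
      have "r * real q powr (1/3) = real q powr (1/2 + 1/3)" unfolding r_def powr_add using powr_half_sqrt[of "real q"] by simp
      also have "\<dots> \<le> real q powr 1" using q1 by (intro powr_mono) auto
      finally have "\<kappa> * B * (r * real q powr (1/3)) \<le> \<kappa> * B * real q" using kappa_ge B1 q1 by (intro mult_left_mono) auto
      then have "Delta * V \<le> \<kappa> * B * real q" unfolding Delta_eq V_def r_def[symmetric] by (simp add: mult_ac)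
      then show ?thesis using q1 by (simp add: divide_le_eq)
    qed
    have UD: "U * (Delta + 1) / real q \<le> 2 * (\<kappa> * U)"
    proof -
      have "Delta / real q = \<kappa> / r" unfolding Delta_eq r_def[symmetric] r(2) using r(1) by simp
      also have "\<dots> \<le> \<kappa> / 1" using r kappa_ge by (intro divide_left_mono) auto
      finally have "Delta / real q \<le> \<kappa>" by simp
      moreover have "1 / real q \<le> 1" using q1 by (simp add: divide_le_eq)
      then have "1 / real q \<le> \<kappa>" using kappa_ge by linarith
      ultimately have "(Delta + 1) / real q \<le> 2 * \<kappa>" by (simp add: add_divide_distrib)
      then have "U * ((Delta + 1) / real q) \<le> U * (2 * \<kappa>)" using AU_pos by (intro mult_left_mono) auto
      then show ?thesis by (simp add: mult_ac)
    qed
    have DV5: "(Delta + 5) * V / real q \<le> 3 * (\<kappa> * B)"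
    proof -
      have "(Delta + 5) * V / real q = Delta * V / real q + 5 * (V / real q)" by (simp add: distrib_right add_divide_distrib)
      moreover have "5 * B \<le> 2 * (\<kappa> * B)" using mult_right_mono[OF kappa_ge(1), of B] B1 by linarith
      ultimately show ?thesis using DV V1 by linarith
    qed
    have eB: "\<eta> * B \<le> \<kappa> * B" "\<eta> * U \<le> \<kappa> * U" using kappa_ge B1 AU_pos by (auto intro: mult_right_mono)
    have k0: "\<kappa> * B \<ge> 0" "\<kappa> * U \<ge> 0" "\<kappa> * r \<ge> 0" "B \<le> \<kappa> * B"
      using kappa_ge B1 AU_pos r mult_right_mono[of 1 \<kappa> B] by (simp_all add: zero_le_mult_iff)
    have up: "z \<le> L2 * z" if "z \<ge> 0" for z using mult_right_mono[OF L2 that] by simp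
    have "E \<le> 7 * (\<kappa> * B) + 5 * (L2 * (\<kappa> * U + \<kappa> * B)) + 8 * (L2 * (\<kappa> * r)) + 8 * (\<kappa> * U)"
    proof -
      have "L2 * (Delta * A / real q + B) \<le> L2 * (\<kappa> * U + \<kappa> * B)" unfolding DA using k0(4) L2 by (intro mult_left_mono add_left_mono) auto
      moreover have "L2 * Delta = L2 * (\<kappa> * r)" unfolding Delta_eq r_def ..
      ultimately show ?thesis unfolding E_def using eB DA DV UD DV5 by linarith
    qed
    \<comment> \<open>The largest of the three coefficients is that of U, namely 5 + 8.\<close>
    also have "\<dots> \<le> 13 * (L2 * (\<kappa> * B)) + 13 * (L2 * (\<kappa> * U)) + 13 * (L2 * (\<kappa> * r))"
      using up[OF k0(1)] up[OF k0(2)] up[OF k0(3)] k0 unfolding distrib_left by linarith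
    finally show ?thesis by (simp only: r_def distrib_left mult.assoc)
  qed
  finally show ?thesis by (simp add: L2_def)
qed

end

text \<open>Two of the four logarithms are those in \<kappa>, the other two come from the staircase.
  Half of \<epsilon> pays for the prime factors and \<epsilon> / 8 for each logarithm.\<close>

lemma subpolynomial_bound:
  fixes \<epsilon> :: real
  assumes "\<epsilon> > 0"
  shows "\<exists>K>0. \<forall>q>0. 4 * 7500 ^ omega q * (1 + ln (real q)) ^ 4 \<le> K * real q powr \<epsilon>"
proof -
  obtain K where K: "K > 0" "\<And>q. q > 0 \<Longrightarrow> 7500 ^ omega q \<le> K * real q powr (\<epsilon>/2)"
    using power_omega_le[of 7500 "\<epsilon>/2"] assms by auto
  define a where "a = \<epsilon> / 8"
  have a: "a > 0" using assms by (simp add: a_def)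
  define M where "M = 1 + 1 / a"
  have M: "M > 0" using a by (simp add: M_def add_pos_pos)
  have "4 * 7500 ^ omega q * (1 + ln (real q)) ^ 4 \<le> (4 * K * M ^ 4) * real q powr \<epsilon>" if q: "q > 0" for q
  proof -
    have q1: "real q \<ge> 1" using q by simp
    have "1 \<le> real q powr a" using q1 a by (intro ge_one_powr_ge_zero) auto
    moreover have "ln (real q) \<le> real q powr a / a" using q1 a by (rule ln_powr_bound)
    ultimately have "1 + ln (real q) \<le> M * real q powr a" by (simp add: M_def distrib_right)
    then have "(1 + ln (real q)) ^ 4 \<le> (M * real q powr a) ^ 4" using q1 by (intro power_mono) auto
    also have "\<dots> = M ^ 4 * real q powr (\<epsilon>/2)" using q by (simp add: power_mult_distrib powr_power a_def)
    finally have 1: "(1 + ln (real q)) ^ 4 \<le> M ^ 4 * real q powr (\<epsilon>/2)" .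
    have "4 * 7500 ^ omega q * (1 + ln (real q)) ^ 4 \<le> 4 * (K * real q powr (\<epsilon>/2)) * (M ^ 4 * real q powr (\<epsilon>/2))"
      using K(2)[OF q] 1 K(1) by (intro mult_mono) auto
    also have "\<dots> = (4 * K * M ^ 4) * (real q powr (\<epsilon>/2) * real q powr (\<epsilon>/2))" by (simp only: mult_ac)
    also have "real q powr (\<epsilon>/2) * real q powr (\<epsilon>/2) = real q powr \<epsilon>" by (simp flip: powr_add)
    finally show ?thesis .
  qed
  then show ?thesis using K(1) M by (intro exI[of _ "4 * K * M ^ 4"]) auto
qed

theorem theorem3:
  fixes \<epsilon> :: real
  assumes "\<epsilon> > 0"
  shows "\<exists>K>0. \<forall>(X::real) (q::nat) (l::int) (\<mu>::real).
    X > 0 \<longrightarrow> q \<ge> 1 \<longrightarrow> coprime l (int q) \<longrightarrow> 0 < \<mu> \<longrightarrow> \<mu> < 1/5 \<longrightarrow>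
    \<bar>real (Sq q X l) - (Cq q l * (X powr (1/2) / real q) + Dq q l * (X powr (1/3) / real q))\<bar>
      \<le> K * (X powr (1/2 - 3 * \<mu> / 2) / real q powr (1/2 - \<epsilon>)
             + max (X powr \<mu>) (real q powr (1/2)) * real q powr \<epsilon>)"
proof -
  obtain K where K: "K > 0" "\<And>q. q > 0 \<Longrightarrow> 4 * 7500 ^ omega q * (1 + ln (real q)) ^ 4 \<le> K * real q powr \<epsilon>"
    using subpolynomial_bound[OF assms] by blast
  show ?thesis
  \<comment> \<open>The constant is twice 13, because both B and sqrt q are bounded by the maximum
    \<open>MM\<close>.\<close>
  proof (intro exI[of _ "26 * K"] conjI allI impI)
    show "26 * K > 0" using K(1) by simp
    fix X \<mu> :: real and q :: nat and l :: int
    assume X: "X > 0" and q: "q \<ge> 1" and l: "coprime l (int q)" and \<mu>: "0 < \<mu>" "\<mu> < 1/5"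
    obtain l' where "[l * l' = 1] (mod int q)" using cong_solve_coprime_int[OF l] by blast
    then interpret residue_class q l l' using q by unfold_locales auto
    define MM where "MM = max (X powr \<mu>) (real q powr (1/2))"
    define Z where "Z = X powr (1/2 - 3 * \<mu> / 2) / real q powr (1/2 - \<epsilon>)"
    have q0: "real q \<ge> 1" "q > 0" using q by auto
    have Z0: "Z \<ge> 0" by (simp add: Z_def)
    have sq: "real q powr (1/2) = sqrt (real q)" using powr_half_sqrt[of "real q"] by simp
    have MM1: "MM \<ge> 1" "MM \<ge> sqrt (real q)" "MM \<ge> X powr \<mu>" using q0 sq by (auto simp: MM_def le_max_iff_disj)
    define Q where "Q = K * real q powr \<epsilon>"
    define L where "L = 1 + ln (real q)"
    have L: "L \<ge> 1" using ln_q by (simp add: L_def)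
    define k where "k = 4 * 7500 ^ omega q * L ^ 2"
    have "L ^ 4 = L ^ 2 * L ^ 2" by (simp flip: power_add)
    then have "L ^ 2 * k = 4 * 7500 ^ omega q * L ^ 4" by (simp add: k_def)
    then have kQ: "L ^ 2 * k \<le> Q" using K(2)[OF q0(2)] by (simp only: Q_def L_def)
    have Lk: "L ^ 2 * k \<ge> 0" by (simp add: k_def)
    have "\<bar>real (Sq q X l) - (Cq q l * (X powr (1/2) / real q) + Dq q l * (X powr (1/3) / real q))\<bar> \<le> 26 * K * (Z + MM * real q powr \<epsilon>)"
    proof (cases "X \<ge> 1")
      case True
      define B where "B = X powr \<mu>"
      have B1: "B \<ge> 1" unfolding B_def using True \<mu> by (intro ge_one_powr_ge_zero) auto
      have "B ^ 5 = X powr (5 * \<mu>)" unfolding B_def using X by (simp add: powr_power mult.commute)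
      also have "\<dots> \<le> X powr 1" using True \<mu> by (intro powr_mono) auto
      finally have "B ^ 5 \<le> X" using X by simp
      then interpret hyperbola q l l' X B using B1 by unfold_locales auto
      have "A = X powr (1/2) * X powr (- (3 * \<mu> / 2))" unfolding A_def u_def using X by (simp add: B_def powr_powr mult.commute)
      then have "A = X powr (1/2 - 3 * \<mu> / 2)" by (simp flip: powr_add)
      then have "U * real q powr \<epsilon> = X powr (1/2 - 3 * \<mu> / 2) * (real q powr \<epsilon> / real q powr (1/2))"
        unfolding U_eq sq by simp
      also have "real q powr \<epsilon> / real q powr (1/2) = 1 / real q powr (1/2 - \<epsilon>)"
        using q0 by (simp add: powr_diff)
      finally have UZ: "U * real q powr \<epsilon> = Z" by (simp add: Z_def)
      have "\<kappa> = k" by (simp add: \<kappa>_def k_def L_def)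
      then have "\<bar>real (Sq q X l) - (Cq q l * (X powr (1/2) / real q) + Dq q l * (X powr (1/3) / real q))\<bar> \<le>
          13 * (L ^ 2 * k) * (B + U + sqrt (real q))" using asymptotic by (simp add: L_def)
      also have "\<dots> \<le> 13 * Q * (MM + U + MM)"
        using kQ Lk MM1 AU_pos K(1) B1 by (intro mult_mono add_mono) (auto simp: Q_def B_def)
      also have "\<dots> = 13 * K * (U * real q powr \<epsilon>) + 26 * K * (MM * real q powr \<epsilon>)" by (simp add: Q_def algebra_simps)
      also have "\<dots> \<le> 26 * K * Z + 26 * K * (MM * real q powr \<epsilon>)" unfolding UZ using K(1) Z0 by simp
      finally show ?thesis by (simp add: distrib_left)
    next
      \<comment> \<open>For X < 1 there are no solutions, and the two main terms themselves must be
        absorbed by the error, in which \<open>MM\<close> is at least 1.\<close>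
      case False
      have "{(a::nat, b::nat). a > 0 \<and> b > 0 \<and> real (a ^ 2 * b ^ 3) \<le> X \<and> [int (a ^ 2 * b ^ 3) = l] (mod int q)} = {}"
      proof -
        have "real (a ^ 2 * b ^ 3) \<ge> 1" if "a > 0" "b > 0" for a b :: nat
        proof -
          have "a ^ 2 * b ^ 3 > 0" using that by simp
          then show ?thesis by linarith
        qed
        then have "\<not> real (a ^ 2 * b ^ 3) \<le> X" if "a > 0" "b > 0" for a b :: nat
          using order_trans[of 1 "real (a ^ 2 * b ^ 3)" X] that False by blast
        then show ?thesis by blast
      qed
      then have S0: "Sq q X l = 0" unfolding Sq_def by (simp only: card.empty)
      have "k \<ge> 4"
      proof -
        have "4 * 1 * 1 \<le> k" unfolding k_def using L by (intro mult_mono one_le_power) auto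
        then show ?thesis by simp
      qed
      have "1 * 27 ^ omega q * 1 \<le> k" unfolding k_def using L by (intro mult_mono power_mono one_le_power) auto
      then have ek: "\<eta> \<le> k" by (simp add: \<eta>_def)
      \<comment> \<open>Cutting the series at V = 1 leaves only the term b = 1 and bounds
        \<open>Cq\<close> by \<open>Delta\<close> and \<eta>.\<close>
      have "\<bar>Cq q l - (\<Sum>b\<in>{0<..1}. n2 b * real b powr (-3/2)) - 2 * \<rho> * 1 powr (-1/2)\<bar> \<le> (Delta + 1) * 1 powr (-3/2)"
        by (rule Cq_tail) auto
      moreover have "{0<..1::nat} = {1}" by auto
      ultimately have "\<bar>Cq q l - n2 1 - 2 * \<rho>\<bar> \<le> Delta + 1" by simp
      then have C: "\<bar>Cq q l\<bar> \<le> \<eta> + 3 + Delta" using n_bounds(1,2)[of 1] rho_bounds by linarith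
      have D: "\<bar>Dq q l\<bar> \<le> Delta + 3" by (rule abs_Dq_le)
      have Dq: "Delta / real q \<le> k"
      proof -
        have "Delta = k * sqrt (real q)" by (simp add: Delta_def k_def L_def)
        moreover have "sqrt (real q) \<le> real q" using q0 by (intro real_le_lsqrt) (auto intro: self_le_power)
        ultimately have "Delta \<le> k * real q" using \<open>k \<ge> 4\<close> by (simp add: mult_left_mono)
        then show ?thesis using q0 by (simp add: divide_le_eq)
      qed
      have "\<bar>Cq q l * (X powr (1/2) / real q) + Dq q l * (X powr (1/3) / real q)\<bar> \<le> \<bar>Cq q l\<bar> * (1 / real q) + \<bar>Dq q l\<bar> * (1 / real q)"
      proof -
        have "X powr (1/2) \<le> 1" "X powr (1/3) \<le> 1" using X False by (auto intro: powr_le1)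
        then have "\<bar>Cq q l * (X powr (1/2) / real q)\<bar> \<le> \<bar>Cq q l\<bar> * (1 / real q)" "\<bar>Dq q l * (X powr (1/3) / real q)\<bar> \<le> \<bar>Dq q l\<bar> * (1 / real q)"
          unfolding abs_mult using q0 by (intro mult_left_mono; simp add: divide_right_mono)+
        then show ?thesis by linarith
      qed
      also have "\<dots> \<le> (\<eta> + 3 + Delta) * (1 / real q) + (Delta + 3) * (1 / real q)"
        using C D by (intro add_mono mult_right_mono) auto
      also have "\<dots> = 2 * (Delta / real q) + (\<eta> + 6) / real q" by (simp add: add_divide_distrib)
      also have "\<dots> \<le> 2 * k + (\<eta> + 6)"
      proof -
        have "(\<eta> + 6) / real q \<le> (\<eta> + 6) / 1" using q0 n_bounds(1,2)[of 1] by (intro divide_left_mono) auto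
        then have "(\<eta> + 6) / real q \<le> \<eta> + 6" by simp
        then show ?thesis using add_mono[OF mult_left_mono[OF Dq, of 2]] by simp
      qed
      also have "\<dots> \<le> 26 * (1 * k * 1)" using ek \<open>k \<ge> 4\<close> by linarith
      also have "\<dots> \<le> 26 * (L ^ 2 * k * MM)"
        using L \<open>k \<ge> 4\<close> MM1 by (intro mult_left_mono mult_mono one_le_power) auto
      also have "\<dots> \<le> 26 * (Q * MM)" using kQ MM1 by (intro mult_left_mono mult_right_mono) auto
      also have "\<dots> = 26 * K * (MM * real q powr \<epsilon>)" by (simp add: Q_def mult_ac)
      also have "\<dots> \<le> 26 * K * (Z + MM * real q powr \<epsilon>)" using K(1) Z0 by (intro mult_left_mono) auto
      finally show ?thesis using S0 by simp
    qed
    then show "\<bar>real (Sq q X l) - (Cq q l * (X powr (1/2) / real q) + Dq q l * (X powr (1/3) / real q))\<bar>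
      \<le> 26 * K * (X powr (1/2 - 3 * \<mu> / 2) / real q powr (1/2 - \<epsilon>) + max (X powr \<mu>) (real q powr (1/2)) * real q powr \<epsilon>)"
      by (simp only: Z_def MM_def)
  qed
qed

end
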